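(* Let $x_1,\dots,x_n\in\mathbb{F}_q$ be distinct, let $d\ge 1$, and let $y_{ij}\in\mathbb{F}_q$ for $1\le i\le n$, $1\le j\le d$. Let $\ell\ge 0$ and $0\le e<n$ be integers with \[ \ell<\frac{n(1-e/n)^2}{d}, \] equivalently $e<n-\sqrt{n\ell d}$. Then in polynomial time one can find all polynomials $w(z)\in\mathbb{F}_q[z]$ of degree at most $\ell$ such that for at least $n-e$ values of $i\in\{1,\dots,n\}$ there exists $j\in\{1,\dots,d\}$ with $w(x_i)=y_{ij}$.
   Context: The case $d=1$ is list decoding of Reed-Solomon codes: codewords are $(w(x_1),\dots,w(x_n))$ with $\deg w\le\ell$, and $e$ is the number of errors allowed. The case $e=0$ is noisy polynomial interpolation. "Polynomial time" means time polynomial in the input size; the algorithm is allowed to be randomized, since it finds roots in $\mathbb{F}_q[z]$ of polynomials over $\mathbb{F}_q[z]$. *)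

theory Defs
  imports
    "HOL-Probability.Probability_Mass_Function"
    "HOL-Computational_Algebra.Primes"
    "HOL-Computational_Algebra.Polynomial"
    "HOL-Algebra.Polynomial_Divisibility"
    "HOL-Library.Log_Nat"
begin

section \<open>A model of randomized computation with logarithmic cost\<close>

datatype val = Num nat | Pair val val

text \<open>Length of a value in bits, up to a constant factor; \<open>floorlog 2 n\<close> is the number of
  binary digits of \<open>n\<close>.\<close>

primrec vsize :: "val \<Rightarrow> nat" where
  "vsize (Num n) = 1 + floorlog 2 n"
| "vsize (Pair u v) = 1 + vsize u + vsize v"

datatype prim = Id | Fst | Snd | Const nat | IsPair | Add | Sub | Mult | Div

text \<open>Arguments of the wrong shape yield \<open>Num 0\<close>; subtraction is truncated and division by \<open>0\<close>
  gives \<open>0\<close>.\<close>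

fun apply_prim :: "prim \<Rightarrow> val \<Rightarrow> val" where
  "apply_prim Id v = v"
| "apply_prim Fst (Pair u v) = u"
| "apply_prim Snd (Pair u v) = v"
| "apply_prim (Const n) v = Num n"
| "apply_prim IsPair (Pair u v) = Num 1"
| "apply_prim Add (Pair (Num m) (Num n)) = Num (m + n)"
| "apply_prim Sub (Pair (Num m) (Num n)) = Num (m - n)"
| "apply_prim Mult (Pair (Num m) (Num n)) = Num (m * n)"
| "apply_prim Div (Pair (Num m) (Num n)) = Num (m div n)"
| "apply_prim _ _ = Num 0"

text \<open>Programs in the style of Backus' FP: a program transforms one value into another, and
  programs are built by sequential composition, construction of pairs, conditionals and
  while loops. \<open>Flip\<close> tosses a fair coin.\<close>

datatype prog =
    Prim prim
  | Flip
  | Seq prog prog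
  | Fork prog prog
  | Cond prog prog prog
  | While prog prog

text \<open>\<open>runs c v r t w r'\<close>: started on the value \<open>v\<close> with the random bits \<open>r\<close>, the program \<open>c\<close> halts
  after time \<open>t\<close> with the value \<open>w\<close>, and \<open>r'\<close> are the random bits it has not read. A program that
  needs more random bits than it is given has no run. The test value \<open>Num 0\<close> means false.

  Time is counted by the logarithmic cost criterion: a primitive operation costs the total size
  of its argument and its result. All control constructs end in primitive operations
  or coin tosses, whose first one is applied to (and charged for) the value being duplicated,
  so that space is bounded by time and the model is polynomially equivalent to
  probabilistic Turing machines.\<close>

inductive runs :: "prog \<Rightarrow> val \<Rightarrow> bool list \<Rightarrow> nat \<Rightarrow> val \<Rightarrow> bool list \<Rightarrow> bool" where
  Prim: "runs (Prim f) v r (vsize v + vsize (apply_prim f v)) (apply_prim f v) r"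
| Flip: "runs Flip v (b # r) (vsize v + 1) (Num (of_bool b)) r"
| Seq: "runs c v r t1 u r1 \<Longrightarrow> runs d u r1 t2 w r2 \<Longrightarrow> runs (Seq c d) v r (1 + t1 + t2) w r2"
| Fork: "runs c v r t1 u r1 \<Longrightarrow> runs d v r1 t2 w r2 \<Longrightarrow>
    runs (Fork c d) v r (1 + t1 + t2) (Pair u w) r2"
| CondTrue: "runs b v r t1 u r1 \<Longrightarrow> u \<noteq> Num 0 \<Longrightarrow> runs c v r1 t2 w r2 \<Longrightarrow>
    runs (Cond b c d) v r (1 + t1 + t2) w r2"
| CondFalse: "runs b v r t1 u r1 \<Longrightarrow> u = Num 0 \<Longrightarrow> runs d v r1 t2 w r2 \<Longrightarrow>
    runs (Cond b c d) v r (1 + t1 + t2) w r2"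
| WhileTrue: "runs b v r t1 u r1 \<Longrightarrow> u \<noteq> Num 0 \<Longrightarrow> runs c v r1 t2 v' r2 \<Longrightarrow>
    runs (While b c) v' r2 t3 w r3 \<Longrightarrow> runs (While b c) v r (1 + t1 + t2 + t3) w r3"
| WhileFalse: "runs b v r t1 u r1 \<Longrightarrow> u = Num 0 \<Longrightarrow> runs (While b c) v r (1 + t1) v r1"

lemma runs_deterministic:
  "runs c v r t w r' \<Longrightarrow> runs c v r s u r'' \<Longrightarrow> s = t \<and> u = w \<and> r'' = r'"
proof (induction arbitrary: s u r'' rule: runs.induct)
  case (Prim f v r) then show ?case by (auto elim: runs.cases)
next
  case (Flip v b r) then show ?case by (auto elim: runs.cases)
next
  case Seq from Seq.prems show ?case by cases (use Seq.IH in blast)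
next
  case Fork from Fork.prems show ?case by cases (use Fork.IH in blast)
next
  case CondTrue from CondTrue.prems show ?case by cases (use CondTrue.IH CondTrue.hyps in blast)+
next
  case CondFalse from CondFalse.prems show ?case
    by cases (use CondFalse.IH CondFalse.hyps in blast)+
next
  case WhileTrue from WhileTrue.prems show ?case
    by cases (use WhileTrue.IH WhileTrue.hyps in blast)+
next
  case WhileFalse from WhileFalse.prems show ?case
    by cases (use WhileFalse.IH WhileFalse.hyps in blast)+
qed

lemma runs_random_bits: "runs c v r t w r' \<Longrightarrow> length r \<le> length r' + t"
  by (induction rule: runs.induct) auto

text \<open>Zero-error randomized computation in time \<open>T\<close>: whatever the coin tosses, the program halts
  within time \<open>T\<close> and returns either an element of \<open>Y\<close>, marked as a success, or the failure value
  \<open>Num 0\<close>; it fails with probability at most \<open>1/2\<close>. At most \<open>T\<close> coins can be tossed in time \<open>T\<close>, so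
  the probability is taken over \<open>T\<close> uniform random bits.\<close>

definition randomized_finds :: "prog \<Rightarrow> val \<Rightarrow> nat \<Rightarrow> val set \<Rightarrow> bool" where
  "randomized_finds c v T Y \<longleftrightarrow>
    (\<forall>r. length r = T \<longrightarrow>
      (\<exists>t w r'. runs c v r t w r' \<and> t \<le> T \<and> (w = Num 0 \<or> (\<exists>y\<in>Y. w = Pair (Num 1) y)))) \<and>
    measure_pmf.prob (pmf_of_set {r. length r = T}) {r. \<exists>t r'. runs c v r t (Num 0) r'} \<le> 1 / 2"


section \<open>Finite fields given by explicit data\<close>

text \<open>Explicit data for a finite field with \<open>p ^ k\<close> elements in the sense of Lenstra: the elements
  are the coordinate vectors with respect to a basis over the prime field, and the
  multiplication is specified by the products of the basis vectors. Every finite field is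
  isomorphic to one of this form, and every choice of basis is allowed; in particular this
  covers the quotient of the polynomial ring over the prime field by an irreducible polynomial.\<close>

definition explicit_finite_field :: "nat \<Rightarrow> nat \<Rightarrow> (nat list) ring \<Rightarrow> bool" where
  "explicit_finite_field p k F \<longleftrightarrow>
    Factorial_Ring.prime p \<and> field F \<and>
    carrier F = {a. length a = k \<and> set a \<subseteq> {..<p}} \<and>
    (\<forall>a\<in>carrier F. \<forall>b\<in>carrier F. a \<oplus>\<^bsub>F\<^esub> b = map2 (\<lambda>u v. (u + v) mod p) a b)"

definition basis_vec :: "nat \<Rightarrow> nat \<Rightarrow> nat list" where
  "basis_vec k i = (replicate k 0)[i := 1]"

definition structure_constants :: "nat \<Rightarrow> (nat list) ring \<Rightarrow> nat list list list" where
  "structure_constants k F =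
    map (\<lambda>i. map (\<lambda>j. basis_vec k i \<otimes>\<^bsub>F\<^esub> basis_vec k j) [0..<k]) [0..<k]"


section \<open>Input and output of the decoding problem\<close>

definition enc_list :: "('a \<Rightarrow> val) \<Rightarrow> 'a list \<Rightarrow> val" where
  "enc_list f xs = foldr (\<lambda>x v. Pair (f x) v) xs (Num 0)"

abbreviation enc_elem :: "nat list \<Rightarrow> val" where
  "enc_elem \<equiv> enc_list Num"

definition enc_input ::
  "nat \<Rightarrow> nat \<Rightarrow> (nat list) ring \<Rightarrow> nat \<Rightarrow> nat \<Rightarrow> (nat \<Rightarrow> nat list) \<Rightarrow> (nat \<Rightarrow> nat \<Rightarrow> nat list) \<Rightarrow>
    nat \<Rightarrow> nat \<Rightarrow> val" where
  "enc_input p k F n d x y l e =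
    Pair (Pair (Num p) (enc_list (enc_list enc_elem) (structure_constants k F)))
   (Pair (Pair (Num l) (Num e))
   (Pair (enc_list enc_elem (map x [1..<n + 1]))
         (enc_list (enc_list enc_elem) (map (\<lambda>i. map (y i) [1..<d + 1]) [1..<n + 1]))))"

definition decodings ::
  "(nat list) ring \<Rightarrow> nat \<Rightarrow> nat \<Rightarrow> (nat \<Rightarrow> nat list) \<Rightarrow> (nat \<Rightarrow> nat \<Rightarrow> nat list) \<Rightarrow> nat \<Rightarrow> nat \<Rightarrow>
    nat list list set" where
  "decodings F n d x y l e =
    {w \<in> carrier (poly_ring F). Polynomials.degree w \<le> l \<and>
      card {i \<in> {1..n}. \<exists>j\<in>{1..d}. ring.eval F w (x i) = y i j} \<ge> n - e}"

text \<open>A set of polynomials is output as a list without repetitions, in any order; a polynomial is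
  the list of its coefficients starting with the leading one.\<close>

definition enc_outputs :: "nat list list set \<Rightarrow> val set" where
  "enc_outputs W = {enc_list (enc_list enc_elem) ws | ws. distinct ws \<and> set ws = W}"

end

theory Submission
  imports Defs "HOL-Algebra.Multiplicative_Group"
begin

text \<open>
  The algorithm is that of Guruswami and Sudan, applied to the \<open>N = n d\<close> points \<open>(x i, y i j)\<close>. Put
  \<open>t = n - e\<close> and \<open>m = N l\<close>. A polynomial \<open>Q(z, Y)\<close> of \<open>(1, l)\<close>-weighted degree less than \<open>m t\<close> that
  vanishes to order \<open>m\<close> at every point is a solution of a homogeneous linear system; because
  \<open>t\<^sup>2 > N l\<close> there are more unknowns than equations, so some \<open>Q \<noteq> 0\<close> exists. If \<open>w\<close> agrees with the data
  at \<open>t\<close> places, then \<open>Q(z, w(z))\<close> has degree less than \<open>m t\<close> and \<open>t\<close> zeros of order \<open>m\<close>, hence is zero.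

  The roots \<open>w\<close> of \<open>Q\<close> are found one coefficient at a time (Roth and Ruckenstein), which reduces the
  problem to finding the roots in \<open>F\<close> of polynomials over \<open>F\<close>. The product of the linear factors is
  split by gcds with quadratic characters of \<open>X + a\<close> (traces of \<open>a X\<close> in characteristic 2) for
  random \<open>a\<close>. For two fixed elements a random \<open>a\<close> fails to separate them with probability at most
  \<open>1/2\<close>, so logarithmically many samples separate all pairs except with probability at most \<open>1/2\<close>; a
  failure shows as a factor of degree greater than 1. All samples are drawn at the beginning,
  and everything else is a deterministic function in a class \<open>pt\<close> of polynomial-time functions that
  is closed under composition and bounded iteration.

  For \<open>l = 0\<close> the system is empty; the constant polynomials \<open>y i j\<close> are always added as candidates.
\<close>

section \<open>Programs running in polynomial time\<close>

text \<open>\<open>pt\<close> demands one time bound for every value of the input type, also for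
  values that describe no field and no valid instance. So the size bounds may use no algebra: all
  they know is that sums, differences and products of field elements are reduced vectors
  (\<open>W C\<close>) and that loops run along lists. Wherever only algebra keeps an object small
  (the number of factors, the width of the root tree), the programs truncate with
  \<open>take\<close> or \<open>min\<close>, and the correctness part, inside \<open>gfield\<close>,
  shows that nothing is lost.

  The input gives \<open>l\<close> in binary while the algorithm spends time polynomial in
  \<open>l\<close> itself. This is harmless because the rate condition forces l < n, so
  \<open>decode\<close> works with the minimum of \<open>l\<close> and \<open>n\<close>.

  The field is known only through its multiplication table on a basis, so even the coordinates of 1
  have to be computed. Zero error is possible because the success flag is sound for all samples;
  chance decides only whether the flag is true.\<close>

class encodable =
  fixes enc :: "'a \<Rightarrow> val"

instantiation nat :: encodable
begin
definition enc_nat :: "nat \<Rightarrow> val" where "enc_nat = Num"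
instance ..
end

instantiation bool :: encodable
begin
definition enc_bool :: "bool \<Rightarrow> val" where "enc_bool b = Num (of_bool b)"
instance ..
end

instantiation prod :: (encodable, encodable) encodable
begin
definition enc_prod :: "'a \<times> 'b \<Rightarrow> val" where "enc_prod z = Pair (enc (fst z)) (enc (snd z))"
instance ..
end

instantiation list :: (encodable) encodable
begin
definition enc_list :: "'a list \<Rightarrow> val" where "enc_list xs = Defs.enc_list enc xs"
instance ..
end

abbreviation sz :: "'a::encodable \<Rightarrow> nat" where "sz x \<equiv> vsize (enc x)"

lemma enc_simps [simp]:
  "enc (n::nat) = Num n" "enc b = Num (of_bool b)" "enc (x, y) = Pair (enc x) (enc y)"
  "enc [] = Num 0" "enc (y # ys) = Pair (enc y) (enc ys)"
  by (simp_all add: enc_nat_def enc_bool_def enc_prod_def enc_list_def Defs.enc_list_def)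

lemma enc_prod_eq: "enc z = Pair (enc (fst z)) (enc (snd z))"
  by (simp add: enc_prod_def)

lemma vsize_pos: "1 \<le> vsize v"
  by (cases v) auto

text \<open>Primitive steps are charged for their argument and their result, so a time bound is also
  a bound on the length of the output. This keeps intermediate values small under
  composition.\<close>

lemma runs_size: "runs c v r t w r' \<Longrightarrow> vsize v \<le> t \<and> vsize w \<le> t"
proof (induction rule: runs.induct)
  case (Flip v b r)
  then show ?case using vsize_pos[of v] by (cases b) (auto simp: floorlog_def)
qed auto

lemma poly_nat_mono: "x \<le> y \<Longrightarrow> poly (P :: nat poly) x \<le> poly P y"
  by (induction P) (auto intro!: add_mono mult_mono)

text \<open>\<open>pb\<close> bounds the value of a number, not its length in bits: it is the
  condition under which a number may serve as a list length, a number of rounds or the exponent of a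
  power of naturals.\<close>

definition pb :: "('a::encodable \<Rightarrow> nat) \<Rightarrow> bool" where
  "pb m \<longleftrightarrow> (\<exists>P :: nat poly. \<forall>x. m x \<le> poly P (sz x))"

text \<open>The random bits \<open>r\<close> come back untouched, so on \<open>D\<close> these
  programs toss no coins. The domain \<open>D\<close> lets a branch or a loop body be analysed only
  where its guard holds.\<close>

definition pt_on :: "'a::encodable set \<Rightarrow> ('a \<Rightarrow> 'b::encodable) \<Rightarrow> bool" where
  "pt_on D f \<longleftrightarrow> (\<exists>c m. pb m \<and> (\<forall>x\<in>D. \<forall>r. \<exists>t. runs c (enc x) r t (enc (f x)) r \<and> t \<le> m x))"

abbreviation pt :: "('a::encodable \<Rightarrow> 'b::encodable) \<Rightarrow> bool" where "pt \<equiv> pt_on UNIV"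

named_theorems pt_intros
named_theorems pb_intros

lemma pb_mono: "pb g \<Longrightarrow> (\<And>x. f x \<le> g x) \<Longrightarrow> pb f"
  unfolding pb_def by (meson le_trans)

lemma pb_const [pb_intros]: "pb (\<lambda>x. c)"
  unfolding pb_def by (rule exI[of _ "[:c:]"]) auto

lemma pb_self: "pb (\<lambda>x. sz x)"
  unfolding pb_def by (rule exI[of _ "[:0, 1:]"]) auto

lemma pb_add [pb_intros]: "pb f \<Longrightarrow> pb g \<Longrightarrow> pb (\<lambda>x. f x + g x)"
  unfolding pb_def by (elim exE, rule_tac x = "P + Pa" in exI) (auto intro: add_mono)

lemma pb_mult [pb_intros]: "pb f \<Longrightarrow> pb g \<Longrightarrow> pb (\<lambda>x. f x * g x)"
  unfolding pb_def by (elim exE, rule_tac x = "P * Pa" in exI) (auto intro: mult_le_mono)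

lemma pb_minus [pb_intros]: "pb f \<Longrightarrow> pb (\<lambda>x. f x - g x)"
  by (erule pb_mono) simp

lemma pb_min [pb_intros]: "pb g \<Longrightarrow> pb (\<lambda>x. min (f x) (g x))"
  by (erule pb_mono) simp

lemma pb_poly: "pb f \<Longrightarrow> pb (\<lambda>x. poly P (f x))"
proof -
  assume "pb f"
  then obtain Q where Q: "f x \<le> poly Q (sz x)" for x by (auto simp: pb_def)
  have "poly P (f x) \<le> poly (pcompose P Q) (sz x)" for x
    using poly_nat_mono[OF Q[of x], of P] by (simp add: poly_pcompose)
  then show ?thesis by (auto simp: pb_def)
qed

lemma pt_on_size: "pt_on D f \<Longrightarrow> \<exists>m. pb m \<and> (\<forall>x\<in>D. sz (f x) \<le> m x)"
proof -
  assume "pt_on D f"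
  then obtain c m where c: "pb m" "\<forall>x\<in>D. \<forall>r. \<exists>t. runs c (enc x) r t (enc (f x)) r \<and> t \<le> m x"
    by (auto simp: pt_on_def)
  have "sz (f x) \<le> m x" if "x \<in> D" for x
    using c(2) that runs_size le_trans by blast
  then show ?thesis using c(1) by blast
qed

lemma pb_sz [pb_intros]: "pt f \<Longrightarrow> pb (\<lambda>x. sz (f x))"
  by (drule pt_on_size) (auto elim: pb_mono)

lemma pt_on_subset: "pt_on E f \<Longrightarrow> D \<subseteq> E \<Longrightarrow> pt_on D f"
  unfolding pt_on_def by blast

lemma pt_on_cong: "pt_on D f \<Longrightarrow> (\<And>x. x \<in> D \<Longrightarrow> f x = g x) \<Longrightarrow> pt_on D g"
  unfolding pt_on_def by auto

lemma pt_cong: "pt f \<Longrightarrow> (\<And>x. f x = g x) \<Longrightarrow> pt g"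
  by (rule pt_on_cong)

lemma pt_onI:
  assumes "\<And>x r. x \<in> D \<Longrightarrow> \<exists>t. runs c (enc x) r t (enc (f x)) r \<and> t \<le> m x" "pb m"
  shows "pt_on D f"
  using assms unfolding pt_on_def by blast

lemma pt_prim:
  assumes "\<And>x. x \<in> D \<Longrightarrow> apply_prim c (enc x) = enc (f x)" "pb m" "\<And>x. x \<in> D \<Longrightarrow> sz (f x) \<le> m x"
  shows "pt_on D f"
proof (rule pt_onI[where c = "Prim c" and m = "\<lambda>x. sz x + m x"])
  fix x r assume "x \<in> D"
  then show "\<exists>t. runs (Prim c) (enc x) r t (enc (f x)) r \<and> t \<le> sz x + m x"
    using runs.Prim[of c "enc x" r] assms by auto
qed (intro pb_add pb_self assms)

section \<open>Closure under composition, pairing, branching and bounded loops\<close>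

lemma pt_on_comp:
  assumes "pt_on D f" "pt_on E g" "\<And>x. x \<in> D \<Longrightarrow> f x \<in> E"
  shows "pt_on D (\<lambda>x. g (f x))"
proof -
  from assms(1) obtain c m where c: "pb m" "\<forall>x\<in>D. \<forall>r. \<exists>t. runs c (enc x) r t (enc (f x)) r \<and> t \<le> m x"
    by (auto simp: pt_on_def)
  from assms(2) obtain d n where d: "pb n" "\<forall>x\<in>E. \<forall>r. \<exists>t. runs d (enc x) r t (enc (g x)) r \<and> t \<le> n x"
    by (auto simp: pt_on_def)
  obtain P where "\<forall>x. n x \<le> poly P (sz x)" using d(1) unfolding pb_def by blast
  then have N: "mono (poly P)" "\<And>x. n x \<le> poly P (sz x)" "pb (\<lambda>x. poly P (m x))"
    using pb_poly[OF c(1)] poly_nat_mono by (auto intro: monoI)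
  show ?thesis
  proof (rule pt_onI[where c = "Seq c d" and m = "\<lambda>x. 1 + m x + poly P (m x)"])
    fix x r assume x: "x \<in> D"
    then obtain t where t: "runs c (enc x) r t (enc (f x)) r" "t \<le> m x" using c by blast
    obtain s where s: "runs d (enc (f x)) r s (enc (g (f x))) r" "s \<le> n (f x)" using d assms(3)[OF x] by blast
    \<comment> \<open>The second program starts on a value whose size is at most the time
      \<open>t\<close> of the first, hence at most \<open>m x\<close>.\<close>
    have "s \<le> poly P (m x)"
      using s(2) N(2)[of "f x"] monoD[OF N(1), of "sz (f x)" "m x"] runs_size[OF t(1)] t(2) by linarith
    then show "\<exists>t. runs (Seq c d) (enc x) r t (enc (g (f x))) r \<and> t \<le> 1 + m x + poly P (m x)"
      using runs.Seq[OF t(1) s(1)] t(2) by (intro exI conjI) auto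
  qed (intro pb_intros c N)
qed

lemma pt_comp: "pt f \<Longrightarrow> pt g \<Longrightarrow> pt (\<lambda>x. g (f x))"
  by (rule pt_on_comp) auto

lemma pt_on_Pair:
  assumes "pt_on D f" "pt_on D g"
  shows "pt_on D (\<lambda>x. (f x, g x))"
proof -
  from assms(1) obtain c m where c: "pb m" "\<forall>x\<in>D. \<forall>r. \<exists>t. runs c (enc x) r t (enc (f x)) r \<and> t \<le> m x"
    by (auto simp: pt_on_def)
  from assms(2) obtain d n where d: "pb n" "\<forall>x\<in>D. \<forall>r. \<exists>t. runs d (enc x) r t (enc (g x)) r \<and> t \<le> n x"
    by (auto simp: pt_on_def)
  show ?thesis
  proof (rule pt_onI[where c = "Fork c d" and m = "\<lambda>x. 1 + m x + n x"])
    fix x r assume x: "x \<in> D"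
    then obtain t where t: "runs c (enc x) r t (enc (f x)) r" "t \<le> m x" using c by blast
    obtain s where s: "runs d (enc x) r s (enc (g x)) r" "s \<le> n x" using d x by blast
    show "\<exists>t. runs (Fork c d) (enc x) r t (enc (f x, g x)) r \<and> t \<le> 1 + m x + n x"
      using runs.Fork[OF t(1) s(1)] t(2) s(2) by (intro exI conjI) auto
  qed (intro pb_intros c d)
qed

lemmas pt_Pair [pt_intros] = pt_on_Pair[of UNIV]

lemma pt_on_if:
  fixes b :: "'a::encodable \<Rightarrow> bool"
  assumes "pt_on D b" "pt_on {x\<in>D. b x} f" "pt_on {x\<in>D. \<not> b x} g"
  shows "pt_on D (\<lambda>x. if b x then f x else g x)"
proof -
  from assms(1) obtain a k where a: "pb k" "\<forall>x\<in>D. \<forall>r. \<exists>t. runs a (enc x) r t (enc (b x)) r \<and> t \<le> k x"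
    by (auto simp: pt_on_def)
  from assms(2) obtain c m where c: "pb m" "\<forall>x\<in>{x\<in>D. b x}. \<forall>r. \<exists>t. runs c (enc x) r t (enc (f x)) r \<and> t \<le> m x"
    unfolding pt_on_def by blast
  from assms(3) obtain d n where d: "pb n" "\<forall>x\<in>{x\<in>D. \<not> b x}. \<forall>r. \<exists>t. runs d (enc x) r t (enc (g x)) r \<and> t \<le> n x"
    unfolding pt_on_def by blast
  show ?thesis
  proof (rule pt_onI[where c = "Cond a c d" and m = "\<lambda>x. 1 + k x + (m x + n x)"])
    fix x r assume x: "x \<in> D"
    then obtain u where u: "runs a (enc x) r u (enc (b x)) r" "u \<le> k x" using a by blast
    show "\<exists>t. runs (Cond a c d) (enc x) r t (enc (if b x then f x else g x)) r \<and> t \<le> 1 + k x + (m x + n x)"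
    proof (cases "b x")
      case True
      then obtain t where t: "runs c (enc x) r t (enc (f x)) r" "t \<le> m x" using c x by blast
      show ?thesis using runs.CondTrue[OF u(1) _ t(1), of d] u(2) t(2) True by (intro exI conjI) auto
    next
      case False
      then obtain t where t: "runs d (enc x) r t (enc (g x)) r" "t \<le> n x" using d x by blast
      show ?thesis using runs.CondFalse[OF u(1) _ t(1), of c] u(2) t(2) False by (intro exI conjI) auto
    qed
  qed (intro pb_intros a c d)
qed

lemma pt_if [pt_intros]:
  "pt b \<Longrightarrow> pt f \<Longrightarrow> pt g \<Longrightarrow> pt (\<lambda>x. if b x then f x else g x)"
  by (rule pt_on_if) (auto elim: pt_on_subset)

text \<open>Iterated composition of polynomial bounds is not polynomial, so besides the number of
  rounds the sizes of all intermediate states must be bounded, by \<open>m\<close>. \<open>N\<close>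
  is the exact number of rounds, and \<open>E\<close> contains the states that are reached.\<close>

lemma pt_on_while:
  fixes b :: "'s::encodable \<Rightarrow> bool" and f :: "'s \<Rightarrow> 's"
  assumes b: "pt_on E b" and f: "pt_on {s\<in>E. b s} f" and s0: "pt_on D s0" and N: "pb N" and m: "pb m"
    and E: "\<And>x j. x \<in> D \<Longrightarrow> j \<le> N x \<Longrightarrow> (f ^^ j) (s0 x) \<in> E"
    and T: "\<And>x j. x \<in> D \<Longrightarrow> j < N x \<Longrightarrow> b ((f ^^ j) (s0 x))"
    and F: "\<And>x. x \<in> D \<Longrightarrow> \<not> b ((f ^^ N x) (s0 x))"
    and sz: "\<And>x j. x \<in> D \<Longrightarrow> j \<le> N x \<Longrightarrow> sz ((f ^^ j) (s0 x)) \<le> m x"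
  shows "pt_on D (\<lambda>x. (f ^^ N x) (s0 x))"
proof -
  from s0 obtain c0 m0 where c0: "pb m0" "\<forall>x\<in>D. \<forall>r. \<exists>t. runs c0 (enc x) r t (enc (s0 x)) r \<and> t \<le> m0 x"
    by (auto simp: pt_on_def)
  from b obtain a k where a: "pb k" "\<forall>x\<in>E. \<forall>r. \<exists>t. runs a (enc x) r t (enc (b x)) r \<and> t \<le> k x"
    by (auto simp: pt_on_def)
  from f obtain c n where c: "pb n" "\<forall>x\<in>{x\<in>E. b x}. \<forall>r. \<exists>t. runs c (enc x) r t (enc (f x)) r \<and> t \<le> n x"
    unfolding pt_on_def by blast
  obtain P where "\<forall>x. k x + n x \<le> poly P (sz x)" using pb_add[OF a(1) c(1)] unfolding pb_def by blast
  then have K: "mono (poly P)" "\<And>x. k x + n x \<le> poly P (sz x)" "pb (\<lambda>x. poly P (m x))"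
    using pb_poly[OF m] poly_nat_mono by (auto intro: monoI)
  \<comment> \<open>Induction from the last round backwards: \<open>N x - j + 1\<close> counts the
    guard tests still to come, each charged together with its body.\<close>
  have loop: "\<exists>t. runs (While a c) (enc ((f ^^ j) (s0 x))) r t (enc ((f ^^ N x) (s0 x))) r
      \<and> t \<le> (N x - j + 1) * (1 + poly P (m x))" if xD: "x \<in> D" and jN: "j \<le> N x" for x j r
    using jN
  proof (induction j rule: inc_induct)
    case base
    let ?s = "(f ^^ N x) (s0 x)"
    obtain t where t: "runs a (enc ?s) r t (enc (b ?s)) r" "t \<le> k ?s" using a E[OF xD order_refl] by blast
    have "t \<le> poly P (m x)" using t(2) K(2)[of ?s] monoD[OF K(1) sz[OF xD, of "N x"]] by simp
    then show ?case using runs.WhileFalse[OF t(1), of c] F[OF xD] by (intro exI conjI) auto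
  next
    case (step j)
    let ?s = "(f ^^ j) (s0 x)"
    have bs: "b ?s" using T xD step by auto
    have Es: "?s \<in> E" using E xD step by auto
    obtain t where t: "runs a (enc ?s) r t (enc (b ?s)) r" "t \<le> k ?s" using a Es by blast
    obtain u where u: "runs c (enc ?s) r u (enc (f ?s)) r" "u \<le> n ?s" using c bs Es by blast
    obtain v where v: "runs (While a c) (enc (f ?s)) r v (enc ((f ^^ N x) (s0 x))) r"
        "v \<le> (N x - Suc j + 1) * (1 + poly P (m x))" using step.IH by auto
    have "t + u \<le> poly P (m x)" using t(2) u(2) K(2)[of ?s] monoD[OF K(1) sz[OF xD, of j]] step by simp
    moreover have "N x - j + 1 = Suc (N x - Suc j + 1)" using step by simp
    ultimately have "1 + t + u + v \<le> (N x - j + 1) * (1 + poly P (m x))" using v(2) by simp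
    then show ?case using runs.WhileTrue[OF t(1) _ u(1) v(1)] bs by auto
  qed
  show ?thesis
  proof (rule pt_onI[where c = "Seq c0 (While a c)" and m = "\<lambda>x. 1 + m0 x + (N x + 1) * (1 + poly P (m x))"])
    fix x r assume x: "x \<in> D"
    then obtain t where t: "runs c0 (enc x) r t (enc (s0 x)) r" "t \<le> m0 x" using c0 by blast
    obtain s where s: "runs (While a c) (enc (s0 x)) r s (enc ((f ^^ N x) (s0 x))) r"
       "s \<le> (N x + 1) * (1 + poly P (m x))" using loop[OF x, of 0 r] by auto
    show "\<exists>t. runs (Seq c0 (While a c)) (enc x) r t (enc ((f ^^ N x) (s0 x))) r \<and> t \<le> 1 + m0 x + (N x + 1) * (1 + poly P (m x))"
      using runs.Seq[OF t(1) s(1)] t(2) s(2) by (intro exI conjI) auto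
  qed (intro pb_intros c0 N K)
qed

section \<open>Basic operations and arithmetic of natural numbers\<close>

lemma pt_on_id: "pt_on D (\<lambda>x. x)"
  by (rule pt_prim[where c = Id, OF _ pb_self]) auto

lemma pt_id [pt_intros]: "pt (\<lambda>x. x)"
  by (rule pt_on_id)

lemma pt_fst0: "pt fst" and pt_snd0: "pt snd"
  by (rule pt_prim[where c = Fst, OF _ pb_self] pt_prim[where c = Snd, OF _ pb_self]; simp add: enc_prod_eq)+

lemma pt_fst [pt_intros]: "pt f \<Longrightarrow> pt (\<lambda>x. fst (f x))"
  and pt_snd [pt_intros]: "pt f \<Longrightarrow> pt (\<lambda>x. snd (f x))"
  by (rule pt_comp[OF _ pt_fst0] pt_comp[OF _ pt_snd0], assumption)+

lemma pt_app2: "pt (\<lambda>z. F (fst z) (snd z)) \<Longrightarrow> pt a \<Longrightarrow> pt b \<Longrightarrow> pt (\<lambda>x. F (a x) (b x))"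
  using pt_comp[of "\<lambda>x. (a x, b x)" "\<lambda>z. F (fst z) (snd z)"] pt_Pair[of a b] by simp

lemma pt_app3: "pt (\<lambda>z. F (fst z) (fst (snd z)) (snd (snd z))) \<Longrightarrow> pt a \<Longrightarrow> pt b \<Longrightarrow> pt c \<Longrightarrow>
    pt (\<lambda>x. F (a x) (b x) (c x))"
  using pt_comp[of "\<lambda>x. (a x, b x, c x)" "\<lambda>z. F (fst z) (fst (snd z)) (snd (snd z))"]
    pt_Pair[of a "\<lambda>x. (b x, c x)"] pt_Pair[of b c] by simp

lemma const_prog: "\<exists>c k. \<forall>v r. \<exists>t. runs c v r t w r \<and> t \<le> k * vsize v + k"
proof (induction w)
  case (Num n)
  have "runs (Prim (Const n)) v r (vsize v + vsize (Num n)) (Num n) r" for v r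
    using runs.Prim[of "Const n" v r] by simp
  then show ?case
    by (intro exI[of _ "Prim (Const n)"] exI[of _ "vsize (Num n)"] allI exI conjI) (assumption, simp)
next
  case (Pair w1 w2)
  then obtain c k d l where c: "\<forall>v r. \<exists>t. runs c v r t w1 r \<and> t \<le> k * vsize v + k"
    and d: "\<forall>v r. \<exists>t. runs d v r t w2 r \<and> t \<le> l * vsize v + l" by blast
  show ?case
  proof (rule exI[of _ "Fork c d"], rule exI[of _ "k + l + 1"], intro allI)
    fix v :: val and r :: "bool list"
    obtain t1 where t1: "runs c v r t1 w1 r" "t1 \<le> k * vsize v + k" using c by blast
    obtain t2 where t2: "runs d v r t2 w2 r" "t2 \<le> l * vsize v + l" using d by blast
    show "\<exists>t. runs (Fork c d) v r t (Pair w1 w2) r \<and> t \<le> (k + l + 1) * vsize v + (k + l + 1)"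
      by (rule exI, rule conjI, rule runs.Fork[OF t1(1) t2(1)]) (use t1(2) t2(2) in \<open>simp add: algebra_simps\<close>)
  qed
qed

lemma pt_const [pt_intros]: "pt (\<lambda>x :: 'b::encodable. c)"
proof -
  obtain d k where "\<forall>v r. \<exists>t. runs d v r t (enc c) r \<and> t \<le> k * vsize v + k" using const_prog by blast
  then have "\<exists>t. runs d (enc x) r t (enc c) r \<and> t \<le> k * sz x + k" for x :: 'b and r by blast
  then show ?thesis
    by (rule pt_onI) (rule pb_add pb_mult pb_const pb_self)+
qed

lemma floorlog_add: "floorlog 2 (a + b) \<le> floorlog 2 a + floorlog 2 b"
proof (cases "a = 0 \<or> b = 0")
  case False
  have "a < 2 ^ floorlog 2 a" "b < 2 ^ floorlog 2 b" using False floorlog_bounds[of a 2] floorlog_bounds[of b 2] by auto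
  then have "a + b < 2 ^ floorlog 2 a + 2 ^ floorlog 2 b" by (rule add_strict_mono)
  also
  \<comment> \<open>Both exponents must be positive: writing the powers as 2 + u and 2 + v, their
    product 4 + 2u + 2v + uv exceeds their sum 4 + u + v or equals it.\<close>
  have "(2::nat) ^ i + 2 ^ j \<le> 2 ^ (i + j)" if "i > 0" "j > 0" for i j :: nat
  proof -
    have "(2::nat) \<le> 2 ^ i" "(2::nat) \<le> 2 ^ j" using that by (auto intro: self_le_power)
    then obtain u v where "(2::nat) ^ i = 2 + u" "(2::nat) ^ j = 2 + v" by (metis le_Suc_ex)
    then show ?thesis by (simp add: power_add algebra_simps)
  qed
  from this[of "floorlog 2 a" "floorlog 2 b"] False
  have "2 ^ floorlog 2 a + 2 ^ floorlog 2 b \<le> (2::nat) ^ (floorlog 2 a + floorlog 2 b)"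
    by (simp add: floorlog_def)
  finally have "a + b < 2 ^ (floorlog 2 a + floorlog 2 b)" .
  then show ?thesis by (intro floorlog_leI) auto
qed auto

lemma floorlog_mult: "floorlog 2 (a * b) \<le> floorlog 2 a + floorlog 2 b"
proof (cases "a = 0 \<or> b = 0")
  case False
  have "a < 2 ^ floorlog 2 a" "b < 2 ^ floorlog 2 b" using False floorlog_bounds[of a 2] floorlog_bounds[of b 2] by auto
  then have "a * b < 2 ^ (floorlog 2 a + floorlog 2 b)"
    by (simp add: power_add mult_strict_mono)
  then show ?thesis by (intro floorlog_leI) auto
qed auto

lemma sz_nat_mono: "a \<le> b \<Longrightarrow> sz (a::nat) \<le> sz b"
  by (simp add: floorlog_mono)

lemma sz_prod: "sz z = 1 + sz (fst z) + sz (snd z)"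
  by (simp add: enc_prod_eq)

lemma pt_prim2:
  assumes "\<And>a b. apply_prim c (Pair (Num a) (Num b)) = Num (F a b)" "\<And>a b. sz (F a b) \<le> sz (a, b)"
  shows "pt f \<Longrightarrow> pt g \<Longrightarrow> pt (\<lambda>x. F (f x) (g x))"
proof -
  have "pt (\<lambda>z. F (fst z) (snd z))"
    by (rule pt_prim[where c = c, OF _ pb_self]) (use assms in \<open>simp_all add: enc_prod_eq\<close>)
  then show "pt f \<Longrightarrow> pt g \<Longrightarrow> pt (\<lambda>x. F (f x) (g x))" by (rule pt_app2)
qed

lemma pt_add [pt_intros]: "pt f \<Longrightarrow> pt g \<Longrightarrow> pt (\<lambda>x. f x + g x :: nat)"
  by (rule pt_prim2[where c = Add]) (auto intro: le_SucI[OF le_SucI[OF floorlog_add]])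

lemma pt_mult [pt_intros]: "pt f \<Longrightarrow> pt g \<Longrightarrow> pt (\<lambda>x. f x * g x :: nat)"
  by (rule pt_prim2[where c = Mult]) (auto intro: le_SucI[OF le_SucI[OF floorlog_mult]])

lemma pt_minus [pt_intros]: "pt f \<Longrightarrow> pt g \<Longrightarrow> pt (\<lambda>x. f x - g x :: nat)"
  by (rule pt_prim2[where c = Sub]) (auto intro!: le_SucI trans_le_add1 floorlog_mono)

lemma pt_div [pt_intros]: "pt f \<Longrightarrow> pt g \<Longrightarrow> pt (\<lambda>x. f x div g x :: nat)"
  by (rule pt_prim2[where c = Div]) (auto intro!: le_SucI trans_le_add1 floorlog_mono div_le_dividend)

lemma pt_mod [pt_intros]: "pt f \<Longrightarrow> pt g \<Longrightarrow> pt (\<lambda>x. f x mod g x :: nat)"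
  unfolding modulo_nat_def by (intro pt_intros)

lemma pt_Suc [pt_intros]: "pt f \<Longrightarrow> pt (\<lambda>x. Suc (f x))"
  unfolding Suc_eq_plus1 by (intro pt_intros)

lemma pt_nonzero: "pt f \<Longrightarrow> pt (\<lambda>x. f x \<noteq> (0::nat))"
proof (rule pt_comp[of f "\<lambda>n. n \<noteq> (0::nat)"])
  have C: "runs (Cond (Prim Id) (Prim (Const 1)) (Prim (Const 0))) (Num n) r
      (1 + (vsize (Num n) + vsize (Num n)) + (vsize (Num n) + vsize (Num (of_bool (n \<noteq> 0))))) (Num (of_bool (n \<noteq> 0))) r" for n r
    using runs.CondTrue[OF runs.Prim[of Id "Num n" r] _ runs.Prim[of "Const 1"], of "Prim (Const 0)"]
      runs.CondFalse[OF runs.Prim[of Id "Num n" r] _ runs.Prim[of "Const 0"], of "Prim (Const 1)"]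
    by (cases "n = 0") (simp_all add: )
  show "pt (\<lambda>n. n \<noteq> (0::nat))"
  proof (rule pt_onI)
    fix n :: nat and r
    show "\<exists>t. runs (Cond (Prim Id) (Prim (Const 1)) (Prim (Const 0))) (enc n) r t (enc (n \<noteq> 0)) r
        \<and> t \<le> 1 + (sz n + sz n) + (sz n + 2)"
      using C[of n r] by (intro exI conjI) (simp, simp add: floorlog_def)
  qed (intro pb_intros pb_self)
qed

lemma pt_not [pt_intros]: "pt b \<Longrightarrow> pt (\<lambda>x. \<not> b x)"
  by (rule pt_cong[OF pt_if[of b "\<lambda>x. False" "\<lambda>x. True"]]) (auto intro: pt_intros)

lemma pt_conj [pt_intros]: "pt a \<Longrightarrow> pt b \<Longrightarrow> pt (\<lambda>x. a x \<and> b x)"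
  by (rule pt_cong[OF pt_if[of a b "\<lambda>x. False"]]) (auto intro: pt_intros)

lemma pt_disj [pt_intros]: "pt a \<Longrightarrow> pt b \<Longrightarrow> pt (\<lambda>x. a x \<or> b x)"
  by (rule pt_cong[OF pt_if[of a "\<lambda>x. True" b]]) (auto intro: pt_intros)

lemma pt_less [pt_intros]: "pt f \<Longrightarrow> pt g \<Longrightarrow> pt (\<lambda>x. f x < (g x :: nat))"
  by (rule pt_cong[OF pt_nonzero[OF pt_minus[of g f]]]) auto

lemma pt_le [pt_intros]: "pt f \<Longrightarrow> pt g \<Longrightarrow> pt (\<lambda>x. f x \<le> (g x :: nat))"
  by (rule pt_cong[OF pt_not[OF pt_less[of g f]]]) auto

lemma pt_eq_nat [pt_intros]: "pt f \<Longrightarrow> pt g \<Longrightarrow> pt (\<lambda>x. f x = (g x :: nat))"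
  by (rule pt_cong[OF pt_conj[OF pt_le[of f g] pt_le[of g f]]]) auto

lemma pt_min [pt_intros]: "pt f \<Longrightarrow> pt g \<Longrightarrow> pt (\<lambda>x. min (f x) (g x :: nat))"
  and pt_max [pt_intros]: "pt f \<Longrightarrow> pt g \<Longrightarrow> pt (\<lambda>x. max (f x) (g x :: nat))"
  unfolding min_def max_def by (intro pt_intros; assumption)+

section \<open>Polynomial-time list operations\<close>

lemma length_le_sz: "length xs \<le> sz xs"
  by (induction xs) auto

lemma sz_append: "sz (xs @ ys) + 1 = sz xs + sz ys"
  by (induction xs) (simp_all add: floorlog_def)

lemma sz_append_le: "sz (xs @ ys) \<le> sz xs + sz ys"
  using sz_append[of xs ys] by linarith

lemma sz_rev: "sz (rev xs) = sz xs"
proof (induction xs)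
  case (Cons a xs)
  then show ?case using sz_append[of "rev xs" "[a]"] by (simp add: floorlog_def)
qed simp

lemma sz_take_le: "sz (take j xs) \<le> sz xs" and sz_drop_le: "sz (drop j xs) \<le> sz xs"
proof -
  have "sz (take j xs) + sz (drop j xs) = sz xs + 1" using sz_append[of "take j xs" "drop j xs"] by simp
  then show "sz (take j xs) \<le> sz xs" "sz (drop j xs) \<le> sz xs"
    using vsize_pos[of "enc (take j xs)"] vsize_pos[of "enc (drop j xs)"] by linarith+
qed

lemma sz_filter_le: "sz (filter P xs) \<le> sz xs"
  by (induction xs) auto

lemma sz_takeWhile_le: "sz (takeWhile P xs) \<le> sz xs"
  by (metis sz_take_le takeWhile_eq_take)

lemma sz_mem_le: "y \<in> set xs \<Longrightarrow> sz y \<le> sz xs"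
  by (induction xs) auto

lemma sz_list_le: "(\<And>y. y \<in> set xs \<Longrightarrow> sz y \<le> B) \<Longrightarrow> length xs \<le> N \<Longrightarrow> sz xs \<le> 1 + N * (1 + B)"
proof (induction xs arbitrary: N)
  case Nil
  then show ?case by (simp add: floorlog_def)
next
  case (Cons a xs)
  then obtain N' where N: "N = Suc N'" by (cases N) auto
  have "sz xs \<le> 1 + N' * (1 + B)" using Cons N by auto
  moreover have "sz a \<le> B" using Cons by auto
  ultimately show ?case using N by simp
qed

text \<open>A program sees only encodings. Since a nonempty list is encoded like a pair, list
  construction inherits its program from pairing.\<close>

lemma pt_enc_cong: "pt f \<Longrightarrow> (\<And>x. enc (f x) = enc (g x)) \<Longrightarrow> pt g"
  unfolding pt_on_def by simp

lemma pt_Cons [pt_intros]: "pt f \<Longrightarrow> pt g \<Longrightarrow> pt (\<lambda>x. f x # g x)"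
  by (rule pt_enc_cong[OF pt_Pair[of f g]]) auto

lemma pt_nonempty: "pt f \<Longrightarrow> pt (\<lambda>x. f x \<noteq> [])"
proof (rule pt_comp[of f "\<lambda>xs. xs \<noteq> []"])
  show "pt (\<lambda>xs :: 'b list. xs \<noteq> [])"
  proof (rule pt_prim[where c = IsPair, OF _ pb_const[of 2]])
    fix xs :: "'b list"
    show "apply_prim IsPair (enc xs) = enc (xs \<noteq> [])" by (cases xs) auto
    show "sz (xs \<noteq> []) \<le> 2" by (auto simp: floorlog_def)
  qed
qed

lemma pt_null [pt_intros]: "pt f \<Longrightarrow> pt (\<lambda>x. f x = [])"
  using pt_not[OF pt_nonempty[of f]] by simp

text \<open>Head and tail are projections only on nonempty lists, so the cons branch is built on
  that domain and then joined to the other branch by \<open>pt_on_if\<close>.\<close>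

lemma pt_case_list [pt_intros]:
  assumes "pt xs" "pt a" "pt (\<lambda>z. b (fst z) (fst (snd z)) (snd (snd z)))"
  shows "pt (\<lambda>x. case xs x of [] \<Rightarrow> a x | y # ys \<Rightarrow> b x y ys)"
proof -
  let ?D = "{zs :: 'b list. zs \<noteq> []}"
  have hd: "pt_on ?D hd" by (rule pt_prim[where c = Fst, OF _ pb_self]) (auto simp: neq_Nil_conv)
  have tl: "pt_on ?D tl" by (rule pt_prim[where c = Snd, OF _ pb_self]) (auto simp: neq_Nil_conv)
  let ?E = "{x. xs x \<noteq> []}"
  have xs: "pt_on ?E xs" using assms(1) by (rule pt_on_subset) auto
  have "pt_on ?E (\<lambda>x. (x, hd (xs x), tl (xs x)))"
    by (intro pt_on_Pair pt_on_id pt_on_comp[OF xs hd] pt_on_comp[OF xs tl]) auto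
  from pt_on_comp[OF this assms(3)] have "pt_on ?E (\<lambda>x. b x (hd (xs x)) (tl (xs x)))" by simp
  then have "pt_on {x \<in> UNIV. xs x \<noteq> []} (\<lambda>x. b x (hd (xs x)) (tl (xs x)))" by simp
  from pt_on_if[OF pt_nonempty[OF assms(1)] this, of a] pt_on_subset[OF assms(2)]
  have "pt (\<lambda>x. if xs x \<noteq> [] then b x (hd (xs x)) (tl (xs x)) else a x)" by auto
  then show ?thesis by (rule pt_cong) (auto split: list.split)
qed

lemma pt_tl [pt_intros]: "pt f \<Longrightarrow> pt (\<lambda>x. tl (f x))"
proof -
  assume f: "pt f"
  have "pt (\<lambda>x. case f x of [] \<Rightarrow> [] | y # ys \<Rightarrow> ys)" by (intro pt_intros f)
  then show ?thesis by (rule pt_cong) (auto split: list.split)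
qed

lemma pb_length [pb_intros]: "pt f \<Longrightarrow> pb (\<lambda>x. length (f x))"
  by (rule pb_mono[OF pb_sz[of f]]) (auto intro: length_le_sz)

text \<open>The workhorse for loops: the number of rounds is the length of a list and hence
  polynomial, which leaves the size of the accumulator. The invariant \<open>I\<close> may depend on
  the number \<open>j\<close> of entries read, so that the accumulator may grow slowly.\<close>

lemma pt_foldl_inv:
  assumes xs: "pt xs" and s0: "pt s0" and g: "pt (\<lambda>z. g (fst z) (fst (snd z)) (snd (snd z)))" and m: "pb m"
    and I0: "\<And>x. I x 0 (s0 x)"
    and IS: "\<And>x j s. j < length (xs x) \<Longrightarrow> I x j s \<Longrightarrow> I x (Suc j) (g x s (xs x ! j))"
    and sz: "\<And>x j s. j \<le> length (xs x) \<Longrightarrow> I x j s \<Longrightarrow> sz s \<le> m x"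
  shows "pt (\<lambda>x. foldl (g x) (s0 x) (xs x))"
proof -
  \<comment> \<open>The loop state carries the unread entries, the parameter and the accumulator,
    since a program has no memory besides its current value.\<close>
  define f where "f = (\<lambda>z. case fst z of [] \<Rightarrow> z | y # ys \<Rightarrow> (ys, fst (snd z), g (fst (snd z)) (snd (snd z)) y))"
  have f: "pt f" unfolding f_def by (intro pt_intros pt_app3[OF g])
  have it: "(f ^^ j) (zs, x, s) = (drop j zs, x, foldl (g x) s (take j zs))" if "j \<le> length zs" for j zs x s
    using that
  proof (induction j)
    case (Suc j)
    then have "drop j zs = zs ! j # drop (Suc j) zs" by (simp add: Cons_nth_drop_Suc)
    then show ?case using Suc by (simp add: f_def take_Suc_conv_app_nth)
  qed simp
  have inv: "I x j (foldl (g x) (s0 x) (take j (xs x)))" if "j \<le> length (xs x)" for x j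
    using that
  proof (induction j)
    case (Suc j)
    then show ?case using IS[of j x] by (simp add: take_Suc_conv_app_nth)
  qed (use I0 in simp)
  have "pt (\<lambda>x. (f ^^ length (xs x)) (xs x, x, s0 x))"
  proof (rule pt_on_while[where E = UNIV and b = "\<lambda>z. fst z \<noteq> []" and m = "\<lambda>x. 2 + sz (xs x) + sz x + m x"])
    show "pt_on {s \<in> UNIV. fst s \<noteq> []} f" using f by (rule pt_on_subset) auto
    show "sz ((f ^^ j) (xs x, x, s0 x)) \<le> 2 + sz (xs x) + sz x + m x" if "j \<le> length (xs x)" for x j
      using sz[OF that inv[OF that]] sz_drop_le[of j "xs x"] by (simp add: it that)
  qed (intro pt_nonempty pt_intros xs s0 pb_intros m pb_self | simp add: it)+
  then have "pt (\<lambda>x. snd (snd ((f ^^ length (xs x)) (xs x, x, s0 x))))" by (intro pt_intros)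
  then show ?thesis by (simp add: it)
qed

lemma pt_foldl:
  assumes "pt xs" "pt s0" "pt (\<lambda>z. g (fst z) (fst (snd z)) (snd (snd z)))" "pb m"
    and sz: "\<And>x j. sz (foldl (g x) (s0 x) (take j (xs x))) \<le> m x"
  shows "pt (\<lambda>x. foldl (g x) (s0 x) (xs x))"
  by (rule pt_foldl_inv[where I = "\<lambda>x j s. s = foldl (g x) (s0 x) (take j (xs x))", OF assms(1-4)])
    (use sz in \<open>auto simp: take_Suc_conv_app_nth\<close>)

lemma foldl_snoc_rev: "foldl (\<lambda>s y. h y # s) zs ys = rev (map h ys) @ zs"
  by (induction ys arbitrary: zs) auto

lemma pt_rev [pt_intros]: "pt f \<Longrightarrow> pt (\<lambda>x. rev (f x))"
proof -
  assume f: "pt f"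
  have "pt (\<lambda>x. foldl (\<lambda>s y. y # s) [] (f x))"
  proof (rule pt_foldl[where m = "\<lambda>x. sz (f x)"])
    show "sz (foldl (\<lambda>s y. y # s) [] (take j (f x))) \<le> sz (f x)" for x j
      using foldl_snoc_rev[of "\<lambda>y. y" "[]" "take j (f x)"] by (simp add: sz_rev sz_take_le)
  qed (intro pt_intros f pb_intros)+
  then show ?thesis by (rule pt_cong) (simp add: foldl_snoc_rev[of "\<lambda>y. y", simplified])
qed

lemma pt_append [pt_intros]: "pt f \<Longrightarrow> pt g \<Longrightarrow> pt (\<lambda>x. f x @ g x)"
proof -
  assume f: "pt f" and g: "pt g"
  have "pt (\<lambda>x. foldl (\<lambda>s y. y # s) (g x) (rev (f x)))"
  proof (rule pt_foldl[where m = "\<lambda>x. sz (f x) + sz (g x)"])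
    show "sz (foldl (\<lambda>s y. y # s) (g x) (take j (rev (f x)))) \<le> sz (f x) + sz (g x)" for x j
      using foldl_snoc_rev[of "\<lambda>y. y" "g x" "take j (rev (f x))"] sz_append_le[of "rev (take j (rev (f x)))" "g x"]
        sz_take_le[of j "rev (f x)"] by (simp add: sz_rev)
  qed (intro pt_intros f g pb_intros)+
  then show ?thesis by (rule pt_cong) (simp add: foldl_snoc_rev[of "\<lambda>y. y", simplified])
qed

lemma pb_sz_app2:
  assumes "pt (\<lambda>z. g (fst z) (snd z))" "pt xs"
  obtains B where "pb B" "\<And>x y. y \<in> set (xs x) \<Longrightarrow> sz (g x y) \<le> B x"
proof -
  from pb_sz[OF assms(1)] obtain P :: "nat poly" where P: "\<forall>z. sz (g (fst z) (snd z)) \<le> poly P (sz z)"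
    unfolding pb_def by blast
  have "sz (g x y) \<le> poly P (1 + sz x + sz (xs x))" if "y \<in> set (xs x)" for x y
  proof -
    have "sz (g x y) \<le> poly P (sz (x, y))" using P by (metis fst_conv snd_conv)
    also have "\<dots> \<le> poly P (1 + sz x + sz (xs x))" using sz_mem_le[OF that] by (intro poly_nat_mono) auto
    finally show ?thesis .
  qed
  moreover have "pb (\<lambda>x. poly P (1 + sz x + sz (xs x)))" by (intro pb_poly pb_intros pb_self assms)
  ultimately show ?thesis using that by blast
qed

lemma pt_map [pt_intros]:
  assumes g: "pt (\<lambda>z. g (fst z) (snd z))" and xs: "pt xs"
  shows "pt (\<lambda>x. map (g x) (xs x))"
proof -
  obtain B where B: "pb B" "\<And>x y. y \<in> set (xs x) \<Longrightarrow> sz (g x y) \<le> B x" using pb_sz_app2[OF g xs] by blast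
  have "pt (\<lambda>x. foldl (\<lambda>s y. g x y # s) [] (xs x))"
  proof (rule pt_foldl[where m = "\<lambda>x. 1 + length (xs x) * (1 + B x)"])
    show "sz (foldl (\<lambda>s y. g x y # s) [] (take j (xs x))) \<le> 1 + length (xs x) * (1 + B x)" for x j
      unfolding foldl_snoc_rev
      by (rule sz_list_le) (use B in \<open>auto dest!: in_set_takeD\<close>)
  qed (intro pt_intros xs pt_app2[OF g] pb_intros B)+
  then have "pt (\<lambda>x. rev (foldl (\<lambda>s y. g x y # s) [] (xs x)))" by (intro pt_intros)
  then show ?thesis by (rule pt_cong) (simp add: foldl_snoc_rev)
qed

lemma foldl_filter_rev: "foldl (\<lambda>s y. if P y then y # s else s) zs ys = rev (filter P ys) @ zs"
  by (induction ys arbitrary: zs) auto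

lemma pt_filter [pt_intros]:
  assumes P: "pt (\<lambda>z. P (fst z) (snd z))" and xs: "pt xs"
  shows "pt (\<lambda>x. filter (P x) (xs x))"
proof -
  have "pt (\<lambda>x. foldl (\<lambda>s y. if P x y then y # s else s) [] (xs x))"
  proof (rule pt_foldl[where m = "\<lambda>x. sz (xs x)"])
    show "sz (foldl (\<lambda>s y. if P x y then y # s else s) [] (take j (xs x))) \<le> sz (xs x)" for x j
      unfolding foldl_filter_rev using sz_filter_le[of "P x" "take j (xs x)"] sz_take_le[of j "xs x"] by (simp add: sz_rev)
  qed (intro pt_intros xs pt_app2[OF P] pb_intros)+
  then have "pt (\<lambda>x. rev (foldl (\<lambda>s y. if P x y then y # s else s) [] (xs x)))" by (intro pt_intros)
  then show ?thesis by (rule pt_cong) (simp add: foldl_filter_rev)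
qed

lemma pt_ball [pt_intros]:
  assumes "pt (\<lambda>z. P (fst z) (snd z))" "pt xs"
  shows "pt (\<lambda>x. \<forall>y\<in>set (xs x). P x y)"
proof -
  have "pt (\<lambda>x. filter (\<lambda>y. \<not> P x y) (xs x) = [])" by (intro pt_intros assms pt_app2[OF assms(1)])
  then show ?thesis by (rule pt_cong) (auto simp: filter_empty_conv)
qed

lemma pt_bex [pt_intros]:
  assumes "pt (\<lambda>z. P (fst z) (snd z))" "pt xs"
  shows "pt (\<lambda>x. \<exists>y\<in>set (xs x). P x y)"
proof -
  have "pt (\<lambda>x. \<not> (\<forall>y\<in>set (xs x). \<not> P x y))" by (intro pt_intros assms pt_app2[OF assms(1)])
  then show ?thesis by (rule pt_cong) auto
qed

lemma floorlog_le_self: "floorlog 2 n \<le> n"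
  by (rule floorlog_leI) auto

lemma pt_length [pt_intros]: "pt xs \<Longrightarrow> pt (\<lambda>x. length (xs x))"
proof -
  assume xs: "pt xs"
  have e: "foldl (\<lambda>s y. Suc s) k ys = k + length ys" for k and ys :: "'c list"
    by (induction ys arbitrary: k) auto
  have "pt (\<lambda>x. foldl (\<lambda>s y. Suc s) 0 (xs x))"
  proof (rule pt_foldl[where m = "\<lambda>x. 1 + length (xs x)"])
    show "sz (foldl (\<lambda>s y. Suc s) 0 (take j (xs x))) \<le> 1 + length (xs x)" for x j
      unfolding e using floorlog_le_self[of "length (take j (xs x))"] by simp
  qed (intro pt_intros pb_intros xs)+
  then show ?thesis by (simp add: e)
qed

lemma foldl_append_concat: "foldl (@) zs xss = zs @ concat xss"
  by (induction xss arbitrary: zs) auto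

lemma sz_concat_le: "sz (concat xss) \<le> sz xss"
proof (induction xss)
  case (Cons xs xss)
  then show ?case using sz_append_le[of xs "concat xss"] by simp
qed simp

lemma pt_concat [pt_intros]: "pt xss \<Longrightarrow> pt (\<lambda>x. concat (xss x))"
proof -
  assume xss: "pt xss"
  have "pt (\<lambda>x. foldl (@) [] (xss x))"
  proof (rule pt_foldl[where m = "\<lambda>x. sz (xss x)"])
    show "sz (foldl (@) [] (take j (xss x))) \<le> sz (xss x)" for x j
      unfolding foldl_append_concat using sz_concat_le[of "take j (xss x)"] sz_take_le[of j "xss x"] by simp
  qed (intro pt_intros pb_intros xss)+
  then show ?thesis by (simp add: foldl_append_concat)
qed

lemma foldl_take: "foldl (\<lambda>s y. if fst s < n then (Suc (fst s), y # snd s) else s) (0, []) ys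
    = (min n (length ys), rev (take n ys))"
  by (induction ys rule: rev_induct) (auto simp: min_def)

lemma pt_take [pt_intros]: "pt n \<Longrightarrow> pt xs \<Longrightarrow> pt (\<lambda>x. take (n x) (xs x))"
proof -
  assume n: "pt n" and xs: "pt xs"
  have "pt (\<lambda>x. foldl (\<lambda>s y. if fst s < n x then (Suc (fst s), y # snd s) else s) (0, []) (xs x))"
  proof (rule pt_foldl[where m = "\<lambda>x. 2 + length (xs x) + sz (xs x)"])
    fix x j
    show "sz (foldl (\<lambda>s y. if fst s < n x then (Suc (fst s), y # snd s) else s) (0, []) (take j (xs x)))
       \<le> 2 + length (xs x) + sz (xs x)"
      unfolding foldl_take
      using floorlog_le_self[of "min (n x) (length (take j (xs x)))"] sz_take_le[of "n x" "take j (xs x)"] sz_take_le[of j "xs x"]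
      by (simp add: sz_rev del: take_take)
  qed (intro pt_intros pb_intros pb_length xs pt_comp[OF _ n])+
  then have "pt (\<lambda>x. rev (snd (foldl (\<lambda>s y. if fst s < n x then (Suc (fst s), y # snd s) else s) (0, []) (xs x))))"
    by (intro pt_intros)
  then show ?thesis by (rule pt_cong) (simp add: foldl_take)
qed

lemma pt_drop [pt_intros]: "pt n \<Longrightarrow> pt xs \<Longrightarrow> pt (\<lambda>x. drop (n x) (xs x))"
proof -
  assume n: "pt n" and xs: "pt xs"
  have e: "foldl (\<lambda>s y. tl s) zs ys = drop (length ys) zs" for zs and ys :: "'c list"
    by (induction ys arbitrary: zs) (auto simp: drop_Suc)
  have "pt (\<lambda>x. foldl (\<lambda>s y. tl s) (xs x) (take (n x) (xs x)))"
  proof (rule pt_foldl[where m = "\<lambda>x. sz (xs x)"])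
    show "sz (foldl (\<lambda>s y. tl s) (xs x) (take j (take (n x) (xs x)))) \<le> sz (xs x)" for x j
      unfolding e by (rule sz_drop_le)
  qed (intro pt_intros pb_intros xs n)+
  then show ?thesis by (rule pt_cong) (simp add: e min_def)
qed

definition getd :: "'a \<Rightarrow> 'a list \<Rightarrow> nat \<Rightarrow> 'a" where
  "getd d xs i = (case drop i xs of [] \<Rightarrow> d | y # ys \<Rightarrow> y)"

lemma getd_eq: "getd d xs i = (if i < length xs then xs ! i else d)"
  by (auto simp: getd_def split: list.split dest: arg_cong[of _ _ length] simp flip: Cons_nth_drop_Suc)

lemma pt_getd [pt_intros]: "pt d \<Longrightarrow> pt xs \<Longrightarrow> pt i \<Longrightarrow> pt (\<lambda>x. getd (d x) (xs x) (i x))"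
  unfolding getd_def by (intro pt_intros)

lemma foldl_zip: "foldl (\<lambda>s y. case fst s of [] \<Rightarrow> s | b # bs \<Rightarrow> (bs, (y, b) # snd s)) (ys, []) xs
    = (drop (length xs) ys, rev (zip xs ys))"
proof (induction xs rule: rev_induct)
  case (snoc x xs)
  show ?case
  proof (cases "length xs < length ys")
    case True
    then have d: "drop (length xs) ys = ys ! length xs # drop (Suc (length xs)) ys" by (simp add: Cons_nth_drop_Suc)
    moreover have "zip xs (take (length xs) ys) = zip xs ys" using take_zip[of "length xs" xs ys] by simp
    ultimately show ?thesis using snoc by (simp add: zip_append1)
  next
    case False
    then show ?thesis using snoc by (simp add: zip_append1)
  qed
qed simp

lemma sz_zip_le: "sz (zip xs ys) \<le> sz xs + sz ys"
proof (induction xs arbitrary: ys)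
  case (Cons a xs)
  then show ?case by (cases ys) (auto simp: floorlog_def intro: le_SucI)
qed simp

lemma pt_zip [pt_intros]: "pt xs \<Longrightarrow> pt ys \<Longrightarrow> pt (\<lambda>x. zip (xs x) (ys x))"
proof -
  assume xs: "pt xs" and ys: "pt ys"
  have "pt (\<lambda>x. foldl (\<lambda>s y. case fst s of [] \<Rightarrow> s | b # bs \<Rightarrow> (bs, (y, b) # snd s)) (ys x, []) (xs x))"
  proof (rule pt_foldl[where m = "\<lambda>x. 1 + sz (ys x) + (sz (xs x) + sz (ys x))"])
    show "sz (foldl (\<lambda>s y. case fst s of [] \<Rightarrow> s | b # bs \<Rightarrow> (bs, (y, b) # snd s)) (ys x, []) (take j (xs x)))
       \<le> 1 + sz (ys x) + (sz (xs x) + sz (ys x))" for x j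
      unfolding foldl_zip using sz_drop_le[of "length (take j (xs x))" "ys x"] sz_zip_le[of "take j (xs x)" "ys x"]
         sz_take_le[of j "xs x"] by (simp add: sz_rev)
  qed (intro pt_intros pb_intros xs ys)+
  then have "pt (\<lambda>x. rev (snd (foldl (\<lambda>s y. case fst s of [] \<Rightarrow> s | b # bs \<Rightarrow> (bs, (y, b) # snd s)) (ys x, []) (xs x))))"
    by (intro pt_intros)
  then show ?thesis by (rule pt_cong) (simp add: foldl_zip)
qed

lemma pt_upt [pt_intros]: "pt n \<Longrightarrow> pb n \<Longrightarrow> pt (\<lambda>x. [0..<n x])"
proof -
  assume n: "pt n" "pb n"
  define f :: "nat \<times> nat list \<Rightarrow> nat \<times> nat list" where "f = (\<lambda>z. (fst z - 1, (fst z - 1) # snd z))"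
  have it: "(f ^^ j) (k, []) = (k - j, [k - j..<k])" if "j \<le> k" for j k
    using that
  proof (induction j)
    case (Suc j)
    then show ?case by (simp add: f_def upt_rec[of "k - Suc j"] Suc_diff_Suc)
  qed simp
  have "pt (\<lambda>x. (f ^^ n x) (n x, []))"
  proof (rule pt_on_while[where E = UNIV and b = "\<lambda>z. fst z \<noteq> 0" and m = "\<lambda>x. 1 + sz (n x) + (1 + n x * (1 + sz (n x)))"])
    show "pt (\<lambda>x. fst x \<noteq> (0::nat))" by (intro pt_nonzero pt_intros)
    show "pt_on {s \<in> UNIV. fst s \<noteq> 0} f" unfolding f_def by (rule pt_on_subset[of UNIV]) (intro pt_intros, auto)
    show "sz ((f ^^ j) (n x, [])) \<le> 1 + sz (n x) + (1 + n x * (1 + sz (n x)))" if "j \<le> n x" for x j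
    proof -
      have "sz (n x - j) \<le> sz (n x)" by (rule sz_nat_mono) simp
      moreover have "sz [n x - j..<n x] \<le> 1 + n x * (1 + sz (n x))"
        by (rule sz_list_le) (auto simp: floorlog_mono)
      ultimately show ?thesis unfolding it[OF that] enc_simps(3) vsize.simps(2) by linarith
    qed
  qed (intro pt_intros pb_intros n | simp add: it)+
  then have "pt (\<lambda>x. snd ((f ^^ n x) (n x, [])))" by (intro pt_intros)
  then show ?thesis by (rule pt_cong) (simp add: it)
qed

lemma pt_replicate [pt_intros]: "pt n \<Longrightarrow> pb n \<Longrightarrow> pt c \<Longrightarrow> pt (\<lambda>x. replicate (n x) (c x))"
proof -
  assume n: "pt n" "pb n" and c: "pt c"
  have "pt (\<lambda>x. map (\<lambda>i. c x) [0..<n x])" by (intro pt_intros n pt_comp[OF pt_fst0 c])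
  then show ?thesis by (rule pt_cong) (simp add: map_replicate_const)
qed

lemma foldl_takeWhile: "foldl (\<lambda>s y. if fst s \<and> P y then (True, y # snd s) else (False, snd s)) (True, []) ys
   = ((\<forall>y\<in>set ys. P y), rev (takeWhile P ys))"
  by (induction ys rule: rev_induct) (auto simp: takeWhile_append)

lemma pt_takeWhile [pt_intros]:
  assumes P: "pt (\<lambda>z. P (fst z) (snd z))" and xs: "pt xs"
  shows "pt (\<lambda>x. takeWhile (P x) (xs x))"
proof -
  have "pt (\<lambda>x. foldl (\<lambda>s y. if fst s \<and> P x y then (True, y # snd s) else (False, snd s)) (True, []) (xs x))"
  proof (rule pt_foldl[where m = "\<lambda>x. 3 + sz (xs x)"])
    show "sz (foldl (\<lambda>s y. if fst s \<and> P x y then (True, y # snd s) else (False, snd s)) (True, []) (take j (xs x)))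
       \<le> 3 + sz (xs x)" for x j
      unfolding foldl_takeWhile using sz_takeWhile_le[of "P x" "take j (xs x)"] sz_take_le[of j "xs x"]
      by (auto simp: sz_rev floorlog_def)
  qed (intro pt_intros xs pt_app2[OF P] pb_intros)+
  then have "pt (\<lambda>x. rev (snd (foldl (\<lambda>s y. if fst s \<and> P x y then (True, y # snd s) else (False, snd s)) (True, []) (xs x))))"
    by (intro pt_intros)
  then show ?thesis by (rule pt_cong) (simp add: foldl_takeWhile)
qed

lemma pt_dropWhile [pt_intros]:
  assumes P: "pt (\<lambda>z. P (fst z) (snd z))" and xs: "pt xs"
  shows "pt (\<lambda>x. dropWhile (P x) (xs x))"
  unfolding dropWhile_eq_drop by (intro pt_intros assms)

lemma pt_butlast [pt_intros]: "pt xs \<Longrightarrow> pt (\<lambda>x. butlast (xs x))"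
  unfolding butlast_conv_take by (intro pt_intros)

lemma pt_sum_list [pt_intros]: "pt xs \<Longrightarrow> pt (\<lambda>x. sum_list (xs x :: nat list))"
proof -
  assume xs: "pt xs"
  have e: "foldl (+) k ys = k + sum_list ys" for k :: nat and ys by (induction ys arbitrary: k) auto
  have s: "1 + floorlog 2 (sum_list ys) \<le> sz ys" for ys :: "nat list"
  proof (induction ys)
    case (Cons a ys)
    then show ?case using floorlog_add[of a "sum_list ys"] by simp
  qed (simp add: floorlog_def)
  have "pt (\<lambda>x. foldl (+) 0 (xs x))"
  proof (rule pt_foldl[where m = "\<lambda>x. sz (xs x)"])
    show "sz (foldl (+) 0 (take j (xs x))) \<le> sz (xs x)" for x j
      unfolding e using s[of "take j (xs x)"] sz_take_le[of j "xs x"] by simp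
  qed (intro pt_intros pb_intros xs)+
  then show ?thesis by (simp add: e)
qed

lemma pt_prod_list [pt_intros]: "pt xs \<Longrightarrow> pt (\<lambda>x. prod_list (xs x :: nat list))"
proof -
  assume xs: "pt xs"
  have e: "foldl (*) k ys = k * prod_list ys" for k :: nat and ys by (induction ys arbitrary: k) auto
  have s: "floorlog 2 (prod_list ys) \<le> sz ys" for ys :: "nat list"
  proof (induction ys)
    case (Cons a ys)
    then show ?case using floorlog_mult[of a "prod_list ys"] by simp
  qed (simp add: floorlog_def)
  have "pt (\<lambda>x. foldl (*) 1 (xs x))"
  proof (rule pt_foldl[where m = "\<lambda>x. 1 + sz (xs x)"])
    show "sz (foldl (*) 1 (take j (xs x))) \<le> 1 + sz (xs x)" for x j
      unfolding e using s[of "take j (xs x)"] sz_take_le[of j "xs x"] by simp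
  qed (intro pt_intros pb_intros xs)+
  then show ?thesis by (simp add: e)
qed

lemma pt_power [pt_intros]: "pt b \<Longrightarrow> pt n \<Longrightarrow> pb n \<Longrightarrow> pt (\<lambda>x. b x ^ n x :: nat)"
  by (rule pt_cong[OF pt_prod_list[OF pt_replicate[of n b]]]) auto

lemma pt_eq_list:
  assumes e: "pt (\<lambda>z. fst z = (snd z :: 'a::encodable))" and a: "pt (a :: 'b::encodable \<Rightarrow> _)" and b: "pt b"
  shows "pt (\<lambda>x. a x = (b x :: 'a list))"
proof -
  have l: "pt (\<lambda>x. length (a x) = length (b x))" by (rule pt_eq_nat[OF pt_length[OF a] pt_length[OF b]])
  have z: "pt (\<lambda>x. zip (a x) (b x))" by (rule pt_zip[OF a b])
  have "pt (\<lambda>w :: 'b::encodable \<times> 'a \<times> 'a. fst (snd w) = snd (snd w))"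
    by (rule pt_comp[of "snd :: 'b \<times> 'a \<times> 'a \<Rightarrow> 'a \<times> 'a" "\<lambda>z. fst z = snd z", OF pt_snd0 e])
  then have "pt (\<lambda>x. \<forall>p\<in>set (zip (a x) (b x)). fst p = snd p)"
    by (intro pt_ball[where P = "\<lambda>x p. fst p = snd p"] z)
  with l have "pt (\<lambda>x. length (a x) = length (b x) \<and> (\<forall>p\<in>set (zip (a x) (b x)). fst p = snd p))" by (rule pt_conj)
  then show ?thesis by (rule pt_cong) (subst list_eq_iff_zip_eq, simp add: split_def)
qed

lemma pt_eq_nat_list [pt_intros]: "pt a \<Longrightarrow> pt b \<Longrightarrow> pt (\<lambda>x. a x = (b x :: nat list))"
  by (rule pt_eq_list) (intro pt_intros)

lemma pt_eq_nat_list_list [pt_intros]: "pt a \<Longrightarrow> pt b \<Longrightarrow> pt (\<lambda>x. a x = (b x :: nat list list))"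
  by (rule pt_eq_list) (intro pt_intros)

text \<open>Membership is spelled as an existential so that \<open>pt_bex\<close> and the equality
  test on nested lists apply.\<close>

definition dedup :: "'a list \<Rightarrow> 'a list" where
  "dedup xs = foldl (\<lambda>s y. if \<exists>z\<in>set s. z = y then s else y # s) [] xs"

lemma dedup: "distinct (dedup xs)" "set (dedup xs) = set xs"
proof -
  have "distinct (dedup xs) \<and> set (dedup xs) = set xs"
    unfolding dedup_def by (induction xs rule: rev_induct) auto
  then show "distinct (dedup xs)" "set (dedup xs) = set xs" by auto
qed

lemma pt_dedup [pt_intros]: "pt xs \<Longrightarrow> pt (\<lambda>x. dedup (xs x :: nat list list list))"
proof -
  assume xs: "pt xs"
  have s: "sz (dedup ys) \<le> sz ys" for ys :: "nat list list list"
  proof (induction ys rule: rev_induct)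
    case (snoc y ys)
    then show ?case using sz_append[of ys "[y]"] by (auto simp: dedup_def floorlog_def)
  qed (simp add: dedup_def)
  show ?thesis unfolding dedup_def
  proof (rule pt_foldl[where m = "\<lambda>x. sz (xs x)"])
    show "sz (foldl (\<lambda>s y. if \<exists>z\<in>set s. z = y then s else y # s) [] (take j (xs x))) \<le> sz (xs x)" for x j
      using s[of "take j (xs x)"] sz_take_le[of j "xs x"] by (simp add: dedup_def)
  qed (intro pt_intros pb_intros xs)+
qed

section \<open>Binary digits, least significant first\<close>

fun bits :: "nat \<Rightarrow> bool list" where
  "bits n = (if n = 0 then [] else (n mod 2 = 1) # bits (n div 2))"

declare bits.simps [simp del]

lemma bits_eq_Nil: "bits n = [] \<longleftrightarrow> n = 0"
  by (subst bits.simps) auto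

lemma bits_pos: "n \<noteq> 0 \<Longrightarrow> bits n = (n mod 2 = 1) # bits (n div 2)"
  by (subst bits.simps) auto

lemma length_bits: "length (bits n) = floorlog 2 n"
proof (induction n rule: bits.induct)
  case (1 n)
  then show ?case by (subst bits.simps, subst compute_floorlog) auto
qed

lemma pt_bits [pt_intros]: "pt n \<Longrightarrow> pt (\<lambda>x. bits (n x))"
proof -
  assume n: "pt n"
  define f :: "nat \<times> bool list \<Rightarrow> nat \<times> bool list" where "f = (\<lambda>z. (fst z div 2, (fst z mod 2 = 1) # snd z))"
  have it: "(f ^^ j) (k, []) = (k div 2 ^ j, rev (take j (bits k))) \<and> drop j (bits k) = bits (k div 2 ^ j)"
    if "j \<le> length (bits k)" for j k
    using that
  proof (induction j)
    case (Suc j)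
    then have IH: "(f ^^ j) (k, []) = (k div 2 ^ j, rev (take j (bits k)))" "drop j (bits k) = bits (k div 2 ^ j)"
      by auto
    \<comment> \<open>While digits remain the quotient is nonzero; this ties the loop test to the
      length of \<open>bits k\<close>.\<close>
    have nz: "k div 2 ^ j \<noteq> 0"
    proof
      assume "k div 2 ^ j = 0"
      then have "drop j (bits k) = []" using IH(2) bits_eq_Nil[of 0] by simp
      then show False using Suc by simp
    qed
    have "drop j (bits k) = (k div 2 ^ j mod 2 = 1) # bits (k div 2 ^ j div 2)" using IH(2) bits_pos[OF nz] by simp
    moreover have "drop j (bits k) = bits k ! j # drop (Suc j) (bits k)" using Suc by (simp add: Cons_nth_drop_Suc)
    ultimately have "bits k ! j = (k div 2 ^ j mod 2 = 1)" "drop (Suc j) (bits k) = bits (k div 2 ^ j div 2)" by auto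
    moreover have "k div 2 ^ j div 2 = k div 2 ^ Suc j" using div_mult2_eq[of k "2 ^ j" 2] by (simp add: mult.commute)
    ultimately show ?case using Suc IH by (simp add: f_def take_Suc_conv_app_nth del: power_Suc)
  qed simp
  have z: "k div 2 ^ j = 0 \<longleftrightarrow> j = length (bits k)" if "j \<le> length (bits k)" for j k
    using it[OF that] that bits_eq_Nil[of "k div 2 ^ j"] drop_eq_Nil[of j "bits k"] by auto
  have "pt (\<lambda>x. (f ^^ length (bits (n x))) (n x, []))"
  proof (rule pt_on_while[where E = UNIV and b = "\<lambda>z. fst z \<noteq> 0" and m = "\<lambda>x. 1 + sz (n x) + (1 + sz (n x) * (1 + 2))"])
    show "pt (\<lambda>x. fst x \<noteq> (0::nat))" by (intro pt_nonzero pt_intros)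
    show "pt_on {s \<in> UNIV. fst s \<noteq> 0} f" unfolding f_def by (rule pt_on_subset[of UNIV]) (intro pt_intros, auto)
    show "pb (\<lambda>x. length (bits (n x)))" by (rule pb_mono[OF pb_sz[OF n]]) (simp add: length_bits)
    show "sz ((f ^^ j) (n x, [])) \<le> 1 + sz (n x) + (1 + sz (n x) * (1 + 2))" if "j \<le> length (bits (n x))" for x j
    proof -
      have "sz (rev (take j (bits (n x)))) \<le> 1 + sz (n x) * (1 + 2)"
        by (rule sz_list_le) (use that length_bits[of "n x"] in \<open>auto simp: floorlog_def\<close>)
      then show ?thesis using it[OF that] sz_nat_mono[of "n x div 2 ^ j" "n x"] by (simp del: One_nat_def)
    qed
  qed (intro pt_intros pb_intros n | simp add: it z)+
  then have "pt (\<lambda>x. rev (snd ((f ^^ length (bits (n x))) (n x, []))))" by (intro pt_intros)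
  then show ?thesis by (rule pt_cong) (simp add: it)
qed

lemma pb_bits [pb_intros]: "pt n \<Longrightarrow> pb (\<lambda>x. length (bits (n x)))"
  by (intro pb_intros pt_intros)

section \<open>Field arithmetic on coordinate vectors\<close>

type_synonym ctx = "nat \<times> nat list list list"

text \<open>The maximum with 1 makes reduction effective on every input: \<open>mod 0\<close> would
  leave numbers unreduced and iterated products could explode.\<close>

definition md :: "ctx \<Rightarrow> nat" where "md C = max 1 (fst C)"
definition dm :: "ctx \<Rightarrow> nat" where "dm C = length (snd C)"
text \<open>Reduced coordinate vectors. Sums, differences and products lie in \<open>W C\<close> for
  arbitrary arguments, so \<open>wsz C\<close> bounds their sizes without any field axiom.\<close>

definition W :: "ctx \<Rightarrow> nat list set" where "W C = {a. length a = dm C \<and> set a \<subseteq> {..<md C}}"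
definition wsz :: "ctx \<Rightarrow> nat" where "wsz C = 1 + dm C * (1 + sz (md C))"
definition fz :: "ctx \<Rightarrow> nat list" where "fz C = replicate (dm C) 0"

definition fadd :: "ctx \<Rightarrow> nat list \<Rightarrow> nat list \<Rightarrow> nat list" where
  "fadd C a b = map (\<lambda>i. (getd 0 a i + getd 0 b i) mod md C) [0..<dm C]"

definition fsub :: "ctx \<Rightarrow> nat list \<Rightarrow> nat list \<Rightarrow> nat list" where
  "fsub C a b = map (\<lambda>i. (getd 0 a i + (md C - getd 0 b i mod md C)) mod md C) [0..<dm C]"

definition fmul :: "ctx \<Rightarrow> nat list \<Rightarrow> nat list \<Rightarrow> nat list" where
  "fmul C a b = map (\<lambda>t. sum_list (map (\<lambda>i. sum_list (map (\<lambda>j.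
      getd 0 a i * getd 0 b j * getd 0 (getd [] (getd [] (snd C) i) j) t) [0..<dm C])) [0..<dm C]) mod md C) [0..<dm C]"

text \<open>Square-and-multiply on the exponent e - 1 with accumulator \<open>a\<close> instead of
  1, because the coordinates of the identity are not part of the input. It yields the power for e >
  0.\<close>

definition fpow :: "ctx \<Rightarrow> nat list \<Rightarrow> nat \<Rightarrow> nat list" where
  "fpow C a e = fst (foldl (\<lambda>s b. (if b then fmul C (fst s) (snd s) else fst s, fmul C (snd s) (snd s)))
      (a, a) (bits (e - 1)))"

definition fq :: "ctx \<Rightarrow> nat" where "fq C = md C ^ dm C"
text \<open>The first basis vector is nonzero, so its power with exponent q - 1 is the identity of
  the multiplicative group.\<close>

definition fone :: "ctx \<Rightarrow> nat list" where "fone C = fpow C (1 # replicate (dm C - 1) 0) (fq C - 1)"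
text \<open>The exponent 2q - 3 is congruent to q - 2 modulo q - 1; unlike q - 2 it stays positive
  for q = 2, as \<open>fpow\<close> requires.\<close>

definition finv :: "ctx \<Rightarrow> nat list \<Rightarrow> nat list" where "finv C a = fpow C a (2 * fq C - 3)"
definition fsum :: "ctx \<Rightarrow> nat list list \<Rightarrow> nat list" where "fsum C xs = foldl (fadd C) (fz C) xs"

lemma pt_md [pt_intros]: "pt C \<Longrightarrow> pt (\<lambda>x. md (C x))"
  and pt_dm [pt_intros]: "pt C \<Longrightarrow> pt (\<lambda>x. dm (C x))"
  unfolding md_def dm_def by (intro pt_intros; assumption)+

lemma pb_dm [pb_intros]: "pt C \<Longrightarrow> pb (\<lambda>x. dm (C x))"
  unfolding dm_def by (intro pb_intros pt_intros)

lemma pb_wsz [pb_intros]: "pt C \<Longrightarrow> pb (\<lambda>x. wsz (C x))"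
  unfolding wsz_def by (intro pb_intros pt_intros)

lemma pt_fz [pt_intros]: "pt C \<Longrightarrow> pt (\<lambda>x. fz (C x))"
  unfolding fz_def by (intro pt_intros pb_intros)

lemma pt_fadd0: "pt (\<lambda>z. fadd (fst z) (fst (snd z)) (snd (snd z)))"
  and pt_fsub0: "pt (\<lambda>z. fsub (fst z) (fst (snd z)) (snd (snd z)))"
  and pt_fmul0: "pt (\<lambda>z. fmul (fst z) (fst (snd z)) (snd (snd z)))"
  unfolding fadd_def fsub_def fmul_def by (intro pt_intros pb_intros)+

lemmas pt_fadd [pt_intros] = pt_app3[OF pt_fadd0]
lemmas pt_fsub [pt_intros] = pt_app3[OF pt_fsub0]
lemmas pt_fmul [pt_intros] = pt_app3[OF pt_fmul0]

lemma md_pos: "md C > 0" by (simp add: md_def)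

lemma fz_W [simp]: "fz C \<in> W C" by (auto simp: fz_def W_def md_pos)
lemma fadd_W [simp]: "fadd C a b \<in> W C" by (auto simp: fadd_def W_def md_pos)
lemma fsub_W [simp]: "fsub C a b \<in> W C" by (auto simp: fsub_def W_def md_pos)
lemma fmul_W [simp]: "fmul C a b \<in> W C" by (auto simp: fmul_def W_def md_pos)

lemma sz_W: "a \<in> W C \<Longrightarrow> sz a \<le> wsz C"
  unfolding wsz_def by (rule sz_list_le) (auto simp: W_def intro!: floorlog_mono)

lemma sz_W_list: "set v \<subseteq> W C \<Longrightarrow> length v \<le> N \<Longrightarrow> sz v \<le> 1 + N * (1 + wsz C)"
  by (rule sz_list_le) (auto intro: sz_W)

lemma pt_fpow0: "pt (\<lambda>z. fpow (fst z) (fst (snd z)) (snd (snd z)))"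
proof -
  have "pt (\<lambda>z :: ctx \<times> nat list \<times> nat. foldl (\<lambda>s b. (if b then fmul (fst z) (fst s) (snd s) else fst s, fmul (fst z) (snd s) (snd s)))
      (fst (snd z), fst (snd z)) (bits (snd (snd z) - 1)))"
  proof (rule pt_foldl_inv[where I = "\<lambda>z j s. sz (fst s) \<le> sz (fst (snd z)) + wsz (fst z) \<and> sz (snd s) \<le> sz (fst (snd z)) + wsz (fst z)"
        and m = "\<lambda>z. 1 + (sz (fst (snd z)) + wsz (fst z)) + (sz (fst (snd z)) + wsz (fst z))"])
    fix z :: "ctx \<times> nat list \<times> nat" and s :: "nat list \<times> nat list" and j
    assume "sz (fst s) \<le> sz (fst (snd z)) + wsz (fst z) \<and> sz (snd s) \<le> sz (fst (snd z)) + wsz (fst z)"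
    moreover have "sz (fmul (fst z) u v) \<le> sz (fst (snd z)) + wsz (fst z)" for u v
      by (rule le_trans[OF sz_W[OF fmul_W]]) simp
    ultimately show "sz (fst (if bits (snd (snd z) - 1) ! j then fmul (fst z) (fst s) (snd s) else fst s, fmul (fst z) (snd s) (snd s))) \<le> sz (fst (snd z)) + wsz (fst z) \<and>
       sz (snd (if bits (snd (snd z) - 1) ! j then fmul (fst z) (fst s) (snd s) else fst s, fmul (fst z) (snd s) (snd s))) \<le> sz (fst (snd z)) + wsz (fst z)"
      by simp
  qed (intro pt_intros pb_intros | simp add: sz_prod)+
  then show ?thesis unfolding fpow_def by (intro pt_fst)
qed

lemmas pt_fpow [pt_intros] = pt_app3[OF pt_fpow0]

lemma pt_fq [pt_intros]: "pt C \<Longrightarrow> pt (\<lambda>x. fq (C x))"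
  unfolding fq_def by (intro pt_intros pb_intros)

lemma pt_fone [pt_intros]: "pt C \<Longrightarrow> pt (\<lambda>x. fone (C x))"
  unfolding fone_def by (intro pt_intros pb_intros)

lemma pt_finv0: "pt (\<lambda>z. finv (fst z) (snd z))"
  unfolding finv_def by (intro pt_intros)

lemmas pt_finv [pt_intros] = pt_app2[OF pt_finv0]

lemma pt_fsum0: "pt (\<lambda>z. fsum (fst z) (snd z))"
  unfolding fsum_def
proof (rule pt_foldl_inv[where I = "\<lambda>z j s. s \<in> W (fst z)" and m = "\<lambda>z. wsz (fst z)"])
  show "pt (\<lambda>z. fadd (fst (fst z)) (fst (snd z)) (snd (snd z)))" by (intro pt_intros)
qed (intro pt_intros pb_intros | simp add: sz_W)+

lemmas pt_fsum [pt_intros] = pt_app2[OF pt_fsum0]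

section \<open>Arithmetic of univariate polynomials\<close>

definition pnorm :: "ctx \<Rightarrow> nat list list \<Rightarrow> nat list list" where
  "pnorm C v = dropWhile (\<lambda>a. a = fz C) v"

definition vadd :: "ctx \<Rightarrow> nat list list \<Rightarrow> nat list list \<Rightarrow> nat list list" where
  "vadd C a b = map (\<lambda>u. fadd C (fst u) (snd u)) (zip a b)"

definition padl :: "ctx \<Rightarrow> nat \<Rightarrow> nat list list \<Rightarrow> nat list list" where
  "padl C n a = replicate (n - length a) (fz C) @ a"

definition padd :: "ctx \<Rightarrow> nat list list \<Rightarrow> nat list list \<Rightarrow> nat list list" where
  "padd C a b = pnorm C (vadd C (padl C (length b) a) (padl C (length a) b))"

definition smulp :: "ctx \<Rightarrow> nat list \<Rightarrow> nat list list \<Rightarrow> nat list list" where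
  "smulp C c b = map (\<lambda>u. fmul C c u) b"

definition pneg :: "ctx \<Rightarrow> nat list list \<Rightarrow> nat list list" where
  "pneg C b = map (\<lambda>u. fsub C (fz C) u) b"

text \<open>Schoolbook multiplication, positions counted from the constant term. The minimum makes
  it visible that a shift is at most \<open>length a\<close>, so that the padding is polynomially
  long.\<close>

definition pmul :: "ctx \<Rightarrow> nat list list \<Rightarrow> nat list list \<Rightarrow> nat list list" where
  "pmul C a b = foldl (\<lambda>s u. padd C (smulp C (fst u) b @ replicate (min (snd u) (length a)) (fz C)) s) [] (zip (rev a) [0..<length a])"

text \<open>One step of long division. \<open>tl\<close> removes the leading position without
  testing it: over a field that entry is zero, and on arbitrary data the length still
  decreases.\<close>

definition redstep :: "ctx \<Rightarrow> nat list list \<Rightarrow> nat list list \<Rightarrow> nat list list" where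
  "redstep C g f = (if g = [] \<or> length f < length g then f else
     pnorm C (tl (vadd C f (smulp C (fsub C (fz C) (fmul C (getd (fz C) f 0) (finv C (getd (fz C) g 0)))) g
        @ replicate (length f - length g) (fz C)))))"

text \<open>Every effective step shortens the dividend, hence \<open>length f\<close> rounds
  suffice.\<close>

definition prem :: "ctx \<Rightarrow> nat list list \<Rightarrow> nat list list \<Rightarrow> nat list list" where
  "prem C f g = (if g = [] then [] else foldl (\<lambda>s i. redstep C g s) f [0..<length f])"

text \<open>Euclid's algorithm. Remainders get strictly shorter, so \<open>length g\<close> rounds
  reach the remainder zero.\<close>

definition pgcd :: "ctx \<Rightarrow> nat list list \<Rightarrow> nat list list \<Rightarrow> nat list list" where
  "pgcd C f g = fst (foldl (\<lambda>s i. if snd s = [] then s else (snd s, prem C (fst s) (snd s))) (f, g) [0..<length g])"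

definition ppow :: "ctx \<Rightarrow> nat list list \<Rightarrow> nat list list \<Rightarrow> nat \<Rightarrow> nat list list" where
  "ppow C g a e = fst (foldl (\<lambda>s b. (if b then prem C (pmul C (fst s) (snd s)) g else fst s, prem C (pmul C (snd s) (snd s)) g))
      (a, a) (bits (e - 1)))"

definition peval :: "ctx \<Rightarrow> nat list list \<Rightarrow> nat list \<Rightarrow> nat list" where
  "peval C w u = foldl (\<lambda>s c. fadd C (fmul C s u) c) (fz C) w"

lemma pt_pnorm0: "pt (\<lambda>z. pnorm (fst z) (snd z))"
  and pt_vadd0: "pt (\<lambda>z. vadd (fst z) (fst (snd z)) (snd (snd z)))"
  and pt_smulp0: "pt (\<lambda>z. smulp (fst z) (fst (snd z)) (snd (snd z)))"
  and pt_pneg0: "pt (\<lambda>z. pneg (fst z) (snd z))"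
  unfolding pnorm_def vadd_def smulp_def pneg_def by (intro pt_intros pb_intros)+

lemmas pt_pnorm [pt_intros] = pt_app2[OF pt_pnorm0]
lemmas pt_vadd [pt_intros] = pt_app3[OF pt_vadd0]
lemmas pt_smulp [pt_intros] = pt_app3[OF pt_smulp0]
lemmas pt_pneg [pt_intros] = pt_app2[OF pt_pneg0]

lemma pt_padd0: "pt (\<lambda>z. padd (fst z) (fst (snd z)) (snd (snd z)))"
  unfolding padd_def padl_def by (intro pt_intros pb_intros)

lemmas pt_padd [pt_intros] = pt_app3[OF pt_padd0]

lemma set_pnorm: "set (pnorm C v) \<subseteq> set v"
  unfolding pnorm_def by (meson set_dropWhileD subsetI)

lemma length_pnorm: "length (pnorm C v) \<le> length v"
  by (simp add: pnorm_def length_dropWhile_le)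

lemma set_vadd: "set (vadd C a b) \<subseteq> W C"
  by (auto simp: vadd_def)

lemma set_padd: "set (padd C a b) \<subseteq> W C"
  unfolding padd_def using set_pnorm set_vadd by blast

lemma length_padd: "length (padd C a b) \<le> max (length a) (length b)"
  unfolding padd_def by (rule order_trans[OF length_pnorm]) (simp add: vadd_def padl_def)

lemma pmul_bounds: "set (pmul C a b) \<subseteq> W C \<and> length (pmul C a b) \<le> length a + length b"
proof -
  have "set (foldl (\<lambda>s u. padd C (smulp C (fst u) b @ replicate (min (snd u) (length a)) (fz C)) s) s0 us) \<subseteq> W C
    \<and> length (foldl (\<lambda>s u. padd C (smulp C (fst u) b @ replicate (min (snd u) (length a)) (fz C)) s) s0 us) \<le> N"
    if "set s0 \<subseteq> W C" "length s0 \<le> N" "length a + length b \<le> N" for s0 N and us :: "(nat list \<times> nat) list"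
    using that
  proof (induction us arbitrary: s0)
    case (Cons u us)
    have "length (padd C (smulp C (fst u) b @ replicate (min (snd u) (length a)) (fz C)) s0) \<le> N"
      by (rule order_trans[OF length_padd]) (use Cons in \<open>auto simp: smulp_def\<close>)
    then show ?case using Cons set_padd by simp
  qed simp
  from this[of "[]" "length a + length b" "zip (rev a) [0..<length a]"] show ?thesis
    by (auto simp: pmul_def dest!: set_zip_rightD)
qed

lemma pt_pmul0: "pt (\<lambda>z. pmul (fst z) (fst (snd z)) (snd (snd z)))"
  unfolding pmul_def
proof (rule pt_foldl_inv[where I = "\<lambda>z j s. set s \<subseteq> W (fst z) \<and> length s \<le> length (fst (snd z)) + length (snd (snd z))"
      and m = "\<lambda>z. 1 + (length (fst (snd z)) + length (snd (snd z))) * (1 + wsz (fst z))"])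
  fix z :: "ctx \<times> nat list list \<times> nat list list" and j s
  assume j: "j < length (zip (rev (fst (snd z))) [0..<length (fst (snd z))])"
    and s: "set s \<subseteq> W (fst z) \<and> length s \<le> length (fst (snd z)) + length (snd (snd z))"
  let ?u = "zip (rev (fst (snd z))) [0..<length (fst (snd z))] ! j"
  have "length (padd (fst z) (smulp (fst z) (fst ?u) (snd (snd z)) @ replicate (min (snd ?u) (length (fst (snd z)))) (fz (fst z))) s) \<le> length (fst (snd z)) + length (snd (snd z))"
    by (rule order_trans[OF length_padd]) (use j s in \<open>auto simp: smulp_def\<close>)
  then show "set (padd (fst z) (smulp (fst z) (fst ?u) (snd (snd z)) @ replicate (min (snd ?u) (length (fst (snd z)))) (fz (fst z))) s) \<subseteq> W (fst z) \<and>
      length (padd (fst z) (smulp (fst z) (fst ?u) (snd (snd z)) @ replicate (min (snd ?u) (length (fst (snd z)))) (fz (fst z))) s) \<le> length (fst (snd z)) + length (snd (snd z))"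
    using set_padd by blast
next
  fix z :: "ctx \<times> nat list list \<times> nat list list" and j s
  assume "set s \<subseteq> W (fst z) \<and> length s \<le> length (fst (snd z)) + length (snd (snd z))"
  then show "sz s \<le> 1 + (length (fst (snd z)) + length (snd (snd z))) * (1 + wsz (fst z))"
    by (intro sz_W_list) auto
qed (intro pt_intros pb_intros | simp)+

lemmas pt_pmul [pt_intros] = pt_app3[OF pt_pmul0]

lemma pt_redstep0: "pt (\<lambda>z. redstep (fst z) (fst (snd z)) (snd (snd z)))"
  unfolding redstep_def by (intro pt_intros pb_intros)

lemmas pt_redstep [pt_intros] = pt_app3[OF pt_redstep0]

lemma redstep_bounds:
  "set (redstep C g f) \<subseteq> set f \<union> W C" "length (redstep C g f) \<le> length f"
  "g \<noteq> [] \<Longrightarrow> length g \<le> length f \<Longrightarrow> length (redstep C g f) < length f"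
proof -
  let ?v = "vadd C f (smulp C (fsub C (fz C) (fmul C (getd (fz C) f 0) (finv C (getd (fz C) g 0)))) g
        @ replicate (length f - length g) (fz C))"
  have "set (tl v) \<subseteq> set v" for v :: "nat list list" by (cases v) auto
  then have "set (tl ?v) \<subseteq> W C" using set_vadd by blast
  then show "set (redstep C g f) \<subseteq> set f \<union> W C"
    unfolding redstep_def using set_pnorm[of C "tl ?v"] by auto
  have l: "length (pnorm C (tl ?v)) \<le> length f - 1" if "length g \<le> length f"
    by (rule order_trans[OF length_pnorm]) (use that in \<open>auto simp: vadd_def smulp_def\<close>)
  then show "length (redstep C g f) \<le> length f" unfolding redstep_def by auto
  show "length (redstep C g f) < length f" if g: "g \<noteq> []" "length g \<le> length f"
  proof -
    have "length f > 0" using g by (cases g) auto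
    then have "length (pnorm C (tl ?v)) < length f" using l[OF g(2)] by linarith
    then show ?thesis using g unfolding redstep_def by auto
  qed
qed

lemma prem_bounds:
  "set (prem C f g) \<subseteq> set f \<union> W C" "length (prem C f g) \<le> length f"
  "g \<noteq> [] \<Longrightarrow> length (prem C f g) < length g" "length (prem C f g) \<le> length g"
proof -
  \<comment> \<open>The last conjunct counts rounds: with at least \<open>length s\<close> of them
    the truncated difference is 0 and the result is shorter than \<open>g\<close>.\<close>
  have "set (foldl (\<lambda>s i. redstep C g s) s us) \<subseteq> set s \<union> W C
     \<and> length (foldl (\<lambda>s i. redstep C g s) s us) \<le> length s
     \<and> (g \<noteq> [] \<longrightarrow> length (foldl (\<lambda>s i. redstep C g s) s us) < length g + (length s - length us))" for s and us :: "nat list"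
  proof (induction us arbitrary: s)
    case (Cons u us)
    show ?case
    proof (cases "g \<noteq> [] \<and> length g \<le> length s")
      case True
      then show ?thesis using Cons[of "redstep C g s"] redstep_bounds[where C = C and f = s and g = g] by auto
    next
      case False
      then have "redstep C g s = s" by (auto simp: redstep_def)
      then show ?thesis using Cons[of s] False by auto
    qed
  next
    case Nil
    then show ?case by (cases g) auto
  qed
  from this[of f "[0..<length f]"] show "set (prem C f g) \<subseteq> set f \<union> W C" "length (prem C f g) \<le> length f"
    "g \<noteq> [] \<Longrightarrow> length (prem C f g) < length g" "length (prem C f g) \<le> length g"
    by (auto simp: prem_def)
qed

lemma pt_prem0: "pt (\<lambda>z. prem (fst z) (fst (snd z)) (snd (snd z)))"
proof -
  have "pt (\<lambda>z :: ctx \<times> nat list list \<times> nat list list. foldl (\<lambda>s i. redstep (fst z) (snd (snd z)) s) (fst (snd z)) [0..<length (fst (snd z))])"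
proof (rule pt_foldl_inv[where I = "\<lambda>z j s. set s \<subseteq> set (fst (snd z)) \<union> W (fst z) \<and> length s \<le> length (fst (snd z))"
      and m = "\<lambda>z. 1 + length (fst (snd z)) * (1 + (sz (fst (snd z)) + wsz (fst z)))"])
  fix z :: "ctx \<times> nat list list \<times> nat list list" and j s
  assume s: "set s \<subseteq> set (fst (snd z)) \<union> W (fst z) \<and> length s \<le> length (fst (snd z))"
  then show "set (redstep (fst z) (snd (snd z)) s) \<subseteq> set (fst (snd z)) \<union> W (fst z) \<and> length (redstep (fst z) (snd (snd z)) s) \<le> length (fst (snd z))"
    using redstep_bounds(1)[of "fst z" "snd (snd z)" s] redstep_bounds(2)[of "fst z" "snd (snd z)" s] by auto
  show "sz s \<le> 1 + length (fst (snd z)) * (1 + (sz (fst (snd z)) + wsz (fst z)))"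
    by (rule sz_list_le) (use s sz_mem_le[of _ "fst (snd z)"] sz_W[of _ "fst z"] in \<open>fastforce intro: trans_le_add1 trans_le_add2\<close>)+
qed (intro pt_intros pb_intros | simp)+
  then show ?thesis unfolding prem_def by (intro pt_intros)
qed

lemmas pt_prem [pt_intros] = pt_app3[OF pt_prem0]

lemma pt_pgcd0: "pt (\<lambda>z. pgcd (fst z) (fst (snd z)) (snd (snd z)))"
proof -
  let ?S = "\<lambda>z :: ctx \<times> nat list list \<times> nat list list. set (fst (snd z)) \<union> set (snd (snd z)) \<union> W (fst z)"
  let ?L = "\<lambda>z :: ctx \<times> nat list list \<times> nat list list. length (fst (snd z)) + length (snd (snd z))"
  let ?B = "\<lambda>z :: ctx \<times> nat list list \<times> nat list list. 1 + ?L z * (1 + (sz (fst (snd z)) + sz (snd (snd z)) + wsz (fst z)))"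
  have "pt (\<lambda>z :: ctx \<times> nat list list \<times> nat list list.
      foldl (\<lambda>s i. if snd s = [] then s else (snd s, prem (fst z) (fst s) (snd s))) (fst (snd z), snd (snd z)) [0..<length (snd (snd z))])"
  proof (rule pt_foldl_inv[where I = "\<lambda>z j s. set (fst s) \<subseteq> ?S z \<and> length (fst s) \<le> ?L z \<and> set (snd s) \<subseteq> ?S z \<and> length (snd s) \<le> ?L z"
      and m = "\<lambda>z. 1 + ?B z + ?B z"])
    fix z :: "ctx \<times> nat list list \<times> nat list list" and j and s :: "nat list list \<times> nat list list"
    assume s: "set (fst s) \<subseteq> ?S z \<and> length (fst s) \<le> ?L z \<and> set (snd s) \<subseteq> ?S z \<and> length (snd s) \<le> ?L z"
    let ?s = "if snd s = [] then s else (snd s, prem (fst z) (fst s) (snd s))"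
    show "set (fst ?s) \<subseteq> ?S z \<and> length (fst ?s) \<le> ?L z \<and> set (snd ?s) \<subseteq> ?S z \<and> length (snd ?s) \<le> ?L z"
      using s prem_bounds(1)[of "fst z" "fst s" "snd s"] prem_bounds(2)[of "fst z" "fst s" "snd s"] by (auto split: if_splits)
    have b: "sz u \<le> ?B z" if "set u \<subseteq> ?S z" "length u \<le> ?L z" for u
    proof (rule sz_list_le)
      fix y assume "y \<in> set u"
      then have "y \<in> ?S z" using that by auto
      then show "sz y \<le> sz (fst (snd z)) + sz (snd (snd z)) + wsz (fst z)"
        using sz_mem_le[of y "fst (snd z)"] sz_mem_le[of y "snd (snd z)"] sz_W[of y "fst z"] by auto
    qed (use that in simp)
    show "sz s \<le> 1 + ?B z + ?B z" unfolding sz_prod[of s] using b[of "fst s"] b[of "snd s"] s by linarith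
  qed (intro pt_intros pb_intros | auto)+
  then show ?thesis unfolding pgcd_def by (intro pt_fst)
qed

lemmas pt_pgcd [pt_intros] = pt_app3[OF pt_pgcd0]

lemma pt_app4: "pt (\<lambda>z. F (fst z) (fst (snd z)) (fst (snd (snd z))) (snd (snd (snd z)))) \<Longrightarrow> pt a \<Longrightarrow> pt b \<Longrightarrow> pt c \<Longrightarrow> pt d \<Longrightarrow>
    pt (\<lambda>x. F (a x) (b x) (c x) (d x))"
  using pt_comp[of "\<lambda>x. (a x, b x, c x, d x)" "\<lambda>z. F (fst z) (fst (snd z)) (fst (snd (snd z))) (snd (snd (snd z)))"]
    pt_Pair[of a "\<lambda>x. (b x, c x, d x)"] pt_Pair[of b "\<lambda>x. (c x, d x)"] pt_Pair[of c d] by simp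

lemma pt_ppow0: "pt (\<lambda>z. ppow (fst z) (fst (snd z)) (fst (snd (snd z))) (snd (snd (snd z))))"
proof -
  let ?P = "\<lambda>(z :: ctx \<times> nat list list \<times> nat list list \<times> nat) u. u = fst (snd (snd z)) \<or> (set u \<subseteq> W (fst z) \<and> length u \<le> length (fst (snd z)))"
  let ?B = "\<lambda>z :: ctx \<times> nat list list \<times> nat list list \<times> nat. sz (fst (snd (snd z))) + (1 + length (fst (snd z)) * (1 + wsz (fst z)))"
  have "pt (\<lambda>z :: ctx \<times> nat list list \<times> nat list list \<times> nat.
      foldl (\<lambda>s b. (if b then prem (fst z) (pmul (fst z) (fst s) (snd s)) (fst (snd z)) else fst s, prem (fst z) (pmul (fst z) (snd s) (snd s)) (fst (snd z))))
      (fst (snd (snd z)), fst (snd (snd z))) (bits (snd (snd (snd z)) - 1)))"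
  proof (rule pt_foldl_inv[where I = "\<lambda>z j s. ?P z (fst s) \<and> ?P z (snd s)" and m = "\<lambda>z. 1 + ?B z + ?B z"])
    fix z :: "ctx \<times> nat list list \<times> nat list list \<times> nat" and j and s :: "nat list list \<times> nat list list"
    assume s: "?P z (fst s) \<and> ?P z (snd s)"
    have p: "?P z (prem (fst z) (pmul (fst z) u v) (fst (snd z)))" for u v
      using prem_bounds(1)[of "fst z" "pmul (fst z) u v" "fst (snd z)"] prem_bounds(4)[of "fst z" "pmul (fst z) u v" "fst (snd z)"]
        pmul_bounds[of "fst z" u v] by blast
    then show "?P z (fst (if bits (snd (snd (snd z)) - 1) ! j then prem (fst z) (pmul (fst z) (fst s) (snd s)) (fst (snd z)) else fst s, prem (fst z) (pmul (fst z) (snd s) (snd s)) (fst (snd z))))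
      \<and> ?P z (snd (if bits (snd (snd (snd z)) - 1) ! j then prem (fst z) (pmul (fst z) (fst s) (snd s)) (fst (snd z)) else fst s, prem (fst z) (pmul (fst z) (snd s) (snd s)) (fst (snd z))))"
      using s by (simp only: fst_conv snd_conv) (cases "bits (snd (snd (snd z)) - 1) ! j"; simp)
    have "sz u \<le> ?B z" if "?P z u" for u
      using that sz_W_list[of u "fst z" "length (fst (snd z))"] by auto
    from this[of "fst s"] this[of "snd s"] show "sz s \<le> 1 + ?B z + ?B z"
      unfolding sz_prod[of s] using s by linarith
  qed (intro pt_intros pb_intros | simp)+
  then show ?thesis unfolding ppow_def by (intro pt_fst)
qed

lemmas pt_ppow [pt_intros] = pt_app4[OF pt_ppow0]

lemma pt_peval0: "pt (\<lambda>z. peval (fst z) (fst (snd z)) (snd (snd z)))"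
  unfolding peval_def
proof (rule pt_foldl_inv[where I = "\<lambda>z j s. s \<in> W (fst z)" and m = "\<lambda>z. wsz (fst z)"])
qed (intro pt_intros pb_intros | simp add: sz_W)+

lemmas pt_peval [pt_intros] = pt_app3[OF pt_peval0]

section \<open>Linear algebra and interpolation\<close>

definition dotp :: "ctx \<Rightarrow> nat list list \<Rightarrow> nat list list \<Rightarrow> nat list" where
  "dotp C r v = fsum C (map (\<lambda>u. fmul C (fst u) (snd u)) (zip r v))"

definition vcomb :: "ctx \<Rightarrow> nat list \<Rightarrow> nat list list \<Rightarrow> nat list \<Rightarrow> nat list list \<Rightarrow> nat list list" where
  "vcomb C \<alpha> u \<beta> v = map (\<lambda>i. fsub C (fmul C \<alpha> (fst i)) (fmul C \<beta> (snd i))) (zip u v)"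

text \<open>In use, \<open>vs\<close> consists of independent solutions of the rows treated so far.
  The first vector v on which \<open>r\<close> does not vanish is given up, and each later u is
  replaced by (r.v) u - (r.u) v, on which \<open>r\<close> vanishes. Cross-multiplication avoids
  division.\<close>

definition elim :: "ctx \<Rightarrow> nat list list \<Rightarrow> nat list list list \<Rightarrow> nat list list list" where
  "elim C r vs = takeWhile (\<lambda>v. dotp C r v = fz C) vs @
    (case dropWhile (\<lambda>v. dotp C r v = fz C) vs of [] \<Rightarrow> []
     | v # post \<Rightarrow> map (\<lambda>u. vcomb C (dotp C r v) u (dotp C r u) v) post)"

definition erow :: "ctx \<Rightarrow> nat list \<Rightarrow> nat \<Rightarrow> nat list list" where
  "erow C us i = map (\<lambda>j. if j = i then fone C else fz C) us"

definition nullvecs :: "ctx \<Rightarrow> nat list list list \<Rightarrow> nat list \<Rightarrow> nat list list list" where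
  "nullvecs C rws us = foldl (\<lambda>vs r. elim C r vs) (map (\<lambda>i. erow C us i) us) rws"

text \<open>The first \<open>length ms\<close> coefficients of \<open>(x + s) ^ length As\<close> in powers of \<open>s\<close>, by Pascal's rule;
  the lists only serve as unary numbers.\<close>

definition hrow :: "ctx \<Rightarrow> nat list \<Rightarrow> nat list \<Rightarrow> nat list \<Rightarrow> nat list list" where
  "hrow C x ms As = foldl (\<lambda>row i. vadd C (smulp C x row) (fz C # row)) (map (\<lambda>a. if a = 0 then fone C else fz C) ms) As"

definition gs_row :: "ctx \<Rightarrow> nat list \<Rightarrow> nat list \<Rightarrow> nat list \<Rightarrow> nat list \<Rightarrow> nat list \<Rightarrow> nat \<Rightarrow> nat \<Rightarrow> nat list list" where
  "gs_row C Ds Xs ms x y a b = concat (map (\<lambda>B. map (\<lambda>A.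
     fmul C (getd (fz C) (hrow C x ms (take A Ds)) a) (getd (fz C) (hrow C y ms (take B Xs)) b)) Ds) Xs)"

text \<open>Unknown number \<open>B * length Ds + A\<close> is the coefficient of \<open>z ^ A * Y ^ B\<close>. The first rows say that
  all Hasse derivatives of order below \<open>length ms\<close> vanish at the points \<open>(x, y)\<close>; the unit rows
  kill the monomials of weighted degree \<open>A + l * B \<ge> length Ds\<close>.\<close>

definition gs_rows :: "ctx \<Rightarrow> nat list \<Rightarrow> nat list \<Rightarrow> nat list \<Rightarrow> nat \<Rightarrow> nat list list \<Rightarrow> nat list list list \<Rightarrow> nat list list list" where
  "gs_rows C Ds Xs ms l xs ys =
    concat (map (\<lambda>u. concat (map (\<lambda>y. concat (map (\<lambda>a. map (\<lambda>b. gs_row C Ds Xs ms (fst u) y a b)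
      (filter (\<lambda>b. a + b < length ms) ms)) ms)) (snd u))) (zip xs ys)) @
    concat (map (\<lambda>B. map (\<lambda>A. erow C [0..<length Xs * length Ds] (B * length Ds + A))
      (filter (\<lambda>A. length Ds \<le> A + l * B) Ds)) Xs)"

text \<open>A null vector is cut into slices of \<open>length Ds\<close> entries, one for each power
  of Y. A slice is reversed because polynomials list the leading coefficient first.\<close>

definition gs_poly :: "ctx \<Rightarrow> nat list \<Rightarrow> nat list \<Rightarrow> nat list \<Rightarrow> nat \<Rightarrow> nat list list \<Rightarrow> nat list list list \<Rightarrow> nat list list list" where
  "gs_poly C Ds Xs ms l xs ys =
    (case nullvecs C (gs_rows C Ds Xs ms l xs ys) [0..<length Xs * length Ds] of [] \<Rightarrow> []
     | v # vs \<Rightarrow> map (\<lambda>B. pnorm C (rev (take (length Ds) (drop (B * length Ds) v)))) Xs)"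

lemma pt_dotp0: "pt (\<lambda>z. dotp (fst z) (fst (snd z)) (snd (snd z)))"
  unfolding dotp_def by (intro pt_intros)

lemmas pt_dotp [pt_intros] = pt_app3[OF pt_dotp0]

lemma pt_elim0: "pt (\<lambda>z. elim (fst z) (fst (snd z)) (snd (snd z)))"
  unfolding elim_def vcomb_def by (intro pt_intros)

lemmas pt_elim [pt_intros] = pt_app3[OF pt_elim0]

lemma length_elim: "length (elim C r vs) \<le> length vs"
proof -
  have "length (takeWhile P vs) + length (dropWhile P vs) = length vs" for P
    by (metis length_append takeWhile_dropWhile_id)
  from this[of "\<lambda>v. dotp C r v = fz C"] show ?thesis by (auto simp: elim_def split: list.split)
qed

lemma elim_bounds:
  assumes "\<forall>v\<in>set vs. set v \<subseteq> insert (fone C) (W C) \<and> length v \<le> N"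
  shows "\<forall>v\<in>set (elim C r vs). set v \<subseteq> insert (fone C) (W C) \<and> length v \<le> N"
proof
  fix v assume v: "v \<in> set (elim C r vs)"
  let ?P = "\<lambda>v. dotp C r v = fz C"
  consider "v \<in> set vs" | u w where "w \<in> set vs" "v = vcomb C (dotp C r u) w (dotp C r w) u"
  proof (cases "v \<in> set (takeWhile ?P vs)")
    case True
    then show ?thesis using that(1) set_takeWhileD by fast
  next
    case False
    show ?thesis
    proof (cases "dropWhile ?P vs")
      case Nil
      then have "elim C r vs = takeWhile ?P vs" unfolding elim_def by (simp only: list.case append_Nil2)
      then show ?thesis using v False by simp
    next
      case (Cons u post)
      then have "elim C r vs = takeWhile ?P vs @ map (\<lambda>w. vcomb C (dotp C r u) w (dotp C r w) u) post"
        unfolding elim_def by (simp only: list.case)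
      then obtain w where w: "w \<in> set post" "v = vcomb C (dotp C r u) w (dotp C r w) u"
        using v False by auto
      then have "w \<in> set (dropWhile ?P vs)" using Cons by simp
      then have "w \<in> set vs" by (rule set_dropWhileD)
      then show ?thesis using that(2) w(2) by blast
    qed
  qed
  then show "set v \<subseteq> insert (fone C) (W C) \<and> length v \<le> N"
    by cases (use assms in \<open>auto simp: vcomb_def min_le_iff_disj\<close>)
qed

lemma pt_nullvecs0: "pt (\<lambda>z. nullvecs (fst z) (fst (snd z)) (snd (snd z)))"
  unfolding nullvecs_def
proof (rule pt_foldl_inv[where I = "\<lambda>z j s. length s \<le> length (snd (snd z)) \<and>
      (\<forall>v\<in>set s. set v \<subseteq> insert (fone (fst z)) (W (fst z)) \<and> length v \<le> length (snd (snd z)))"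
    and m = "\<lambda>z. 1 + length (snd (snd z)) * (1 + (1 + length (snd (snd z)) * (1 + (sz (fone (fst z)) + wsz (fst z)))))"])
  fix z :: "ctx \<times> nat list list list \<times> nat list" and j s
  assume s: "length s \<le> length (snd (snd z)) \<and>
      (\<forall>v\<in>set s. set v \<subseteq> insert (fone (fst z)) (W (fst z)) \<and> length v \<le> length (snd (snd z)))"
  then show "length (elim (fst z) (fst (snd z) ! j) s) \<le> length (snd (snd z)) \<and>
      (\<forall>v\<in>set (elim (fst z) (fst (snd z) ! j) s). set v \<subseteq> insert (fone (fst z)) (W (fst z)) \<and> length v \<le> length (snd (snd z)))"
    using length_elim[of "fst z" "fst (snd z) ! j" s] elim_bounds[of s "fst z" "length (snd (snd z))"] by auto
  have "sz v \<le> 1 + length (snd (snd z)) * (1 + (sz (fone (fst z)) + wsz (fst z)))" if "v \<in> set s" for v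
    by (rule sz_list_le) (use s that in \<open>auto dest!: bspec[of _ _ v] subsetD sz_W\<close>)
  then show "sz s \<le> 1 + length (snd (snd z)) * (1 + (1 + length (snd (snd z)) * (1 + (sz (fone (fst z)) + wsz (fst z)))))"
    by (rule sz_list_le) (use s in auto)
next
  show "pt (\<lambda>z :: ctx \<times> nat list list list \<times> nat list. map (erow (fst z) (snd (snd z))) (snd (snd z)))"
    unfolding erow_def by (intro pt_intros)
qed (intro pt_intros pb_intros | auto simp: erow_def)+

lemmas pt_nullvecs [pt_intros] = pt_app3[OF pt_nullvecs0]

lemma pt_hrow0: "pt (\<lambda>z. hrow (fst z) (fst (snd z)) (fst (snd (snd z))) (snd (snd (snd z))))"
  unfolding hrow_def
proof (rule pt_foldl_inv[where I = "\<lambda>z j s. length s \<le> length (fst (snd (snd z))) \<and> set s \<subseteq> insert (fone (fst z)) (W (fst z))"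
    and m = "\<lambda>z. 1 + length (fst (snd (snd z))) * (1 + (sz (fone (fst z)) + wsz (fst z)))"])
  fix z :: "ctx \<times> nat list \<times> nat list \<times> nat list" and j s
  assume s: "length s \<le> length (fst (snd (snd z))) \<and> set s \<subseteq> insert (fone (fst z)) (W (fst z))"
  then show "length (vadd (fst z) (smulp (fst z) (fst (snd z)) s) (fz (fst z) # s)) \<le> length (fst (snd (snd z))) \<and>
      set (vadd (fst z) (smulp (fst z) (fst (snd z)) s) (fz (fst z) # s)) \<subseteq> insert (fone (fst z)) (W (fst z))"
    using set_vadd by (fastforce simp: vadd_def smulp_def)
  show "sz s \<le> 1 + length (fst (snd (snd z))) * (1 + (sz (fone (fst z)) + wsz (fst z)))"
    by (rule sz_list_le) (use s in \<open>auto dest!: subsetD sz_W\<close>)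
qed (intro pt_intros pb_intros | auto)+

lemmas pt_hrow [pt_intros] = pt_app4[OF pt_hrow0]

type_synonym gs_arg = "ctx \<times> nat list \<times> nat list \<times> nat list \<times> nat \<times> nat list list \<times> nat list list list"

lemma pt_gs_poly0: "pt (\<lambda>z :: gs_arg. gs_poly (fst z) (fst (snd z)) (fst (snd (snd z))) (fst (snd (snd (snd z))))
    (fst (snd (snd (snd (snd z))))) (fst (snd (snd (snd (snd (snd z)))))) (snd (snd (snd (snd (snd (snd z)))))))"
  unfolding gs_poly_def gs_rows_def gs_row_def erow_def by (intro pt_intros pb_intros)

lemma pt_gs_poly [pt_intros]:
  assumes "pt a1" "pt a2" "pt a3" "pt a4" "pt a5" "pt a6" "pt a7"
  shows "pt (\<lambda>x. gs_poly (a1 x) (a2 x) (a3 x) (a4 x) (a5 x) (a6 x) (a7 x))"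
proof -
  have "pt (\<lambda>x. (a1 x, a2 x, a3 x, a4 x, a5 x, a6 x, a7 x))" by (intro pt_intros assms)
  from pt_comp[OF this pt_gs_poly0] show ?thesis by simp
qed

section \<open>Roots of univariate polynomials\<close>

text \<open>The trace polynomial of a X modulo \<open>g\<close>: the sum of its powers with
  exponents 1, 2, 4, ..., 2^(k-1). The list \<open>snd C\<close> has k entries and counts the
  squarings.\<close>

definition ptrace :: "ctx \<Rightarrow> nat list list \<Rightarrow> nat list \<Rightarrow> nat list list" where
  "ptrace C g a = fst (foldl (\<lambda>s i. (padd C (fst s) (snd s), prem C (pmul C (snd s) (snd s)) g))
     ([], pnorm C [a, fz C]) (snd C))"

definition pX :: "ctx \<Rightarrow> nat list list" where "pX C = [fone C, fz C]"

definition hpoly :: "ctx \<Rightarrow> nat list list \<Rightarrow> nat list \<Rightarrow> nat list list" where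
  "hpoly C g a = (if md C mod 2 = 1 then ppow C g (padd C (pX C) (pnorm C [a])) ((fq C - 1) div 2) else ptrace C g a)"

text \<open>All values of the quadratic character for odd p, and of the absolute trace for p =
  2.\<close>

definition cvals :: "ctx \<Rightarrow> nat list list" where
  "cvals C = (if md C mod 2 = 1 then [fz C, fone C, fsub C (fz C) (fone C)] else [fz C, fone C])"

text \<open>Nonzero constants among the gcds carry no roots and are dropped. The upper bound on the
  length is automatic for divisors of \<open>g\<close>; it keeps the parts bounded on arbitrary
  data.\<close>

definition splitp :: "ctx \<Rightarrow> nat list \<Rightarrow> nat list list \<Rightarrow> nat list list list" where
  "splitp C a g = filter (\<lambda>h. 2 \<le> length h \<and> length h \<le> length g)
     (map (\<lambda>c. pgcd C g (padd C (hpoly C g a) (pneg C (pnorm C [c])))) (cvals C))"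

text \<open>The start is the gcd of f with X^q - X, the product of the distinct linear factors of f.
  Cutting to \<open>length f\<close> parts bounds the list on all inputs; over a field there are
  never more parts than roots.\<close>

definition rparts :: "ctx \<Rightarrow> nat list list \<Rightarrow> nat list list \<Rightarrow> nat list list list" where
  "rparts C as f = foldl (\<lambda>ps a. take (length f) (concat (map (\<lambda>g. splitp C a g) ps)))
     (filter (\<lambda>h. 2 \<le> length h \<and> length h \<le> length f) [pgcd C f (padd C (ppow C f (pX C) (fq C)) (pneg C (pX C)))]) as"

definition uroots :: "ctx \<Rightarrow> nat list list \<Rightarrow> nat list list \<Rightarrow> bool \<times> nat list list" where
  "uroots C as f = ((\<forall>h\<in>set (rparts C as f). length h = 2),
     map (\<lambda>h. fmul C (fsub C (fz C) (getd (fz C) h 1)) (finv C (getd (fz C) h 0))) (rparts C as f))"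

lemma pt_pX [pt_intros]: "pt C \<Longrightarrow> pt (\<lambda>x. pX (C x))"
  unfolding pX_def by (intro pt_intros)

lemma pt_ptrace0: "pt (\<lambda>z. ptrace (fst z) (fst (snd z)) (snd (snd z)))"
proof -
  let ?P = "\<lambda>(z :: ctx \<times> nat list list \<times> nat list) u. set u \<subseteq> insert (snd (snd z)) (W (fst z)) \<and> length u \<le> 2 + length (fst (snd z))"
  let ?B = "\<lambda>z :: ctx \<times> nat list list \<times> nat list. 1 + (2 + length (fst (snd z))) * (1 + (sz (snd (snd z)) + wsz (fst z)))"
  have "pt (\<lambda>z :: ctx \<times> nat list list \<times> nat list. foldl (\<lambda>s i. (padd (fst z) (fst s) (snd s), prem (fst z) (pmul (fst z) (snd s) (snd s)) (fst (snd z))))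
     ([], pnorm (fst z) [snd (snd z), fz (fst z)]) (snd (fst z)))"
  proof (rule pt_foldl_inv[where I = "\<lambda>z j s. ?P z (fst s) \<and> ?P z (snd s)" and m = "\<lambda>z. 1 + ?B z + ?B z"])
    fix z :: "ctx \<times> nat list list \<times> nat list" and j and s :: "nat list list \<times> nat list list"
    assume s: "?P z (fst s) \<and> ?P z (snd s)"
    have "?P z (padd (fst z) (fst s) (snd s))"
      using s set_padd[of "fst z" "fst s" "snd s"] length_padd[of "fst z" "fst s" "snd s"] by auto
    moreover have "?P z (prem (fst z) (pmul (fst z) u v) (fst (snd z)))" for u v
      using prem_bounds(1)[of "fst z" "pmul (fst z) u v" "fst (snd z)"] prem_bounds(4)[of "fst z" "pmul (fst z) u v" "fst (snd z)"]
        pmul_bounds[of "fst z" u v] by auto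
    ultimately show "?P z (fst (padd (fst z) (fst s) (snd s), prem (fst z) (pmul (fst z) (snd s) (snd s)) (fst (snd z)))) \<and>
      ?P z (snd (padd (fst z) (fst s) (snd s), prem (fst z) (pmul (fst z) (snd s) (snd s)) (fst (snd z))))"
      by simp
    have b: "sz u \<le> ?B z" if "?P z u" for u
      by (rule sz_list_le) (use that in \<open>auto dest!: subsetD sz_W\<close>)
    show "sz s \<le> 1 + ?B z + ?B z"
      unfolding sz_prod[of s] using s b[of "fst s"] b[of "snd s"] by linarith
  next
    fix z :: "ctx \<times> nat list list \<times> nat list"
    show "?P z (fst ([], pnorm (fst z) [snd (snd z), fz (fst z)])) \<and> ?P z (snd ([], pnorm (fst z) [snd (snd z), fz (fst z)]))"
      using set_pnorm[of "fst z" "[snd (snd z), fz (fst z)]"] length_pnorm[of "fst z" "[snd (snd z), fz (fst z)]"] by auto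
  qed (intro pt_intros pb_intros)+
  then show ?thesis unfolding ptrace_def by (intro pt_fst)
qed

lemmas pt_ptrace [pt_intros] = pt_app3[OF pt_ptrace0]

lemma pt_splitp0: "pt (\<lambda>z. splitp (fst z) (fst (snd z)) (snd (snd z)))"
  unfolding splitp_def cvals_def hpoly_def by (intro pt_intros)

lemmas pt_splitp [pt_intros] = pt_app3[OF pt_splitp0]

lemma set_pgcd: "set (pgcd C f g) \<subseteq> set f \<union> set g \<union> W C"
proof -
  have "set (fst (foldl (\<lambda>s i. if snd s = [] then s else (snd s, prem C (fst s) (snd s))) s us)) \<subseteq> set (fst s) \<union> set (snd s) \<union> W C"
    for s and us :: "nat list"
  proof (induction us arbitrary: s)
    case (Cons u us)
    show ?case using Cons[of "if snd s = [] then s else (snd s, prem C (fst s) (snd s))"] prem_bounds(1)[of C "fst s" "snd s"]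
      by (auto split: if_splits)
  qed auto
  from this[of "(f, g)"] show ?thesis by (simp add: pgcd_def)
qed

lemma pt_rparts0: "pt (\<lambda>z. rparts (fst z) (fst (snd z)) (snd (snd z)))"
  unfolding rparts_def
proof (rule pt_foldl_inv[where I = "\<lambda>z j s. length s \<le> 1 + length (snd (snd z)) \<and>
      (\<forall>h\<in>set s. set h \<subseteq> set (snd (snd z)) \<union> W (fst z) \<and> length h \<le> length (snd (snd z)))"
    and m = "\<lambda>z. 1 + (1 + length (snd (snd z))) * (1 + (1 + length (snd (snd z)) * (1 + (sz (snd (snd z)) + wsz (fst z)))))"])
  fix z :: "ctx \<times> nat list list \<times> nat list list" and j s
  assume s: "length s \<le> 1 + length (snd (snd z)) \<and>
      (\<forall>h\<in>set s. set h \<subseteq> set (snd (snd z)) \<union> W (fst z) \<and> length h \<le> length (snd (snd z)))"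
  have sp: "set h \<subseteq> set (snd (snd z)) \<union> W (fst z) \<and> length h \<le> length (snd (snd z))"
    if "g \<in> set s" "h \<in> set (splitp (fst z) a g)" for g h a
  proof -
    from that(2) obtain k where "h = pgcd (fst z) g (padd (fst z) (hpoly (fst z) g a) k)" "length h \<le> length g"
      by (auto simp: splitp_def)
    then show ?thesis using s that(1) set_pgcd[of "fst z" g "padd (fst z) (hpoly (fst z) g a) k"]
        set_padd[of "fst z" "hpoly (fst z) g a" k] by fastforce
  qed
  show "length (take (length (snd (snd z))) (concat (map (splitp (fst z) (fst (snd z) ! j)) s))) \<le> 1 + length (snd (snd z)) \<and>
      (\<forall>h\<in>set (take (length (snd (snd z))) (concat (map (splitp (fst z) (fst (snd z) ! j)) s))).
        set h \<subseteq> set (snd (snd z)) \<union> W (fst z) \<and> length h \<le> length (snd (snd z)))"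
  proof (intro conjI ballI)
    fix h assume "h \<in> set (take (length (snd (snd z))) (concat (map (splitp (fst z) (fst (snd z) ! j)) s)))"
    then obtain g where g: "g \<in> set s" "h \<in> set (splitp (fst z) (fst (snd z) ! j) g)" by (auto dest!: in_set_takeD)
    show "set h \<subseteq> set (snd (snd z)) \<union> W (fst z)" "length h \<le> length (snd (snd z))" using sp[OF g] by blast+
  qed simp
  have "sz h \<le> 1 + length (snd (snd z)) * (1 + (sz (snd (snd z)) + wsz (fst z)))" if h: "h \<in> set s" for h
  proof (rule sz_list_le)
    fix y assume "y \<in> set h"
    then have "y \<in> set (snd (snd z)) \<union> W (fst z)" using s h by auto
    then show "sz y \<le> sz (snd (snd z)) + wsz (fst z)" using sz_mem_le[of y "snd (snd z)"] sz_W[of y "fst z"] by auto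
  qed (use s h in auto)
  then show "sz s \<le> 1 + (1 + length (snd (snd z))) * (1 + (1 + length (snd (snd z)) * (1 + (sz (snd (snd z)) + wsz (fst z)))))"
    by (rule sz_list_le) (use s in auto)
next
  fix z :: "ctx \<times> nat list list \<times> nat list list"
  show "length (filter (\<lambda>h. 2 \<le> length h \<and> length h \<le> length (snd (snd z)))
           [pgcd (fst z) (snd (snd z)) (padd (fst z) (ppow (fst z) (snd (snd z)) (pX (fst z)) (fq (fst z))) (pneg (fst z) (pX (fst z))))])
          \<le> 1 + length (snd (snd z)) \<and>
         (\<forall>h\<in>set (filter (\<lambda>h. 2 \<le> length h \<and> length h \<le> length (snd (snd z)))
           [pgcd (fst z) (snd (snd z)) (padd (fst z) (ppow (fst z) (snd (snd z)) (pX (fst z)) (fq (fst z))) (pneg (fst z) (pX (fst z))))]).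
             set h \<subseteq> set (snd (snd z)) \<union> W (fst z) \<and> length h \<le> length (snd (snd z)))"
    using set_pgcd[of "fst z" "snd (snd z)" "padd (fst z) (ppow (fst z) (snd (snd z)) (pX (fst z)) (fq (fst z))) (pneg (fst z) (pX (fst z)))"]
      set_padd[of "fst z" "ppow (fst z) (snd (snd z)) (pX (fst z)) (fq (fst z))" "pneg (fst z) (pX (fst z))"] by auto
qed (intro pt_intros pb_intros)+

lemmas pt_rparts [pt_intros] = pt_app3[OF pt_rparts0]

lemma pt_uroots0: "pt (\<lambda>z. uroots (fst z) (fst (snd z)) (snd (snd z)))"
  unfolding uroots_def by (intro pt_intros)

lemmas pt_uroots [pt_intros] = pt_app3[OF pt_uroots0]

section \<open>Roots in the polynomial ring\<close>

definition cterm :: "ctx \<Rightarrow> nat list list \<Rightarrow> nat list" where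
  "cterm C q = getd (fz C) (rev q) 0"

text \<open>Division by the largest common power of z. The entries of \<open>concat Q\<close> are a
  supply of rounds: each division of a nonzero polynomial uses up at least one coefficient.\<close>

definition stripz :: "ctx \<Rightarrow> nat list list list \<Rightarrow> nat list list list" where
  "stripz C Q = foldl (\<lambda>s i. if \<forall>q\<in>set s. cterm C q = fz C then map (\<lambda>q. butlast q) s else s) Q (concat Q)"

definition psm :: "ctx \<Rightarrow> nat list \<Rightarrow> nat list list \<Rightarrow> nat list list" where
  "psm C c h = pnorm C (smulp C c h)"

text \<open>One Horner step, from the coefficients of H(Y) to those of q + (c + Y) H(Y); iterated in
  \<open>taylor\<close> it gives the shift Q(c + Y).\<close>

definition tstep :: "ctx \<Rightarrow> nat list \<Rightarrow> nat list list list \<Rightarrow> nat list list \<Rightarrow> nat list list list" where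
  "tstep C c H q = (case map (\<lambda>u. padd C (fst u) (snd u)) (zip (map (\<lambda>h. psm C c h) H @ [[]]) ([] # H)) of
     [] \<Rightarrow> [] | s # ss \<Rightarrow> padd C q s # ss)"

definition taylor :: "ctx \<Rightarrow> nat list \<Rightarrow> nat list list list \<Rightarrow> nat list list list" where
  "taylor C c Q = foldl (\<lambda>H q. tstep C c H q) [] (rev Q)"

text \<open>The substitution of z Y for Y. Multiplication by z^i appends i zeros, except to the zero
  polynomial, which must remain [].\<close>

definition zscale :: "ctx \<Rightarrow> nat list list list \<Rightarrow> nat list list list" where
  "zscale C H = map (\<lambda>u. if fst u = [] then [] else fst u @ replicate (min (snd u) (length H)) (fz C)) (zip H [0..<length H])"

text \<open>Roth-Ruckenstein: a node holds the coefficients of a root found so far (highest first) and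
  the polynomial, as a list of its coefficients with the constant one first, whose roots are the
  possible continuations. After division by a power of \<open>z\<close>, the next coefficient is a root of the
  polynomial at \<open>z = 0\<close>.\<close>

definition rrnode :: "ctx \<Rightarrow> nat list list \<Rightarrow> nat list list \<times> nat list list list \<Rightarrow>
    bool \<times> (nat list list \<times> nat list list list) list" where
  "rrnode C as nd = (let r = uroots C as (pnorm C (rev (map (\<lambda>q. cterm C q) (stripz C (snd nd))))) in
     (fst r, map (\<lambda>c. (c # fst nd, zscale C (taylor C c (stripz C (snd nd))))) (snd r)))"

text \<open>\<open>N\<close> is the number of coefficients in Y of the initial polynomial. Cutting
  each level to N nodes bounds the tree on all inputs; over a field, a degree count along the tree
  shows that a level never has more.\<close>

definition rrstep :: "ctx \<Rightarrow> nat list list \<Rightarrow> nat \<Rightarrow> bool \<times> (nat list list \<times> nat list list list) list \<Rightarrow>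
    bool \<times> (nat list list \<times> nat list list list) list" where
  "rrstep C as N s = (let rs = map (\<lambda>nd. rrnode C as nd) (snd s) in
     (fst s \<and> (\<forall>r\<in>set rs. fst r), take N (concat (map (\<lambda>r. snd r) rs))))"

definition rr :: "ctx \<Rightarrow> nat list list \<Rightarrow> nat list list list \<Rightarrow> nat list \<Rightarrow> bool \<times> (nat list list \<times> nat list list list) list" where
  "rr C as Q ls = foldl (\<lambda>s i. rrstep C as (length Q) s) (True, [([], Q)]) ls"

text \<open>Here and in \<open>samples\<close> the bounds by \<open>min\<close> never take effect; they make the exponents visibly
  polynomially bounded.\<close>

definition felt :: "ctx \<Rightarrow> nat \<Rightarrow> nat list" where
  "felt C Y = map (\<lambda>i. (Y div md C ^ min i (dm C)) mod md C) [0..<dm C]"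

text \<open>With \<open>T\<close> samples a fixed pair of elements stays unseparated with probability at most \<open>1 / 2 ^ T\<close>;
  this \<open>T\<close> satisfies \<open>2 ^ T \<ge> 4 * q * q\<close>, which beats the number of pairs.\<close>

definition nsamp :: "ctx \<Rightarrow> nat" where "nsamp C = 2 + 2 * length (bits (fq C))"

definition samples :: "ctx \<Rightarrow> nat \<Rightarrow> nat list list" where
  "samples C R = map (\<lambda>i. felt C ((R div fq C ^ min i (nsamp C)) mod fq C)) [0..<nsamp C]"

definition good :: "ctx \<Rightarrow> nat \<Rightarrow> nat \<Rightarrow> nat list list \<Rightarrow> nat list list list \<Rightarrow> nat list list \<Rightarrow> bool" where
  "good C l t xs ys w \<longleftrightarrow> length w \<le> l + 1 \<and>
     t \<le> length (filter (\<lambda>u. \<exists>y\<in>set (snd u). peval C w (fst u) = y) (zip xs ys))"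

text \<open>With N = n d points, K = N t is chosen so that l K = m t: for l > 0 the powers Y^B with
  B < K are exactly those of weighted degree below m t.\<close>

definition gs_decode :: "ctx \<Rightarrow> nat \<Rightarrow> nat \<Rightarrow> nat list list \<Rightarrow> nat list list list \<Rightarrow> nat \<Rightarrow> bool \<times> nat list list list" where
  "gs_decode C l t xs ys R = (let m = length xs * length (getd [] ys 0) * l; K = length xs * length (getd [] ys 0) * t;
      r = rr C (samples C R) (gs_poly C [0..<m * t] [0..<K] [0..<m] l xs ys) [0..<l + 1] in
    (fst r, dedup (filter (good C l t xs ys)
       (map (\<lambda>y. pnorm C [y]) (concat ys) @ map (\<lambda>u. pnorm C (fst u)) (snd r)))))"

type_synonym inp = "ctx \<times> (nat \<times> nat) \<times> nat list list \<times> nat list list list"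

definition decode :: "inp \<times> nat \<Rightarrow> bool \<times> nat list list list" where
  "decode z = gs_decode (fst (fst z)) (min (fst (fst (snd (fst z)))) (length (fst (snd (snd (fst z))))))
     (length (fst (snd (snd (fst z)))) - snd (fst (snd (fst z)))) (fst (snd (snd (fst z)))) (snd (snd (snd (fst z)))) (snd z)"

lemma pt_cterm0: "pt (\<lambda>z. cterm (fst z) (snd z))"
  unfolding cterm_def by (intro pt_intros)

lemmas pt_cterm [pt_intros] = pt_app2[OF pt_cterm0]

lemma sz_map_butlast: "sz (map butlast Q) \<le> sz (Q :: nat list list list)"
proof (induction Q)
  case (Cons q Q)
  then show ?case using sz_take_le[of "length q - 1" q] by (simp add: butlast_conv_take)
qed simp

lemma stripz_inv:
  assumes "P Q" "\<And>Q. P Q \<Longrightarrow> \<forall>q\<in>set Q. cterm C q = fz C \<Longrightarrow> P (map butlast Q)"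
  shows "P (foldl (\<lambda>s i. if \<forall>q\<in>set s. cterm C q = fz C then map (\<lambda>q. butlast q) s else s) Q us)"
  using assms by (induction us arbitrary: Q) auto

lemma pt_stripz0: "pt (\<lambda>z. stripz (fst z) (snd z))"
  unfolding stripz_def
proof (rule pt_foldl[where m = "\<lambda>z. sz (snd z)"])
  fix z :: "ctx \<times> nat list list list" and j
  show "sz (foldl (\<lambda>s i. if \<forall>q\<in>set s. cterm (fst z) q = fz (fst z) then map (\<lambda>q. butlast q) s else s) (snd z) (take j (concat (snd z)))) \<le> sz (snd z)"
    by (rule stripz_inv) (auto intro: le_trans[OF sz_map_butlast])
qed (intro pt_intros pb_intros)+

lemmas pt_stripz [pt_intros] = pt_app2[OF pt_stripz0]

lemma stripz_bounds:
  assumes "\<forall>q\<in>set Q. set q \<subseteq> S \<and> length q \<le> L"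
  shows "length (stripz C Q) = length Q" "\<forall>q\<in>set (stripz C Q). set q \<subseteq> S \<and> length q \<le> L"
proof -
  have b: "set (butlast q) \<subseteq> S \<and> length (butlast q) \<le> L" if "set q \<subseteq> S \<and> length q \<le> L" for q
    using that in_set_butlastD[of _ q] by auto
  have "length (stripz C Q) = length Q \<and> (\<forall>q\<in>set (stripz C Q). set q \<subseteq> S \<and> length q \<le> L)"
    unfolding stripz_def
    by (rule stripz_inv[where P = "\<lambda>R. length R = length Q \<and> (\<forall>q\<in>set R. set q \<subseteq> S \<and> length q \<le> L)"])
      (use assms b in simp_all)
  then show "length (stripz C Q) = length Q" "\<forall>q\<in>set (stripz C Q). set q \<subseteq> S \<and> length q \<le> L" by auto
qed

lemma pt_tstep0: "pt (\<lambda>z. tstep (fst z) (fst (snd z)) (fst (snd (snd z))) (snd (snd (snd z))))"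
  unfolding tstep_def psm_def by (intro pt_intros)

lemmas pt_tstep [pt_intros] = pt_app4[OF pt_tstep0]

lemma length_psm: "length (psm C c h) \<le> length h"
  unfolding psm_def by (rule order_trans[OF length_pnorm]) (simp add: smulp_def)

lemma tstep_bounds:
  assumes H: "\<forall>h\<in>set H. set h \<subseteq> W C \<and> length h \<le> L" and q: "length q \<le> L"
  shows "length (tstep C c H q) = Suc (length H)" "\<forall>h\<in>set (tstep C c H q). set h \<subseteq> W C \<and> length h \<le> L"
proof -
  let ?S = "map (\<lambda>u. padd C (fst u) (snd u)) (zip (map (\<lambda>h. psm C c h) H @ [[]]) ([] # H))"
  have "length (padd C a b) \<le> L" if "(a, b) \<in> set (zip (map (\<lambda>h. psm C c h) H @ [[]]) ([] # H))" for a b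
  proof -
    have "length a \<le> L" using set_zip_leftD[OF that] H by (auto intro: order_trans[OF length_psm])
    moreover have "length b \<le> L" using set_zip_rightD[OF that] H by auto
    ultimately show ?thesis using length_padd[of C a b] by simp
  qed
  then have S: "\<forall>h\<in>set ?S. set h \<subseteq> W C \<and> length h \<le> L" using set_padd by fastforce
  have l: "length ?S = Suc (length H)" by simp
  then obtain s ss where ss: "?S = s # ss" by (cases ?S) auto
  have "length (padd C q s) \<le> L" using length_padd[of C q s] q S ss by auto
  then show "\<forall>h\<in>set (tstep C c H q). set h \<subseteq> W C \<and> length h \<le> L"
    using S set_padd[of C q s] unfolding tstep_def ss by auto
  show "length (tstep C c H q) = Suc (length H)"
    using l unfolding tstep_def ss by auto
qed

lemma taylor_bounds:
  assumes "\<forall>q\<in>set Q. length q \<le> L"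
  shows "length (taylor C c Q) = length Q \<and> (\<forall>h\<in>set (taylor C c Q). set h \<subseteq> W C \<and> length h \<le> L)"
  using assms
proof (induction Q)
  case (Cons q Q)
  then have IH: "length (taylor C c Q) = length Q" "\<forall>h\<in>set (taylor C c Q). set h \<subseteq> W C \<and> length h \<le> L" "length q \<le> L"
    by auto
  have t: "taylor C c (q # Q) = tstep C c (taylor C c Q) q" by (simp add: taylor_def)
  show ?case unfolding t using tstep_bounds[OF IH(2,3), of c] IH(1) by simp
qed (simp add: taylor_def)

lemma pt_taylor0: "pt (\<lambda>z. taylor (fst z) (fst (snd z)) (snd (snd z)))"
  unfolding taylor_def
proof (rule pt_foldl_inv[where I = "\<lambda>z j s. length s \<le> j \<and> (\<forall>h\<in>set s. set h \<subseteq> W (fst z) \<and> length h \<le> sz (snd (snd z)))"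
     and m = "\<lambda>z. 1 + length (snd (snd z)) * (1 + (1 + sz (snd (snd z)) * (1 + wsz (fst z))))"])
  fix z :: "ctx \<times> nat list \<times> nat list list list" and j s
  assume j: "j < length (rev (snd (snd z)))" and s: "length s \<le> j \<and> (\<forall>h\<in>set s. set h \<subseteq> W (fst z) \<and> length h \<le> sz (snd (snd z)))"
  have "rev (snd (snd z)) ! j \<in> set (snd (snd z))" using nth_mem[OF j] by simp
  from sz_mem_le[OF this] have l: "length (rev (snd (snd z)) ! j) \<le> sz (snd (snd z))"
    using length_le_sz[of "rev (snd (snd z)) ! j"] by linarith
  show "length (tstep (fst z) (fst (snd z)) s (rev (snd (snd z)) ! j)) \<le> Suc j \<and>
     (\<forall>h\<in>set (tstep (fst z) (fst (snd z)) s (rev (snd (snd z)) ! j)). set h \<subseteq> W (fst z) \<and> length h \<le> sz (snd (snd z)))"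
    using tstep_bounds[OF conjunct2[OF s] l, of "fst (snd z)"] s by simp
next
  fix z :: "ctx \<times> nat list \<times> nat list list list" and j s
  assume j: "j \<le> length (rev (snd (snd z)))" and s: "length s \<le> j \<and> (\<forall>h\<in>set s. set h \<subseteq> W (fst z) \<and> length h \<le> sz (snd (snd z)))"
  have "sz h \<le> 1 + sz (snd (snd z)) * (1 + wsz (fst z))" if "h \<in> set s" for h
    by (rule sz_W_list) (use s that in auto)
  then show "sz s \<le> 1 + length (snd (snd z)) * (1 + (1 + sz (snd (snd z)) * (1 + wsz (fst z))))"
    by (rule sz_list_le) (use s j in auto)
qed (intro pt_intros pb_intros | simp)+

lemmas pt_taylor [pt_intros] = pt_app3[OF pt_taylor0]

lemma pt_zscale0: "pt (\<lambda>z. zscale (fst z) (snd z))"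
  unfolding zscale_def by (intro pt_intros pb_intros)

lemmas pt_zscale [pt_intros] = pt_app2[OF pt_zscale0]

lemma zscale_bounds:
  assumes "\<forall>h\<in>set H. set h \<subseteq> W C \<and> length h \<le> L" "length H \<le> N"
  shows "length (zscale C H) = length H" "\<forall>h\<in>set (zscale C H). set h \<subseteq> W C \<and> length h \<le> L + N"
proof -
  show "length (zscale C H) = length H" by (simp add: zscale_def)
  show "\<forall>h\<in>set (zscale C H). set h \<subseteq> W C \<and> length h \<le> L + N"
  proof
    fix h assume "h \<in> set (zscale C H)"
    then obtain u i where u: "(u, i) \<in> set (zip H [0..<length H])"
      "h = (if u = [] then [] else u @ replicate (min i (length H)) (fz C))" by (auto simp: zscale_def)
    have "set u \<subseteq> W C" "length u \<le> L" using assms(1) set_zip_leftD[OF u(1)] by auto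
    moreover have "min i (length H) \<le> N" using assms(2) by simp
    ultimately show "set h \<subseteq> W C \<and> length h \<le> L + N" unfolding u(2)
      by (simp add: add_mono set_replicate_conv_if del: min_le_iff_disj)
  qed
qed

lemma pt_rrnode0: "pt (\<lambda>z. rrnode (fst z) (fst (snd z)) (snd (snd z)))"
  unfolding rrnode_def Let_def by (intro pt_intros)

lemmas pt_rrnode [pt_intros] = pt_app3[OF pt_rrnode0]

lemma pt_rrstep0: "pt (\<lambda>z. rrstep (fst z) (fst (snd z)) (fst (snd (snd z))) (snd (snd (snd z))))"
  unfolding rrstep_def Let_def by (intro pt_intros)

lemmas pt_rrstep [pt_intros] = pt_app4[OF pt_rrstep0]

text \<open>Size invariant at depth \<open>j\<close> of the tree. Coefficients are reduced or still
  belong to the input list, collected in \<open>S\<close>. Lengths grow by at most \<open>N\<close>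
  per level, because \<open>zscale\<close> multiplies the coefficient of Y^i by z^i and i <
  N.\<close>

definition node_ok :: "ctx \<Rightarrow> nat \<Rightarrow> nat \<Rightarrow> nat list list set \<Rightarrow> nat \<Rightarrow> nat list list \<times> nat list list list \<Rightarrow> bool" where
  "node_ok C N L S j nd \<longleftrightarrow> length (fst nd) \<le> j \<and> set (fst nd) \<subseteq> W C \<and> length (snd nd) \<le> N \<and>
     (\<forall>q\<in>set (snd nd). (set q \<subseteq> W C \<or> q \<in> S) \<and> length q \<le> L + j * N)"

lemma rrnode_ok:
  assumes nd: "node_ok C N L S j nd" and c: "ch \<in> set (snd (rrnode C as nd))"
  shows "node_ok C N L S (Suc j) ch"
proof -
  let ?Q = "stripz C (snd nd)"
  from c obtain c where ch: "ch = (c # fst nd, zscale C (taylor C c ?Q))" "c \<in> W C"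
    by (auto simp: rrnode_def Let_def uroots_def)
  have Q: "length ?Q = length (snd nd)" "\<forall>q\<in>set ?Q. length q \<le> L + j * N"
    using stripz_bounds[of "snd nd" UNIV "L + j * N" C] nd by (auto simp: node_ok_def)
  have t: "length (taylor C c ?Q) \<le> N" "\<forall>h\<in>set (taylor C c ?Q). set h \<subseteq> W C \<and> length h \<le> L + j * N"
    using taylor_bounds[OF Q(2), of C c] Q(1) nd by (auto simp: node_ok_def)
  show ?thesis using zscale_bounds[OF t(2,1)] t(1) nd ch by (auto simp: node_ok_def algebra_simps)
qed

lemma pt_rr0: "pt (\<lambda>z. rr (fst z) (fst (snd z)) (fst (snd (snd z))) (snd (snd (snd z))))"
  unfolding rr_def
proof (rule pt_foldl_inv[where I = "\<lambda>z j s. length (snd s) \<le> 1 + length (fst (snd (snd z))) \<and>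
      (\<forall>nd\<in>set (snd s). node_ok (fst z) (length (fst (snd (snd z)))) (sz (fst (snd (snd z)))) (set (fst (snd (snd z)))) j nd)"
    and m = "\<lambda>z. 3 + (1 + (1 + length (fst (snd (snd z)))) * (1 +
      (1 + (1 + length (snd (snd (snd z))) * (1 + wsz (fst z))) +
      (1 + length (fst (snd (snd z))) * (1 + (sz (fst (snd (snd z))) + (1 + (sz (fst (snd (snd z))) + length (snd (snd (snd z))) * length (fst (snd (snd z)))) * (1 + wsz (fst z)))))))))"])
  fix z :: "ctx \<times> nat list list \<times> nat list list list \<times> nat list" and j and s :: "bool \<times> (nat list list \<times> nat list list list) list"
  let ?C = "fst z" and ?as = "fst (snd z)" and ?Q = "fst (snd (snd z))" and ?ls = "snd (snd (snd z))"
  assume s: "length (snd s) \<le> 1 + length ?Q \<and> (\<forall>nd\<in>set (snd s). node_ok ?C (length ?Q) (sz ?Q) (set ?Q) j nd)"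
  have "node_ok ?C (length ?Q) (sz ?Q) (set ?Q) (Suc j) nd" if "nd \<in> set (snd (rrstep ?C ?as (length ?Q) s))" for nd
  proof -
    from that obtain nd' where nd': "nd' \<in> set (snd s)" "nd \<in> set (snd (rrnode ?C ?as nd'))"
      by (auto simp: rrstep_def Let_def dest!: in_set_takeD)
    show ?thesis by (rule rrnode_ok[OF bspec[OF conjunct2[OF s] nd'(1)] nd'(2)])
  qed
  then show "length (snd (rrstep ?C ?as (length ?Q) s)) \<le> 1 + length ?Q \<and>
     (\<forall>nd\<in>set (snd (rrstep ?C ?as (length ?Q) s)). node_ok ?C (length ?Q) (sz ?Q) (set ?Q) (Suc j) nd)"
    by (auto simp: rrstep_def Let_def)
next
  fix z :: "ctx \<times> nat list list \<times> nat list list list \<times> nat list" and j and s :: "bool \<times> (nat list list \<times> nat list list list) list"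
  let ?C = "fst z" and ?as = "fst (snd z)" and ?Q = "fst (snd (snd z))" and ?ls = "snd (snd (snd z))"
  assume j: "j \<le> length ?ls" and s: "length (snd s) \<le> 1 + length ?Q \<and> (\<forall>nd\<in>set (snd s). node_ok ?C (length ?Q) (sz ?Q) (set ?Q) j nd)"
  let ?a = "1 + length ?ls * (1 + wsz ?C)"
  let ?q = "sz ?Q + (1 + (sz ?Q + length ?ls * length ?Q) * (1 + wsz ?C))"
  let ?b = "1 + length ?Q * (1 + ?q)"
  have "sz nd \<le> 1 + ?a + ?b" if nd: "nd \<in> set (snd s)" for nd
  proof -
    have ok: "node_ok ?C (length ?Q) (sz ?Q) (set ?Q) j nd" using s nd by blast
    have "sz (fst nd) \<le> ?a" by (rule sz_W_list) (use ok j in \<open>auto simp: node_ok_def\<close>)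
    moreover have "sz (snd nd) \<le> ?b"
    proof (rule sz_list_le)
      fix q assume "q \<in> set (snd nd)"
      then have q: "(set q \<subseteq> W ?C \<or> q \<in> set ?Q) \<and> length q \<le> sz ?Q + j * length ?Q" using ok by (auto simp: node_ok_def)
      have "j * length ?Q \<le> length ?ls * length ?Q" using j by simp
      then have "length q \<le> sz ?Q + length ?ls * length ?Q" using q by linarith
      then show "sz q \<le> ?q" using q sz_W_list[of q ?C "sz ?Q + length ?ls * length ?Q"] sz_mem_le[of q ?Q] by auto
    qed (use ok in \<open>auto simp: node_ok_def\<close>)
    ultimately show ?thesis unfolding sz_prod[of nd] by linarith
  qed
  then have "sz (snd s) \<le> 1 + (1 + length ?Q) * (1 + (1 + ?a + ?b))" by (rule sz_list_le) (use s in auto)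
  moreover have "sz (fst s) \<le> 2" by (auto simp: floorlog_def)
  ultimately show "sz s \<le> 3 + (1 + (1 + length ?Q) * (1 + (1 + ?a + ?b)))"
    unfolding sz_prod[of s] by linarith
next
  fix z :: "ctx \<times> nat list list \<times> nat list list list \<times> nat list"
  have "length q \<le> sz (fst (snd (snd z)))" if "q \<in> set (fst (snd (snd z)))" for q
    using sz_mem_le[OF that] length_le_sz[of q] by linarith
  then show "length (snd (True, [([], fst (snd (snd z)))])) \<le> 1 + length (fst (snd (snd z))) \<and>
      (\<forall>nd\<in>set (snd (True, [([], fst (snd (snd z)))])). node_ok (fst z) (length (fst (snd (snd z)))) (sz (fst (snd (snd z)))) (set (fst (snd (snd z)))) 0 nd)"
    by (auto simp: node_ok_def)
qed (intro pt_intros pb_intros)+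

lemmas pt_rr [pt_intros] = pt_app4[OF pt_rr0]

lemma pt_felt0: "pt (\<lambda>z. felt (fst z) (snd z))"
  unfolding felt_def by (intro pt_intros pb_intros)

lemmas pt_felt [pt_intros] = pt_app2[OF pt_felt0]

lemma pt_nsamp [pt_intros]: "pt C \<Longrightarrow> pt (\<lambda>x. nsamp (C x))"
  and pb_nsamp [pb_intros]: "pt C \<Longrightarrow> pb (\<lambda>x. nsamp (C x))"
  unfolding nsamp_def by (intro pt_intros pb_intros; assumption)+

lemma pt_samples0: "pt (\<lambda>z. samples (fst z) (snd z))"
  unfolding samples_def by (intro pt_intros pb_intros)

lemmas pt_samples [pt_intros] = pt_app2[OF pt_samples0]

lemma pt_decode: "pt decode"
  unfolding decode_def gs_decode_def good_def Let_def by (intro pt_intros pb_intros)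

section \<open>Correctness of the field arithmetic\<close>

locale gfield = field F for F :: "(nat list) ring" (structure) +
  fixes p k :: nat and C :: ctx
  assumes eff: "explicit_finite_field p k F" and C_def: "C = (p, structure_constants k F)"
begin

lemma prime_p: "Factorial_Ring.prime p" and carrier_F: "carrier F = {a. length a = k \<and> set a \<subseteq> {..<p}}"
  and add_F: "a \<in> carrier F \<Longrightarrow> b \<in> carrier F \<Longrightarrow> a \<oplus> b = map2 (\<lambda>u v. (u + v) mod p) a b"
  using eff by (auto simp: explicit_finite_field_def)

lemma p_gt1: "p > 1" using prime_p prime_gt_1_nat by blast

lemma md_C [simp]: "md C = p" using p_gt1 by (simp add: md_def C_def)
lemma dm_C [simp]: "dm C = k" by (simp add: dm_def C_def structure_constants_def)
lemma W_C [simp]: "W C = carrier F" by (simp add: W_def carrier_F)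

lemma length_el: "a \<in> carrier F \<Longrightarrow> length a = k" by (simp add: carrier_F)
lemma nth_el_less: "a \<in> carrier F \<Longrightarrow> t < k \<Longrightarrow> a ! t < p"
  by (auto simp: carrier_F subset_iff)

lemma el_eqI: "a \<in> carrier F \<Longrightarrow> b \<in> carrier F \<Longrightarrow> (\<And>t. t < k \<Longrightarrow> a ! t = b ! t) \<Longrightarrow> a = b"
  by (rule nth_equalityI) (auto simp: length_el)

lemma nth_add: "a \<in> carrier F \<Longrightarrow> b \<in> carrier F \<Longrightarrow> t < k \<Longrightarrow> (a \<oplus> b) ! t = (a ! t + b ! t) mod p"
  by (simp add: add_F length_el)

text \<open>By 0 + 0 = 0 a coordinate a < p of the zero element satisfies 2 a = a modulo p.\<close>

lemma zero_F: "\<zero> = replicate k 0"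
proof (rule nth_equalityI)
  show "length \<zero> = length (replicate k 0)" using length_el[OF zero_closed] by simp
  fix t assume "t < length \<zero>"
  then have t: "t < k" using length_el[OF zero_closed] by simp
  have z: "\<zero> ! t < p" using nth_el_less[OF zero_closed t] .
  have "\<zero> ! t = (\<zero> ! t + \<zero> ! t) mod p" using nth_add[OF zero_closed zero_closed t] by simp
  then have "\<zero> ! t = 0" using z by (cases "\<zero> ! t + \<zero> ! t < p") (auto simp: mod_if split: if_splits)
  then show "\<zero> ! t = replicate k 0 ! t" using t by simp
qed

lemma k_pos: "k > 0"
proof (rule ccontr)
  assume "\<not> k > 0"
  then have "\<one> = \<zero>" using length_el[OF one_closed] length_el[OF zero_closed] by auto
  then show False by simp
qed

lemma fz_C [simp]: "fz C = \<zero>" by (simp add: fz_def zero_F)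

lemma fadd_C [simp]: "a \<in> carrier F \<Longrightarrow> b \<in> carrier F \<Longrightarrow> fadd C a b = a \<oplus> b"
proof (rule el_eqI)
  assume ab: "a \<in> carrier F" "b \<in> carrier F"
  show "fadd C a b \<in> carrier F" using fadd_W[of C a b] by simp
  show "fadd C a b ! t = (a \<oplus> b) ! t" if "t < k" for t
    using that ab by (simp add: fadd_def nth_add getd_eq length_el)
qed auto

lemma fsub_C [simp]: "a \<in> carrier F \<Longrightarrow> b \<in> carrier F \<Longrightarrow> fsub C a b = a \<ominus> b"
proof -
  assume ab: "a \<in> carrier F" "b \<in> carrier F"
  have c: "fsub C a b \<in> carrier F" using fsub_W[of C a b] by simp
  have "fsub C a b \<oplus> b = a"
  proof (rule el_eqI)
    fix t assume t: "t < k"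
    have "fsub C a b ! t = (a ! t + (p - b ! t)) mod p"
      using t ab nth_el_less[OF ab(2) t] by (simp add: fsub_def getd_eq length_el)
    then have "(fsub C a b \<oplus> b) ! t = (a ! t + (p - b ! t) + b ! t) mod p"
      using nth_add[OF c ab(2) t] by (simp add: mod_simps)
    also have "\<dots> = (a ! t + p) mod p" using nth_el_less[OF ab(2) t] by (simp add: add.assoc)
    finally show "(fsub C a b \<oplus> b) ! t = a ! t" using nth_el_less[OF ab(1) t] by simp
  qed (use ab c in auto)
  then have "a \<ominus> b = fsub C a b \<oplus> b \<ominus> b" by simp
  also have "\<dots> = fsub C a b" using c ab by (simp add: a_minus_def a_assoc r_neg)
  finally show ?thesis by simp
qed

lemma nth_add_pow: "u \<in> carrier F \<Longrightarrow> t < k \<Longrightarrow> ([(n::nat)] \<cdot> u) ! t = (n * u ! t) mod p"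
proof (induction n)
  case 0
  then show ?case by (simp add: zero_F)
next
  case (Suc n)
  have "([Suc n] \<cdot> u) = ([n] \<cdot> u) \<oplus> u" by simp
  then show ?case using Suc nth_add[of "[n] \<cdot> u" u t] by (simp add: mod_simps add.commute)
qed

lemma nth_finsum: "finite A \<Longrightarrow> f \<in> A \<rightarrow> carrier F \<Longrightarrow> t < k \<Longrightarrow> (\<Oplus>i\<in>A. f i) ! t = (\<Sum>i\<in>A. f i ! t) mod p"
proof (induction A rule: finite_induct)
  case (insert x A)
  then have "(\<Oplus>i\<in>insert x A. f i) ! t = (f x ! t + (\<Oplus>i\<in>A. f i) ! t) mod p"
    by (subst finsum_insert) (auto simp: nth_add Pi_def)
  then show ?case using insert by (simp add: mod_simps Pi_def)
qed (simp add: zero_F)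

abbreviation ev :: "nat \<Rightarrow> nat list" where "ev i \<equiv> basis_vec k i"

lemma ev_closed: "ev i \<in> carrier F"
  using p_gt1 by (auto simp: basis_vec_def carrier_F set_update_subset_insert dest!: set_update_subset_insert[THEN subsetD])

lemma nth_ev: "t < k \<Longrightarrow> ev i ! t = (if t = i then 1 else 0)"
  by (simp add: basis_vec_def nth_list_update)

lemma basis_decomp: "a \<in> carrier F \<Longrightarrow> a = (\<Oplus>i\<in>{0..<k}. [a ! i] \<cdot> ev i)"
proof (rule el_eqI)
  assume a: "a \<in> carrier F"
  show "(\<Oplus>i\<in>{0..<k}. [a ! i] \<cdot> ev i) \<in> carrier F" using ev_closed by (intro finsum_closed) auto
  fix t assume t: "t < k"
  have "(\<Oplus>i\<in>{0..<k}. [a ! i] \<cdot> ev i) ! t = (\<Sum>i\<in>{0..<k}. (a ! i * (if t = i then 1 else 0)) mod p) mod p"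
    using t ev_closed by (subst nth_finsum) (auto simp: nth_add_pow nth_ev)
  also have "\<dots> = (\<Sum>i\<in>{0..<k}. if t = i then a ! t else 0) mod p"
    using t nth_el_less[OF a t] by (intro arg_cong[where f = "\<lambda>s. s mod p"] sum.cong) auto
  also have "\<dots> = a ! t" using t nth_el_less[OF a t] by simp
  finally show "a ! t = (\<Oplus>i\<in>{0..<k}. [a ! i] \<cdot> ev i) ! t" by simp
qed

text \<open>Every element is a sum of natural multiples of basis vectors, so the form of the
  addition and distributivity already determine the product from the structure constants.\<close>

lemma mult_decomp:
  assumes a: "a \<in> carrier F" and b: "b \<in> carrier F"
  shows "a \<otimes> b = (\<Oplus>i\<in>{0..<k}. \<Oplus>j\<in>{0..<k}. [(a ! i * b ! j)] \<cdot> (ev i \<otimes> ev j))"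
proof -
  have 1: "([a ! i] \<cdot> ev i) \<otimes> b = (\<Oplus>j\<in>{0..<k}. [(a ! i * b ! j)] \<cdot> (ev i \<otimes> ev j))" for i
  proof -
    have "([a ! i] \<cdot> ev i) \<otimes> b = ([a ! i] \<cdot> ev i) \<otimes> (\<Oplus>j\<in>{0..<k}. [b ! j] \<cdot> ev j)" using basis_decomp[OF b] by simp
    also have "\<dots> = (\<Oplus>j\<in>{0..<k}. ([a ! i] \<cdot> ev i) \<otimes> ([b ! j] \<cdot> ev j))"
      using ev_closed by (intro finsum_rdistr) auto
    also have "\<dots> = (\<Oplus>j\<in>{0..<k}. [(a ! i * b ! j)] \<cdot> (ev i \<otimes> ev j))"
      using ev_closed
      by (intro finsum_cong' refl) (auto simp: add_pow_ldistr add_pow_rdistr add.nat_pow_pow mult.commute)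
    finally show ?thesis .
  qed
  have "a \<otimes> b = (\<Oplus>i\<in>{0..<k}. [a ! i] \<cdot> ev i) \<otimes> b" using basis_decomp[OF a] by simp
  also have "\<dots> = (\<Oplus>i\<in>{0..<k}. ([a ! i] \<cdot> ev i) \<otimes> b)" using ev_closed b by (intro finsum_ldistr) auto
  also have "\<dots> = (\<Oplus>i\<in>{0..<k}. \<Oplus>j\<in>{0..<k}. [(a ! i * b ! j)] \<cdot> (ev i \<otimes> ev j))" unfolding 1 ..
  finally show ?thesis .
qed

lemma fmul_C [simp]: "a \<in> carrier F \<Longrightarrow> b \<in> carrier F \<Longrightarrow> fmul C a b = a \<otimes> b"
proof (rule el_eqI)
  assume a: "a \<in> carrier F" and b: "b \<in> carrier F"
  show "fmul C a b \<in> carrier F" using fmul_W[of C a b] by simp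
  fix t assume t: "t < k"
  have e: "ev i \<otimes> ev j \<in> carrier F" for i j using ev_closed by simp
  have "(a \<otimes> b) ! t = (\<Sum>i\<in>{0..<k}. (\<Oplus>j\<in>{0..<k}. [(a ! i * b ! j)] \<cdot> (ev i \<otimes> ev j)) ! t) mod p"
    unfolding mult_decomp[OF a b] using t e by (intro nth_finsum) (auto intro!: finsum_closed)
  also have "\<dots> = (\<Sum>i\<in>{0..<k}. (\<Sum>j\<in>{0..<k}. (a ! i * b ! j * (ev i \<otimes> ev j) ! t) mod p) mod p) mod p"
    using t e by (intro arg_cong[where f = "\<lambda>s. s mod p"] sum.cong refl, subst nth_finsum) (auto simp: nth_add_pow)
  also have "\<dots> = (\<Sum>i\<in>{0..<k}. \<Sum>j\<in>{0..<k}. a ! i * b ! j * (ev i \<otimes> ev j) ! t) mod p"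
    by (simp add: mod_sum_eq)
  also have "\<dots> = fmul C a b ! t"
  proof -
    have M: "getd [] (getd [] (snd C) i) j = ev i \<otimes> ev j" if "i < k" "j < k" for i j
      using that by (simp add: C_def structure_constants_def getd_eq)
    have "fmul C a b ! t = (\<Sum>i = 0..<k. \<Sum>j = 0..<k. getd 0 a i * getd 0 b j * getd 0 (getd [] (getd [] (snd C) i) j) t) mod p"
      using t by (simp add: fmul_def interv_sum_list_conv_sum_set_nat)
    also have "\<dots> = (\<Sum>i\<in>{0..<k}. \<Sum>j\<in>{0..<k}. a ! i * b ! j * (ev i \<otimes> ev j) ! t) mod p"
      by (intro arg_cong[where f = "\<lambda>s. s mod p"] sum.cong refl)
        (use t a b length_el[OF e] in \<open>simp add: M, simp add: getd_eq length_el\<close>)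
    finally show ?thesis by simp
  qed
  finally show "fmul C a b ! t = (a \<otimes> b) ! t" by simp
qed auto

lemma bits_pow:
  assumes "acc \<in> carrier F" "sq \<in> carrier F"
  shows "fst (foldl (\<lambda>s b. (if b then fmul C (fst s) (snd s) else fst s, fmul C (snd s) (snd s))) (acc, sq) (bits n)) = acc \<otimes> sq [^] n"
  using assms
proof (induction n arbitrary: acc sq rule: bits.induct)
  case (1 n)
  show ?case
  proof (cases "n = 0")
    case True
    then show ?thesis using 1 bits_eq_Nil[of 0] by simp
  next
    case False
    have sq: "(sq \<otimes> sq) [^] (n div 2) = sq [^] (2 * (n div 2))"
    proof -
      have "sq [^] (2::nat) = sq \<otimes> sq" using 1(3) by (simp add: numeral_2_eq_2)
      then show ?thesis using nat_pow_pow[OF 1(3), of 2 "n div 2"] by simp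
    qed
    show ?thesis
    proof (cases "n mod 2 = 1")
      case True
      then have "sq [^] n = sq \<otimes> sq [^] (2 * (n div 2))" using nat_pow_Suc2[OF 1(3), of "2 * (n div 2)"] by (metis Suc_eq_plus1 mult_div_mod_eq)
      then show ?thesis using 1(1)[OF False, of "acc \<otimes> sq" "sq \<otimes> sq"] 1(2,3) True False
        by (simp add: bits_pos sq m_assoc)
    next
      case f: False
      then have "n = 2 * (n div 2)" by presburger
      then show ?thesis using 1(1)[OF False, of "acc" "sq \<otimes> sq"] 1(2,3) f False
        by (simp add: bits_pos sq)
    qed
  qed
qed

lemma fpow_C: "a \<in> carrier F \<Longrightarrow> e > 0 \<Longrightarrow> fpow C a e = a [^] e"
  using bits_pow[of a a "e - 1"] nat_pow_Suc2[of a "e - 1"] by (simp add: fpow_def)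

lemma card_F: "card (carrier F) = p ^ k" and finite_F: "finite (carrier F)"
proof -
  have e: "carrier F = {a. set a \<subseteq> {..<p} \<and> length a = k}" by (auto simp: carrier_F)
  show "card (carrier F) = p ^ k" unfolding e by (subst card_lists_length_eq) auto
  show "finite (carrier F)" unfolding e by (rule finite_lists_length_eq) auto
qed

lemma fq_C [simp]: "fq C = p ^ k" by (simp add: fq_def)

lemma q_ge2: "p ^ k \<ge> 2"
  using p_gt1 k_pos by (metis One_nat_def Suc_leI less_numeral_extra(1) numeral_2_eq_2 one_less_power)

lemma pow_q1: "a \<in> carrier F \<Longrightarrow> a \<noteq> \<zero> \<Longrightarrow> a [^] (p ^ k - 1) = \<one>"
proof -
  assume a: "a \<in> carrier F" "a \<noteq> \<zero>"
  interpret M: group "Multiplicative_Group.mult_of F" by (rule field_mult_group)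
  have "order (Multiplicative_Group.mult_of F) = p ^ k - 1" using order_mult_of[OF finite_F] card_F by (simp add: order_def)
  then show ?thesis using M.pow_order_eq_1[of a] a by (simp add: Multiplicative_Group.nat_pow_mult_of)
qed

lemma pow_q: "a \<in> carrier F \<Longrightarrow> a [^] (p ^ k) = a"
proof (cases "a = \<zero>")
  case True
  have "p ^ k \<noteq> 0" using q_ge2 by linarith
  from nat_pow_zero[OF this] True show ?thesis by simp
next
  case False
  assume a: "a \<in> carrier F"
  obtain r where r: "p ^ k = Suc r" using q_ge2 by (cases "p ^ k") auto
  show ?thesis using pow_q1[OF a False] a unfolding r by simp
qed

lemma fone_C [simp]: "fone C = \<one>"
proof -
  have e: "1 # replicate (k - 1) 0 = ev 0" using k_pos by (cases k) (auto simp: basis_vec_def)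
  have "ev 0 \<noteq> \<zero>" using nth_ev[of 0 0] k_pos by (auto simp: zero_F)
  then show ?thesis using fpow_C[OF ev_closed, of "p ^ k - 1" 0] pow_q1[OF ev_closed] q_ge2 by (simp add: fone_def e[simplified])
qed

lemma finv_C [simp]: "a \<in> carrier F \<Longrightarrow> a \<noteq> \<zero> \<Longrightarrow> finv C a = inv a"
proof -
  assume a: "a \<in> carrier F" "a \<noteq> \<zero>"
  let ?q = "p ^ k"
  have e: "finv C a = a [^] (2 * ?q - 3)" using fpow_C[OF a(1), of "2 * ?q - 3"] q_ge2 by (simp add: finv_def)
  have "a [^] (2 * ?q - 3) \<otimes> a = a [^] Suc (2 * ?q - 3)" by simp
  also have "Suc (2 * ?q - 3) = (?q - 1) * 2" using q_ge2 by simp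
  also have "a [^] ((?q - 1) * 2) = \<one>" using pow_q1[OF a] a nat_pow_pow[OF a(1), of "?q - 1" 2] by simp
  finally show ?thesis unfolding e using a by (intro comm_inv_char[symmetric]) (auto simp: m_comm)
qed

lemma fsum_C: "set xs \<subseteq> carrier F \<Longrightarrow> fsum C xs = foldr (\<oplus>) xs \<zero>"
proof -
  have "foldl (fadd C) s xs = s \<oplus> foldr (\<oplus>) xs \<zero> \<and> foldr (\<oplus>) xs \<zero> \<in> carrier F" if "s \<in> carrier F" "set xs \<subseteq> carrier F" for s
    using that by (induction xs arbitrary: s) (auto simp: a_assoc)
  then show "set xs \<subseteq> carrier F \<Longrightarrow> fsum C xs = foldr (\<oplus>) xs \<zero>" by (simp add: fsum_def)
qed

end

section \<open>The polynomial ring\<close>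

context gfield
begin

abbreviation R :: "nat list list ring" where "R \<equiv> poly_ring F"

sublocale R: domain "poly_ring F"
  by (rule univ_poly_is_domain[OF carrier_is_subring])

lemma R_zero: "\<zero>\<^bsub>R\<^esub> = []" and R_one: "\<one>\<^bsub>R\<^esub> = [\<one>]"
  and R_add: "a \<oplus>\<^bsub>R\<^esub> b = poly_add a b" and R_mult: "a \<otimes>\<^bsub>R\<^esub> b = poly_mult a b"
  by (simp_all add: univ_poly_zero univ_poly_one univ_poly_add univ_poly_mult)

lemma in_R: "w \<in> carrier R \<longleftrightarrow> w = [] \<or> (set w \<subseteq> carrier F \<and> hd w \<noteq> \<zero>)"
  by (simp add: univ_poly_carrier[symmetric] polynomial_def)

lemma R_set: "w \<in> carrier R \<Longrightarrow> set w \<subseteq> carrier F"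
  by (auto simp: in_R)

lemma Nil_R [simp]: "[] \<in> carrier R" by (simp add: in_R)

lemma pnorm_C: "pnorm C v = normalize v"
  by (induction v) (simp_all add: pnorm_def)

lemma normalize_R: "set v \<subseteq> carrier F \<Longrightarrow> normalize v \<in> carrier R"
  using normalize_gives_polynomial[of v "carrier F"] by (simp add: univ_poly_carrier)

lemma normalize_id: "v \<in> carrier R \<Longrightarrow> normalize v = v"
  using normalize_polynomial[of "carrier F" v] by (simp add: univ_poly_carrier)

lemma vadd_C: "set a \<subseteq> carrier F \<Longrightarrow> set b \<subseteq> carrier F \<Longrightarrow> vadd C a b = map2 (\<oplus>) a b"
proof -
  assume "set a \<subseteq> carrier F" "set b \<subseteq> carrier F"
  then have "u \<in> carrier F \<and> v \<in> carrier F" if "(u, v) \<in> set (zip a b)" for u v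
    using that by (meson set_zip_leftD set_zip_rightD subsetD)
  then show ?thesis unfolding vadd_def by (auto intro!: fadd_C)
qed

lemma map2_comm:
  "set a \<subseteq> carrier F \<Longrightarrow> set b \<subseteq> carrier F \<Longrightarrow> map2 (\<oplus>) a b = map2 (\<oplus>) b a"
proof (induction a arbitrary: b)
  case (Cons x a)
  then show ?case by (cases b) (auto simp: a_comm)
qed simp

lemma padd_C: "set a \<subseteq> carrier F \<Longrightarrow> set b \<subseteq> carrier F \<Longrightarrow> padd C a b = poly_add a b"
proof -
  assume ab: "set a \<subseteq> carrier F" "set b \<subseteq> carrier F"
  have pad: "set (padl C n a) \<subseteq> carrier F" "set (padl C n b) \<subseteq> carrier F" for n using ab by (auto simp: padl_def)
  have e: "padd C a b = normalize (map2 (\<oplus>) (padl C (length b) a) (padl C (length a) b))"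
    by (simp add: padd_def pnorm_C vadd_C pad)
  show ?thesis
  proof (cases "length b \<le> length a")
    case True
    then show ?thesis unfolding e by (simp add: padl_def)
  next
    case False
    then have "map2 (\<oplus>) (padl C (length b) a) (padl C (length a) b) = map2 (\<oplus>) b (padl C (length b) a)"
      using map2_comm[OF pad(1) ab(2)] by (simp add: padl_def)
    then show ?thesis unfolding e using False by (simp add: padl_def)
  qed
qed

declare poly_add.simps [simp del]

lemma padd_R [simp]: "a \<in> carrier R \<Longrightarrow> b \<in> carrier R \<Longrightarrow> padd C a b = a \<oplus>\<^bsub>R\<^esub> b"
  by (simp add: padd_C R_set R_add)

lemma pneg_R [simp]: "b \<in> carrier R \<Longrightarrow> pneg C b = \<ominus>\<^bsub>R\<^esub> b"
  using R_set[of b] unfolding pneg_def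
  by (subst univ_poly_a_inv_def'[OF carrier_is_subring]) (auto simp: a_minus_def)

lemma smulp_C: "c \<in> carrier F \<Longrightarrow> set b \<subseteq> carrier F \<Longrightarrow> smulp C c b = map ((\<otimes>) c) b"
  by (auto simp: smulp_def)

lemma pmul_C: "set a \<subseteq> carrier F \<Longrightarrow> set b \<subseteq> carrier F \<Longrightarrow> pmul C a b = poly_mult a b"
proof -
  assume b: "set b \<subseteq> carrier F"
  have "foldl (\<lambda>s u. padd C (smulp C (fst u) b @ replicate (min (snd u) N) (fz C)) s) [] (zip (rev a) [0..<length a]) = poly_mult a b"
    if "set a \<subseteq> carrier F" "length a \<le> N" for N
    using that
  proof (induction a)
    case (Cons x a)
    have "zip (rev (x # a)) [0..<length (x # a)] = zip (rev a) [0..<length a] @ [(x, length a)]" by simp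
    moreover have "set (map ((\<otimes>) x) b @ replicate (length a) \<zero>) \<subseteq> carrier F" "set (poly_mult a b) \<subseteq> carrier F"
      using Cons b poly_mult_in_carrier[of a b] by auto
    note padd_C[OF this]
    ultimately show ?case using Cons b by (simp add: smulp_C)
  qed simp
  then show "set a \<subseteq> carrier F \<Longrightarrow> pmul C a b = poly_mult a b" by (simp add: pmul_def)
qed

lemma pmul_R [simp]: "a \<in> carrier R \<Longrightarrow> b \<in> carrier R \<Longrightarrow> pmul C a b = a \<otimes>\<^bsub>R\<^esub> b"
  by (simp add: pmul_C R_set R_mult)

text \<open>Constants are embedded by \<open>normalize\<close> so that 0 becomes the zero polynomial
  [], which makes \<open>pc\<close> a ring homomorphism.\<close>

definition pc :: "nat list \<Rightarrow> nat list list" where "pc c = normalize [c]"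

lemma pc_R [simp]: "c \<in> carrier F \<Longrightarrow> pc c \<in> carrier R"
  by (simp add: pc_def in_R)

lemma psm_R: "c \<in> carrier F \<Longrightarrow> h \<in> carrier R \<Longrightarrow> psm C c h = pc c \<otimes>\<^bsub>R\<^esub> h"
proof -
  assume c: "c \<in> carrier F" and h: "h \<in> carrier R"
  have "pc c \<otimes>\<^bsub>R\<^esub> h = poly_mult [c] h"
    using poly_mult_normalize[of "[c]" h] c R_set[OF h] by (simp add: R_mult pc_def)
  also have "\<dots> = normalize (map ((\<otimes>) c) h)" using poly_mult_const'(1)[of h c] R_set[OF h] c by simp
  finally show ?thesis using c R_set[OF h] by (simp add: psm_def pnorm_C smulp_C)
qed

lemma peval_C: "set w \<subseteq> carrier F \<Longrightarrow> u \<in> carrier F \<Longrightarrow> peval C w u = eval w u"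
  unfolding peval_def
proof (induction w rule: rev_induct)
  case (snoc c w)
  then show ?case using eval_append_aux[of w c u] eval_in_carrier[of w u] by simp
qed simp

lemma eval_hom:
  assumes "u \<in> carrier F"
  shows "a \<in> carrier R \<Longrightarrow> eval a u \<in> carrier F"
    "a \<in> carrier R \<Longrightarrow> b \<in> carrier R \<Longrightarrow> eval (a \<oplus>\<^bsub>R\<^esub> b) u = eval a u \<oplus> eval b u"
    "a \<in> carrier R \<Longrightarrow> b \<in> carrier R \<Longrightarrow> eval (a \<otimes>\<^bsub>R\<^esub> b) u = eval a u \<otimes> eval b u"
    "a \<in> carrier R \<Longrightarrow> eval (\<ominus>\<^bsub>R\<^esub> a) u = \<ominus> eval a u"
    "a \<in> carrier R \<Longrightarrow> b \<in> carrier R \<Longrightarrow> eval (a \<ominus>\<^bsub>R\<^esub> b) u = eval a u \<ominus> eval b u"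
    "a \<in> carrier R \<Longrightarrow> eval (a [^]\<^bsub>R\<^esub> (n::nat)) u = eval a u [^] n"
    "eval \<zero>\<^bsub>R\<^esub> u = \<zero>" "eval \<one>\<^bsub>R\<^esub> u = \<one>" "c \<in> carrier F \<Longrightarrow> eval (pc c) u = c"
proof -
  interpret h: ring_hom_cring R F "\<lambda>w. eval w u" by (rule eval_cring_hom[OF carrier_is_subring assms])
  show "a \<in> carrier R \<Longrightarrow> eval a u \<in> carrier F" by simp
  show "a \<in> carrier R \<Longrightarrow> b \<in> carrier R \<Longrightarrow> eval (a \<oplus>\<^bsub>R\<^esub> b) u = eval a u \<oplus> eval b u" by simp
  show "a \<in> carrier R \<Longrightarrow> b \<in> carrier R \<Longrightarrow> eval (a \<otimes>\<^bsub>R\<^esub> b) u = eval a u \<otimes> eval b u" by simp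
  show "a \<in> carrier R \<Longrightarrow> eval (\<ominus>\<^bsub>R\<^esub> a) u = \<ominus> eval a u" by simp
  show "a \<in> carrier R \<Longrightarrow> b \<in> carrier R \<Longrightarrow> eval (a \<ominus>\<^bsub>R\<^esub> b) u = eval a u \<ominus> eval b u" by (simp add: a_minus_def)
  show "eval (a [^]\<^bsub>R\<^esub> (n::nat)) u = eval a u [^] n" if "a \<in> carrier R"
    using that by (induction n) auto
  show "eval \<zero>\<^bsub>R\<^esub> u = \<zero>" "eval \<one>\<^bsub>R\<^esub> u = \<one>" by simp_all
  show "c \<in> carrier F \<Longrightarrow> eval (pc c) u = c" using assms by (simp add: pc_def)
qed

text \<open>Congruence modulo \<open>g\<close> with an explicit quotient. It transports values at
  roots of \<open>g\<close> (\<open>cg_eval\<close>) and divisors shared with \<open>g\<close>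
  (\<open>cg_divides\<close>), which is how the root finder uses remainders.\<close>

definition cg :: "nat list list \<Rightarrow> nat list list \<Rightarrow> nat list list \<Rightarrow> bool" where
  "cg g f f' \<longleftrightarrow> f' \<in> carrier R \<and> (\<exists>h\<in>carrier R. f = f' \<oplus>\<^bsub>R\<^esub> h \<otimes>\<^bsub>R\<^esub> g)"

lemma cg_R: "g \<in> carrier R \<Longrightarrow> cg g f f' \<Longrightarrow> f \<in> carrier R \<and> f' \<in> carrier R"
  by (auto simp: cg_def)

lemma cg_refl: "g \<in> carrier R \<Longrightarrow> f \<in> carrier R \<Longrightarrow> cg g f f"
  unfolding cg_def using R.zero_closed by (metis R.l_null R.r_zero)

lemma cg_trans: "g \<in> carrier R \<Longrightarrow> cg g f f' \<Longrightarrow> cg g f' f'' \<Longrightarrow> cg g f f''"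
proof -
  assume g: "g \<in> carrier R" and 1: "cg g f f'" and 2: "cg g f' f''"
  then obtain h h' where h: "h \<in> carrier R" "f = f' \<oplus>\<^bsub>R\<^esub> h \<otimes>\<^bsub>R\<^esub> g" "h' \<in> carrier R" "f' = f'' \<oplus>\<^bsub>R\<^esub> h' \<otimes>\<^bsub>R\<^esub> g"
    and f: "f'' \<in> carrier R" by (auto simp: cg_def)
  have "f = f'' \<oplus>\<^bsub>R\<^esub> (h' \<oplus>\<^bsub>R\<^esub> h) \<otimes>\<^bsub>R\<^esub> g" unfolding h(2,4) using g h(1,3) f by (simp add: R.l_distr R.a_assoc)
  then show ?thesis unfolding cg_def using h(1,3) f by blast
qed

lemma cg_mult: "g \<in> carrier R \<Longrightarrow> cg g a a' \<Longrightarrow> cg g b b' \<Longrightarrow> cg g (a \<otimes>\<^bsub>R\<^esub> b) (a' \<otimes>\<^bsub>R\<^esub> b')"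
proof -
  assume g: "g \<in> carrier R" and 1: "cg g a a'" and 2: "cg g b b'"
  then obtain h h' where h: "h \<in> carrier R" "a = a' \<oplus>\<^bsub>R\<^esub> h \<otimes>\<^bsub>R\<^esub> g" "h' \<in> carrier R" "b = b' \<oplus>\<^bsub>R\<^esub> h' \<otimes>\<^bsub>R\<^esub> g"
    and ab: "a' \<in> carrier R" "b' \<in> carrier R" by (auto simp: cg_def)
  have "a \<otimes>\<^bsub>R\<^esub> b = a' \<otimes>\<^bsub>R\<^esub> b' \<oplus>\<^bsub>R\<^esub> (h \<otimes>\<^bsub>R\<^esub> b \<oplus>\<^bsub>R\<^esub> a' \<otimes>\<^bsub>R\<^esub> h') \<otimes>\<^bsub>R\<^esub> g"
    unfolding h(2,4) using g h(1,3) ab by (simp add: R.l_distr R.r_distr R.a_ac R.m_ac)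
  moreover have "h \<otimes>\<^bsub>R\<^esub> b \<oplus>\<^bsub>R\<^esub> a' \<otimes>\<^bsub>R\<^esub> h' \<in> carrier R" using h ab g by auto
  ultimately show ?thesis unfolding cg_def using ab by blast
qed

lemma cg_eval: "g \<in> carrier R \<Longrightarrow> cg g f f' \<Longrightarrow> u \<in> carrier F \<Longrightarrow> eval g u = \<zero> \<Longrightarrow> eval f u = eval f' u"
  unfolding cg_def using eval_hom(1)[of u f'] by (auto simp: eval_hom)

lemma cg_divides: "g \<in> carrier R \<Longrightarrow> cg g f f' \<Longrightarrow> d \<in> carrier R \<Longrightarrow> d divides\<^bsub>R\<^esub> g \<Longrightarrow> d divides\<^bsub>R\<^esub> f \<Longrightarrow> d divides\<^bsub>R\<^esub> f'"
proof -
  assume g: "g \<in> carrier R" and 1: "cg g f f'" and d: "d \<in> carrier R" "d divides\<^bsub>R\<^esub> g"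
  then obtain h where h: "h \<in> carrier R" "f = f' \<oplus>\<^bsub>R\<^esub> h \<otimes>\<^bsub>R\<^esub> g" and f': "f' \<in> carrier R" by (auto simp: cg_def)
  obtain c where c: "c \<in> carrier R" "g = d \<otimes>\<^bsub>R\<^esub> c" using d(2) by (auto simp: factor_def)
  show "d divides\<^bsub>R\<^esub> f'" if "d divides\<^bsub>R\<^esub> f"
  proof -
    from that obtain c' where c': "c' \<in> carrier R" "f = d \<otimes>\<^bsub>R\<^esub> c'" by (auto simp: factor_def)
    have "f' = f \<ominus>\<^bsub>R\<^esub> h \<otimes>\<^bsub>R\<^esub> g" unfolding h(2) using h(1) f' g by (simp add: R.minus_eq R.a_assoc R.r_neg)
    also have "\<dots> = d \<otimes>\<^bsub>R\<^esub> (c' \<ominus>\<^bsub>R\<^esub> h \<otimes>\<^bsub>R\<^esub> c)" unfolding c(2) c'(2) using d h c c'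
      by (simp add: R.minus_eq R.r_distr R.r_minus R.m_ac)
    finally show ?thesis using h c c' by (auto simp: factor_def)
  qed
qed

lemma divides_root: "d \<in> carrier R \<Longrightarrow> d divides\<^bsub>R\<^esub> f \<Longrightarrow> u \<in> carrier F \<Longrightarrow> eval d u = \<zero> \<Longrightarrow> eval f u = \<zero>"
  by (auto simp: factor_def eval_hom)

lemma redstep_R:
  assumes f: "f \<in> carrier R" and g: "g \<in> carrier R" "g \<noteq> []"
  shows "cg g (redstep C g f) f"
proof (cases "length f < length g")
  case True
  then show ?thesis using cg_refl[OF g(1) f] by (simp add: redstep_def)
next
  case False
  then have "f \<noteq> []" using g by auto
  then obtain a f' b g' where fg: "f = a # f'" "g = b # g'" using g by (metis list.exhaust)
  have ab: "a \<in> carrier F" "a \<noteq> \<zero>" "b \<in> carrier F" "b \<noteq> \<zero>" using f g(1) unfolding fg by (auto simp: in_R)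
  have invb: "inv b \<in> carrier F" "inv b \<noteq> \<zero>" "inv b \<otimes> b = \<one>" using ab field_Units by auto
  define c where "c = \<ominus> (a \<otimes> inv b)"
  have c: "c \<in> carrier F" "c \<noteq> \<zero>" using ab invb integral_iff[of a "inv b"] by (auto simp: c_def)
  have c': "fsub C \<zero> (fmul C a (finv C b)) = c" using ab invb by (simp add: c_def a_minus_def)
  define n where "n = length f - length g"
  let ?m = "map ((\<otimes>) c) g @ replicate n \<zero>"
  have sm: "set ?m \<subseteq> carrier F" using c R_set[OF g(1)] by auto
  have lm: "length ?m = length f" using False by (simp add: n_def)
  have mm: "monom c n \<in> carrier R" using c by (auto simp: in_R monom_def)
  have "poly_mult (monom c n) g = ?m"
    using poly_mult_monom'[OF R_set[OF g(1)] c(1), of n] integral_iff[of c b] c ab by (simp add: fg)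
  then have m: "monom c n \<otimes>\<^bsub>R\<^esub> g = ?m" by (simp add: R_mult)
  have "f \<oplus>\<^bsub>R\<^esub> monom c n \<otimes>\<^bsub>R\<^esub> g = normalize (map2 (\<oplus>) f ?m)" unfolding m R_add using lm by (simp add: poly_add.simps)
  also have "\<dots> = normalize (tl (map2 (\<oplus>) f ?m))"
  proof -
    have "a \<oplus> c \<otimes> b = \<zero>" using ab invb by (simp add: c_def l_minus m_assoc r_neg)
    then show ?thesis by (simp add: fg)
  qed
  also have "\<dots> = redstep C g f"
    using False g R_set[OF f] sm c R_set[OF g(1)] vadd_C[OF R_set[OF f] sm] c'
    by (simp add: redstep_def pnorm_C smulp_C getd_eq n_def fg)
  finally have "redstep C g f = f \<oplus>\<^bsub>R\<^esub> monom c n \<otimes>\<^bsub>R\<^esub> g" ..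
  then show ?thesis using mm f unfolding cg_def by blast
qed

lemma prem_R:
  assumes f: "f \<in> carrier R" and g: "g \<in> carrier R" "g \<noteq> []"
  shows "cg g (prem C f g) f" "prem C f g \<in> carrier R" "length (prem C f g) < length g"
proof -
  have "cg g (foldl (\<lambda>s i. redstep C g s) s us) s" if "s \<in> carrier R" for s and us :: "nat list"
    using that
  proof (induction us arbitrary: s)
    case Nil
    then show ?case using cg_refl[OF g(1)] by simp
  next
    case (Cons u us)
    have 1: "cg g (redstep C g s) s" using redstep_R[OF Cons.prems g] .
    then have "redstep C g s \<in> carrier R" using cg_R[OF g(1)] by blast
    from cg_trans[OF g(1) Cons.IH[OF this] 1] show ?case by simp
  qed
  from this[OF f] g show 1: "cg g (prem C f g) f" by (simp add: prem_def)
  then show "prem C f g \<in> carrier R" using cg_R[OF g(1)] by blast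
  show "length (prem C f g) < length g" using prem_bounds(3)[OF g(2)] .
qed

text \<open>Two properties of a gcd suffice for splitting: it divides both arguments, and it
  vanishes at their common roots. Both pass from the pair of g and f mod g to the pair of f and
  g.\<close>

lemma pgcd_R:
  assumes "f \<in> carrier R" "g \<in> carrier R"
  shows "pgcd C f g \<in> carrier R" "pgcd C f g divides\<^bsub>R\<^esub> f" "pgcd C f g divides\<^bsub>R\<^esub> g"
    "u \<in> carrier F \<Longrightarrow> eval f u = \<zero> \<Longrightarrow> eval g u = \<zero> \<Longrightarrow> eval (pgcd C f g) u = \<zero>"
proof -
  let ?G = "\<lambda>s us. fst (foldl (\<lambda>s i. if snd s = [] then s else (snd s, prem C (fst s) (snd s))) s us)"
  have "?G (f, g) us \<in> carrier R \<and> ?G (f, g) us divides\<^bsub>R\<^esub> f \<and> ?G (f, g) us divides\<^bsub>R\<^esub> g \<and>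
     (\<forall>u\<in>carrier F. eval f u = \<zero> \<longrightarrow> eval g u = \<zero> \<longrightarrow> eval (?G (f, g) us) u = \<zero>)"
    if "f \<in> carrier R" "g \<in> carrier R" "length g \<le> length us" for f g and us :: "nat list"
    using that
  proof (induction us arbitrary: f g)
    case Nil
    then show ?case using R.divides_refl[of f] R.divides_zero[of f] by (simp add: R_zero)
  next
    case (Cons i us)
    show ?case
    proof (cases "g = []")
      case True
      have "?G (f, []) vs = f" for vs :: "nat list" by (induction vs) auto
      then show ?thesis using True Cons(2) R.divides_refl[of f] R.divides_zero[of f] by (simp add: R_zero)
    next
      case False
      note P = prem_R[OF Cons(2,3) False]
      let ?r = "prem C f g" let ?d = "?G (g, ?r) us"
      have IH: "?d \<in> carrier R \<and> ?d divides\<^bsub>R\<^esub> g \<and> ?d divides\<^bsub>R\<^esub> ?r \<and>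
         (\<forall>u\<in>carrier F. eval g u = \<zero> \<longrightarrow> eval ?r u = \<zero> \<longrightarrow> eval ?d u = \<zero>)"
        by (rule Cons.IH) (use P Cons in auto)
      have "?d divides\<^bsub>R\<^esub> f" using cg_divides[OF Cons(3) P(1)] IH by blast
      moreover have "eval ?r u = \<zero>" if "u \<in> carrier F" "eval f u = \<zero>" "eval g u = \<zero>" for u
        using cg_eval[OF Cons(3) P(1) that(1,3)] that(2) by simp
      ultimately show ?thesis using IH False by auto
    qed
  qed
  from this[OF assms, of "[0..<length g]"]
  show "pgcd C f g \<in> carrier R" "pgcd C f g divides\<^bsub>R\<^esub> f" "pgcd C f g divides\<^bsub>R\<^esub> g"
    "u \<in> carrier F \<Longrightarrow> eval f u = \<zero> \<Longrightarrow> eval g u = \<zero> \<Longrightarrow> eval (pgcd C f g) u = \<zero>"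
    by (auto simp: pgcd_def)
qed

lemma ppow_R:
  assumes g: "g \<in> carrier R" "g \<noteq> []" and a: "a \<in> carrier R" and e: "e > 0"
  shows "cg g (ppow C g a e) (a [^]\<^bsub>R\<^esub> e)"
proof -
  let ?G = "\<lambda>s bs. fst (foldl (\<lambda>s b. (if b then prem C (pmul C (fst s) (snd s)) g else fst s, prem C (pmul C (snd s) (snd s)) g)) s bs)"
  have m: "cg g (prem C (u \<otimes>\<^bsub>R\<^esub> v) g) (u' \<otimes>\<^bsub>R\<^esub> v')" if "cg g u u'" "cg g v v'" for u u' v v'
    using cg_trans[OF g(1) prem_R(1)[OF _ g] cg_mult[OF g(1) that]] cg_R[OF g(1) that(1)] cg_R[OF g(1) that(2)] by blast
  have "cg g (?G (acc, sq) (bits n)) (acc' \<otimes>\<^bsub>R\<^esub> sq' [^]\<^bsub>R\<^esub> n)" if "cg g acc acc'" "cg g sq sq'" for acc sq acc' sq' n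
    using that
  proof (induction n arbitrary: acc sq acc' sq' rule: bits.induct)
    case (1 n)
    note A = cg_R[OF g(1) 1(2)] and S = cg_R[OF g(1) 1(3)]
    show ?case
    proof (cases "n = 0")
      case True
      then show ?thesis using 1 A bits_eq_Nil[of 0] by simp
    next
      case False
      have sq: "(sq' \<otimes>\<^bsub>R\<^esub> sq') [^]\<^bsub>R\<^esub> (n div 2) = sq' [^]\<^bsub>R\<^esub> (2 * (n div 2))"
      proof -
        have "sq' [^]\<^bsub>R\<^esub> (2::nat) = sq' \<otimes>\<^bsub>R\<^esub> sq'" using S by (simp add: numeral_2_eq_2)
        then show ?thesis using R.nat_pow_pow[of sq' 2 "n div 2"] S by simp
      qed
      show ?thesis
      proof (cases "n mod 2 = 1")
        case True
        then have "sq' [^]\<^bsub>R\<^esub> n = sq' \<otimes>\<^bsub>R\<^esub> sq' [^]\<^bsub>R\<^esub> (2 * (n div 2))"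
          using R.nat_pow_Suc2[of sq' "2 * (n div 2)"] S by (metis Suc_eq_plus1 mult_div_mod_eq)
        then show ?thesis using 1(1)[OF False m[OF 1(2,3)] m[OF 1(3,3)]] A S True False
          by (simp add: bits_pos sq R.m_assoc)
      next
        case f: False
        then have "n = 2 * (n div 2)" by presburger
        then show ?thesis using 1(1)[OF False 1(2) m[OF 1(3,3)]] A S f False
          by (simp add: bits_pos sq)
      qed
    qed
  qed
  from this[OF cg_refl[OF g(1) a] cg_refl[OF g(1) a], of "e - 1"]
  show ?thesis using R.nat_pow_Suc2[OF a, of "e - 1"] e by (simp add: ppow_def)
qed

end

section \<open>Splitting by quadratic characters and traces\<close>

context cring
begin

text \<open>The sum v + v^2 + v^4 + ... with i terms; in a field with 2^i elements it is the
  absolute trace. It is defined in any commutative ring because it is applied to elements of F as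
  well as to the polynomial X.\<close>

primrec trf :: "nat \<Rightarrow> 'a \<Rightarrow> 'a" where
  "trf 0 v = \<zero>"
| "trf (Suc i) v = v \<oplus> trf i (v \<otimes> v)"

lemma trf_closed [simp]: "v \<in> carrier R \<Longrightarrow> trf i v \<in> carrier R"
  by (induction i arbitrary: v) auto

lemma sq_pow: "v \<in> carrier R \<Longrightarrow> (v \<otimes> v) [^] (n::nat) = v [^] (2 * n)"
proof -
  assume v: "v \<in> carrier R"
  have "v [^] (2::nat) = v \<otimes> v" using v by (simp add: numeral_2_eq_2)
  then show ?thesis using nat_pow_pow[OF v, of 2 n] by simp
qed

lemma trf_Suc: "v \<in> carrier R \<Longrightarrow> trf (Suc i) v = trf i v \<oplus> v [^] ((2::nat) ^ i)"
proof (induction i arbitrary: v)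
  case (Suc i)
  have "trf (Suc (Suc i)) v = v \<oplus> (trf i (v \<otimes> v) \<oplus> (v \<otimes> v) [^] ((2::nat) ^ i))"
    using Suc.IH[of "v \<otimes> v"] Suc.prems by simp
  also have "\<dots> = trf (Suc i) v \<oplus> v [^] ((2::nat) ^ Suc i)" using Suc.prems by (simp add: sq_pow a_assoc)
  finally show ?case .
qed simp

end

context gfield
begin

lemma length_mult: "a \<in> carrier R \<Longrightarrow> b \<in> carrier R \<Longrightarrow> a \<noteq> [] \<Longrightarrow> b \<noteq> [] \<Longrightarrow>
    a \<otimes>\<^bsub>R\<^esub> b \<noteq> [] \<and> length (a \<otimes>\<^bsub>R\<^esub> b) - 1 = (length a - 1) + (length b - 1)"
  using poly_mult_degree_eq[OF carrier_is_subring, of a b] R.integral_iff[of a b]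
  by (simp add: univ_poly_carrier R_mult R_zero)

lemma divides_nonzero: "d \<in> carrier R \<Longrightarrow> d divides\<^bsub>R\<^esub> f \<Longrightarrow> f \<noteq> [] \<Longrightarrow> d \<noteq> [] \<and> length d \<le> length f"
proof -
  assume d: "d \<in> carrier R" "d divides\<^bsub>R\<^esub> f" and f: "f \<noteq> []"
  then obtain c where c: "c \<in> carrier R" "f = d \<otimes>\<^bsub>R\<^esub> c" by (auto simp: factor_def)
  have "d \<noteq> []" "c \<noteq> []" using f c d R.l_null[of c] R.r_null[of d] by (auto simp: R_zero)
  then have "length f - 1 = (length d - 1) + (length c - 1)" "length d > 0" "length f > 0"
    using length_mult[of d c] c d f by auto
  then show ?thesis using \<open>d \<noteq> []\<close> by arith
qed

definition rts :: "nat list list \<Rightarrow> nat list set" where "rts f = {u \<in> carrier F. eval f u = \<zero>}"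

lemma finite_rts [simp]: "finite (rts f)" using finite_F by (simp add: rts_def)

lemma set_roots: "f \<in> carrier R \<Longrightarrow> f \<noteq> [] \<Longrightarrow> set_mset (roots f) = rts f"
  using roots_mem_iff_is_root[of f] by (auto simp: is_root_def rts_def)

lemma card_rts: "f \<in> carrier R \<Longrightarrow> f \<noteq> [] \<Longrightarrow> card (rts f) \<le> length f - 1"
proof -
  assume f: "f \<in> carrier R" "f \<noteq> []"
  have "card (rts f) = size (mset_set (set_mset (roots f)))" using set_roots[OF f] by simp
  also have "\<dots> \<le> size (roots f)" by (rule size_mset_mono[OF mset_set_set_mset_msubset])
  also have "\<dots> \<le> length f - 1" using size_roots_le_degree[OF f(1)] .
  finally show ?thesis .
qed

lemma pX_C: "pX C = [\<one>, \<zero>]" "pX C \<in> carrier R" "u \<in> carrier F \<Longrightarrow> eval (pX C) u = u"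
  by (simp_all add: pX_def in_R)

lemma length_pow: "a \<in> carrier R \<Longrightarrow> a \<noteq> [] \<Longrightarrow> a [^]\<^bsub>R\<^esub> (n::nat) \<noteq> [] \<and> length (a [^]\<^bsub>R\<^esub> n) - 1 = n * (length a - 1)"
proof (induction n)
  case 0
  then show ?case by (simp add: R_one)
next
  case (Suc n)
  then show ?case using length_mult[of "a [^]\<^bsub>R\<^esub> n" a] by (simp add: add.commute)
qed

lemma length_add_neq: "a \<in> carrier R \<Longrightarrow> b \<in> carrier R \<Longrightarrow> length a \<noteq> length b \<Longrightarrow>
    length (a \<oplus>\<^bsub>R\<^esub> b) = max (length a) (length b)"
  using poly_add_length_eq[OF carrier_is_subring, of a b] by (simp add: univ_poly_carrier R_add)

lemma length_minus: "a \<in> carrier R \<Longrightarrow> length (\<ominus>\<^bsub>R\<^esub> a) = length a"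
  by (subst univ_poly_a_inv_def'[OF carrier_is_subring]) auto

definition frob :: "nat list list" where "frob = pX C [^]\<^bsub>R\<^esub> (p ^ k) \<ominus>\<^bsub>R\<^esub> pX C"

lemma frob: "frob \<in> carrier R" "length frob = Suc (p ^ k)" "u \<in> carrier F \<Longrightarrow> eval frob u = \<zero>"
proof -
  show "frob \<in> carrier R" using pX_C by (simp add: frob_def)
  have l: "pX C [^]\<^bsub>R\<^esub> (p ^ k) \<noteq> []" "length (pX C [^]\<^bsub>R\<^esub> (p ^ k)) - 1 = p ^ k"
    using length_pow[of "pX C" "p ^ k"] pX_C by auto
  then have l': "length (pX C [^]\<^bsub>R\<^esub> (p ^ k)) = Suc (p ^ k)" by (cases "pX C [^]\<^bsub>R\<^esub> (p ^ k)") auto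
  show "length frob = Suc (p ^ k)" unfolding frob_def a_minus_def
    using length_add_neq[of "pX C [^]\<^bsub>R\<^esub> (p ^ k)" "\<ominus>\<^bsub>R\<^esub> pX C"] l' q_ge2 k_pos p_gt1 pX_C by (simp add: length_minus pX_C(1))
  show "u \<in> carrier F \<Longrightarrow> eval frob u = \<zero>" using pX_C pow_q by (simp add: frob_def eval_hom r_neg a_minus_def)
qed

text \<open>If g h = X^q - X, each of the q elements of F is a root of g or of h. At most deg h of
  them are roots of h, which leaves at least deg g for g.\<close>

lemma card_rts_split:
  assumes g: "g \<in> carrier R" "g divides\<^bsub>R\<^esub> frob"
  shows "card (rts g) = length g - 1" "g \<noteq> []"
proof -
  obtain h where h: "h \<in> carrier R" "frob = g \<otimes>\<^bsub>R\<^esub> h" using g by (auto simp: factor_def)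
  have f0: "frob \<noteq> []" using frob(2) by auto
  show gn: "g \<noteq> []" using divides_nonzero[OF g f0] by blast
  have hn: "h \<noteq> []" using f0 h g R.r_null[of g] by (auto simp: R_zero)
  have "carrier F \<subseteq> rts g \<union> rts h"
  proof
    fix u assume u: "u \<in> carrier F"
    have "eval g u \<otimes> eval h u = \<zero>" using frob(3)[OF u] g h u by (simp add: eval_hom)
    then show "u \<in> rts g \<union> rts h" using u g h integral_iff[of "eval g u" "eval h u"] by (auto simp: rts_def eval_hom)
  qed
  then have "p ^ k \<le> card (rts g \<union> rts h)" using card_F card_mono[of "rts g \<union> rts h" "carrier F"] by simp
  also have "\<dots> \<le> card (rts g) + card (rts h)" by (rule card_Un_le)
  also have "\<dots> \<le> card (rts g) + (length h - 1)" using card_rts[OF h(1) hn] by simp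
  finally have "p ^ k \<le> card (rts g) + (length h - 1)" .
  moreover have "p ^ k = (length g - 1) + (length h - 1)" using length_mult[OF g(1) h(1) gn hn] frob(2) h(2) by simp
  ultimately show "card (rts g) = length g - 1" using card_rts[OF g(1) gn] by linarith
qed

text \<open>Two roots of a squarefree split polynomial are separated by the gcd with
  \<open>(X + a) ^ ((q - 1) / 2) - c\<close> (for \<open>p = 2\<close>: with \<open>Tr (a * X) - c\<close>) iff their values \<open>hval a\<close> differ.\<close>

definition hval :: "nat list \<Rightarrow> nat list \<Rightarrow> nat list" where
  "hval a u = (if p mod 2 = 1 then (u \<oplus> a) [^] ((p ^ k - 1) div 2) else trf k (a \<otimes> u))"

lemma half_pos: "p mod 2 = 1 \<Longrightarrow> (p ^ k - 1) div 2 > 0 \<and> 2 * ((p ^ k - 1) div 2) = p ^ k - 1"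
proof -
  assume o: "p mod 2 = 1"
  then have "odd (p ^ k)" by (simp add: odd_iff_mod_2_eq_one)
  moreover have "p ^ k \<noteq> 2" using calculation by (metis dvd_refl)
  ultimately show ?thesis using q_ge2 by (auto elim!: oddE)
qed

lemma p_even: "p mod 2 \<noteq> 1 \<Longrightarrow> p = 2"
  using prime_p primes_dvd_imp_eq[of 2 p] two_is_prime_nat by (auto simp: even_iff_mod_2_eq_zero)

lemma char2: "p mod 2 \<noteq> 1 \<Longrightarrow> x \<in> carrier F \<Longrightarrow> x \<oplus> x = \<zero>"
proof -
  assume p: "p mod 2 \<noteq> 1" and x: "x \<in> carrier F"
  show ?thesis
  proof (rule el_eqI)
    fix t assume "t < k"
    then show "(x \<oplus> x) ! t = \<zero> ! t" using nth_add[OF x x, of t] p_even[OF p] by (simp add: zero_F)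
  qed (use x in auto)
qed

lemma sq_add: "p mod 2 \<noteq> 1 \<Longrightarrow> x \<in> carrier F \<Longrightarrow> y \<in> carrier F \<Longrightarrow> (x \<oplus> y) \<otimes> (x \<oplus> y) = x \<otimes> x \<oplus> y \<otimes> y"
proof -
  assume p: "p mod 2 \<noteq> 1" and xy: "x \<in> carrier F" "y \<in> carrier F"
  have "(x \<oplus> y) \<otimes> (x \<oplus> y) = (x \<otimes> x \<oplus> y \<otimes> y) \<oplus> (x \<otimes> y \<oplus> x \<otimes> y)"
    using xy by (simp add: l_distr r_distr a_ac m_ac)
  then show ?thesis using char2[OF p, of "x \<otimes> y"] xy by simp
qed

lemma trf_add: "p mod 2 \<noteq> 1 \<Longrightarrow> x \<in> carrier F \<Longrightarrow> y \<in> carrier F \<Longrightarrow> trf i (x \<oplus> y) = trf i x \<oplus> trf i y"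
  by (induction i arbitrary: x y) (auto simp: sq_add a_ac)

lemma trf_sq: "p mod 2 \<noteq> 1 \<Longrightarrow> x \<in> carrier F \<Longrightarrow> trf i x \<otimes> trf i x = trf i (x \<otimes> x)"
  by (induction i arbitrary: x) (auto simp: sq_add)

text \<open>Since x^q = x, squaring permutes the terms of the trace cyclically. So the trace is
  equal to its square and hence 0 or 1.\<close>

lemma trf_range: "p mod 2 \<noteq> 1 \<Longrightarrow> x \<in> carrier F \<Longrightarrow> trf k x = \<zero> \<or> trf k x = \<one>"
proof -
  assume p: "p mod 2 \<noteq> 1" and x: "x \<in> carrier F"
  have "x [^] ((2::nat) ^ k) = x" using pow_q[OF x] p_even[OF p] by simp
  then have "x \<oplus> trf k (x \<otimes> x) = trf k x \<oplus> x" using trf_Suc[OF x, of k] by simp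
  then have "trf k (x \<otimes> x) = trf k x" using x by (simp add: a_comm[of "trf k x"] add.l_cancel)
  then have "trf k x \<otimes> trf k x = trf k x" using trf_sq[OF p x] by simp
  then have "trf k x \<otimes> (trf k x \<ominus> \<one>) = \<zero>" using x by (simp add: a_minus_def r_distr r_minus r_neg)
  then have "trf k x = \<zero> \<or> trf k x \<ominus> \<one> = \<zero>" using x integral[of "trf k x" "trf k x \<ominus> \<one>"] by simp
  then show ?thesis using x by (auto simp: r_right_minus_eq)
qed

lemma set_cvals: "set (cvals C) \<subseteq> carrier F" "distinct (cvals C)"
proof -
  show "set (cvals C) \<subseteq> carrier F" by (auto simp: cvals_def)
  \<comment> \<open>Otherwise 1 + 1 = 0, and a nonzero coordinate a < p of 1 would satisfy p dvd 2 a
    with p odd.\<close>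
  have "\<one> \<noteq> \<zero> \<ominus> \<one>" if o: "p mod 2 = 1"
  proof
    assume e: "\<one> = \<zero> \<ominus> \<one>"
    then have two: "\<one> \<oplus> \<one> = \<zero>" by (metis add.l_inv_ex l_zero minus_eq one_closed r_neg a_inv_closed)
    obtain t where t: "t < k" "\<one> ! t \<noteq> 0"
      using el_eqI[OF one_closed zero_closed] by (metis nth_replicate one_not_zero zero_F)
    have "(\<one> ! t + \<one> ! t) mod p = 0" using nth_add[OF one_closed one_closed t(1)] two t by (simp add: zero_F)
    then have "p dvd 2 * \<one> ! t" by (simp add: mod_eq_0_iff_dvd mult_2)
    moreover have "coprime p 2" using o by (simp add: coprime_commute coprime_left_2_iff_odd odd_iff_mod_2_eq_one)
    ultimately have "p dvd \<one> ! t" using coprime_dvd_mult_right_iff by blast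
    then show False using t nth_el_less[OF one_closed t(1)] by (simp add: nat_dvd_not_less)
  qed
  moreover have "\<zero> \<ominus> \<one> \<noteq> \<zero>" by (simp add: a_minus_def)
  moreover from calculation(2) have "\<zero> \<noteq> \<zero> \<ominus> \<one>" by metis
  ultimately show "distinct (cvals C)" by (auto simp: cvals_def)
qed

lemma hval_range: "a \<in> carrier F \<Longrightarrow> u \<in> carrier F \<Longrightarrow> hval a u \<in> set (cvals C)"
proof (cases "p mod 2 = 1")
  case True
  assume au: "a \<in> carrier F" "u \<in> carrier F"
  let ?m = "(p ^ k - 1) div 2" and ?x = "u \<oplus> a"
  let ?y = "?x [^] ?m"
  have y: "?y \<in> carrier F" using au by simp
  show ?thesis
  proof (cases "?x = \<zero>")
    case x: True
    then have "?y = \<zero>" using half_pos[OF True] nat_pow_zero[of ?m] by simp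
    then show ?thesis using True by (simp add: hval_def cvals_def)
  next
    case x: False
    have "?y \<otimes> ?y = ?x [^] (?m + ?m)" using au by (simp add: nat_pow_mult)
    also have "?m + ?m = p ^ k - 1" using half_pos[OF True] by simp
    finally have "?y \<otimes> ?y = \<one>" using pow_q1[of ?x] x au by simp
    then have "(?y \<ominus> \<one>) \<otimes> (?y \<oplus> \<one>) = \<zero>"
      using y by (simp add: a_minus_def l_distr r_distr l_minus a_ac r_neg r_neg2 r_neg1)
    then have "?y \<ominus> \<one> = \<zero> \<or> ?y \<oplus> \<one> = \<zero>" using y integral[of "?y \<ominus> \<one>" "?y \<oplus> \<one>"] by auto
    then have "?y = \<one> \<or> ?y = \<ominus> \<one>" using y by (auto simp: r_right_minus_eq sum_zero_eq_neg)
    then show ?thesis using True by (auto simp: hval_def cvals_def a_minus_def)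
  qed
next
  case False
  assume au: "a \<in> carrier F" "u \<in> carrier F"
  then show ?thesis using trf_range[OF False, of "a \<otimes> u"] False by (auto simp: hval_def cvals_def)
qed

lemma eval_ptrace:
  assumes g: "g \<in> carrier R" "g \<noteq> []" and a: "a \<in> carrier F" and u: "u \<in> carrier F" "eval g u = \<zero>"
  shows "ptrace C g a \<in> carrier R" "eval (ptrace C g a) u = trf k (a \<otimes> u)"
proof -
  have *: "fst (foldl (\<lambda>s i. (padd C (fst s) (snd s), prem C (pmul C (snd s) (snd s)) g)) (s, x) us) \<in> carrier R \<and>
     eval (fst (foldl (\<lambda>s i. (padd C (fst s) (snd s), prem C (pmul C (snd s) (snd s)) g)) (s, x) us)) u = eval s u \<oplus> trf (length us) (eval x u)"
    if "s \<in> carrier R" "x \<in> carrier R" for s x and us :: "nat list list list"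
    using that
  proof (induction us arbitrary: s x)
    case Nil
    then show ?case using u by (simp add: eval_hom)
  next
    case (Cons i us)
    have r: "prem C (x \<otimes>\<^bsub>R\<^esub> x) g \<in> carrier R" "cg g (prem C (x \<otimes>\<^bsub>R\<^esub> x) g) (x \<otimes>\<^bsub>R\<^esub> x)"
      using prem_R[OF _ g, of "x \<otimes>\<^bsub>R\<^esub> x"] Cons by auto
    have "eval (prem C (x \<otimes>\<^bsub>R\<^esub> x) g) u = eval x u \<otimes> eval x u"
      using cg_eval[OF g(1) r(2) u] Cons u by (simp add: eval_hom)
    then show ?case using Cons.IH[of "s \<oplus>\<^bsub>R\<^esub> x" "prem C (x \<otimes>\<^bsub>R\<^esub> x) g"] r(1) Cons.prems u
      by (simp add: eval_hom a_assoc)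
  qed
  have n: "pnorm C [a, fz C] \<in> carrier R" using normalize_R[of "[a, \<zero>]"] a by (simp add: pnorm_C)
  have "eval (pnorm C [a, fz C]) u = a \<otimes> u" using eval_normalize[of "[a, \<zero>]" u] a u by (simp add: pnorm_C)
  moreover have "length (snd C) = k" using dm_C unfolding dm_def .
  ultimately show "ptrace C g a \<in> carrier R" "eval (ptrace C g a) u = trf k (a \<otimes> u)"
    using *[OF Nil_R n, of "snd C"] a u by (simp_all add: ptrace_def)
qed

lemma hpoly_C:
  assumes g: "g \<in> carrier R" "g \<noteq> []" and a: "a \<in> carrier F" and u: "u \<in> carrier F" "eval g u = \<zero>"
  shows "hpoly C g a \<in> carrier R" "eval (hpoly C g a) u = hval a u"
proof -
  have "hpoly C g a \<in> carrier R \<and> eval (hpoly C g a) u = hval a u"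
  proof (cases "p mod 2 = 1")
    case True
    let ?b = "pX C \<oplus>\<^bsub>R\<^esub> pc a"
    have b: "?b \<in> carrier R" using pX_C a by simp
    have c: "cg g (ppow C g ?b ((p ^ k - 1) div 2)) (?b [^]\<^bsub>R\<^esub> ((p ^ k - 1) div 2))"
      using ppow_R[OF g b] half_pos[OF True] by blast
    have e: "pnorm C [a] = pc a" unfolding pnorm_C pc_def ..
    have "hpoly C g a = ppow C g ?b ((p ^ k - 1) div 2)" unfolding hpoly_def e using True a pX_C(2) by simp
    then show ?thesis using cg_R[OF g(1) c] cg_eval[OF g(1) c u] True b u a pX_C by (simp add: eval_hom hval_def)
  next
    case False
    then show ?thesis using eval_ptrace[OF assms] by (simp add: hpoly_def hval_def)
  qed
  then show "hpoly C g a \<in> carrier R" "eval (hpoly C g a) u = hval a u" by auto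
qed

end

section \<open>Refining the factors until every root is isolated\<close>

context gfield
begin

definition pok :: "nat list list \<Rightarrow> nat list list \<Rightarrow> bool" where
  "pok f h \<longleftrightarrow> h \<in> carrier R \<and> h divides\<^bsub>R\<^esub> frob \<and> h divides\<^bsub>R\<^esub> f \<and> 2 \<le> length h"

text \<open>Keeping this number equal to 1 at the roots of f and 0 elsewhere says at once that no
  root is lost and that no two parts share a root.\<close>

definition cnt :: "nat list \<Rightarrow> nat list list list \<Rightarrow> nat" where
  "cnt u ps = length (filter (\<lambda>h. eval h u = \<zero>) ps)"

lemma divides_trans: "d divides\<^bsub>R\<^esub> g \<Longrightarrow> g divides\<^bsub>R\<^esub> f \<Longrightarrow> d \<in> carrier R \<Longrightarrow> d divides\<^bsub>R\<^esub> f"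
  by (rule R.divides_trans)

lemma rts_short: "h \<in> carrier R \<Longrightarrow> h \<noteq> [] \<Longrightarrow> u \<in> rts h \<Longrightarrow> 2 \<le> length h"
proof -
  assume h: "h \<in> carrier R" "h \<noteq> []" and u: "u \<in> rts h"
  have "card (rts h) > 0" using u card_gt_0_iff finite_rts by blast
  then show ?thesis using card_rts[OF h] by linarith
qed

lemma pok_root: "pok f h \<Longrightarrow> card (rts h) \<ge> 1"
  using card_rts_split(1)[of h] by (auto simp: pok_def)

text \<open>The value \<open>hval a u\<close> is exactly one of the distinct entries of
  \<open>cvals C\<close>, so each root of \<open>g\<close> falls into exactly one of the
  gcds.\<close>

lemma splitp_C:
  assumes g: "pok f g" and f: "f \<in> carrier R" and a: "a \<in> carrier F"
  shows "h \<in> set (splitp C a g) \<Longrightarrow> pok f h"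
    "u \<in> carrier F \<Longrightarrow> cnt u (splitp C a g) = of_bool (eval g u = \<zero>)"
    "h \<in> set (splitp C a g) \<Longrightarrow> u \<in> rts h \<Longrightarrow> v \<in> rts h \<Longrightarrow> u \<in> rts g \<and> v \<in> rts g \<and> hval a u = hval a v"
proof -
  have gR: "g \<in> carrier R" "g \<noteq> []" using g by (auto simp: pok_def)
  \<comment> \<open>\<open>hpoly_C\<close> speaks about a root of \<open>g\<close>; one is needed
    even to know that \<open>hpoly\<close> is a polynomial.\<close>
  have "rts g \<noteq> {}" using pok_root[OF g] by auto
  then obtain u0 where u0: "u0 \<in> carrier F" "eval g u0 = \<zero>" by (auto simp: rts_def)
  let ?H = "hpoly C g a"
  have H: "?H \<in> carrier R" using hpoly_C(1)[OF gR a u0] .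
  define d where "d = (\<lambda>c. pgcd C g (padd C ?H (pneg C (pnorm C [c]))))"
  have dd: "d c \<in> carrier R \<and> d c divides\<^bsub>R\<^esub> g \<and> (\<forall>u\<in>carrier F. eval (d c) u = \<zero> \<longleftrightarrow> eval g u = \<zero> \<and> hval a u = c)"
    if c: "c \<in> carrier F" for c
  proof -
    have e: "pnorm C [c] = pc c" unfolding pnorm_C pc_def ..
    have w: "padd C ?H (pneg C (pnorm C [c])) = ?H \<ominus>\<^bsub>R\<^esub> pc c" unfolding e using H c by (simp add: a_minus_def)
    have wR: "?H \<ominus>\<^bsub>R\<^esub> pc c \<in> carrier R" using H c by simp
    note G = pgcd_R[OF gR(1) wR]
    have ev: "eval (?H \<ominus>\<^bsub>R\<^esub> pc c) u = hval a u \<ominus> c" if "u \<in> carrier F" "eval g u = \<zero>" for u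
      using that H c hpoly_C(2)[OF gR a that] by (simp add: eval_hom)
    have hc: "hval a u \<in> carrier F" if "u \<in> carrier F" for u using hval_range[OF a that] set_cvals by blast
    have "eval (d c) u = \<zero> \<longleftrightarrow> eval g u = \<zero> \<and> hval a u = c" if u: "u \<in> carrier F" for u
    proof
      assume z: "eval (d c) u = \<zero>"
      have 1: "eval g u = \<zero>" using divides_root[OF G(1,2) u] z by (simp add: d_def w)
      have "eval (?H \<ominus>\<^bsub>R\<^esub> pc c) u = \<zero>" using divides_root[OF G(1,3) u] z by (simp add: d_def w)
      then show "eval g u = \<zero> \<and> hval a u = c" using 1 ev[OF u 1] hc[OF u] c by (simp add: r_right_minus_eq)
    next
      assume z: "eval g u = \<zero> \<and> hval a u = c"
      then have "eval (?H \<ominus>\<^bsub>R\<^esub> pc c) u = \<zero>" using ev[OF u] c by (simp add: a_minus_def r_neg)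
      then show "eval (d c) u = \<zero>" using G(4)[OF u] z by (simp add: d_def w)
    qed
    then show ?thesis using G by (simp add: d_def w)
  qed
  have sp: "splitp C a g = filter (\<lambda>h. 2 \<le> length h \<and> length h \<le> length g) (map d (cvals C))"
    by (simp add: splitp_def d_def)
  have cv: "c \<in> carrier F" if "c \<in> set (cvals C)" for c using that set_cvals by blast
  show "pok f h" if "h \<in> set (splitp C a g)"
  proof -
    from that obtain c where c: "c \<in> set (cvals C)" "h = d c" "2 \<le> length h" by (auto simp: sp)
    have "h \<in> carrier R" "h divides\<^bsub>R\<^esub> g" using dd[OF cv[OF c(1)]] c by auto
    then show ?thesis using g c(3) divides_trans unfolding pok_def by blast
  qed
  show "u \<in> rts g \<and> v \<in> rts g \<and> hval a u = hval a v" if "h \<in> set (splitp C a g)" "u \<in> rts h" "v \<in> rts h"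
  proof -
    from that obtain c where c: "c \<in> set (cvals C)" "h = d c" by (auto simp: sp)
    show ?thesis using dd[OF cv[OF c(1)]] c(2) that(2,3) by (auto simp: rts_def)
  qed
  show "cnt u (splitp C a g) = of_bool (eval g u = \<zero>)" if u: "u \<in> carrier F"
  proof -
    have len: "2 \<le> length (d c) \<and> length (d c) \<le> length g" if "c \<in> set (cvals C)" "eval (d c) u = \<zero>" for c
      using dd[OF cv[OF that(1)]] divides_nonzero[of "d c" g] gR rts_short[of "d c" u] that(2) u by (auto simp: rts_def)
    have "cnt u (splitp C a g) = length (filter (\<lambda>c. 2 \<le> length (d c) \<and> length (d c) \<le> length g \<and> eval (d c) u = \<zero>) (cvals C))"
      unfolding cnt_def sp by (simp add: filter_map comp_def)
    also have "filter (\<lambda>c. 2 \<le> length (d c) \<and> length (d c) \<le> length g \<and> eval (d c) u = \<zero>) (cvals C)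
        = filter (\<lambda>c. eval g u = \<zero> \<and> hval a u = c) (cvals C)"
      using len dd[OF cv] u by (intro filter_cong refl) blast
    also have "length \<dots> = card ({c. eval g u = \<zero> \<and> hval a u = c} \<inter> set (cvals C))"
      by (rule distinct_length_filter[OF set_cvals(2)])
    also have "{c. eval g u = \<zero> \<and> hval a u = c} \<inter> set (cvals C) = (if eval g u = \<zero> then {hval a u} else {})"
      using hval_range[OF a u] by auto
    finally show ?thesis by simp
  qed
qed

lemma card_rts_sum: "(\<Sum>u\<in>carrier F. of_bool (eval h u = \<zero>)) = card (rts h)"
proof -
  have "rts h = carrier F \<inter> {u. eval h u = \<zero>}" by (auto simp: rts_def)
  moreover have "(\<Sum>u\<in>carrier F. of_bool (eval h u = \<zero>) :: nat) = of_nat (card (carrier F \<inter> {u. eval h u = \<zero>}))"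
    using finite_F by simp
  ultimately show ?thesis by simp
qed

lemma sum_cnt: "sum_list (map (\<lambda>h. card (rts h)) ps) = (\<Sum>u\<in>carrier F. cnt u ps)"
proof (induction ps)
  case (Cons h ps)
  have "cnt u (h # ps) = of_bool (eval h u = \<zero>) + cnt u ps" for u by (simp add: cnt_def)
  then have "(\<Sum>u\<in>carrier F. cnt u (h # ps)) = card (rts h) + (\<Sum>u\<in>carrier F. cnt u ps)"
    by (simp only: sum.distrib card_rts_sum)
  then show ?case using Cons by simp
qed (simp add: cnt_def)

text \<open>Every part has at least one root and no root is shared, so there are at most as many
  parts as roots of \<open>f\<close>. Hence the \<open>take\<close> in \<open>rparts\<close> loses
  nothing.\<close>

lemma parts_count:
  assumes f: "f \<in> carrier R" "f \<noteq> []" and ps: "\<And>h. h \<in> set ps \<Longrightarrow> pok f h"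
    and cn: "\<And>u. u \<in> carrier F \<Longrightarrow> cnt u ps = of_bool (eval f u = \<zero>)"
  shows "length ps \<le> length f"
proof -
  have "length ps = sum_list (map (\<lambda>h. 1) ps)" by (simp add: sum_list_triv)
  also have "\<dots> \<le> sum_list (map (\<lambda>h. card (rts h)) ps)" using pok_root ps by (intro sum_list_mono) auto
  also have "\<dots> = (\<Sum>u\<in>carrier F. cnt u ps)" by (rule sum_cnt)
  also have "\<dots> = (\<Sum>u\<in>carrier F. of_bool (eval f u = \<zero>))" by (rule sum.cong[OF refl cn])
  also have "\<dots> = card (rts f)" by (rule card_rts_sum)
  also have "\<dots> \<le> length f" using card_rts[OF f] by simp
  finally show ?thesis .
qed

lemma cnt_append: "cnt u (xs @ ys) = cnt u xs + cnt u ys" by (simp add: cnt_def)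

lemma rparts_C:
  assumes f: "f \<in> carrier R" "f \<noteq> []" and as: "set as \<subseteq> carrier F"
  shows "(\<forall>h\<in>set (rparts C as f). pok f h) \<and> (\<forall>u\<in>carrier F. cnt u (rparts C as f) = of_bool (eval f u = \<zero>)) \<and>
    (\<forall>h\<in>set (rparts C as f). \<forall>u\<in>rts h. \<forall>v\<in>rts h. \<forall>a\<in>set as. hval a u = hval a v)"
  using as
proof (induction as rule: rev_induct)
  case Nil
  let ?r = "ppow C f (pX C) (p ^ k)"
  have q0: "p ^ k > 0" using q_ge2 by linarith
  have c: "cg f ?r (pX C [^]\<^bsub>R\<^esub> (p ^ k))" by (rule ppow_R[OF f pX_C(2) q0])
  have rR: "?r \<in> carrier R" using cg_R[OF f(1) c] by blast
  let ?w = "?r \<ominus>\<^bsub>R\<^esub> pX C"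
  have wR: "?w \<in> carrier R" using rR pX_C by simp
  have w: "padd C ?r (pneg C (pX C)) = ?w" using rR pX_C by (simp add: a_minus_def)
  have cw: "cg f ?w frob"
  proof -
    from c obtain h where h: "h \<in> carrier R" "?r = pX C [^]\<^bsub>R\<^esub> (p ^ k) \<oplus>\<^bsub>R\<^esub> h \<otimes>\<^bsub>R\<^esub> f" by (auto simp: cg_def)
    have "?w = frob \<oplus>\<^bsub>R\<^esub> h \<otimes>\<^bsub>R\<^esub> f" unfolding h(2) frob_def using h(1) f pX_C by (simp add: R.minus_eq R.a_ac)
    then show ?thesis using h(1) frob(1) unfolding cg_def by blast
  qed
  let ?g = "pgcd C f ?w"
  note G = pgcd_R[OF f(1) wR]
  have gf: "?g divides\<^bsub>R\<^esub> frob" using cg_divides[OF f(1) cw G(1,2,3)] .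
  have gn: "?g \<noteq> []" "length ?g \<le> length f" using divides_nonzero[OF G(1,2) f(2)] by auto
  have rt: "eval ?g u = \<zero> \<longleftrightarrow> eval f u = \<zero>" if u: "u \<in> carrier F" for u
  proof
    show "eval ?g u = \<zero> \<Longrightarrow> eval f u = \<zero>" using divides_root[OF G(1,2) u] .
    assume z: "eval f u = \<zero>"
    have "eval ?w u = \<zero>" using cg_eval[OF f(1) cw u z] frob(3)[OF u] by simp
    then show "eval ?g u = \<zero>" using G(4)[OF u z] by simp
  qed
  have e: "rparts C [] f = filter (\<lambda>h. 2 \<le> length h \<and> length h \<le> length f) [?g]"
    unfolding rparts_def by (simp add: w)
  have s: "2 \<le> length ?g" if "u \<in> carrier F" "eval f u = \<zero>" for u
    using rts_short[OF G(1) gn(1), of u] rt[OF that(1)] that by (simp add: rts_def)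
  show ?case
  proof (cases "2 \<le> length ?g")
    case True
    have e': "rparts C [] f = [?g]" unfolding e using True gn(2) by simp
    have "pok f ?g" unfolding pok_def using G(1,2) gf True by blast
    moreover have "cnt u [?g] = of_bool (eval f u = \<zero>)" if "u \<in> carrier F" for u
      using rt[OF that] by (simp add: cnt_def)
    ultimately show ?thesis unfolding e' by simp
  next
    case False
    have e': "rparts C [] f = []" unfolding e using False by simp
    have "eval f u \<noteq> \<zero>" if "u \<in> carrier F" for u using s[OF that] False by blast
    then show ?thesis unfolding e' by (simp add: cnt_def)
  qed
next
  case (snoc a as)
  let ?ps = "rparts C as f" let ?qs = "concat (map (\<lambda>g. splitp C a g) ?ps)"
  have a: "a \<in> carrier F" and as: "set as \<subseteq> carrier F" using snoc.prems by simp_all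
  note IH0 = snoc.IH[OF as]
  note IH = conjunct1[OF IH0] conjunct1[OF conjunct2[OF IH0]] conjunct2[OF conjunct2[OF IH0]]
  have q1: "pok f h" if "h \<in> set ?qs" for h
  proof -
    from that obtain g where g: "g \<in> set ?ps" "h \<in> set (splitp C a g)" by auto
    show ?thesis by (rule splitp_C(1)[OF bspec[OF IH(1) g(1)] f(1) a g(2)])
  qed
  have cc: "cnt u (concat (map (\<lambda>g. splitp C a g) ps)) = cnt u ps" if "u \<in> carrier F" "\<forall>h\<in>set ps. pok f h" for u ps
    using that(2)
  proof (induction ps)
    case (Cons g ps)
    then have g: "pok f g" by simp
    have "cnt u (concat (map (\<lambda>g. splitp C a g) (g # ps))) = of_bool (eval g u = \<zero>) + cnt u ps"
      using Cons splitp_C(2)[OF g f(1) a that(1)] by (simp add: cnt_append)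
    then show ?case by (simp add: cnt_def)
  qed (simp add: cnt_def)
  have q2: "cnt u ?qs = of_bool (eval f u = \<zero>)" if "u \<in> carrier F" for u using cc[OF that IH(1)] bspec[OF IH(2) that] by simp
  have "length ?qs \<le> length f" by (rule parts_count[OF f q1 q2])
  then have e: "rparts C (as @ [a]) f = ?qs" by (simp add: rparts_def)
  have "hval b u = hval b v" if "h \<in> set ?qs" "u \<in> rts h" "v \<in> rts h" "b \<in> set (as @ [a])" for h u v b
  proof -
    from that(1) obtain g where g: "g \<in> set ?ps" "h \<in> set (splitp C a g)" by auto
    have "u \<in> rts g \<and> v \<in> rts g \<and> hval a u = hval a v" by (rule splitp_C(3)[OF bspec[OF IH(1) g(1)] f(1) a g(2) that(2,3)])
    then show ?thesis using bspec[OF IH(3) g(1)] that(4) by (cases "b = a") auto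
  qed
  then show ?case unfolding e using q1 q2 by blast
qed

definition separating :: "nat list list \<Rightarrow> bool" where
  "separating as \<longleftrightarrow> (\<forall>u\<in>carrier F. \<forall>v\<in>carrier F. u \<noteq> v \<longrightarrow> (\<exists>a\<in>set as. hval a u \<noteq> hval a v))"

text \<open>The first claim assumes no separation: once all parts are linear, the list of roots is
  complete. This makes the algorithm free of error; separation guarantees that the flag is
  true.\<close>

lemma uroots_C:
  assumes f: "f \<in> carrier R" "f \<noteq> []" and as: "set as \<subseteq> carrier F"
  shows "fst (uroots C as f) \<Longrightarrow> set (snd (uroots C as f)) = rts f \<and> distinct (snd (uroots C as f))"
    "separating as \<Longrightarrow> fst (uroots C as f)"
proof -
  let ?ps = "rparts C as f"
  note P = rparts_C[OF assms]
  define rt where "rt = (\<lambda>h. fmul C (fsub C (fz C) (getd (fz C) h 1)) (finv C (getd (fz C) h 0)))"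
  assume "separating as"
  show "fst (uroots C as f)" unfolding uroots_def fst_conv
  proof
    fix h assume h: "h \<in> set ?ps"
    have "card (rts h) \<le> 1"
    proof (rule ccontr)
      assume "\<not> card (rts h) \<le> 1"
      then obtain u v where uv: "u \<in> rts h" "v \<in> rts h" "u \<noteq> v" by (metis card_le_Suc0_iff_eq finite_rts One_nat_def)
      then have "u \<in> carrier F" "v \<in> carrier F" by (auto simp: rts_def)
      then obtain a where "a \<in> set as" "hval a u \<noteq> hval a v" using \<open>separating as\<close> uv(3) unfolding separating_def by blast
      then show False using P h uv by blast
    qed
    moreover have "pok f h" using P h by blast
    ultimately have "length h - 1 \<le> 1" "2 \<le> length h" using card_rts_split(1)[of h] by (simp_all add: pok_def)
    then show "length h = 2" by linarith
  qed
next
  let ?ps = "rparts C as f"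
  note P = rparts_C[OF assms]
  define rt where "rt = (\<lambda>h. fmul C (fsub C (fz C) (getd (fz C) h 1)) (finv C (getd (fz C) h 0)))"
  assume "fst (uroots C as f)"
  then have l2: "\<forall>h\<in>set ?ps. length h = 2" by (simp add: uroots_def)
  have e: "snd (uroots C as f) = map rt ?ps" by (simp add: uroots_def rt_def)
  have r: "rts h = {rt h}" if h: "h \<in> set ?ps" for h
  proof -
    have "pok f h" using P h by blast
    then have hR: "h \<in> carrier R" by (simp add: pok_def)
    obtain \<alpha> \<beta> where ab: "h = [\<alpha>, \<beta>]" using l2 h by (metis (no_types, lifting) One_nat_def Suc_1 length_0_conv length_Suc_conv)
    have c: "\<alpha> \<in> carrier F" "\<alpha> \<noteq> \<zero>" "\<beta> \<in> carrier F" using hR by (auto simp: ab in_R)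
    have i: "inv \<alpha> \<in> carrier F" "\<alpha> \<otimes> inv \<alpha> = \<one>" using c field_Units by auto
    have "rt h = \<ominus> \<beta> \<otimes> inv \<alpha>" using c i by (simp add: rt_def ab getd_eq a_minus_def)
    moreover have "eval h (\<ominus> \<beta> \<otimes> inv \<alpha>) = \<zero>"
    proof -
      have "\<alpha> \<otimes> (\<ominus> \<beta> \<otimes> inv \<alpha>) = \<ominus> \<beta>" using m_lcomm[of \<alpha> "\<ominus> \<beta>" "inv \<alpha>"] c i by simp
      then show ?thesis using c i by (simp add: ab l_neg)
    qed
    ultimately have "rt h \<in> rts h" using c i by (simp add: rts_def)
    moreover have "card (rts h) \<le> 1" using card_rts[OF hR] by (simp add: ab)
    then have "\<forall>x\<in>rts h. \<forall>y\<in>rts h. x = y" using card_le_Suc0_iff_eq[OF finite_rts[of h]] by simp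
    ultimately show ?thesis by blast
  qed
  have "u \<in> rts f \<longleftrightarrow> u \<in> set (map rt ?ps)" for u
  proof (cases "u \<in> carrier F")
    case True
    have "u \<in> rts f \<longleftrightarrow> cnt u ?ps \<noteq> 0" using P True by (simp add: rts_def)
    also have "\<dots> \<longleftrightarrow> (\<exists>h\<in>set ?ps. u \<in> rts h)" using True by (auto simp: cnt_def filter_empty_conv rts_def)
    also have "\<dots> \<longleftrightarrow> u \<in> set (map rt ?ps)" using r by auto
    finally show ?thesis .
  next
    case False
    moreover have "rt h \<in> carrier F" for h using fmul_W[of C] by (simp add: rt_def)
    ultimately show ?thesis by (auto simp: rts_def)
  qed
  moreover have "distinct (map rt qs)" if "\<forall>h\<in>set qs. rts h = {rt h}" "\<forall>u\<in>carrier F. cnt u qs \<le> 1" for qs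
    using that
  proof (induction qs)
    case (Cons h qs)
    have "rt h \<in> rts h" using Cons by auto
    then have rh: "rt h \<in> carrier F" "eval h (rt h) = \<zero>" by (auto simp: rts_def)
    have c1: "cnt (rt h) (h # qs) \<le> 1" using Cons(3) rh(1) by blast
    then have "cnt (rt h) qs = 0" using rh by (simp add: cnt_def)
    then have "rt h \<notin> rt ` set qs" using Cons(2) rh(1) by (auto simp: cnt_def filter_empty_conv rts_def)
    moreover have "cnt u qs \<le> 1" if "u \<in> carrier F" for u
      using bspec[OF Cons(3) that] by (simp add: cnt_def split: if_splits)
    ultimately show ?case using Cons by auto
  qed simp
  ultimately show "set (snd (uroots C as f)) = rts f \<and> distinct (snd (uroots C as f))"
    unfolding e using r P by (auto simp del: set_map)
qed

section \<open>Elements that fail to separate two given roots\<close>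

lemma pow_nonzero: "x \<in> carrier F \<Longrightarrow> x \<noteq> \<zero> \<Longrightarrow> x [^] (n::nat) \<noteq> \<zero>"
  by (induction n) (auto simp: integral_iff)

lemma length_add_le: "length (a \<oplus>\<^bsub>R\<^esub> b) \<le> max (length a) (length b)"
  unfolding R_add by (rule poly_add_length_le)

lemma length_trf: "length (R.trf (Suc i) (pX C)) = Suc (2 ^ i) \<and> R.trf (Suc i) (pX C) \<in> carrier R"
proof (induction i)
  case 0
  then show ?case using pX_C by (simp add: R_zero[symmetric] pX_C(1) del: R.trf.simps(2)) (simp add: R_zero pX_C(1) R.r_zero[unfolded R_zero])
next
  case (Suc i)
  have l: "length (pX C [^]\<^bsub>R\<^esub> ((2::nat) ^ Suc i)) = Suc (2 ^ Suc i)"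
    using length_pow[OF pX_C(2), of "2 ^ Suc i"] pX_C(1) by (cases "pX C [^]\<^bsub>R\<^esub> ((2::nat) ^ Suc i)") auto
  have "R.trf (Suc (Suc i)) (pX C) = R.trf (Suc i) (pX C) \<oplus>\<^bsub>R\<^esub> pX C [^]\<^bsub>R\<^esub> ((2::nat) ^ Suc i)"
    by (rule R.trf_Suc[OF pX_C(2)])
  then show ?case using length_add_neq[of "R.trf (Suc i) (pX C)" "pX C [^]\<^bsub>R\<^esub> ((2::nat) ^ Suc i)"] Suc l pX_C(2) R.trf_closed[OF pX_C(2)]
    by simp
qed

lemma eval_trf: "g \<in> carrier R \<Longrightarrow> u \<in> carrier F \<Longrightarrow> eval (R.trf i g) u = trf i (eval g u)"
  by (induction i arbitrary: g) (auto simp: eval_hom)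

text \<open>For odd p the bad \<open>a\<close> are roots of (X + u)^m - (X + v)^m with m = (q - 1) /
  2, a nonzero polynomial of degree at most m. For p = 2 the map from a to a (u - v) embeds them
  into the zeros of the trace polynomial, which has degree q / 2.\<close>

lemma bad_count:
  assumes u: "u \<in> carrier F" and v: "v \<in> carrier F" and uv: "u \<noteq> v"
  shows "2 * card {a \<in> carrier F. hval a u = hval a v} \<le> p ^ k"
proof (cases "p mod 2 = 1")
  case True
  let ?m = "(p ^ k - 1) div 2"
  let ?b = "\<lambda>x. pX C \<oplus>\<^bsub>R\<^esub> pc x"
  let ?f = "?b u [^]\<^bsub>R\<^esub> ?m \<ominus>\<^bsub>R\<^esub> ?b v [^]\<^bsub>R\<^esub> ?m"
  have b: "?b x \<in> carrier R" "length (?b x) = 2" if "x \<in> carrier F" for x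
  proof -
    show "?b x \<in> carrier R" using that pX_C by simp
    have "length (pc x) \<le> 1" by (simp add: pc_def)
    then show "length (?b x) = 2" using length_add_neq[OF pX_C(2) pc_R[OF that]] by (simp add: pX_C(1))
  qed
  have bm: "length (?b x [^]\<^bsub>R\<^esub> ?m) = Suc ?m" if "x \<in> carrier F" for x
  proof -
    have "?b x \<noteq> []" using b(2)[OF that] by auto
    from length_pow[OF b(1)[OF that] this, of ?m] b(2)[OF that] show ?thesis by (cases "?b x [^]\<^bsub>R\<^esub> ?m") auto
  qed
  have fR: "?f \<in> carrier R" using b u v by simp
  have ev: "eval ?f a = (u \<oplus> a) [^] ?m \<ominus> (v \<oplus> a) [^] ?m" if "a \<in> carrier F" for a
    using that b u v pX_C by (simp add: eval_hom a_comm)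
  \<comment> \<open>At -u the first power vanishes, its exponent being positive, and the second does
    not; so the difference is not the zero polynomial.\<close>
  have "eval ?f (\<ominus> u) \<noteq> \<zero>"
  proof
    assume "eval ?f (\<ominus> u) = \<zero>"
    then have "(u \<oplus> \<ominus> u) [^] ?m \<ominus> (v \<oplus> \<ominus> u) [^] ?m = \<zero>" unfolding ev[OF a_inv_closed[OF u]] .
    then have "(u \<oplus> \<ominus> u) [^] ?m = (v \<oplus> \<ominus> u) [^] ?m"
      using u v r_right_minus_eq[of "(u \<oplus> \<ominus> u) [^] ?m" "(v \<oplus> \<ominus> u) [^] ?m"] by blast
    moreover have "(u \<oplus> \<ominus> u) [^] ?m = \<zero>" using u half_pos[OF True] nat_pow_zero[of ?m] by (simp add: r_neg)
    moreover have "v \<oplus> \<ominus> u \<noteq> \<zero>" using u v uv r_right_minus_eq[of v u] by (simp add: a_minus_def)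
    ultimately show False using pow_nonzero[of "v \<oplus> \<ominus> u" ?m] u v by simp
  qed
  then have fn: "?f \<noteq> []" by auto
  have "length ?f \<le> Suc ?m" unfolding a_minus_def
    using length_add_le[of "?b u [^]\<^bsub>R\<^esub> ?m" "\<ominus>\<^bsub>R\<^esub> (?b v [^]\<^bsub>R\<^esub> ?m)"] length_minus[of "?b v [^]\<^bsub>R\<^esub> ?m"] bm[OF u] bm[OF v] b(1)[OF v] by simp
  then have "card (rts ?f) \<le> ?m" using card_rts[OF fR fn] by linarith
  moreover have "{a \<in> carrier F. hval a u = hval a v} \<subseteq> rts ?f"
    using ev True u v by (auto simp: rts_def hval_def a_minus_def r_neg)
  ultimately have "card {a \<in> carrier F. hval a u = hval a v} \<le> ?m" using card_mono[OF finite_rts] le_trans by blast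
  then show ?thesis using half_pos[OF True] by simp
next
  case False
  obtain j where j: "k = Suc j" using k_pos by (cases k) auto
  let ?T = "R.trf k (pX C)"
  have T: "?T \<in> carrier R" "length ?T = Suc (2 ^ j)" using length_trf[of j] by (simp_all only: j)
  have Tn: "?T \<noteq> []" using T(2) by auto
  \<comment> \<open>By additivity of the trace, equal traces of a u and a v mean that a (u - v) has
    trace 0.\<close>
  have "(\<lambda>a. a \<otimes> (u \<ominus> v)) ` {a \<in> carrier F. hval a u = hval a v} \<subseteq> rts ?T"
  proof
    fix x assume "x \<in> (\<lambda>a. a \<otimes> (u \<ominus> v)) ` {a \<in> carrier F. hval a u = hval a v}"
    then obtain a where a: "a \<in> carrier F" "hval a u = hval a v" "x = a \<otimes> (u \<ominus> v)" by auto
    have "x \<oplus> a \<otimes> v = a \<otimes> u" using a u v by (simp add: a_minus_def r_distr r_minus a_assoc l_neg)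
    then have "trf k x \<oplus> trf k (a \<otimes> v) = trf k (a \<otimes> u)" using trf_add[OF False, of x "a \<otimes> v" k] a u v by simp
    also have "\<dots> = trf k (a \<otimes> v)" using a(2) False by (simp add: hval_def)
    finally have "trf k x = \<zero>" using a u v by (metis a_closed add.r_cancel_one' trf_closed m_closed minus_closed)
    then show "x \<in> rts ?T" using a u v pX_C by (simp add: rts_def eval_trf)
  qed
  moreover have "inj_on (\<lambda>a. a \<otimes> (u \<ominus> v)) {a \<in> carrier F. hval a u = hval a v}"
  proof (rule inj_onI)
    have nz: "u \<ominus> v \<in> carrier F" "u \<ominus> v \<noteq> \<zero>" using u v uv by (auto simp: r_right_minus_eq)
    fix a b assume "a \<in> {a \<in> carrier F. hval a u = hval a v}" "b \<in> {a \<in> carrier F. hval a u = hval a v}" "a \<otimes> (u \<ominus> v) = b \<otimes> (u \<ominus> v)"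
    then show "a = b" using nz m_rcancel[of "u \<ominus> v" a b] by auto
  qed
  ultimately have "card {a \<in> carrier F. hval a u = hval a v} \<le> card (rts ?T)"
    by (intro card_inj_on_le[where f = "\<lambda>a. a \<otimes> (u \<ominus> v)"] finite_rts)
  also have "\<dots> \<le> 2 ^ j" using card_rts[OF T(1) Tn] T(2) by simp
  finally show ?thesis using p_even[OF False] by (simp add: j)
qed

end

section \<open>Bivariate polynomials and root lifting\<close>

context cring
begin

text \<open>Generic in the ring because it serves twice: over F[z] for the bivariate polynomial and
  over F for its reduction at z = 0.\<close>

primrec hev :: "'a list \<Rightarrow> 'a \<Rightarrow> 'a" where
  "hev [] y = \<zero>"
| "hev (q # Q) y = q \<oplus> y \<otimes> hev Q y"

text \<open>The ring-theoretic counterpart of \<open>tstep\<close>. It allows the shift to be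
  carried through two homomorphisms, the evaluation at z = 0 and the embedding of F into its
  polynomial ring.\<close>

definition tstp :: "'a \<Rightarrow> 'a \<Rightarrow> 'a list \<Rightarrow> 'a list" where
  "tstp c q H = (case map2 (\<oplus>) (map ((\<otimes>) c) H @ [\<zero>]) (\<zero> # H) of [] \<Rightarrow> [] | s # ss \<Rightarrow> (q \<oplus> s) # ss)"

primrec tay :: "'a \<Rightarrow> 'a list \<Rightarrow> 'a list" where
  "tay c [] = []"
| "tay c (q # Q) = tstp c q (tay c Q)"

lemma hev_closed [simp]: "set Q \<subseteq> carrier R \<Longrightarrow> y \<in> carrier R \<Longrightarrow> hev Q y \<in> carrier R"
  by (induction Q) auto

lemma hev_map2: "length A = length B \<Longrightarrow> set A \<subseteq> carrier R \<Longrightarrow> set B \<subseteq> carrier R \<Longrightarrow> y \<in> carrier R \<Longrightarrow>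
    hev (map2 (\<oplus>) A B) y = hev A y \<oplus> hev B y"
  by (induction A B rule: list_induct2) (auto simp: r_distr a_ac)

lemma hev_smult: "set A \<subseteq> carrier R \<Longrightarrow> c \<in> carrier R \<Longrightarrow> y \<in> carrier R \<Longrightarrow> hev (map ((\<otimes>) c) A @ [\<zero>]) y = c \<otimes> hev A y"
  by (induction A) (auto simp: r_distr m_lcomm)

lemma set_map2_closed: "set A \<subseteq> carrier R \<Longrightarrow> set B \<subseteq> carrier R \<Longrightarrow> set (map2 (\<oplus>) A B) \<subseteq> carrier R"
proof
  fix x assume A: "set A \<subseteq> carrier R" and B: "set B \<subseteq> carrier R" and x: "x \<in> set (map2 (\<oplus>) A B)"
  then obtain a b where "(a, b) \<in> set (zip A B)" "x = a \<oplus> b" by auto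
  then show "x \<in> carrier R" using A B set_zip_leftD set_zip_rightD by (metis a_closed subsetD)
qed

lemma tstp:
  assumes H: "set H \<subseteq> carrier R" and c: "c \<in> carrier R" and q: "q \<in> carrier R"
  shows "set (tstp c q H) \<subseteq> carrier R" "length (tstp c q H) = Suc (length H)"
    "y \<in> carrier R \<Longrightarrow> hev (tstp c q H) y = q \<oplus> (c \<oplus> y) \<otimes> hev H y"
proof -
  let ?A = "map ((\<otimes>) c) H @ [\<zero>]" and ?B = "\<zero> # H"
  let ?S = "map2 (\<oplus>) ?A ?B"
  have AB: "set ?A \<subseteq> carrier R" "set ?B \<subseteq> carrier R" "length ?A = length ?B" using H c by auto
  have S: "set ?S \<subseteq> carrier R" by (rule set_map2_closed[OF AB(1,2)])
  have l: "length ?S = Suc (length H)" by simp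
  then obtain s ss where ss: "?S = s # ss" by (cases ?S) auto
  have t: "tstp c q H = (q \<oplus> s) # ss" unfolding tstp_def ss by simp
  have sc: "s \<in> carrier R" "set ss \<subseteq> carrier R" using S unfolding ss by auto
  show "set (tstp c q H) \<subseteq> carrier R" unfolding t using sc q by auto
  show "length (tstp c q H) = Suc (length H)" unfolding t using l unfolding ss by simp
  assume y: "y \<in> carrier R"
  have "hev (tstp c q H) y = q \<oplus> hev ?S y" unfolding t ss using sc q y by (simp add: a_assoc)
  also have "hev ?S y = hev ?A y \<oplus> hev ?B y" by (rule hev_map2[OF AB(3,1,2) y])
  also have "hev ?A y = c \<otimes> hev H y" by (rule hev_smult[OF H c y])
  also have "hev ?B y = y \<otimes> hev H y" using H y by simp
  finally show "hev (tstp c q H) y = q \<oplus> (c \<oplus> y) \<otimes> hev H y" using H c y by (simp add: l_distr)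
qed

lemma tay:
  assumes c: "c \<in> carrier R" and Q: "set Q \<subseteq> carrier R"
  shows "set (tay c Q) \<subseteq> carrier R \<and> length (tay c Q) = length Q \<and> (\<forall>y\<in>carrier R. hev (tay c Q) y = hev Q (c \<oplus> y))"
  using Q
proof (induction Q)
  case (Cons q Q)
  then have IH: "set (tay c Q) \<subseteq> carrier R" "length (tay c Q) = length Q" "\<forall>y\<in>carrier R. hev (tay c Q) y = hev Q (c \<oplus> y)"
    and q: "q \<in> carrier R" by auto
  have "hev (tay c (q # Q)) y = hev (q # Q) (c \<oplus> y)" if y: "y \<in> carrier R" for y
    using tstp(3)[OF IH(1) c q y] bspec[OF IH(3) y] by simp
  then show ?case using tstp(1,2)[OF IH(1) c q] IH(2) by simp
qed simp

lemma hev_low_zeros: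
  assumes "set g \<subseteq> carrier R" "y \<in> carrier R" "\<forall>b<\<mu>. g ! b = \<zero>" "\<mu> \<le> length g"
  shows "hev g y = y [^] \<mu> \<otimes> hev (drop \<mu> g) y"
  using assms
proof (induction \<mu> arbitrary: g)
  case (Suc \<mu>)
  then obtain g0 g' where g: "g = g0 # g'" by (cases g) auto
  have "g0 = \<zero>" using Suc(4) g by auto
  moreover have "\<forall>b<\<mu>. g' ! b = \<zero>" using Suc(4) g by auto
  then have "hev g' y = y [^] \<mu> \<otimes> hev (drop \<mu> g') y" using Suc g by auto
  moreover have "set (drop \<mu> g') \<subseteq> carrier R" using Suc(2) g set_drop_subset[of \<mu> g'] by auto
  ultimately show ?case using Suc(2,3) g by (simp add: m_ac)
qed simp

text \<open>The offset \<open>n\<close> makes the induction along the list possible.\<close>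

lemma hev_scale:
  assumes "set H \<subseteq> carrier R" "z \<in> carrier R" "w \<in> carrier R"
  shows "hev (map (\<lambda>u. fst u \<otimes> z [^] snd u) (zip H [n..<n + length H])) w = z [^] (n::nat) \<otimes> hev H (z \<otimes> w)"
  using assms
proof (induction H arbitrary: n)
  case (Cons h H)
  have e: "zip (h # H) [n..<n + length (h # H)] = (h, n) # zip H [Suc n..<Suc n + length H]"
    by (simp add: upt_rec[of n] del: upt_Suc)
  have IH: "hev (map (\<lambda>u. fst u \<otimes> z [^] snd u) (zip H [Suc n..<Suc n + length H])) w = z [^] Suc n \<otimes> hev H (z \<otimes> w)"
    by (rule Cons.IH) (use Cons.prems in auto)
  have "hev (map (\<lambda>u. fst u \<otimes> z [^] snd u) (zip (h # H) [n..<n + length (h # H)])) w =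
      h \<otimes> z [^] n \<oplus> w \<otimes> (z [^] Suc n \<otimes> hev H (z \<otimes> w))"
    unfolding e list.map hev.simps IH by simp
  also have "\<dots> = z [^] n \<otimes> hev (h # H) (z \<otimes> w)" using Cons by (simp add: r_distr m_ac)
  finally show ?case .
qed simp

end

lemma (in ring_hom_cring) hom_hev: "set Q \<subseteq> carrier R \<Longrightarrow> y \<in> carrier R \<Longrightarrow> h (R.hev Q y) = S.hev (map h Q) (h y)"
  by (induction Q) auto

lemma (in ring_hom_cring) hom_tay: "c \<in> carrier R \<Longrightarrow> set Q \<subseteq> carrier R \<Longrightarrow> map h (R.tay c Q) = S.tay (h c) (map h Q)"
proof (induction Q)
  case (Cons q Q)
  let ?H = "R.tay c Q"
  have H: "set ?H \<subseteq> carrier R" using R.tay[of c Q] Cons by auto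
  have m: "map h (map2 (\<oplus>) A B) = map2 (\<oplus>\<^bsub>S\<^esub>) (map h A) (map h B)" if "set A \<subseteq> carrier R" "set B \<subseteq> carrier R" for A B
    using that
  proof (induction A arbitrary: B)
    case (Cons a A)
    then show ?case by (cases B) auto
  qed simp
  have hH: "map h (map ((\<otimes>) c) ?H) = map ((\<otimes>\<^bsub>S\<^esub>) (h c)) (map h ?H)" using H Cons.prems by auto
  let ?S = "map2 (\<oplus>) (map ((\<otimes>) c) ?H @ [\<zero>]) (\<zero> # ?H)"
  have AB: "set (map ((\<otimes>) c) ?H @ [\<zero>]) \<subseteq> carrier R" "set (\<zero> # ?H) \<subseteq> carrier R" using H Cons.prems by auto
  have "map h ?S = map2 (\<oplus>\<^bsub>S\<^esub>) (map ((\<otimes>\<^bsub>S\<^esub>) (h c)) (map h ?H) @ [\<zero>\<^bsub>S\<^esub>]) (\<zero>\<^bsub>S\<^esub> # map h ?H)"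
    using m[OF AB] unfolding map_append hH list.map hom_zero .
  moreover obtain s ss where ss: "?S = s # ss" by (cases ?S) auto
  moreover have "set ?S \<subseteq> carrier R" using R.set_map2_closed[of "map ((\<otimes>) c) ?H @ [\<zero>]" "\<zero> # ?H"] H Cons.prems by auto
  then have "s \<in> carrier R" unfolding ss by simp
  moreover have "map h ?H = S.tay (h c) (map h Q)" using Cons by simp
  ultimately have "S.tstp (h c) (h q) (S.tay (h c) (map h Q)) = (h q \<oplus>\<^bsub>S\<^esub> h s) # map h ss"
    unfolding S.tstp_def by (metis (no_types, lifting) list.simps(5) list.simps(9))
  moreover have "map h (R.tstp c q ?H) = (h q \<oplus>\<^bsub>S\<^esub> h s) # map h ss"
    unfolding R.tstp_def ss using \<open>s \<in> carrier R\<close> Cons.prems by simp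
  ultimately show ?case by simp
qed simp

section \<open>Powers of z, shifts and scaling of coefficient lists\<close>

context gfield
begin

abbreviation zz :: "nat list list" where "zz \<equiv> pX C"

abbreviation eps :: "nat list list \<Rightarrow> nat list" where "eps q \<equiv> eval q \<zero>"

lemma cterm_C: "set q \<subseteq> carrier F \<Longrightarrow> cterm C q = eps q"
proof (cases q rule: rev_cases)
  case Nil
  then show ?thesis by (simp add: cterm_def getd_eq)
next
  case (snoc q' c)
  assume "set q \<subseteq> carrier F"
  then show ?thesis using eval_append_aux[of q' c \<zero>] eval_in_carrier[of q' \<zero>] snoc by (simp add: cterm_def getd_eq)
qed

lemma mult_zz: "w \<in> carrier R \<Longrightarrow> w \<otimes>\<^bsub>R\<^esub> zz = (if w = [] then [] else w @ [\<zero>])"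
  using poly_mult_var[OF carrier_is_subring, of w] by (simp add: var_def pX_C(1))

text \<open>With the leading coefficient first, the last entry is the constant term, so dividing by
  z means dropping it.\<close>

lemma butlast_zz: "q \<in> carrier R \<Longrightarrow> eps q = \<zero> \<Longrightarrow> butlast q \<in> carrier R \<and> q = butlast q \<otimes>\<^bsub>R\<^esub> zz"
proof (cases q rule: rev_cases)
  case Nil
  then show ?thesis using mult_zz[of "[]"] by simp
next
  case (snoc q' c)
  assume q: "q \<in> carrier R" and z: "eps q = \<zero>"
  have "c = \<zero>" using z R_set[OF q] eval_append_aux[of q' c \<zero>] eval_in_carrier[of q' \<zero>] snoc by simp
  moreover have "q' \<noteq> []" using q snoc \<open>c = \<zero>\<close> by (auto simp: in_R)
  moreover have "q' \<in> carrier R" using q snoc \<open>q' \<noteq> []\<close> by (auto simp: in_R)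
  ultimately show ?thesis using snoc mult_zz[of q'] by simp
qed

lemma zz_nonzero: "zz [^]\<^bsub>R\<^esub> (n::nat) \<noteq> \<zero>\<^bsub>R\<^esub>"
  using length_pow[OF pX_C(2), of n] by (simp add: pX_C(1) R_zero)

lemma zz_cancel: "a \<in> carrier R \<Longrightarrow> b \<in> carrier R \<Longrightarrow> a \<otimes>\<^bsub>R\<^esub> zz [^]\<^bsub>R\<^esub> (n::nat) = b \<otimes>\<^bsub>R\<^esub> zz [^]\<^bsub>R\<^esub> n \<Longrightarrow> a = b"
  using R.m_rcancel[OF zz_nonzero[of n], of a b] pX_C(2) by simp

lemma eps_zz: "a \<in> carrier R \<Longrightarrow> n > 0 \<Longrightarrow> eps (a \<otimes>\<^bsub>R\<^esub> zz [^]\<^bsub>R\<^esub> (n::nat)) = \<zero>"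
  using pX_C nat_pow_zero[of n] by (simp add: eval_hom)

lemma mult_zz_pow: "w \<in> carrier R \<Longrightarrow> w \<otimes>\<^bsub>R\<^esub> zz [^]\<^bsub>R\<^esub> (n::nat) = (if w = [] then [] else w @ replicate n \<zero>)"
proof (induction n)
  case (Suc n)
  have "w \<otimes>\<^bsub>R\<^esub> zz [^]\<^bsub>R\<^esub> Suc n = (w \<otimes>\<^bsub>R\<^esub> zz [^]\<^bsub>R\<^esub> n) \<otimes>\<^bsub>R\<^esub> zz" using Suc.prems pX_C(2) by (simp add: R.m_assoc)
  also have "\<dots> = (if w = [] then [] else w @ replicate (Suc n) \<zero>)"
  proof -
    have cl: "w \<otimes>\<^bsub>R\<^esub> zz [^]\<^bsub>R\<^esub> n \<in> carrier R" using Suc.prems pX_C(2) by simp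
    show ?thesis unfolding mult_zz[OF cl] unfolding Suc.IH[OF Suc.prems] by (simp add: replicate_append_same)
  qed
  finally show ?case .
qed simp

text \<open>The last alternative counts rounds. As long as Q is nonzero, a division removes at least
  one coefficient, so rounds can run out only if there were fewer of them than coefficients; for
  \<open>us = concat Q\<close> this is impossible.\<close>

lemma strip_step:
  fixes us :: "nat list list"
  assumes Q: "set Q \<subseteq> carrier R"
  shows "\<exists>\<rho>::nat. set (foldl (\<lambda>s i. if \<forall>q\<in>set s. cterm C q = fz C then map (\<lambda>q. butlast q) s else s) Q us) \<subseteq> carrier R \<and>
    Q = map (\<lambda>q. q \<otimes>\<^bsub>R\<^esub> zz [^]\<^bsub>R\<^esub> \<rho>) (foldl (\<lambda>s i. if \<forall>q\<in>set s. cterm C q = fz C then map (\<lambda>q. butlast q) s else s) Q us) \<and>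
    ((\<exists>q\<in>set (foldl (\<lambda>s i. if \<forall>q\<in>set s. cterm C q = fz C then map (\<lambda>q. butlast q) s else s) Q us). eps q \<noteq> \<zero>) \<or>
     (\<forall>q\<in>set Q. q = []) \<or> length us < length (concat Q))"
  using Q
proof (induction us arbitrary: Q)
  case Nil
  have "Q = map (\<lambda>q. q \<otimes>\<^bsub>R\<^esub> zz [^]\<^bsub>R\<^esub> (0::nat)) Q" using Nil by (simp add: map_idI subset_iff)
  moreover have "(\<forall>q\<in>set Q. q = []) \<or> length [] < length (concat Q)" by (auto simp: concat_eq_Nil_conv)
  ultimately show ?case using Nil unfolding foldl_Nil by blast
next
  case (Cons i us)
  let ?f = "\<lambda>s i. if \<forall>q\<in>set s. cterm C q = fz C then map (\<lambda>q. butlast q) s else s"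
  have ct: "cterm C q = eps q" if "q \<in> set Q" for q using cterm_C[OF R_set] Cons.prems that by blast
  show ?case
  proof (cases "\<forall>q\<in>set Q. eps q = \<zero>")
    case True
    let ?Q = "map (\<lambda>q. butlast q) Q"
    have st: "?f Q i = ?Q" using True ct by simp
    have b: "butlast q \<in> carrier R \<and> q = butlast q \<otimes>\<^bsub>R\<^esub> zz" if "q \<in> set Q" for q
      using butlast_zz[of q] Cons.prems True that by blast
    have QR: "set ?Q \<subseteq> carrier R" using b by auto
    let ?Q' = "foldl ?f ?Q us"
    from Cons.IH[OF QR] obtain \<rho> :: nat where \<rho>: "set ?Q' \<subseteq> carrier R" "?Q = map (\<lambda>q. q \<otimes>\<^bsub>R\<^esub> zz [^]\<^bsub>R\<^esub> \<rho>) ?Q'"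
      "(\<exists>q\<in>set ?Q'. eps q \<noteq> \<zero>) \<or> (\<forall>q\<in>set ?Q. q = []) \<or> length us < length (concat ?Q)" by blast
    have "Q = map (\<lambda>q. butlast q \<otimes>\<^bsub>R\<^esub> zz) Q" using b by (simp add: map_idI)
    also have "\<dots> = map (\<lambda>q. q \<otimes>\<^bsub>R\<^esub> zz) ?Q" by simp
    also have "\<dots> = map (\<lambda>q. (q \<otimes>\<^bsub>R\<^esub> zz [^]\<^bsub>R\<^esub> \<rho>) \<otimes>\<^bsub>R\<^esub> zz) ?Q'" by (subst \<rho>(2)) simp
    also have "\<dots> = map (\<lambda>q. q \<otimes>\<^bsub>R\<^esub> zz [^]\<^bsub>R\<^esub> Suc \<rho>) ?Q'" using \<rho>(1) pX_C(2) by (auto simp: R.m_assoc)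
    finally have e: "Q = map (\<lambda>q. q \<otimes>\<^bsub>R\<^esub> zz [^]\<^bsub>R\<^esub> Suc \<rho>) ?Q'" .
    have "(\<exists>q\<in>set ?Q'. eps q \<noteq> \<zero>) \<or> (\<forall>q\<in>set Q. q = []) \<or> length (i # us) < length (concat Q)"
    proof (cases "\<forall>q\<in>set ?Q. q = []")
      case t: True
      have "q = []" if "q \<in> set Q" for q using b[OF that] t that mult_zz[of "[]"] by auto
      then show ?thesis by blast
    next
      case f: False
      have le: "length (concat (map butlast Qs)) \<le> length (concat Qs)" for Qs :: "nat list list list" by (induction Qs) auto
      have "length (concat (map butlast Qs)) < length (concat Qs)" if "\<exists>q\<in>set Qs. butlast q \<noteq> []" for Qs :: "nat list list list"
        using that
      proof (induction Qs)
        case (Cons q Qs)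
        show ?case
        proof (cases "butlast q = []")
          case True
          then show ?thesis using Cons by (simp add: trans_less_add2)
        next
          case False
          then have "length (butlast q) < length q" by (cases q) auto
          then show ?thesis using le[of Qs] by simp
        qed
      qed simp
      from this[of Q] f have "length (concat ?Q) < length (concat Q)" by auto
      then show ?thesis using \<rho>(3) f by auto
    qed
    then show ?thesis using \<rho>(1) e unfolding foldl.simps(2) st by blast
  next
    case False
    then have st: "?f Q i = Q" using ct by auto
    have "foldl ?f Q vs = Q" for vs :: "nat list list" by (induction vs) (use False ct in auto)
    then have "foldl ?f Q (i # us) = Q" by blast
    moreover have "Q = map (\<lambda>q. q \<otimes>\<^bsub>R\<^esub> zz [^]\<^bsub>R\<^esub> (0::nat)) Q" using Cons.prems by (simp add: map_idI subset_iff)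
    ultimately show ?thesis using False Cons.prems by (intro exI[of _ 0]) auto
  qed
qed

lemma stripz_C:
  assumes Q: "set Q \<subseteq> carrier R" and nz: "\<exists>q\<in>set Q. q \<noteq> []"
  obtains \<rho> :: nat where "set (stripz C Q) \<subseteq> carrier R" "Q = map (\<lambda>q. q \<otimes>\<^bsub>R\<^esub> zz [^]\<^bsub>R\<^esub> \<rho>) (stripz C Q)"
    "\<exists>q\<in>set (stripz C Q). eps q \<noteq> \<zero>"
proof -
  from strip_step[OF Q, of "concat Q"] nz show ?thesis using that unfolding stripz_def by blast
qed

lemma taylor_C: "c \<in> carrier F \<Longrightarrow> set Q \<subseteq> carrier R \<Longrightarrow> taylor C c Q = R.tay (pc c) Q"
proof (induction Q)
  case (Cons q Q)
  let ?H = "R.tay (pc c) Q"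
  have IH: "taylor C c Q = ?H" using Cons by simp
  have H: "set ?H \<subseteq> carrier R" using R.tay[of "pc c" Q] Cons by auto
  have "taylor C c (q # Q) = tstep C c ?H q" using IH by (simp add: taylor_def)
  also have "\<dots> = R.tstp (pc c) q ?H"
  proof -
    have "map (\<lambda>h. psm C c h) ?H @ [[]] = map ((\<otimes>\<^bsub>R\<^esub>) (pc c)) ?H @ [\<zero>\<^bsub>R\<^esub>]"
      using H Cons.prems(1) by (auto simp: R_zero psm_R)
    moreover have "map (\<lambda>u. padd C (fst u) (snd u)) (zip A B) = map2 (\<oplus>\<^bsub>R\<^esub>) A B"
      if "set A \<subseteq> carrier R" "set B \<subseteq> carrier R" for A B
    proof (rule map_cong[OF refl])
      fix u assume u: "u \<in> set (zip A B)"
      then have "(fst u, snd u) \<in> set (zip A B)" by simp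
      then have "fst u \<in> carrier R" "snd u \<in> carrier R" using that by (blast dest: set_zip_leftD set_zip_rightD)+
      then show "padd C (fst u) (snd u) = (case u of (x, y) \<Rightarrow> x \<oplus>\<^bsub>R\<^esub> y)" by (simp add: split_def)
    qed
    note mp = this
    have AB: "set (map ((\<otimes>\<^bsub>R\<^esub>) (pc c)) ?H @ [\<zero>\<^bsub>R\<^esub>]) \<subseteq> carrier R" "set (\<zero>\<^bsub>R\<^esub> # ?H) \<subseteq> carrier R"
      using H Cons.prems(1) by auto
    note mp[OF AB]
    moreover have S: "set (map2 (\<oplus>\<^bsub>R\<^esub>) (map ((\<otimes>\<^bsub>R\<^esub>) (pc c)) ?H @ [\<zero>\<^bsub>R\<^esub>]) (\<zero>\<^bsub>R\<^esub> # ?H)) \<subseteq> carrier R"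
      by (rule R.set_map2_closed) (use H Cons.prems(1) in auto)
    obtain s ss where ss: "map2 (\<oplus>\<^bsub>R\<^esub>) (map ((\<otimes>\<^bsub>R\<^esub>) (pc c)) ?H @ [\<zero>\<^bsub>R\<^esub>]) (\<zero>\<^bsub>R\<^esub> # ?H) = s # ss"
      by (cases "map2 (\<oplus>\<^bsub>R\<^esub>) (map ((\<otimes>\<^bsub>R\<^esub>) (pc c)) ?H @ [\<zero>\<^bsub>R\<^esub>]) (\<zero>\<^bsub>R\<^esub> # ?H)") auto
    have "padd C q s = q \<oplus>\<^bsub>R\<^esub> s" using S Cons.prems unfolding ss by simp
    ultimately show ?thesis unfolding tstep_def R.tstp_def R_zero[symmetric] ss by (simp only: ss list.case)
  qed
  finally show ?case by simp
qed (simp add: taylor_def)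

lemma zscale_C: "set H \<subseteq> carrier R \<Longrightarrow> zscale C H = map (\<lambda>u. fst u \<otimes>\<^bsub>R\<^esub> zz [^]\<^bsub>R\<^esub> snd u) (zip H [0..<length H])"
  unfolding zscale_def
proof (rule map_cong[OF refl])
  fix u assume H: "set H \<subseteq> carrier R" and u: "u \<in> set (zip H [0..<length H])"
  obtain h i where hi: "u = (h, i)" by (cases u)
  have "h \<in> carrier R" "i < length H" using H set_zip_leftD[OF u[unfolded hi]] set_zip_rightD[OF u[unfolded hi]] by auto
  then show "(if fst u = [] then [] else fst u @ replicate (min (snd u) (length H)) (fz C)) = fst u \<otimes>\<^bsub>R\<^esub> zz [^]\<^bsub>R\<^esub> snd u"
    using mult_zz_pow[of h i] unfolding hi by (simp add: min_def)
qed

lemma normalize_snoc: "set v \<subseteq> carrier F \<Longrightarrow> c \<in> carrier F \<Longrightarrow> normalize (v @ [c]) = pc c \<oplus>\<^bsub>R\<^esub> zz \<otimes>\<^bsub>R\<^esub> normalize v"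
proof -
  assume v: "set v \<subseteq> carrier F" and c: "c \<in> carrier F"
  let ?n = "normalize v"
  have n: "?n \<in> carrier R" using normalize_R[OF v] .
  have e: "normalize (v @ [c]) = normalize (?n @ [c])" using normalize_idem[of v "[c]"] by simp
  have nz: "zz \<otimes>\<^bsub>R\<^esub> ?n = (if ?n = [] then [] else ?n @ [\<zero>])" using mult_zz[OF n] n pX_C(2) by (simp add: R.m_comm)
  show ?thesis
  proof (cases "?n = []")
    case True
    have "pc c \<oplus>\<^bsub>R\<^esub> [] = pc c" using R.r_zero[OF pc_R[OF c]] unfolding R_zero .
    moreover have "normalize (?n @ [c]) = pc c" unfolding True pc_def by (simp only: append_Nil)
    ultimately show ?thesis unfolding e nz using True by simp
  next
    case False
    have "poly_add (?n @ replicate (length [c]) \<zero>) [c] = normalize (?n @ [c])"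
      using poly_add_append_replicate[of ?n "[c]"] R_set[OF n] c by simp
    moreover have "pc c \<oplus>\<^bsub>R\<^esub> (?n @ [\<zero>]) = poly_add [c] (?n @ [\<zero>])"
      using poly_add_normalize(1)[of "[c]" "?n @ [\<zero>]"] R_set[OF n] c unfolding R_add pc_def by auto
    moreover have "poly_add [c] (?n @ [\<zero>]) = poly_add (?n @ [\<zero>]) [c]"
      using False c by (subst poly_add.simps) (cases ?n, auto)
    ultimately show ?thesis unfolding e nz using False by simp
  qed
qed

lemma hev_const: "set cs \<subseteq> carrier F \<Longrightarrow> R.hev (map pc cs) zz = normalize (rev cs)"
  by (induction cs) (auto simp: R_zero normalize_snoc)

lemma eval_rev: "set cs \<subseteq> carrier F \<Longrightarrow> u \<in> carrier F \<Longrightarrow> eval (rev cs) u = hev cs u"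
  by (induction cs) (auto simp: eval_append_aux a_comm m_comm)

lemma pc_hom: "ring_hom_cring F R pc"
proof -
  interpret ring_hom_ring F R poly_of_const
    using canonical_embedding_ring_hom[OF carrier_is_subring] by simp
  have "poly_of_const = pc" by (simp add: fun_eq_iff poly_of_const_def pc_def)
  then show ?thesis using homh by unfold_locales simp
qed

end

lemma (in cring) hev_map_mult: "set Q \<subseteq> carrier R \<Longrightarrow> w \<in> carrier R \<Longrightarrow> a \<in> carrier R \<Longrightarrow> hev (map (\<lambda>q. q \<otimes> a) Q) w = hev Q w \<otimes> a"
  by (induction Q) (auto simp: l_distr m_assoc)

lemma (in cring) hev_all_zero: "\<forall>q\<in>set Q. q = \<zero> \<Longrightarrow> w \<in> carrier R \<Longrightarrow> hev Q w = \<zero>"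
  by (induction Q) auto

section \<open>Completeness and width of the root tree\<close>

context gfield
begin

text \<open>Q(0, Y) as a univariate polynomial over F. The list \<open>Q\<close> starts with the
  constant coefficient in Y, ring elements with the leading one; hence the reversal.\<close>

definition fl :: "nat list list list \<Rightarrow> nat list list" where "fl Q = normalize (rev (map (\<lambda>q. eps q) Q))"

lemma eps_hom: "ring_hom_cring R F (\<lambda>q. eps q)"
  by (rule eval_cring_hom[OF carrier_is_subring zero_closed])

lemma set_eps: "set Q \<subseteq> carrier R \<Longrightarrow> set (map (\<lambda>q. eps q) Q) \<subseteq> carrier F"
proof -
  assume "set Q \<subseteq> carrier R"
  then have "eps q \<in> carrier F" if "q \<in> set Q" for q using eval_hom(1)[OF zero_closed, of q] that by blast
  then show ?thesis by auto
qed

lemma normalize_eq_Nil: "normalize v = [] \<longleftrightarrow> (\<forall>c\<in>set v. c = \<zero>)"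
  by (induction v) auto

lemma fl_R: "set Q \<subseteq> carrier R \<Longrightarrow> fl Q \<in> carrier R"
  unfolding fl_def by (rule normalize_R) (use set_eps in simp)

lemma fl_nonzero: "\<exists>q\<in>set Q. eps q \<noteq> \<zero> \<Longrightarrow> fl Q \<noteq> []"
  unfolding fl_def normalize_eq_Nil by auto

lemma eval_fl: "set Q \<subseteq> carrier R \<Longrightarrow> u \<in> carrier F \<Longrightarrow> eval (fl Q) u = hev (map (\<lambda>q. eps q) Q) u"
  unfolding fl_def using set_eps[of Q] by (simp add: eval_normalize eval_rev)

lemma node_poly: "set Q \<subseteq> carrier R \<Longrightarrow> pnorm C (rev (map (\<lambda>q. cterm C q) Q)) = fl Q"
proof -
  assume Q: "set Q \<subseteq> carrier R"
  have "map (\<lambda>q. cterm C q) Q = map (\<lambda>q. eps q) Q"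
    by (rule map_cong[OF refl]) (use cterm_C[OF R_set] Q in blast)
  then show ?thesis unfolding pnorm_C fl_def by (rule arg_cong[where f = "\<lambda>v. normalize (rev v)"])
qed

text \<open>Write w = w(0) + z w1. There are no zero divisors, so dividing Q by a power of z keeps
  its roots. Setting z = 0 afterwards shows that w(0) is a root of the node polynomial, and w1 is a
  root of the divided Q at (z, w(0) + z Y).\<close>

lemma child_complete:
  assumes Q: "set Q \<subseteq> carrier R" and nz: "\<exists>q\<in>set Q. q \<noteq> []" and w: "w \<in> carrier R" "R.hev Q w = \<zero>\<^bsub>R\<^esub>"
  shows "eps w \<in> rts (fl (stripz C Q))"
    "\<exists>w1\<in>carrier R. w = pc (eps w) \<oplus>\<^bsub>R\<^esub> w1 \<otimes>\<^bsub>R\<^esub> zz \<and> R.hev (zscale C (taylor C (eps w) (stripz C Q))) w1 = \<zero>\<^bsub>R\<^esub>"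
proof -
  let ?Q = "stripz C Q" and ?c = "eps w"
  obtain \<rho> :: nat where S: "set ?Q \<subseteq> carrier R" "Q = map (\<lambda>q. q \<otimes>\<^bsub>R\<^esub> zz [^]\<^bsub>R\<^esub> \<rho>) ?Q" "\<exists>q\<in>set ?Q. eps q \<noteq> \<zero>"
    using stripz_C[OF Q nz] by blast
  have zR: "zz [^]\<^bsub>R\<^esub> \<rho> \<in> carrier R" using pX_C(2) by simp
  have hR: "R.hev ?Q w \<in> carrier R" by (rule R.hev_closed[OF S(1) w(1)])
  have "R.hev Q w = R.hev ?Q w \<otimes>\<^bsub>R\<^esub> zz [^]\<^bsub>R\<^esub> \<rho>" using R.hev_map_mult[OF S(1) w(1) zR] S(2) by simp
  then have "R.hev ?Q w \<otimes>\<^bsub>R\<^esub> zz [^]\<^bsub>R\<^esub> \<rho> = \<zero>\<^bsub>R\<^esub>" using w(2) by simp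
  then have h0: "R.hev ?Q w = \<zero>\<^bsub>R\<^esub>" using R.integral[OF _ hR zR] zz_nonzero[of \<rho>] by blast
  interpret e: ring_hom_cring R F "\<lambda>q. eps q" by (rule eps_hom)
  have c: "?c \<in> carrier F" by (rule eval_hom(1)[OF zero_closed w(1)])
  have "hev (map (\<lambda>q. eps q) ?Q) ?c = eps (R.hev ?Q w)" by (rule e.hom_hev[OF S(1) w(1), symmetric])
  then have "eval (fl ?Q) ?c = \<zero>" using eval_fl[OF S(1) c] h0 by simp
  then show "?c \<in> rts (fl ?Q)" using c by (simp add: rts_def)
  have pcR: "pc ?c \<in> carrier R" using c by simp
  let ?d = "w \<ominus>\<^bsub>R\<^esub> pc ?c"
  have dR: "?d \<in> carrier R" using w pcR by simp
  have "eps ?d = \<zero>" using w(1) pcR c by (simp add: eval_hom a_minus_def r_neg)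
  then have b: "butlast ?d \<in> carrier R" "?d = butlast ?d \<otimes>\<^bsub>R\<^esub> zz" using butlast_zz[OF dR] by auto
  let ?w1 = "butlast ?d"
  have "pc ?c \<oplus>\<^bsub>R\<^esub> ?d = w" using w(1) pcR by (simp add: R.minus_eq R.a_lcomm R.r_neg)
  then have we: "w = pc ?c \<oplus>\<^bsub>R\<^esub> ?w1 \<otimes>\<^bsub>R\<^esub> zz" using b(2) by simp
  let ?H = "R.tay (pc ?c) ?Q"
  have H: "set ?H \<subseteq> carrier R" "length ?H = length ?Q" "\<forall>y\<in>carrier R. R.hev ?H y = R.hev ?Q (pc ?c \<oplus>\<^bsub>R\<^esub> y)"
    using R.tay[OF pcR S(1)] by auto
  have "R.hev (zscale C (taylor C ?c ?Q)) ?w1 = R.hev ?H (zz \<otimes>\<^bsub>R\<^esub> ?w1)"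
    using R.hev_scale[OF H(1) pX_C(2) b(1), of 0] H(1) b(1) pX_C(2) unfolding taylor_C[OF c S(1)] zscale_C[OF H(1)] by simp
  also have "\<dots> = R.hev ?Q (pc ?c \<oplus>\<^bsub>R\<^esub> zz \<otimes>\<^bsub>R\<^esub> ?w1)" using bspec[OF H(3), of "zz \<otimes>\<^bsub>R\<^esub> ?w1"] b(1) pX_C(2) by simp
  also have "\<dots> = \<zero>\<^bsub>R\<^esub>" using h0 we R.m_comm[OF pX_C(2) b(1)] by simp
  finally show "\<exists>w1\<in>carrier R. w = pc ?c \<oplus>\<^bsub>R\<^esub> w1 \<otimes>\<^bsub>R\<^esub> zz \<and> R.hev (zscale C (taylor C ?c ?Q)) w1 = \<zero>\<^bsub>R\<^esub>"
    using we b(1) by blast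
qed

lemma length_normalize_rev:
  assumes "\<forall>b<length cs. \<rho> < b \<longrightarrow> cs ! b = \<zero>"
  shows "length (normalize (rev cs)) \<le> Suc \<rho>"
proof -
  have "\<forall>c\<in>set (drop (Suc \<rho>) cs). c = \<zero>" using assms by (auto simp: in_set_conv_nth)
  then have r: "rev (drop (Suc \<rho>) cs) = replicate (length cs - Suc \<rho>) \<zero>"
    by (metis length_drop length_rev replicate_length_same set_rev)
  have "rev cs = rev (drop (Suc \<rho>) cs) @ rev (take (Suc \<rho>) cs)" by (metis append_take_drop_id rev_append)
  then have "normalize (rev cs) = normalize (rev (take (Suc \<rho>) cs))" unfolding r by (simp add: normalize_replicate_zero)
  then show ?thesis using normalize_length_le[of "rev (take (Suc \<rho>) cs)"] by simp
qed

lemma lin_factor: "c \<in> carrier F \<Longrightarrow> zz \<ominus>\<^bsub>R\<^esub> pc c = [\<one>, \<ominus> c]"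
proof -
  assume c: "c \<in> carrier F"
  interpret h: ring_hom_cring F R pc by (rule pc_hom)
  have "normalize ([\<one>] @ [\<ominus> c]) = pc (\<ominus> c) \<oplus>\<^bsub>R\<^esub> zz \<otimes>\<^bsub>R\<^esub> normalize [\<one>]" by (rule normalize_snoc) (use c in auto)
  moreover have "normalize [\<one>] = \<one>\<^bsub>R\<^esub>" by (simp add: R_one)
  ultimately have "[\<one>, \<ominus> c] = pc (\<ominus> c) \<oplus>\<^bsub>R\<^esub> zz" using pX_C(2) by simp
  also have "pc (\<ominus> c) = \<ominus>\<^bsub>R\<^esub> pc c" using c by simp
  finally show ?thesis using c pX_C(2) by (simp add: R.minus_eq R.a_comm)
qed

lemma pc_zero: "pc \<zero> = \<zero>\<^bsub>R\<^esub>"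
  by (simp add: pc_def R_zero)

text \<open>The width argument. Let H(Y) = Q(c + Y) and let \<mu> be the first index with H_\<mu>(0)
  nonzero. Then (Y - c)^\<mu> divides Q(0, Y), so \<mu> is at most the multiplicity of c. The child
  has the coefficients H_b z^b. If it is divided by z^\<rho>, then \<rho> is at most \<mu> because
  of the index \<mu>, and the coefficients with b > \<rho> are still divisible by z. So at z = 0 the
  degree is at most \<rho>.\<close>

lemma child_ok:
  assumes Q: "set Q \<subseteq> carrier R" and nz: "\<exists>q\<in>set Q. eps q \<noteq> \<zero>" and c: "c \<in> carrier F"
  defines "Q1 \<equiv> zscale C (taylor C c Q)"
  shows "set Q1 \<subseteq> carrier R" "length Q1 = length Q" "\<exists>q\<in>set Q1. q \<noteq> []"
    "length (fl (stripz C Q1)) - 1 \<le> alg_mult (fl Q) c"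
proof -
  interpret e: ring_hom_cring R F "\<lambda>q. eps q" by (rule eps_hom)
  interpret h: ring_hom_cring F R pc by (rule pc_hom)
  have pcR: "pc c \<in> carrier R" using c by simp
  let ?H = "R.tay (pc c) Q"
  have H: "set ?H \<subseteq> carrier R" "length ?H = length Q" using R.tay[OF pcR Q] by auto
  have Q1: "Q1 = map (\<lambda>u. fst u \<otimes>\<^bsub>R\<^esub> zz [^]\<^bsub>R\<^esub> snd u) (zip ?H [0..<length ?H])"
    unfolding Q1_def taylor_C[OF c Q] zscale_C[OF H(1)] ..
  have Q1n: "Q1 ! b = ?H ! b \<otimes>\<^bsub>R\<^esub> zz [^]\<^bsub>R\<^esub> b" if "b < length Q" for b using that H(2) by (simp add: Q1)
  have Hn: "?H ! b \<in> carrier R" if "b < length Q" for b using that H by auto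
  show l1: "length Q1 = length Q" using H(2) by (simp add: Q1)
  show R1: "set Q1 \<subseteq> carrier R"
  proof
    fix q assume "q \<in> set Q1"
    then obtain b where "b < length Q" "q = Q1 ! b" using l1 by (metis in_set_conv_nth)
    then show "q \<in> carrier R" using Q1n[of b] Hn[of b] pX_C(2) by simp
  qed
  let ?fc = "map (\<lambda>q. eps q) Q"
  let ?g = "map (\<lambda>q. eps q) ?H"
  have fc: "set ?fc \<subseteq> carrier F" by (rule set_eps[OF Q])
  have gF: "set ?g \<subseteq> carrier F" by (rule set_eps[OF H(1)])
  have gt: "?g = tay c ?fc" using e.hom_tay[OF pcR Q] eval_hom(9)[OF zero_closed c] by simp
  let ?y = "zz \<ominus>\<^bsub>R\<^esub> pc c"
  have yR: "?y \<in> carrier R" using pX_C(2) pcR by simp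
  have pfc: "set (map pc ?fc) \<subseteq> carrier R" and pg: "set (map pc ?g) \<subseteq> carrier R" using fc gF by auto
  \<comment> \<open>Q(0, Y) lives in the univariate ring, with X in the role of Y. Its expansion at
    c has the coefficients \<open>?g\<close> of H at z = 0.\<close>
  have "fl Q = R.hev (map pc ?fc) zz" unfolding fl_def by (rule hev_const[OF fc, symmetric])
  also have "zz = pc c \<oplus>\<^bsub>R\<^esub> ?y" using pX_C(2) pcR by (simp add: R.minus_eq R.a_lcomm R.r_neg)
  also have "R.hev (map pc ?fc) (pc c \<oplus>\<^bsub>R\<^esub> ?y) = R.hev (R.tay (pc c) (map pc ?fc)) ?y"
    using R.tay[OF pcR pfc] yR by simp
  also have "R.tay (pc c) (map pc ?fc) = map pc ?g" unfolding gt by (rule h.hom_tay[OF c fc, symmetric])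
  finally have fy: "fl Q = R.hev (map pc ?g) ?y" .
  have fn: "fl Q \<noteq> []" by (rule fl_nonzero[OF nz])
  have ex: "\<exists>b. b < length Q \<and> ?g ! b \<noteq> \<zero>"
  proof (rule ccontr)
    assume a: "\<not> ?thesis"
    have "x = \<zero>\<^bsub>R\<^esub>" if x: "x \<in> set (map pc ?g)" for x
    proof -
      from x obtain b where b: "b < length (map pc ?g)" "x = map pc ?g ! b" unfolding in_set_conv_nth by blast
      have bQ: "b < length Q" using b(1) H(2) by simp
      have "x = pc (?g ! b)" unfolding b(2) by (rule nth_map) (use b(1) in simp)
      also have "?g ! b = \<zero>" using a bQ by blast
      finally show ?thesis by (simp add: pc_def R_zero)
    qed
    then have "R.hev (map pc ?g) ?y = \<zero>\<^bsub>R\<^esub>" using R.hev_all_zero[OF _ yR] by blast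
    then have "fl Q = []" unfolding R_zero by (rule trans[OF fy])
    then show False using fn by blast
  qed
  define \<mu> where "\<mu> = (LEAST b. b < length Q \<and> ?g ! b \<noteq> \<zero>)"
  have \<mu>0: "\<mu> < length Q \<and> ?g ! \<mu> \<noteq> \<zero>" unfolding \<mu>_def by (rule LeastI_ex[OF ex])
  have \<mu>b: "?g ! b = \<zero>" if "b < \<mu>" for b
  proof -
    have "\<not> (b < length Q \<and> ?g ! b \<noteq> \<zero>)" using not_less_Least[of b "\<lambda>b. b < length Q \<and> ?g ! b \<noteq> \<zero>"] that unfolding \<mu>_def by blast
    moreover have "b < length Q" using that \<mu>0 by linarith
    ultimately show ?thesis by blast
  qed
  have \<mu>: "\<mu> < length Q" "?g ! \<mu> \<noteq> \<zero>" "\<forall>b<\<mu>. ?g ! b = \<zero>" using \<mu>0 \<mu>b by blast+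
  have "\<forall>b<\<mu>. map pc ?g ! b = \<zero>\<^bsub>R\<^esub>"
  proof (intro allI impI)
    fix b assume b: "b < \<mu>"
    have "map pc ?g ! b = pc (?g ! b)" by (rule nth_map) (use b \<mu>(1) H(2) in simp)
    also have "?g ! b = \<zero>" using \<mu>(3) b by blast
    also note pc_zero
    finally show "map pc ?g ! b = \<zero>\<^bsub>R\<^esub>" .
  qed
  from R.hev_low_zeros[OF pg yR this] \<mu>(1) H(2)
  have "fl Q = ?y [^]\<^bsub>R\<^esub> \<mu> \<otimes>\<^bsub>R\<^esub> R.hev (drop \<mu> (map pc ?g)) ?y" unfolding fy by simp
  moreover have "R.hev (drop \<mu> (map pc ?g)) ?y \<in> carrier R"
    by (rule R.hev_closed[OF _ yR]) (use pg set_drop_subset[of \<mu> "map pc ?g"] in blast)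
  ultimately have "(?y [^]\<^bsub>R\<^esub> \<mu>) divides\<^bsub>R\<^esub> fl Q" unfolding factor_def by blast
  then have "([\<one>, \<ominus> c] [^]\<^bsub>R\<^esub> \<mu>) pdivides fl Q" unfolding lin_factor[OF c] pdivides_def .
  from alg_multE(2)[OF c fl_R[OF Q] fn this] have \<mu>m: "\<mu> \<le> alg_mult (fl Q) c" .
  have g\<mu>: "eps (?H ! \<mu>) \<noteq> \<zero>" using \<mu>(1,2) H(2) by simp
  have "Q1 ! \<mu> \<noteq> \<zero>\<^bsub>R\<^esub>"
  proof
    assume "Q1 ! \<mu> = \<zero>\<^bsub>R\<^esub>"
    then have "?H ! \<mu> = \<zero>\<^bsub>R\<^esub>" using Q1n[OF \<mu>(1)] R.integral[of "?H ! \<mu>" "zz [^]\<^bsub>R\<^esub> \<mu>"] Hn[OF \<mu>(1)] pX_C(2) zz_nonzero[of \<mu>] by simp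
    then show False using g\<mu> by simp
  qed
  then show nz1: "\<exists>q\<in>set Q1. q \<noteq> []" using \<mu>(1) l1 unfolding R_zero using nth_mem[of \<mu> Q1] by auto
  let ?Q1 = "stripz C Q1"
  obtain \<rho> :: nat where S: "set ?Q1 \<subseteq> carrier R" "Q1 = map (\<lambda>q. q \<otimes>\<^bsub>R\<^esub> zz [^]\<^bsub>R\<^esub> \<rho>) ?Q1"
    using stripz_C[OF R1 nz1] by blast
  have l2: "length ?Q1 = length Q" using S(2) l1 by (metis length_map)
  have Sn: "?Q1 ! b \<in> carrier R" "?H ! b \<otimes>\<^bsub>R\<^esub> zz [^]\<^bsub>R\<^esub> b = ?Q1 ! b \<otimes>\<^bsub>R\<^esub> zz [^]\<^bsub>R\<^esub> \<rho>" if "b < length Q" for b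
  proof -
    show "?Q1 ! b \<in> carrier R" using S(1) l2 that by auto
    have "Q1 ! b = ?Q1 ! b \<otimes>\<^bsub>R\<^esub> zz [^]\<^bsub>R\<^esub> \<rho>" by (subst S(2)) (use that l2 in simp)
    then show "?H ! b \<otimes>\<^bsub>R\<^esub> zz [^]\<^bsub>R\<^esub> b = ?Q1 ! b \<otimes>\<^bsub>R\<^esub> zz [^]\<^bsub>R\<^esub> \<rho>" using Q1n[OF that] by simp
  qed
  have shift: "x \<otimes>\<^bsub>R\<^esub> zz [^]\<^bsub>R\<^esub> (i + j) = (x \<otimes>\<^bsub>R\<^esub> zz [^]\<^bsub>R\<^esub> i) \<otimes>\<^bsub>R\<^esub> zz [^]\<^bsub>R\<^esub> j" if "x \<in> carrier R" for x and i j :: nat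
    using that pX_C(2) by (simp add: R.nat_pow_mult[symmetric] R.m_assoc)
  \<comment> \<open>Otherwise cancelling z^\<mu> would exhibit H_\<mu> as a multiple of z.\<close>
  have \<rho>\<mu>: "\<rho> \<le> \<mu>"
  proof (rule ccontr)
    assume "\<not> \<rho> \<le> \<mu>"
    then obtain i where i: "\<rho> = Suc i + \<mu>" using less_imp_Suc_add[of \<mu> \<rho>] by (auto simp: add.commute)
    have "?H ! \<mu> \<otimes>\<^bsub>R\<^esub> zz [^]\<^bsub>R\<^esub> \<mu> = (?Q1 ! \<mu> \<otimes>\<^bsub>R\<^esub> zz [^]\<^bsub>R\<^esub> Suc i) \<otimes>\<^bsub>R\<^esub> zz [^]\<^bsub>R\<^esub> \<mu>"
      using Sn(2)[OF \<mu>(1)] shift[OF Sn(1)[OF \<mu>(1)], of "Suc i" \<mu>] unfolding i by simp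
    then have "?H ! \<mu> = ?Q1 ! \<mu> \<otimes>\<^bsub>R\<^esub> zz [^]\<^bsub>R\<^esub> Suc i"
      by (rule zz_cancel[OF Hn[OF \<mu>(1)] R.m_closed[OF Sn(1)[OF \<mu>(1)] R.nat_pow_closed[OF pX_C(2)]]])
    then show False using g\<mu> eps_zz[OF Sn(1)[OF \<mu>(1)], of "Suc i"] by simp
  qed
  \<comment> \<open>For b > \<rho>, cancelling z^\<rho> leaves a factor z in the coefficient of
    Y^b.\<close>
  have "\<forall>b<length (map (\<lambda>q. eps q) ?Q1). \<rho> < b \<longrightarrow> map (\<lambda>q. eps q) ?Q1 ! b = \<zero>"
  proof (intro allI impI)
    fix b assume b: "b < length (map (\<lambda>q. eps q) ?Q1)" "\<rho> < b"
    then have bQ: "b < length Q" using l2 by simp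
    obtain i where i: "b = Suc i + \<rho>" using less_imp_Suc_add[OF b(2)] by (auto simp: add.commute)
    have "?Q1 ! b \<otimes>\<^bsub>R\<^esub> zz [^]\<^bsub>R\<^esub> \<rho> = (?H ! b \<otimes>\<^bsub>R\<^esub> zz [^]\<^bsub>R\<^esub> Suc i) \<otimes>\<^bsub>R\<^esub> zz [^]\<^bsub>R\<^esub> \<rho>"
      using Sn(2)[OF bQ] shift[OF Hn[OF bQ], of "Suc i" \<rho>] i by simp
    then have "?Q1 ! b = ?H ! b \<otimes>\<^bsub>R\<^esub> zz [^]\<^bsub>R\<^esub> Suc i"
      by (rule zz_cancel[OF Sn(1)[OF bQ] R.m_closed[OF Hn[OF bQ] R.nat_pow_closed[OF pX_C(2)]]])
    then have "eps (?Q1 ! b) = \<zero>" using eps_zz[OF Hn[OF bQ], of "Suc i"] by simp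
    then show "map (\<lambda>q. eps q) ?Q1 ! b = \<zero>" using b(1) by simp
  qed
  from length_normalize_rev[OF this] have "length (fl ?Q1) \<le> Suc \<rho>" unfolding fl_def .
  then show "length (fl ?Q1) - 1 \<le> alg_mult (fl Q) c" using \<rho>\<mu> \<mu>m by linarith
qed

lemma sum_alg_mult:
  assumes f: "f \<in> carrier R" "f \<noteq> []" and cs: "set cs = rts f" "distinct cs"
  shows "sum_list (map (\<lambda>c. alg_mult f c) cs) \<le> length f - 1" "length cs \<le> length f - 1"
proof -
  have "sum_list (map (\<lambda>c. alg_mult f c) cs) = (\<Sum>c\<in>rts f. count (roots f) c)"
    using sum_list_distinct_conv_sum_set[OF cs(2)] alg_mult_eq_count_roots[OF f(1)] cs(1) by simp
  also have "\<dots> = size (roots f)" unfolding size_multiset_overloaded_eq set_roots[OF f] ..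
  finally show "sum_list (map (\<lambda>c. alg_mult f c) cs) \<le> length f - 1" using size_roots_le_degree[OF f(1)] by simp
  show "length cs \<le> length f - 1" using card_rts[OF f] distinct_card[OF cs(2)] cs(1) by simp
qed

text \<open>A budget: this degree bounds the number of children of a node, and the budgets of the
  children sum to at most that of the parent. So the sum over a level never exceeds the initial one,
  which is at most \<open>length Q\<close>.\<close>

definition bud :: "nat list list list \<Rightarrow> nat" where "bud Q = length (fl (stripz C Q)) - 1"

definition nok :: "nat \<Rightarrow> nat \<Rightarrow> nat list list \<times> nat list list list \<Rightarrow> bool" where
  "nok N j nd \<longleftrightarrow> set (fst nd) \<subseteq> carrier F \<and> length (fst nd) = j \<and> set (snd nd) \<subseteq> carrier R \<and>
     length (snd nd) = N \<and> (\<exists>q\<in>set (snd nd). q \<noteq> [])"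

lemma rrnode_C:
  assumes nd: "nok N j nd" and as: "set as \<subseteq> carrier F"
  shows "separating as \<Longrightarrow> fst (rrnode C as nd)"
    "fst (rrnode C as nd) \<Longrightarrow> (\<forall>ch\<in>set (snd (rrnode C as nd)). nok N (Suc j) ch) \<and>
      length (snd (rrnode C as nd)) \<le> bud (snd nd) \<and>
      sum_list (map (\<lambda>ch. bud (snd ch)) (snd (rrnode C as nd))) \<le> bud (snd nd) \<and>
      (\<forall>w\<in>carrier R. R.hev (snd nd) w = \<zero>\<^bsub>R\<^esub> \<longrightarrow> (\<exists>ch\<in>set (snd (rrnode C as nd)). \<exists>w1\<in>carrier R.
         R.hev (snd ch) w1 = \<zero>\<^bsub>R\<^esub> \<and> fst ch = eps w # fst nd \<and> w = pc (eps w) \<oplus>\<^bsub>R\<^esub> w1 \<otimes>\<^bsub>R\<^esub> zz))"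
proof -
  let ?Q = "stripz C (snd nd)"
  have Q: "set (snd nd) \<subseteq> carrier R" and nz: "\<exists>q\<in>set (snd nd). q \<noteq> []" and lN: "length (snd nd) = N" using nd by (auto simp: nok_def)
  obtain \<rho> :: nat where S: "set ?Q \<subseteq> carrier R" "snd nd = map (\<lambda>q. q \<otimes>\<^bsub>R\<^esub> zz [^]\<^bsub>R\<^esub> \<rho>) ?Q" "\<exists>q\<in>set ?Q. eps q \<noteq> \<zero>"
    using stripz_C[OF Q nz] by blast
  have lQ: "length ?Q = N" using arg_cong[OF S(2), of length] lN by simp
  let ?f = "fl ?Q"
  have f: "?f \<in> carrier R" "?f \<noteq> []" using fl_R[OF S(1)] fl_nonzero[OF S(3)] by auto
  let ?r = "uroots C as ?f"
  let ?ch = "\<lambda>c. (c # fst nd, zscale C (taylor C c ?Q))"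
  have rn: "rrnode C as nd = (fst ?r, map ?ch (snd ?r))" unfolding rrnode_def node_poly[OF S(1)] Let_def ..
  note U = uroots_C[OF f as]
  show "separating as \<Longrightarrow> fst (rrnode C as nd)" unfolding rn fst_conv by (rule U(2))
  assume "fst (rrnode C as nd)"
  then have "fst ?r" unfolding rn by simp
  then have cs: "set (snd ?r) = rts ?f" "distinct (snd ?r)" using U(1) by auto
  have cF: "c \<in> carrier F" if "c \<in> set (snd ?r)" for c using that cs(1) by (simp add: rts_def)
  have ok: "nok N (Suc j) (?ch c)" if "c \<in> set (snd ?r)" for c
    using child_ok(1-3)[OF S(1,3) cF[OF that]] lQ nd cF[OF that] by (simp add: nok_def)
  have bd: "bud (snd (?ch c)) \<le> alg_mult ?f c" if "c \<in> set (snd ?r)" for c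
    using child_ok(4)[OF S(1,3) cF[OF that]] by (simp add: bud_def)
  have "sum_list (map (\<lambda>c. bud (snd (?ch c))) (snd ?r)) \<le> sum_list (map (\<lambda>c. alg_mult ?f c) (snd ?r))"
    by (rule sum_list_mono) (rule bd)
  also have "\<dots> \<le> bud (snd nd)" using sum_alg_mult(1)[OF f cs] by (simp add: bud_def)
  finally have sb: "sum_list (map (\<lambda>ch. bud (snd ch)) (map ?ch (snd ?r))) \<le> bud (snd nd)" by (simp add: comp_def)
  have ln: "length (map ?ch (snd ?r)) \<le> bud (snd nd)" using sum_alg_mult(2)[OF f cs] by (simp add: bud_def)
  have cp: "\<exists>ch\<in>set (map ?ch (snd ?r)). \<exists>w1\<in>carrier R. R.hev (snd ch) w1 = \<zero>\<^bsub>R\<^esub> \<and> fst ch = eps w # fst nd \<and>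
      w = pc (eps w) \<oplus>\<^bsub>R\<^esub> w1 \<otimes>\<^bsub>R\<^esub> zz" if w: "w \<in> carrier R" "R.hev (snd nd) w = \<zero>\<^bsub>R\<^esub>" for w
  proof -
    note CC = child_complete[OF Q nz w]
    obtain w1 where w1: "w1 \<in> carrier R" "w = pc (eps w) \<oplus>\<^bsub>R\<^esub> w1 \<otimes>\<^bsub>R\<^esub> zz"
      "R.hev (zscale C (taylor C (eps w) ?Q)) w1 = \<zero>\<^bsub>R\<^esub>" using CC(2) by blast
    have "eps w \<in> set (snd ?r)" using CC(1) cs(1) by blast
    then have "?ch (eps w) \<in> set (map ?ch (snd ?r))" unfolding set_map by (rule imageI)
    moreover have "R.hev (snd (?ch (eps w))) w1 = \<zero>\<^bsub>R\<^esub> \<and> fst (?ch (eps w)) = eps w # fst nd" using w1(3) by simp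
    ultimately show ?thesis using w1(1,2) by blast
  qed
  have "\<forall>ch\<in>set (map ?ch (snd ?r)). nok N (Suc j) ch" using ok by simp
  then show "(\<forall>ch\<in>set (snd (rrnode C as nd)). nok N (Suc j) ch) \<and>
      length (snd (rrnode C as nd)) \<le> bud (snd nd) \<and>
      sum_list (map (\<lambda>ch. bud (snd ch)) (snd (rrnode C as nd))) \<le> bud (snd nd) \<and>
      (\<forall>w\<in>carrier R. R.hev (snd nd) w = \<zero>\<^bsub>R\<^esub> \<longrightarrow> (\<exists>ch\<in>set (snd (rrnode C as nd)). \<exists>w1\<in>carrier R.
         R.hev (snd ch) w1 = \<zero>\<^bsub>R\<^esub> \<and> fst ch = eps w # fst nd \<and> w = pc (eps w) \<oplus>\<^bsub>R\<^esub> w1 \<otimes>\<^bsub>R\<^esub> zz))"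
    unfolding rn snd_conv using ln sb cp by blast
qed

lemma normalize_Cons: "set u \<subseteq> carrier F \<Longrightarrow> c \<in> carrier F \<Longrightarrow>
    normalize (c # u) = pc c \<otimes>\<^bsub>R\<^esub> zz [^]\<^bsub>R\<^esub> length u \<oplus>\<^bsub>R\<^esub> normalize u"
proof -
  assume u: "set u \<subseteq> carrier F" and c: "c \<in> carrier F"
  have nR: "normalize u \<in> carrier R" by (rule normalize_R[OF u])
  show ?thesis
  proof (cases "c = \<zero>")
    case True
    have "pc c = \<zero>\<^bsub>R\<^esub>" unfolding True by (simp add: pc_def R_zero)
    then show ?thesis using True nR pX_C(2) by simp
  next
    case False
    have pc: "pc c = [c]" using False by (simp add: pc_def)
    have "pc c \<otimes>\<^bsub>R\<^esub> zz [^]\<^bsub>R\<^esub> length u = monom c (length u)"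
      using mult_zz_pow[OF pc_R[OF c], of "length u"] unfolding pc by (simp add: monom_def)
    moreover have "poly_add (monom c (length u)) (normalize u) = poly_add (monom c (length u)) u"
      by (rule poly_add_normalize(2)[OF monom_in_carrier[OF c] u, symmetric])
    moreover have "poly_add (monom c (length u)) u = c # u" using poly_add_monom[of u c] u c False by simp
    ultimately show ?thesis using False by (simp add: R_add)
  qed
qed

lemma sum_list_concat_map: "sum_list (map g (concat xss)) = sum_list (map (\<lambda>xs. sum_list (map g xs)) xss)" for g :: "'z \<Rightarrow> nat"
  by (induction xss) auto

text \<open>Each root w of \<open>Q\<close> is tracked by a node on every level: w = w1 z^j + (the j
  recorded coefficients), where the continuation w1 is a root of the node's own polynomial.\<close>

lemma rr_C:
  assumes as: "set as \<subseteq> carrier F" and Q: "set Q \<subseteq> carrier R" and nz: "\<exists>q\<in>set Q. q \<noteq> []"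
  shows "(separating as \<longrightarrow> fst (rr C as Q ls)) \<and> (fst (rr C as Q ls) \<longrightarrow>
    (\<forall>nd\<in>set (snd (rr C as Q ls)). nok (length Q) (length ls) nd) \<and>
    sum_list (map (\<lambda>nd. bud (snd nd)) (snd (rr C as Q ls))) \<le> length Q \<and>
    (\<forall>w\<in>carrier R. R.hev Q w = \<zero>\<^bsub>R\<^esub> \<longrightarrow> (\<exists>nd\<in>set (snd (rr C as Q ls)). \<exists>w1\<in>carrier R.
       R.hev (snd nd) w1 = \<zero>\<^bsub>R\<^esub> \<and> w = w1 \<otimes>\<^bsub>R\<^esub> zz [^]\<^bsub>R\<^esub> length ls \<oplus>\<^bsub>R\<^esub> normalize (fst nd))))"
proof (induction ls rule: rev_induct)
  case Nil
  have e: "rr C as Q [] = (True, [([], Q)])" by (simp add: rr_def)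
  obtain \<rho> :: nat where S: "Q = map (\<lambda>q. q \<otimes>\<^bsub>R\<^esub> zz [^]\<^bsub>R\<^esub> \<rho>) (stripz C Q)" using stripz_C[OF Q nz] by blast
  have "length (fl (stripz C Q)) \<le> length (stripz C Q)" unfolding fl_def
    using normalize_length_le[of "rev (map (\<lambda>q. eps q) (stripz C Q))"] by simp
  also have "\<dots> = length Q" using arg_cong[OF S, of length] by simp
  finally have b: "bud Q \<le> length Q" by (simp add: bud_def)
  have nk: "nok (length Q) 0 ([], Q)" using Q nz by (simp add: nok_def)
  have base: "w = w \<otimes>\<^bsub>R\<^esub> zz [^]\<^bsub>R\<^esub> (0::nat) \<oplus>\<^bsub>R\<^esub> normalize (fst ([], Q))" if "w \<in> carrier R" for w
  proof -
    have "w \<otimes>\<^bsub>R\<^esub> zz [^]\<^bsub>R\<^esub> (0::nat) = w" using that by simp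
    moreover have "normalize (fst ([], Q)) = \<zero>\<^bsub>R\<^esub>" by (simp add: R_zero)
    ultimately show ?thesis using R.r_zero[OF that] by metis
  qed
  show ?case unfolding e fst_conv snd_conv list.size(3)
  proof (intro conjI impI ballI TrueI)
    fix w assume wR: "w \<in> carrier R" "R.hev Q w = \<zero>\<^bsub>R\<^esub>"
    show "\<exists>nd\<in>set [([], Q)]. \<exists>w1\<in>carrier R. R.hev (snd nd) w1 = \<zero>\<^bsub>R\<^esub> \<and> w = w1 \<otimes>\<^bsub>R\<^esub> zz [^]\<^bsub>R\<^esub> (0::nat) \<oplus>\<^bsub>R\<^esub> normalize (fst nd)"
      by (rule bexI[of _ "([], Q)"], rule bexI[of _ w]) (use wR base[OF wR(1)] in \<open>simp_all only: snd_conv simp_thms list.set insert_iff\<close>)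
  qed (use b nk in simp_all)
next
  case (snoc i ls)
  let ?s = "rr C as Q ls" and ?N = "length Q"
  let ?rs = "map (\<lambda>nd. rrnode C as nd) (snd ?s)"
  let ?ch = "concat (map (\<lambda>r. snd r) ?rs)"
  have e: "rr C as Q (ls @ [i]) = (fst ?s \<and> (\<forall>r\<in>set ?rs. fst r), take ?N ?ch)"
    by (simp add: rr_def rrstep_def Let_def)
  have sep: "fst (rr C as Q (ls @ [i]))" if "separating as"
  proof -
    have 1: "fst ?s" using snoc that by blast
    then have nk: "\<forall>nd\<in>set (snd ?s). nok ?N (length ls) nd" using snoc by blast
    have "fst r" if "r \<in> set ?rs" for r
    proof -
      from that obtain nd where nd: "nd \<in> set (snd ?s)" "r = rrnode C as nd" by auto
      show ?thesis unfolding nd(2) by (rule rrnode_C(1)[OF bspec[OF nk nd(1)] as \<open>separating as\<close>])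
    qed
    then show ?thesis unfolding e using 1 by simp
  qed
  moreover have "(\<forall>nd\<in>set (take ?N ?ch). nok ?N (length (ls @ [i])) nd) \<and>
    sum_list (map (\<lambda>nd. bud (snd nd)) (take ?N ?ch)) \<le> ?N \<and>
    (\<forall>w\<in>carrier R. R.hev Q w = \<zero>\<^bsub>R\<^esub> \<longrightarrow> (\<exists>nd\<in>set (take ?N ?ch). \<exists>w1\<in>carrier R.
       R.hev (snd nd) w1 = \<zero>\<^bsub>R\<^esub> \<and> w = w1 \<otimes>\<^bsub>R\<^esub> zz [^]\<^bsub>R\<^esub> length (ls @ [i]) \<oplus>\<^bsub>R\<^esub> normalize (fst nd)))"
    if t: "fst ?s" "\<forall>r\<in>set ?rs. fst r"
  proof -
    have nk: "\<forall>nd\<in>set (snd ?s). nok ?N (length ls) nd" and sm: "sum_list (map (\<lambda>nd. bud (snd nd)) (snd ?s)) \<le> ?N"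
      and cp: "\<forall>w\<in>carrier R. R.hev Q w = \<zero>\<^bsub>R\<^esub> \<longrightarrow> (\<exists>nd\<in>set (snd ?s). \<exists>w1\<in>carrier R.
       R.hev (snd nd) w1 = \<zero>\<^bsub>R\<^esub> \<and> w = w1 \<otimes>\<^bsub>R\<^esub> zz [^]\<^bsub>R\<^esub> length ls \<oplus>\<^bsub>R\<^esub> normalize (fst nd))"
      using snoc t(1) by blast+
    have fr: "fst (rrnode C as nd)" if "nd \<in> set (snd ?s)" for nd using t(2) that by simp
    note RN = rrnode_C(2)[OF bspec[OF nk] as fr]
    have "length ?ch = sum_list (map (\<lambda>nd. length (snd (rrnode C as nd))) (snd ?s))" by (simp add: length_concat comp_def)
    also have "\<dots> \<le> sum_list (map (\<lambda>nd. bud (snd nd)) (snd ?s))" by (rule sum_list_mono) (use RN in blast)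
    finally have "length ?ch \<le> ?N" using sm by linarith
    \<comment> \<open>The sum of the budgets bounds the number of children, so the cut to
      \<open>?N\<close> nodes loses nothing.\<close>
    then have tk: "take ?N ?ch = ?ch" by (rule take_all)
    have "sum_list (map (\<lambda>nd. bud (snd nd)) ?ch) = sum_list (map (\<lambda>nd. sum_list (map (\<lambda>ch. bud (snd ch)) (snd (rrnode C as nd)))) (snd ?s))"
      unfolding sum_list_concat_map by (simp add: comp_def)
    also have "\<dots> \<le> sum_list (map (\<lambda>nd. bud (snd nd)) (snd ?s))" by (rule sum_list_mono) (use RN in blast)
    finally have sb: "sum_list (map (\<lambda>nd. bud (snd nd)) ?ch) \<le> ?N" using sm by linarith
    have ok: "nok ?N (Suc (length ls)) ch" if ch: "ch \<in> set ?ch" for ch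
    proof -
      from ch obtain nd where nd: "nd \<in> set (snd ?s)" "ch \<in> set (snd (rrnode C as nd))" by auto
      show ?thesis using RN[OF nd(1,1)] nd(2) by blast
    qed
    have "\<exists>nd\<in>set ?ch. \<exists>w1\<in>carrier R. R.hev (snd nd) w1 = \<zero>\<^bsub>R\<^esub> \<and>
       w = w1 \<otimes>\<^bsub>R\<^esub> zz [^]\<^bsub>R\<^esub> Suc (length ls) \<oplus>\<^bsub>R\<^esub> normalize (fst nd)" if w: "w \<in> carrier R" "R.hev Q w = \<zero>\<^bsub>R\<^esub>" for w
    proof -
      obtain nd w1 where nd: "nd \<in> set (snd ?s)" "w1 \<in> carrier R" "R.hev (snd nd) w1 = \<zero>\<^bsub>R\<^esub>"
        "w = w1 \<otimes>\<^bsub>R\<^esub> zz [^]\<^bsub>R\<^esub> length ls \<oplus>\<^bsub>R\<^esub> normalize (fst nd)" using cp w by blast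
      obtain ch w2 where ch: "ch \<in> set (snd (rrnode C as nd))" "w2 \<in> carrier R" "R.hev (snd ch) w2 = \<zero>\<^bsub>R\<^esub>"
        "fst ch = eps w1 # fst nd" "w1 = pc (eps w1) \<oplus>\<^bsub>R\<^esub> w2 \<otimes>\<^bsub>R\<^esub> zz" using RN[OF nd(1,1)] nd(2,3) by blast
      have chs: "ch \<in> set ?ch" using ch(1) nd(1) by auto
      have c: "eps w1 \<in> carrier F" by (rule eval_hom(1)[OF zero_closed nd(2)])
      have u: "set (fst nd) \<subseteq> carrier F" "length (fst nd) = length ls" using bspec[OF nk nd(1)] by (auto simp: nok_def)
      let ?z = "zz [^]\<^bsub>R\<^esub> length ls"
      have zR: "?z \<in> carrier R" "zz \<in> carrier R" using pX_C(2) by auto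
      have nR: "normalize (fst nd) \<in> carrier R" by (rule normalize_R[OF u(1)])
      have pR: "pc (eps w1) \<in> carrier R" using c by simp
      have "w = (pc (eps w1) \<oplus>\<^bsub>R\<^esub> w2 \<otimes>\<^bsub>R\<^esub> zz) \<otimes>\<^bsub>R\<^esub> ?z \<oplus>\<^bsub>R\<^esub> normalize (fst nd)" using nd(4) ch(5) by simp
      also have "\<dots> = w2 \<otimes>\<^bsub>R\<^esub> (?z \<otimes>\<^bsub>R\<^esub> zz) \<oplus>\<^bsub>R\<^esub> (pc (eps w1) \<otimes>\<^bsub>R\<^esub> ?z \<oplus>\<^bsub>R\<^esub> normalize (fst nd))"
        using pR ch(2) zR nR by (simp add: R.l_distr R.r_distr R.m_ac R.a_ac)
      also have "pc (eps w1) \<otimes>\<^bsub>R\<^esub> ?z \<oplus>\<^bsub>R\<^esub> normalize (fst nd) = normalize (fst ch)"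
        unfolding ch(4) using normalize_Cons[OF u(1) c] u(2) by simp
      finally have "w = w2 \<otimes>\<^bsub>R\<^esub> zz [^]\<^bsub>R\<^esub> Suc (length ls) \<oplus>\<^bsub>R\<^esub> normalize (fst ch)" by simp
      then show ?thesis using chs ch(2,3) by blast
    qed
    then show ?thesis unfolding tk using ok sb by simp
  qed
  ultimately show ?case unfolding e fst_conv snd_conv by blast
qed

lemma rr_complete:
  assumes as: "set as \<subseteq> carrier F" and Q: "set Q \<subseteq> carrier R" and nz: "\<exists>q\<in>set Q. q \<noteq> []"
    and t: "fst (rr C as Q ls)" and w: "w \<in> carrier R" "length w \<le> length ls" "R.hev Q w = \<zero>\<^bsub>R\<^esub>"
  shows "\<exists>nd\<in>set (snd (rr C as Q ls)). w = normalize (fst nd)"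
proof -
  obtain nd w1 where nd: "nd \<in> set (snd (rr C as Q ls))" "w1 \<in> carrier R"
    "w = w1 \<otimes>\<^bsub>R\<^esub> zz [^]\<^bsub>R\<^esub> length ls \<oplus>\<^bsub>R\<^esub> normalize (fst nd)" and ok: "nok (length Q) (length ls) nd"
    using rr_C[OF as Q nz, of ls] t w by blast
  have u: "set (fst nd) \<subseteq> carrier F" "length (fst nd) = length ls" using ok by (auto simp: nok_def)
  have nR: "normalize (fst nd) \<in> carrier R" by (rule normalize_R[OF u(1)])
  \<comment> \<open>A nonzero continuation would give w more than \<open>length ls\<close>
    coefficients.\<close>
  have "w1 = []"
  proof (rule ccontr)
    assume n: "w1 \<noteq> []"
    have l: "length (w1 \<otimes>\<^bsub>R\<^esub> zz [^]\<^bsub>R\<^esub> length ls) = length w1 + length ls" using mult_zz_pow[OF nd(2), of "length ls"] n by simp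
    have l2: "length (normalize (fst nd)) \<le> length ls" using normalize_length_le[of "fst nd"] u(2) by simp
    have w1: "length w1 > 0" using n by simp
    have "length w = max (length w1 + length ls) (length (normalize (fst nd)))"
      unfolding nd(3) using length_add_neq[of "w1 \<otimes>\<^bsub>R\<^esub> zz [^]\<^bsub>R\<^esub> length ls" "normalize (fst nd)"] l l2 w1 nd(2) nR pX_C(2) by simp
    then show False using w(2) w1 by linarith
  qed
  then have "w = \<zero>\<^bsub>R\<^esub> \<oplus>\<^bsub>R\<^esub> normalize (fst nd)" using nd(3) pX_C(2) by (simp add: R_zero[symmetric])
  then show ?thesis using nd(1) nR by auto
qed

end

section \<open>Null vectors\<close>

context cring
begin

primrec lsum :: "('i \<Rightarrow> 'a) \<Rightarrow> 'i list \<Rightarrow> 'a" where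
  "lsum f [] = \<zero>"
| "lsum f (x # xs) = f x \<oplus> lsum f xs"

lemma lsum_closed [simp]: "(\<And>x. x \<in> set xs \<Longrightarrow> f x \<in> carrier R) \<Longrightarrow> lsum f xs \<in> carrier R"
  by (induction xs) auto

lemma lsum_cong: "(\<And>x. x \<in> set xs \<Longrightarrow> f x = g x) \<Longrightarrow> lsum f xs = lsum g xs"
  by (induction xs) auto

lemma lsum_zero: "(\<And>x. x \<in> set xs \<Longrightarrow> f x = \<zero>) \<Longrightarrow> lsum f xs = \<zero>"
  by (induction xs) auto

lemma lsum_append: "(\<And>x. x \<in> set xs \<Longrightarrow> f x \<in> carrier R) \<Longrightarrow> (\<And>x. x \<in> set ys \<Longrightarrow> f x \<in> carrier R) \<Longrightarrow>
    lsum f (xs @ ys) = lsum f xs \<oplus> lsum f ys"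
  by (induction xs) (auto simp: a_assoc)

lemma lsum_map: "lsum f (map g xs) = lsum (\<lambda>x. f (g x)) xs"
  by (induction xs) auto

lemma lsum_add: "(\<And>x. x \<in> set xs \<Longrightarrow> f x \<in> carrier R) \<Longrightarrow> (\<And>x. x \<in> set xs \<Longrightarrow> g x \<in> carrier R) \<Longrightarrow>
    lsum (\<lambda>x. f x \<oplus> g x) xs = lsum f xs \<oplus> lsum g xs"
proof (induction xs)
  case (Cons x xs)
  then have c: "f x \<in> carrier R" "g x \<in> carrier R" "lsum f xs \<in> carrier R" "lsum g xs \<in> carrier R" by simp_all
  have "lsum (\<lambda>x. f x \<oplus> g x) xs = lsum f xs \<oplus> lsum g xs" by (rule Cons.IH) (use Cons.prems in auto)
  then show ?case using c by (simp add: a_ac)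
qed simp

lemma lsum_distr: "c \<in> carrier R \<Longrightarrow> (\<And>x. x \<in> set xs \<Longrightarrow> f x \<in> carrier R) \<Longrightarrow> lsum (\<lambda>x. c \<otimes> f x) xs = c \<otimes> lsum f xs"
proof (induction xs)
  case (Cons x xs)
  have "lsum (\<lambda>x. c \<otimes> f x) xs = c \<otimes> lsum f xs" by (rule Cons.IH) (use Cons.prems in auto)
  then show ?case using Cons.prems by (simp add: r_distr)
qed simp

lemma lsum_swap: "(\<And>x y. x \<in> set xs \<Longrightarrow> y \<in> set ys \<Longrightarrow> f x y \<in> carrier R) \<Longrightarrow>
    lsum (\<lambda>x. lsum (\<lambda>y. f x y) ys) xs = lsum (\<lambda>y. lsum (\<lambda>x. f x y) xs) ys"
proof (induction xs)
  case Nil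
  then show ?case using lsum_zero[of ys "\<lambda>y. \<zero>"] by simp
next
  case (Cons x xs)
  have IH: "lsum (\<lambda>x. lsum (\<lambda>y. f x y) ys) xs = lsum (\<lambda>y. lsum (\<lambda>x. f x y) xs) ys" by (rule Cons.IH) (use Cons.prems in auto)
  have "lsum (\<lambda>y. f x y \<oplus> lsum (\<lambda>x. f x y) xs) ys = lsum (\<lambda>y. f x y) ys \<oplus> lsum (\<lambda>y. lsum (\<lambda>x. f x y) xs) ys"
    by (rule lsum_add) (use Cons.prems in auto)
  then show ?case using IH by simp
qed

lemma hev_lsum: "set rw \<subseteq> carrier R \<Longrightarrow> s \<in> carrier R \<Longrightarrow> hev rw s = lsum (\<lambda>a. rw ! a \<otimes> s [^] a) [0..<length rw]"
proof (induction rw)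
  case (Cons r rw)
  have IH: "hev rw s = lsum (\<lambda>a. rw ! a \<otimes> s [^] a) [0..<length rw]" using Cons by simp
  have c: "rw ! a \<in> carrier R" if "a < length rw" for a using Cons.prems that by auto
  have "lsum (\<lambda>a. (r # rw) ! a \<otimes> s [^] a) [0..<length (r # rw)] = r \<oplus> lsum (\<lambda>a. (r # rw) ! a \<otimes> s [^] a) (map Suc [0..<length rw])"
    using Cons.prems by (simp add: upt_conv_Cons map_Suc_upt del: upt_Suc)
  also have "lsum (\<lambda>a. (r # rw) ! a \<otimes> s [^] a) (map Suc [0..<length rw]) = lsum (\<lambda>a. s \<otimes> (rw ! a \<otimes> s [^] a)) [0..<length rw]"
    unfolding lsum_map by (rule lsum_cong) (use c Cons.prems in \<open>simp add: m_ac\<close>)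
  also have "\<dots> = s \<otimes> lsum (\<lambda>a. rw ! a \<otimes> s [^] a) [0..<length rw]"
    by (rule lsum_distr) (use c Cons.prems in auto)
  finally show ?case using IH by simp
qed simp

definition dot :: "'a list \<Rightarrow> 'a list \<Rightarrow> 'a" where "dot r v = lsum (\<lambda>u. fst u \<otimes> snd u) (zip r v)"

lemma dot_simps [simp]: "dot [] v = \<zero>" "dot r [] = \<zero>" "dot (a # r) (b # v) = a \<otimes> b \<oplus> dot r v"
  by (simp_all add: dot_def)

lemma dot_closed [simp]: "set r \<subseteq> carrier R \<Longrightarrow> set v \<subseteq> carrier R \<Longrightarrow> dot r v \<in> carrier R"
  unfolding dot_def
proof (rule lsum_closed)
  fix u assume r: "set r \<subseteq> carrier R" and v: "set v \<subseteq> carrier R" and u: "u \<in> set (zip r v)"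
  then have "(fst u, snd u) \<in> set (zip r v)" by simp
  then have "fst u \<in> carrier R" "snd u \<in> carrier R" using r v by (blast dest: set_zip_leftD set_zip_rightD)+
  then show "fst u \<otimes> snd u \<in> carrier R" by simp
qed

lemma dot_linear:
  assumes "length u = length v" "set r \<subseteq> carrier R" "set u \<subseteq> carrier R" "set v \<subseteq> carrier R" "\<alpha> \<in> carrier R" "\<beta> \<in> carrier R"
  shows "dot r (map2 (\<lambda>a b. \<alpha> \<otimes> a \<ominus> \<beta> \<otimes> b) u v) = \<alpha> \<otimes> dot r u \<ominus> \<beta> \<otimes> dot r v"
  using assms
proof (induction u v arbitrary: r rule: list_induct2)
  case Nil
  then show ?case by (simp add: a_minus_def)
next
  case (Cons a u b v)
  show ?case
  proof (cases r)
    case Nil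
    then show ?thesis using Cons.prems by (simp add: a_minus_def)
  next
    case r: (Cons c r')
    have cl: "a \<in> carrier R" "b \<in> carrier R" "c \<in> carrier R" "set u \<subseteq> carrier R" "set v \<subseteq> carrier R" "set r' \<subseteq> carrier R"
      using Cons.prems r by auto
    have IH: "dot r' (map2 (\<lambda>a b. \<alpha> \<otimes> a \<ominus> \<beta> \<otimes> b) u v) = \<alpha> \<otimes> dot r' u \<ominus> \<beta> \<otimes> dot r' v"
      by (rule Cons.IH[OF cl(6,4,5) Cons.prems(4,5)])
    have d: "dot r' u \<in> carrier R" "dot r' v \<in> carrier R" using cl by auto
    show ?thesis unfolding r using cl d Cons.prems(4,5)
      by (simp add: IH[unfolded a_minus_def] a_minus_def r_distr minus_add r_minus a_ac m_ac)
  qed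
qed

lemma dot_conv_nth: "length r = length v \<Longrightarrow> dot r v = lsum (\<lambda>i. r ! i \<otimes> v ! i) [0..<length v]"
proof (induction r v rule: list_induct2)
  case (Cons a r b v)
  have "lsum (\<lambda>i. (a # r) ! i \<otimes> (b # v) ! i) [0..<length (b # v)] = a \<otimes> b \<oplus> lsum (\<lambda>i. (a # r) ! i \<otimes> (b # v) ! i) (map Suc [0..<length v])"
    by (simp add: upt_conv_Cons map_Suc_upt del: upt_Suc)
  then show ?case using Cons by (simp add: lsum_map)
qed simp

end

context gfield
begin

lemma dotp_C: "set r \<subseteq> carrier F \<Longrightarrow> set v \<subseteq> carrier F \<Longrightarrow> dotp C r v = dot r v"
proof -
  assume r: "set r \<subseteq> carrier F" and v: "set v \<subseteq> carrier F"
  have c: "fst u \<in> carrier F \<and> snd u \<in> carrier F" if "u \<in> set (zip r v)" for u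
  proof -
    have "(fst u, snd u) \<in> set (zip r v)" using that by simp
    then show ?thesis using r v by (blast dest: set_zip_leftD set_zip_rightD)
  qed
  have "map (\<lambda>u. fmul C (fst u) (snd u)) (zip r v) = map (\<lambda>u. fst u \<otimes> snd u) (zip r v)"
    by (rule map_cong[OF refl]) (use c in simp)
  moreover have "set (map (\<lambda>u. fst u \<otimes> snd u) (zip r v)) \<subseteq> carrier F" using c by auto
  moreover have "foldr (\<oplus>) (map g xs) \<zero> = lsum g xs" for g :: "nat list \<times> nat list \<Rightarrow> nat list" and xs by (induction xs) auto
  ultimately show ?thesis unfolding dotp_def dot_def by (simp only: fsum_C)
qed

lemma vcomb_C: "set u \<subseteq> carrier F \<Longrightarrow> set v \<subseteq> carrier F \<Longrightarrow> \<alpha> \<in> carrier F \<Longrightarrow> \<beta> \<in> carrier F \<Longrightarrow>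
    vcomb C \<alpha> u \<beta> v = map2 (\<lambda>a b. \<alpha> \<otimes> a \<ominus> \<beta> \<otimes> b) u v"
  unfolding vcomb_def
proof (rule map_cong[OF refl])
  fix i assume u: "set u \<subseteq> carrier F" and v: "set v \<subseteq> carrier F" and ab: "\<alpha> \<in> carrier F" "\<beta> \<in> carrier F" and i: "i \<in> set (zip u v)"
  then have "(fst i, snd i) \<in> set (zip u v)" by simp
  then have "fst i \<in> carrier F" "snd i \<in> carrier F" using u v by (blast dest: set_zip_leftD set_zip_rightD)+
  then show "fsub C (fmul C \<alpha> (fst i)) (fmul C \<beta> (snd i)) = (case i of (a, b) \<Rightarrow> \<alpha> \<otimes> a \<ominus> \<beta> \<otimes> b)"
    using ab by (simp add: split_def)
qed

text \<open>\<open>\<pi>\<close> is the last nonzero position. Vectors with strictly increasing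
  positions of this kind are independent, and this concrete form of independence is easy to preserve
  under elimination.\<close>

definition piv :: "nat \<Rightarrow> nat \<Rightarrow> nat list list \<Rightarrow> bool" where
  "piv U \<pi> v \<longleftrightarrow> length v = U \<and> set v \<subseteq> carrier F \<and> \<pi> < U \<and> v ! \<pi> \<noteq> \<zero> \<and> (\<forall>j<U. \<pi> < j \<longrightarrow> v ! j = \<zero>)"

text \<open>At \<open>\<sigma>\<close> and beyond \<open>v\<close> is zero, so only the nonzero
  multiple of \<open>u\<close> is seen there. This is why \<open>elim\<close> uses the first vector
  violating a row to correct the later ones.\<close>

lemma piv_comb:
  assumes v: "piv U \<pi> v" and u: "piv U \<sigma> u" and lt: "\<pi> < \<sigma>" and a: "\<alpha> \<in> carrier F" "\<alpha> \<noteq> \<zero>" and b: "\<beta> \<in> carrier F"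
  shows "piv U \<sigma> (vcomb C \<alpha> u \<beta> v)"
proof -
  have c: "length v = U" "set v \<subseteq> carrier F" "length u = U" "set u \<subseteq> carrier F" "\<sigma> < U" "u ! \<sigma> \<noteq> \<zero>"
    "\<forall>j<U. \<pi> < j \<longrightarrow> v ! j = \<zero>" "\<forall>j<U. \<sigma> < j \<longrightarrow> u ! j = \<zero>" using u v by (auto simp: piv_def)
  have e: "vcomb C \<alpha> u \<beta> v = map2 (\<lambda>a b. \<alpha> \<otimes> a \<ominus> \<beta> \<otimes> b) u v" by (rule vcomb_C[OF c(4,2) a(1) b])
  have n: "vcomb C \<alpha> u \<beta> v ! j = \<alpha> \<otimes> u ! j \<ominus> \<beta> \<otimes> v ! j" if "j < U" for j unfolding e using that c(1,3) by simp
  have cu: "u ! j \<in> carrier F" "v ! j \<in> carrier F" if "j < U" for j using that c by auto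
  have "vcomb C \<alpha> u \<beta> v ! \<sigma> \<noteq> \<zero>"
    using n[OF c(5)] c(5,6,7) lt a b cu[OF c(5)] integral_iff[of \<alpha> "u ! \<sigma>"] by (simp add: a_minus_def)
  moreover have "vcomb C \<alpha> u \<beta> v ! j = \<zero>" if "j < U" "\<sigma> < j" for j
    using n[OF that(1)] c(7,8) that lt a b by (simp add: a_minus_def)
  moreover have "set (vcomb C \<alpha> u \<beta> v) \<subseteq> carrier F"
  proof
    fix x assume "x \<in> set (vcomb C \<alpha> u \<beta> v)"
    then obtain i where "x = fsub C (fmul C \<alpha> (fst i)) (fmul C \<beta> (snd i))" by (auto simp: vcomb_def)
    then show "x \<in> carrier F" using fsub_W[of C] by simp
  qed
  moreover have "length (vcomb C \<alpha> u \<beta> v) = U" using c by (simp add: vcomb_def)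
  ultimately show ?thesis using c(5) unfolding piv_def by blast
qed

lemma elim_C:
  assumes r: "set r \<subseteq> carrier F" and vs: "list_all2 (piv U) \<pi>s vs" "sorted_wrt (<) \<pi>s"
    and rs: "\<forall>r'\<in>rs. set r' \<subseteq> carrier F \<and> (\<forall>v\<in>set vs. dot r' v = \<zero>)"
  shows "(\<exists>\<pi>s'. list_all2 (piv U) \<pi>s' (elim C r vs) \<and> sorted_wrt (<) \<pi>s') \<and>
    (\<forall>r'\<in>insert r rs. set r' \<subseteq> carrier F \<and> (\<forall>v\<in>set (elim C r vs). dot r' v = \<zero>)) \<and> length vs \<le> Suc (length (elim C r vs))"
proof -
  have pv: "length v = U \<and> set v \<subseteq> carrier F" if "v \<in> set vs" for v
    using vs(1) that by (auto simp: list_all2_conv_all_nth in_set_conv_nth piv_def)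
  let ?P = "\<lambda>v. dotp C r v = fz C"
  have P: "?P v \<longleftrightarrow> dot r v = \<zero>" if "v \<in> set vs" for v using dotp_C[OF r] pv[OF that] by simp
  let ?pre = "takeWhile ?P vs"
  have pre: "dot r v = \<zero> \<and> v \<in> set vs" if "v \<in> set ?pre" for v using set_takeWhileD[OF that] P by blast
  show ?thesis
  proof (cases "dropWhile ?P vs")
    case Nil
    have el: "elim C r vs = ?pre" unfolding elim_def Nil by (simp only: list.case append_Nil2)
    have "?pre = vs" using takeWhile_dropWhile_id[of ?P vs] Nil by simp
    then have "elim C r vs = vs" using el by simp
    moreover have "\<forall>v\<in>set vs. dot r v = \<zero>"
    proof
      fix v assume "v \<in> set vs"
      then have "v \<in> set ?pre" by (simp only: \<open>?pre = vs\<close>)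
      then show "dot r v = \<zero>" using pre by blast
    qed
    ultimately show ?thesis using vs rs r by auto
  next
    case (Cons v post)
    let ?c = "\<lambda>u. vcomb C (dotp C r v) u (dotp C r u) v"
    have el: "elim C r vs = ?pre @ map ?c post" unfolding elim_def Cons by (simp only: list.case)
    have "?pre @ dropWhile ?P vs = vs" by (rule takeWhile_dropWhile_id)
    then have vse: "vs = ?pre @ v # post" unfolding Cons by (rule sym)
    have vin: "v \<in> set vs" using vse by (metis in_set_conv_decomp)
    have pin: "u \<in> set vs" if "u \<in> set post" for u using vse that by (metis Un_iff list.set_intros(2) set_append)
    have "\<not> ?P v" using Cons by (simp only: dropWhile_eq_Cons_conv not_False_eq_True)
    then have \<alpha>: "dotp C r v \<in> carrier F" "dotp C r v \<noteq> \<zero>" "dotp C r v = dot r v"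
      using P[OF vin] dotp_C[OF r] pv[OF vin] r by auto
    have \<beta>: "dotp C r u \<in> carrier F" "dotp C r u = dot r u" if "u \<in> set post" for u
      using dotp_C[OF r] pv[OF pin[OF that]] r by auto
    obtain \<pi>1 \<pi>2' where p1: "\<pi>s = \<pi>1 @ \<pi>2'" "list_all2 (piv U) \<pi>1 ?pre" "list_all2 (piv U) \<pi>2' (v # post)"
      using vs(1) vse by (metis list_all2_append2)
    then obtain \<pi> \<pi>2 where p2: "\<pi>2' = \<pi> # \<pi>2" "piv U \<pi> v" "list_all2 (piv U) \<pi>2 post" by (auto simp: list_all2_Cons2)
    have lt: "\<forall>\<sigma>\<in>set \<pi>2. \<pi> < \<sigma>" and so: "sorted_wrt (<) (\<pi>1 @ \<pi>2)" using vs(2) unfolding p1(1) p2(1) by (auto simp: sorted_wrt_append)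
    have "list_all2 (piv U) \<pi>2 (map ?c post)"
      unfolding list_all2_conv_all_nth
    proof (intro conjI allI impI)
      show "length \<pi>2 = length (map ?c post)" using p2(3) by (simp add: list_all2_lengthD)
      fix i assume i: "i < length \<pi>2"
      then have ip: "i < length post" using p2(3) by (simp add: list_all2_lengthD)
      have "piv U (\<pi>2 ! i) (?c (post ! i))"
        by (rule piv_comb[OF p2(2) _ _ \<alpha>(1,2) \<beta>(1)[OF nth_mem[OF ip]]]) (use p2(3) i lt in \<open>auto simp: list_all2_conv_all_nth\<close>)
      then show "piv U (\<pi>2 ! i) (map ?c post ! i)" using ip by simp
    qed
    then have "list_all2 (piv U) (\<pi>1 @ \<pi>2) (elim C r vs)" unfolding el using p1(2) by (simp add: list_all2_appendI)
    moreover have "dot r' x = \<zero>" if r': "r' \<in> insert r rs" and x: "x \<in> set (elim C r vs)" for r' x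
    proof (cases "x \<in> set ?pre")
      case True
      then show ?thesis using pre[OF True] rs r' by blast
    next
      case False
      then obtain u where u: "u \<in> set post" "x = ?c u" using x unfolding el by auto
      have r'c: "set r' \<subseteq> carrier F" using r' r rs by blast
      note pu = pv[OF pin[OF u(1)]] and pvv = pv[OF vin]
      have x': "x = map2 (\<lambda>a b. dotp C r v \<otimes> a \<ominus> dotp C r u \<otimes> b) u v"
        unfolding u(2) by (rule vcomb_C) (use pu pvv \<alpha> \<beta>[OF u(1)] in auto)
      have d: "dot r' x = dotp C r v \<otimes> dot r' u \<ominus> dotp C r u \<otimes> dot r' v"
        unfolding x' by (rule dot_linear) (use pu pvv \<alpha> \<beta>[OF u(1)] r'c in auto)
      show ?thesis
      proof (cases "r' = r")
        case True
        then show ?thesis using d \<alpha> \<beta>[OF u(1)] by (simp add: a_minus_def m_comm r_neg)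
      next
        case False
        then have "dot r' u = \<zero>" "dot r' v = \<zero>" using r' rs pin[OF u(1)] vin by blast+
        then show ?thesis using d \<alpha> \<beta>[OF u(1)] by (simp add: a_minus_def)
      qed
    qed
    moreover have "length vs \<le> Suc (length (elim C r vs))" using arg_cong[OF vse, of length] unfolding el by simp
    ultimately show ?thesis using so r rs by blast
  qed
qed

lemma erow_C: "erow C [0..<U] i = map (\<lambda>j. if j = i then \<one> else \<zero>) [0..<U]"
  by (simp add: erow_def)

lemma piv_erow: "i < U \<Longrightarrow> piv U i (erow C [0..<U] i)"
  by (auto simp: piv_def erow_C)

text \<open>The start consists of \<open>U\<close> unit vectors and each row costs at most one
  vector, so fewer than \<open>U\<close> rows leave one; its entry at \<open>\<pi>\<close> shows
  that it is nonzero.\<close>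

lemma nullvecs_C:
  assumes rws: "\<forall>r\<in>set rws. set r \<subseteq> carrier F" and lt: "length rws < U"
  shows "\<exists>v vs \<pi>. nullvecs C rws [0..<U] = v # vs \<and> piv U \<pi> v \<and> (\<forall>r\<in>set rws. dot r v = \<zero>)"
proof -
  have "(\<exists>\<pi>s. list_all2 (piv U) \<pi>s (nullvecs C rws [0..<U]) \<and> sorted_wrt (<) \<pi>s) \<and>
      (\<forall>r\<in>set rws. set r \<subseteq> carrier F \<and> (\<forall>v\<in>set (nullvecs C rws [0..<U]). dot r v = \<zero>)) \<and>
      U \<le> length rws + length (nullvecs C rws [0..<U])"
    using rws
  proof (induction rws rule: rev_induct)
    case Nil
    have "list_all2 (piv U) [0..<U] (nullvecs C [] [0..<U])"
      using piv_erow by (simp add: nullvecs_def list_all2_conv_all_nth)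
    then show ?case using sorted_wrt_upt[of 0 U] by (auto simp: nullvecs_def)
  next
    case (snoc r rws)
    let ?v = "nullvecs C rws [0..<U]"
    have e: "nullvecs C (rws @ [r]) [0..<U] = elim C r ?v" by (simp add: nullvecs_def)
    have IH: "(\<exists>\<pi>s. list_all2 (piv U) \<pi>s ?v \<and> sorted_wrt (<) \<pi>s) \<and>
      (\<forall>r\<in>set rws. set r \<subseteq> carrier F \<and> (\<forall>v\<in>set ?v. dot r v = \<zero>)) \<and> U \<le> length rws + length ?v"
      by (rule snoc.IH) (use snoc.prems in simp)
    then obtain \<pi>s where \<pi>s: "list_all2 (piv U) \<pi>s ?v" "sorted_wrt (<) \<pi>s" by blast
    have rc: "set r \<subseteq> carrier F" using snoc.prems by simp
    from elim_C[OF rc \<pi>s conjunct1[OF conjunct2[OF IH]]] IH show ?case unfolding e by auto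
  qed
  note N = this
  then obtain v vs where v: "nullvecs C rws [0..<U] = v # vs" using lt by (cases "nullvecs C rws [0..<U]") auto
  then obtain \<pi> where "piv U \<pi> v" using N by (auto simp: list_all2_Cons2)
  then show ?thesis using v N by auto
qed

end

section \<open>Vanishing to high order along an agreeing polynomial\<close>

context cring
begin

lemma lsum_concat: "(\<And>x. x \<in> set (concat xss) \<Longrightarrow> f x \<in> carrier R) \<Longrightarrow> lsum f (concat xss) = lsum (\<lambda>xs. lsum f xs) xss"
proof (induction xss)
  case (Cons xs xss)
  have "lsum f (concat xss) = lsum (\<lambda>xs. lsum f xs) xss" by (rule Cons.IH) (use Cons.prems in auto)
  moreover have "lsum f (xs @ concat xss) = lsum f xs \<oplus> lsum f (concat xss)"
    by (rule lsum_append) (use Cons.prems in auto)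
  ultimately show ?case by simp
qed simp

lemma lsum_product:
  assumes f: "\<And>x. x \<in> set xs \<Longrightarrow> f x \<in> carrier R" and g: "\<And>y. y \<in> set ys \<Longrightarrow> g y \<in> carrier R"
  shows "lsum f xs \<otimes> lsum g ys = lsum (\<lambda>u. f (fst u) \<otimes> g (snd u)) (List.product xs ys)"
  using f
proof (induction xs)
  case Nil
  have "lsum g ys \<in> carrier R" by (rule lsum_closed[OF g])
  then show ?case by simp
next
  case (Cons x xs)
  have gy: "lsum g ys \<in> carrier R" by (rule lsum_closed[OF g])
  have fx: "f x \<in> carrier R" and fs: "lsum f xs \<in> carrier R" using Cons.prems by (simp_all)
  have IH: "lsum f xs \<otimes> lsum g ys = lsum (\<lambda>u. f (fst u) \<otimes> g (snd u)) (List.product xs ys)"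
    by (rule Cons.IH) (use Cons.prems in simp)
  have "lsum (\<lambda>u. f (fst u) \<otimes> g (snd u)) (List.product (x # xs) ys) =
      lsum (\<lambda>u. f (fst u) \<otimes> g (snd u)) (map (Product_Type.Pair x) ys) \<oplus> lsum (\<lambda>u. f (fst u) \<otimes> g (snd u)) (List.product xs ys)"
    unfolding product.simps by (rule lsum_append) (use Cons.prems g in auto)
  also have "lsum (\<lambda>u. f (fst u) \<otimes> g (snd u)) (map (Product_Type.Pair x) ys) = f x \<otimes> lsum g ys"
    unfolding lsum_map fst_conv snd_conv by (rule lsum_distr[OF fx g])
  finally show ?case using fx fs gy by (simp add: l_distr IH)
qed

lemma hev_append: "set A \<subseteq> carrier R \<Longrightarrow> set B \<subseteq> carrier R \<Longrightarrow> y \<in> carrier R \<Longrightarrow> hev (A @ B) y = hev A y \<oplus> y [^] length A \<otimes> hev B y"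
proof (induction A)
  case (Cons a A)
  have "y \<otimes> (y [^] length A \<otimes> hev B y) = y [^] length (a # A) \<otimes> hev B y"
    using Cons.prems by (simp add: m_ac)
  then show ?case using Cons by (simp add: r_distr a_assoc)
qed simp

end

lemma (in ring_hom_cring) hom_lsum: "(\<And>i. i \<in> set is \<Longrightarrow> f i \<in> carrier R) \<Longrightarrow> h (R.lsum f is) = S.lsum (\<lambda>i. h (f i)) is"
  by (induction "is") simp_all

text \<open>Converts between the double index (B, A) of a monomial and its position B D + A in the
  vector of unknowns.\<close>

lemma concat_map_upt:
  fixes D :: nat
  assumes "D > 0"
  shows "concat (map (\<lambda>B. map (\<lambda>A. g B A) [0..<D]) [0..<K]) = map (\<lambda>i. g (i div D) (i mod D)) [0..<K * D]"
proof (induction K)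
  case (Suc K)
  have "[0..<Suc K * D] = [0..<K * D] @ map (\<lambda>A. A + K * D) [0..<D]"
    unfolding map_add_upt using upt_add_eq_append[of 0 "K * D" D] by (simp add: add.commute)
  then show ?case using assms Suc by (simp del: upt_Suc add: upt_Suc_append)
qed simp

context gfield
begin

lemma cg_add: "g \<in> carrier R \<Longrightarrow> cg g a a' \<Longrightarrow> cg g b b' \<Longrightarrow> cg g (a \<oplus>\<^bsub>R\<^esub> b) (a' \<oplus>\<^bsub>R\<^esub> b')"
proof -
  assume g: "g \<in> carrier R" and 1: "cg g a a'" and 2: "cg g b b'"
  then obtain h h' where h: "h \<in> carrier R" "a = a' \<oplus>\<^bsub>R\<^esub> h \<otimes>\<^bsub>R\<^esub> g" "h' \<in> carrier R" "b = b' \<oplus>\<^bsub>R\<^esub> h' \<otimes>\<^bsub>R\<^esub> g"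
    and ab: "a' \<in> carrier R" "b' \<in> carrier R" by (auto simp: cg_def)
  have "a \<oplus>\<^bsub>R\<^esub> b = (a' \<oplus>\<^bsub>R\<^esub> b') \<oplus>\<^bsub>R\<^esub> (h \<oplus>\<^bsub>R\<^esub> h') \<otimes>\<^bsub>R\<^esub> g" unfolding h(2,4) using g h(1,3) ab by (simp add: R.l_distr R.a_ac)
  then show ?thesis unfolding cg_def using h(1,3) ab by blast
qed

lemma cg_lsum: "g \<in> carrier R \<Longrightarrow> (\<And>i. i \<in> set is \<Longrightarrow> cg g (f i) (f' i)) \<Longrightarrow> cg g (R.lsum f is) (R.lsum f' is)"
  by (induction "is") (simp_all add: cg_refl cg_add)

lemma cg_weaken: "g \<in> carrier R \<Longrightarrow> t \<in> carrier R \<Longrightarrow> cg (t \<otimes>\<^bsub>R\<^esub> g) a a' \<Longrightarrow> cg g a a'"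
proof -
  assume g: "g \<in> carrier R" and t: "t \<in> carrier R" and "cg (t \<otimes>\<^bsub>R\<^esub> g) a a'"
  then obtain h where h: "h \<in> carrier R" "a' \<in> carrier R" "a = a' \<oplus>\<^bsub>R\<^esub> h \<otimes>\<^bsub>R\<^esub> (t \<otimes>\<^bsub>R\<^esub> g)" by (auto simp: cg_def)
  then have "a = a' \<oplus>\<^bsub>R\<^esub> (h \<otimes>\<^bsub>R\<^esub> t) \<otimes>\<^bsub>R\<^esub> g" using g t by (simp add: R.m_assoc)
  then show ?thesis unfolding cg_def using h t by blast
qed

lemma map_pc_R: "set cs \<subseteq> carrier F \<Longrightarrow> set (map pc cs) \<subseteq> carrier R"
  using pc_R by (auto simp del: pc_R)

lemma pc_ring_hom:
  "pc \<one> = \<one>\<^bsub>R\<^esub>" "a \<in> carrier F \<Longrightarrow> b \<in> carrier F \<Longrightarrow> pc (a \<oplus> b) = pc a \<oplus>\<^bsub>R\<^esub> pc b"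
  "a \<in> carrier F \<Longrightarrow> b \<in> carrier F \<Longrightarrow> pc (a \<otimes> b) = pc a \<otimes>\<^bsub>R\<^esub> pc b"
proof -
  interpret h: ring_hom_cring F R pc by (rule pc_hom)
  show "pc \<one> = \<one>\<^bsub>R\<^esub>" by (rule h.hom_one)
  show "a \<in> carrier F \<Longrightarrow> b \<in> carrier F \<Longrightarrow> pc (a \<oplus> b) = pc a \<oplus>\<^bsub>R\<^esub> pc b" by (rule h.hom_add)
  show "a \<in> carrier F \<Longrightarrow> b \<in> carrier F \<Longrightarrow> pc (a \<otimes> b) = pc a \<otimes>\<^bsub>R\<^esub> pc b" by (rule h.hom_mult)
qed

text \<open>Multiplying a polynomial in s by x + s and dropping the coefficient of s^m changes the
  result by a multiple of s^m only. So the rows represent powers of x + s modulo s^m, without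
  divisions and hence in every characteristic.\<close>

lemma hrow_step:
  assumes x: "x \<in> carrier F" and rw: "set rw \<subseteq> carrier F" "length rw = m" "m > 0"
  defines "rw' \<equiv> vadd C (smulp C x rw) (fz C # rw)"
  shows "set rw' \<subseteq> carrier F" "length rw' = m"
    "s \<in> carrier R \<Longrightarrow> cg (s [^]\<^bsub>R\<^esub> m) ((pc x \<oplus>\<^bsub>R\<^esub> s) \<otimes>\<^bsub>R\<^esub> R.hev (map pc rw) s) (R.hev (map pc rw') s)"
proof -
  obtain r0 c where r: "rw = r0 @ [c]" using rw(2,3) by (cases rw rule: rev_cases) auto
  have cl: "set r0 \<subseteq> carrier F" "c \<in> carrier F" using rw(1) r by auto
  have l0: "m = Suc (length r0)" using rw(2) r by simp
  have sm: "smulp C x rw = map ((\<otimes>) x) rw" by (rule smulp_C[OF x rw(1)])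
  have sc: "set (map ((\<otimes>) x) rw) \<subseteq> carrier F" using x rw(1) by auto
  have zc: "set (\<zero> # r0) \<subseteq> carrier F" using cl by simp
  have "rw' = map2 (\<oplus>) (map ((\<otimes>) x) rw) (\<zero> # rw)"
    unfolding rw'_def sm by (rule trans[OF vadd_C]) (use sc rw(1) in auto)
  \<comment> \<open>\<open>zip\<close> stops at the shorter list, which discards the top coefficient
    \<open>c\<close> of the shifted row.\<close>
  also have "\<dots> = map2 (\<oplus>) (map ((\<otimes>) x) rw) (\<zero> # r0)"
    using l0 rw(2) zip_append2[of "map ((\<otimes>) x) rw" "\<zero> # r0" "[c]"] unfolding r by simp
  finally have e: "rw' = map2 (\<oplus>) (map ((\<otimes>) x) rw) (\<zero> # r0)" .
  show "set rw' \<subseteq> carrier F" unfolding e by (rule set_map2_closed[OF sc zc])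
  show "length rw' = m" unfolding e using l0 rw(2) by simp
  assume s: "s \<in> carrier R"
  have l: "length (map pc (map ((\<otimes>) x) rw)) = length (map pc (\<zero> # r0))" using l0 rw(2) by simp
  have "map pc (map2 (\<oplus>) A B) = map2 (\<oplus>\<^bsub>R\<^esub>) (map pc A) (map pc B)" if "set A \<subseteq> carrier F" "set B \<subseteq> carrier F" for A B
    using that
  proof (induction A arbitrary: B)
    case (Cons a A)
    then show ?case by (cases B) (auto simp: pc_ring_hom)
  qed simp
  then have "R.hev (map pc rw') s = R.hev (map2 (\<oplus>\<^bsub>R\<^esub>) (map pc (map ((\<otimes>) x) rw)) (map pc (\<zero> # r0))) s"
    unfolding e using sc zc by metis
  also have "\<dots> = R.hev (map pc (map ((\<otimes>) x) rw)) s \<oplus>\<^bsub>R\<^esub> R.hev (map pc (\<zero> # r0)) s"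
    by (rule R.hev_map2[OF l map_pc_R[OF sc] map_pc_R[OF zc] s])
  also have "map pc (map ((\<otimes>) x) rw) = map (\<lambda>q. q \<otimes>\<^bsub>R\<^esub> pc x) (map pc rw)"
    unfolding map_map o_def
  proof (rule map_cong[OF refl])
    fix a assume "a \<in> set rw"
    then have a: "a \<in> carrier F" using rw(1) by blast
    show "pc (x \<otimes> a) = pc a \<otimes>\<^bsub>R\<^esub> pc x" using pc_ring_hom(3)[OF x a] R.m_comm[OF pc_R[OF a] pc_R[OF x]] by simp
  qed
  also have "R.hev (map (\<lambda>q. q \<otimes>\<^bsub>R\<^esub> pc x) (map pc rw)) s = R.hev (map pc rw) s \<otimes>\<^bsub>R\<^esub> pc x"
    by (rule R.hev_map_mult[OF map_pc_R[OF rw(1)] s pc_R[OF x]])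
  also have "R.hev (map pc (\<zero> # r0)) s = s \<otimes>\<^bsub>R\<^esub> R.hev (map pc r0) s"
    unfolding list.map R.hev.simps pc_zero by (rule R.l_zero) (use R.hev_closed[OF map_pc_R[OF cl(1)] s] s in simp)
  finally have H': "R.hev (map pc rw') s = R.hev (map pc rw) s \<otimes>\<^bsub>R\<^esub> pc x \<oplus>\<^bsub>R\<^esub> s \<otimes>\<^bsub>R\<^esub> R.hev (map pc r0) s" .
  define h0 where "h0 = R.hev (map pc r0) s"
  define h1 where "h1 = R.hev (map pc rw) s"
  define px where "px = pc x"
  define c' where "c' = pc c"
  have h0: "h0 \<in> carrier R" unfolding h0_def by (rule R.hev_closed[OF map_pc_R[OF cl(1)] s])
  have h1: "h1 \<in> carrier R" unfolding h1_def by (rule R.hev_closed[OF map_pc_R[OF rw(1)] s])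
  have Xc: "px \<in> carrier R" "c' \<in> carrier R" unfolding px_def c'_def using x cl(2) by (simp_all only: pc_R)
  have "h1 = h0 \<oplus>\<^bsub>R\<^esub> s [^]\<^bsub>R\<^esub> length r0 \<otimes>\<^bsub>R\<^esub> R.hev [c'] s"
    unfolding h1_def h0_def r map_append using R.hev_append[OF map_pc_R[OF cl(1)] _ s, of "[c']"] Xc(2) by (simp add: c'_def)
  moreover have "R.hev [c'] s = c'" unfolding R.hev.simps using Xc s by simp
  ultimately have h1e: "h1 = h0 \<oplus>\<^bsub>R\<^esub> s [^]\<^bsub>R\<^esub> length r0 \<otimes>\<^bsub>R\<^esub> c'" by simp
  have "(px \<oplus>\<^bsub>R\<^esub> s) \<otimes>\<^bsub>R\<^esub> h1 = h1 \<otimes>\<^bsub>R\<^esub> px \<oplus>\<^bsub>R\<^esub> s \<otimes>\<^bsub>R\<^esub> h1"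
    using h1 Xc s by (simp add: R.l_distr R.r_distr R.m_ac)
  also have "s \<otimes>\<^bsub>R\<^esub> h1 = s \<otimes>\<^bsub>R\<^esub> h0 \<oplus>\<^bsub>R\<^esub> c' \<otimes>\<^bsub>R\<^esub> s [^]\<^bsub>R\<^esub> m"
    unfolding h1e l0 R.nat_pow_Suc using h0 Xc s by (simp add: R.r_distr R.m_ac)
  also have "h1 \<otimes>\<^bsub>R\<^esub> px \<oplus>\<^bsub>R\<^esub> (s \<otimes>\<^bsub>R\<^esub> h0 \<oplus>\<^bsub>R\<^esub> c' \<otimes>\<^bsub>R\<^esub> s [^]\<^bsub>R\<^esub> m) = R.hev (map pc rw') s \<oplus>\<^bsub>R\<^esub> c' \<otimes>\<^bsub>R\<^esub> s [^]\<^bsub>R\<^esub> m"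
    unfolding H' h1_def[symmetric] h0_def[symmetric] px_def[symmetric] using h0 h1 Xc s by (simp add: R.a_assoc)
  finally show "cg (s [^]\<^bsub>R\<^esub> m) ((pc x \<oplus>\<^bsub>R\<^esub> s) \<otimes>\<^bsub>R\<^esub> R.hev (map pc rw) s) (R.hev (map pc rw') s)"
    unfolding cg_def H' h1_def[symmetric] h0_def[symmetric] px_def[symmetric] using h0 h1 Xc s by blast
qed

lemma hrow_C:
  assumes x: "x \<in> carrier F" and m: "m > 0"
  shows "set (hrow C x [0..<m] As) \<subseteq> carrier F \<and> length (hrow C x [0..<m] As) = m \<and>
    (\<forall>s\<in>carrier R. cg (s [^]\<^bsub>R\<^esub> m) ((pc x \<oplus>\<^bsub>R\<^esub> s) [^]\<^bsub>R\<^esub> length As) (R.hev (map pc (hrow C x [0..<m] As)) s))"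
proof (induction As rule: rev_induct)
  case Nil
  have h: "hrow C x [0..<m] [] = \<one> # map (\<lambda>a. \<zero>) [1..<m]"
    using m by (simp add: hrow_def upt_conv_Cons)
  have "R.hev (map pc (hrow C x [0..<m] [])) s = \<one>\<^bsub>R\<^esub>" if s: "s \<in> carrier R" for s
  proof -
    have "R.hev (map pc (map (\<lambda>a. \<zero>) [1..<m])) s = \<zero>\<^bsub>R\<^esub>"
      by (rule R.hev_all_zero[OF _ s]) (simp add: pc_zero del: R_zero)
    then show ?thesis unfolding h list.map R.hev.simps pc_ring_hom(1) using s by (simp only: R.r_null R.r_zero R.one_closed)
  qed
  then show ?case using m by (auto simp: h cg_refl)
next
  case (snoc A As)
  let ?rw = "hrow C x [0..<m] As"
  have e: "hrow C x [0..<m] (As @ [A]) = vadd C (smulp C x ?rw) (fz C # ?rw)" by (simp add: hrow_def)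
  have r: "set ?rw \<subseteq> carrier F" "length ?rw = m" using snoc by auto
  note st = hrow_step[OF x r m]
  have "cg (s [^]\<^bsub>R\<^esub> m) ((pc x \<oplus>\<^bsub>R\<^esub> s) [^]\<^bsub>R\<^esub> length (As @ [A])) (R.hev (map pc (hrow C x [0..<m] (As @ [A]))) s)"
    if s: "s \<in> carrier R" for s
  proof -
    have sm: "s [^]\<^bsub>R\<^esub> m \<in> carrier R" and xs: "pc x \<oplus>\<^bsub>R\<^esub> s \<in> carrier R"
      using s x by (simp_all only: R.nat_pow_closed R.add.m_closed pc_R)
    have ih: "cg (s [^]\<^bsub>R\<^esub> m) ((pc x \<oplus>\<^bsub>R\<^esub> s) [^]\<^bsub>R\<^esub> length As) (R.hev (map pc ?rw) s)" using snoc s by blast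
    have "(pc x \<oplus>\<^bsub>R\<^esub> s) [^]\<^bsub>R\<^esub> length (As @ [A]) = (pc x \<oplus>\<^bsub>R\<^esub> s) \<otimes>\<^bsub>R\<^esub> (pc x \<oplus>\<^bsub>R\<^esub> s) [^]\<^bsub>R\<^esub> length As"
      using R.nat_pow_Suc2[OF xs] by simp
    moreover have "cg (s [^]\<^bsub>R\<^esub> m) ((pc x \<oplus>\<^bsub>R\<^esub> s) \<otimes>\<^bsub>R\<^esub> (pc x \<oplus>\<^bsub>R\<^esub> s) [^]\<^bsub>R\<^esub> length As) ((pc x \<oplus>\<^bsub>R\<^esub> s) \<otimes>\<^bsub>R\<^esub> R.hev (map pc ?rw) s)"
      by (rule cg_mult[OF sm cg_refl[OF sm xs] ih])
    ultimately show ?thesis unfolding e using cg_trans[OF sm _ st(3)[OF s]] by simp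
  qed
  then show ?case unfolding e using st(1,2) by auto
qed

lemma dot_gs_row:
  assumes D: "D > 0" and m: "m > 0" and x: "x \<in> carrier F" and y: "y \<in> carrier F" and v: "length v = K * D" and ab: "a < m" "b < m"
  shows "dot (gs_row C [0..<D] [0..<K] [0..<m] x y a b) v =
    lsum (\<lambda>i. (hrow C x [0..<m] [0..<i mod D] ! a \<otimes> hrow C y [0..<m] [0..<i div D] ! b) \<otimes> v ! i) [0..<K * D]" (is "_ = lsum ?f _")
    "set (gs_row C [0..<D] [0..<K] [0..<m] x y a b) \<subseteq> carrier F"
proof -
  let ?g = "\<lambda>B A. fmul C (getd (fz C) (hrow C x [0..<m] (take A [0..<D])) a) (getd (fz C) (hrow C y [0..<m] (take B [0..<K])) b)"
  have e: "gs_row C [0..<D] [0..<K] [0..<m] x y a b = map (\<lambda>i. ?g (i div D) (i mod D)) [0..<K * D]"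
    unfolding gs_row_def by (rule concat_map_upt[OF D])
  have hx: "hrow C x [0..<m] As ! a \<in> carrier F" "length (hrow C x [0..<m] As) = m" for As
    using hrow_C[OF x m, of As] ab(1) by (auto dest: nth_mem)
  have hy: "hrow C y [0..<m] As ! b \<in> carrier F" "length (hrow C y [0..<m] As) = m" for As
    using hrow_C[OF y m, of As] ab(2) by (auto dest: nth_mem)
  have g: "?g (i div D) (i mod D) = hrow C x [0..<m] [0..<i mod D] ! a \<otimes> hrow C y [0..<m] [0..<i div D] ! b"
    if "i < K * D" for i
  proof -
    have "i div D < K" using that by (simp add: less_mult_imp_div_less)
    moreover have "i mod D < D" using D by simp
    ultimately show ?thesis using hx hy ab by (simp add: getd_eq take_upt)
  qed
  have e': "gs_row C [0..<D] [0..<K] [0..<m] x y a b =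
      map (\<lambda>i. hrow C x [0..<m] [0..<i mod D] ! a \<otimes> hrow C y [0..<m] [0..<i div D] ! b) [0..<K * D]"
    unfolding e by (rule map_cong[OF refl]) (use g in simp)
  show "set (gs_row C [0..<D] [0..<K] [0..<m] x y a b) \<subseteq> carrier F" unfolding e' using hx hy by auto
  show "dot (gs_row C [0..<D] [0..<K] [0..<m] x y a b) v = lsum ?f [0..<K * D]"
    unfolding e' by (rule trans[OF dot_conv_nth]) (use v in \<open>auto intro!: lsum_cong\<close>)
qed

lemma linear_R: "x \<in> carrier F \<Longrightarrow> [\<one>, \<ominus> x] \<in> carrier R"
  by (simp add: in_R)

lemma root_divides:
  assumes f: "f \<in> carrier R" and x: "x \<in> carrier F" and r: "eval f x = \<zero>"
  shows "\<exists>t\<in>carrier R. f = [\<one>, \<ominus> x] \<otimes>\<^bsub>R\<^esub> t"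
proof (cases "f = []")
  case True
  then have "f = [\<one>, \<ominus> x] \<otimes>\<^bsub>R\<^esub> \<zero>\<^bsub>R\<^esub>" using R.r_null[OF linear_R[OF x]] by (simp add: R_zero)
  then show ?thesis using R.zero_closed by blast
next
  case False
  then have "is_root f x" using x r by (simp add: is_root_def)
  from is_root_imp_pdivides[OF f this] show ?thesis by (auto simp: pdivides_def factor_def)
qed

text \<open>With s = z - x and Y = w - y the sum becomes a polynomial in s and Y, where s divides Y.
  Modulo s^m, the coefficients of s^a Y^b with a + b < m vanish by the linear equations, and every
  other term is a multiple of s^(a+b), hence of s^m.\<close>

lemma gs_divides:
  assumes D: "D > 0" and m: "m > 0" and x: "x \<in> carrier F" and v: "length v = K * D" "set v \<subseteq> carrier F"
    and w: "w \<in> carrier R" "eval w x = y"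
    and N: "\<And>a b. a + b < m \<Longrightarrow> dot (gs_row C [0..<D] [0..<K] [0..<m] x y a b) v = \<zero>"
  shows "\<exists>h\<in>carrier R. R.lsum (\<lambda>i. pc (v ! i) \<otimes>\<^bsub>R\<^esub> (zz [^]\<^bsub>R\<^esub> (i mod D) \<otimes>\<^bsub>R\<^esub> w [^]\<^bsub>R\<^esub> (i div D))) [0..<K * D] = h \<otimes>\<^bsub>R\<^esub> [\<one>, \<ominus> x] [^]\<^bsub>R\<^esub> m"
proof -
  define s where "s = [\<one>, \<ominus> x]"
  define Y where "Y = w \<ominus>\<^bsub>R\<^esub> pc y"
  have y: "y \<in> carrier F" using w eval_hom(1)[OF x w(1)] by simp
  have s: "s \<in> carrier R" unfolding s_def by (rule linear_R[OF x])
  have px: "pc x \<in> carrier R" and py: "pc y \<in> carrier R" using x y by (simp_all only: pc_R)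
  have Y: "Y \<in> carrier R" unfolding Y_def by (rule R.minus_closed[OF w(1) py])
  have zz: "zz \<in> carrier R" by (rule pX_C(2))
  have cancel: "a \<oplus>\<^bsub>R\<^esub> (b \<ominus>\<^bsub>R\<^esub> a) = b" if "a \<in> carrier R" "b \<in> carrier R" for a b
    using R.a_lcomm[OF that R.a_inv_closed[OF that(1)]] that by (simp add: a_minus_def R.r_neg)
  have zs: "pc x \<oplus>\<^bsub>R\<^esub> s = zz" unfolding s_def lin_factor[OF x, symmetric] by (rule cancel[OF px zz])
  have wY: "pc y \<oplus>\<^bsub>R\<^esub> Y = w" unfolding Y_def by (rule cancel[OF py w(1)])
  have "eval Y x = \<zero>" unfolding Y_def eval_hom(5)[OF x w(1) py] eval_hom(9)[OF x y] w(2) using y by (simp add: a_minus_def r_neg)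
  from root_divides[OF Y x this] obtain t where t: "t \<in> carrier R" "Y = s \<otimes>\<^bsub>R\<^esub> t" unfolding s_def by blast
  define sm where "sm = s [^]\<^bsub>R\<^esub> m"
  have sm: "sm \<in> carrier R" unfolding sm_def by (rule R.nat_pow_closed[OF s])
  \<comment> \<open>\<open>hrow_C\<close> for y gives congruences modulo Y^m. Since s^m divides Y^m,
    they hold modulo s^m as well.\<close>
  have Ym: "Y [^]\<^bsub>R\<^esub> m = t [^]\<^bsub>R\<^esub> m \<otimes>\<^bsub>R\<^esub> sm"
    unfolding t(2) sm_def using R.nat_pow_distrib[OF s t(1)] R.m_comm[OF R.nat_pow_closed[OF s] R.nat_pow_closed[OF t(1)]] by simp
  define hx where "hx i = hrow C x [0..<m] [0..<i mod D]" for i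
  define hy where "hy i = hrow C y [0..<m] [0..<i div D]" for i
  have hx: "set (hx i) \<subseteq> carrier F" "length (hx i) = m" "cg sm (zz [^]\<^bsub>R\<^esub> (i mod D)) (R.hev (map pc (hx i)) s)" for i
    using hrow_C[OF x m, of "[0..<i mod D]"] s unfolding hx_def sm_def zs[symmetric] by auto
  have hy: "set (hy i) \<subseteq> carrier F" "length (hy i) = m" "cg sm (w [^]\<^bsub>R\<^esub> (i div D)) (R.hev (map pc (hy i)) Y)" for i
  proof -
    note h = hrow_C[OF y m, of "[0..<i div D]"]
    show "set (hy i) \<subseteq> carrier F" "length (hy i) = m" using h unfolding hy_def by auto
    have "cg (Y [^]\<^bsub>R\<^esub> m) ((pc y \<oplus>\<^bsub>R\<^esub> Y) [^]\<^bsub>R\<^esub> (i div D)) (R.hev (map pc (hy i)) Y)" using h Y unfolding hy_def by auto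
    then show "cg sm (w [^]\<^bsub>R\<^esub> (i div D)) (R.hev (map pc (hy i)) Y)" unfolding wY Ym
      by (rule cg_weaken[OF sm R.nat_pow_closed[OF t(1)]])
  qed
  define E where "E u = s [^]\<^bsub>R\<^esub> fst u \<otimes>\<^bsub>R\<^esub> Y [^]\<^bsub>R\<^esub> snd u" for u :: "nat \<times> nat"
  have E: "E u \<in> carrier R" for u unfolding E_def using s Y by (simp only: R.nat_pow_closed R.m_closed)
  define H where "H i u = hx i ! fst u \<otimes> hy i ! snd u" for i and u :: "nat \<times> nat"
  define us where "us = List.product [0..<m] [0..<m]"
  have us: "fst u < m \<and> snd u < m" if "u \<in> set us" for u using that by (auto simp: us_def)
  have hxc: "hx i ! a \<in> carrier F" and hyc: "hy i ! a \<in> carrier F" if "a < m" for i a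
    using hx(1,2)[of i] hy(1,2)[of i] that by (auto dest: nth_mem)
  have H: "H i u \<in> carrier F" if "u \<in> set us" for i u unfolding H_def using hxc hyc us[OF that] by simp
  have prod: "R.hev (map pc (hx i)) s \<otimes>\<^bsub>R\<^esub> R.hev (map pc (hy i)) Y = R.lsum (\<lambda>u. E u \<otimes>\<^bsub>R\<^esub> pc (H i u)) us" for i
  proof -
    have 1: "R.hev (map pc (hx i)) s = R.lsum (\<lambda>a. pc (hx i ! a) \<otimes>\<^bsub>R\<^esub> s [^]\<^bsub>R\<^esub> a) [0..<m]"
      unfolding R.hev_lsum[OF map_pc_R[OF hx(1)] s] length_map hx(2) by (rule R.lsum_cong) (simp add: hx(2))
    have 2: "R.hev (map pc (hy i)) Y = R.lsum (\<lambda>a. pc (hy i ! a) \<otimes>\<^bsub>R\<^esub> Y [^]\<^bsub>R\<^esub> a) [0..<m]"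
      unfolding R.hev_lsum[OF map_pc_R[OF hy(1)] Y] length_map hy(2) by (rule R.lsum_cong) (simp add: hy(2))
    have c1: "pc (hx i ! a) \<otimes>\<^bsub>R\<^esub> s [^]\<^bsub>R\<^esub> a \<in> carrier R" if "a \<in> set [0..<m]" for a
      using that hxc[of a i] s by (simp only: set_upt atLeastLessThan_iff pc_R R.m_closed R.nat_pow_closed)
    have c2: "pc (hy i ! a) \<otimes>\<^bsub>R\<^esub> Y [^]\<^bsub>R\<^esub> a \<in> carrier R" if "a \<in> set [0..<m]" for a
      using that hyc[of a i] Y by (simp only: set_upt atLeastLessThan_iff pc_R R.m_closed R.nat_pow_closed)
    show ?thesis unfolding 1 2
    proof (rule trans[OF R.lsum_product], goal_cases)
      case (1 a) then show ?case by (rule c1)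
    next
      case (2 a) then show ?case by (rule c2)
    next
      case 3
      show ?case unfolding us_def[symmetric]
      proof (rule R.lsum_cong)
        fix u assume "u \<in> set us"
        then have a: "fst u < m" "snd u < m" using us by auto
        define A where "A = pc (hx i ! fst u)"
        define B where "B = pc (hy i ! snd u)"
        have AB: "A \<in> carrier R" "B \<in> carrier R" unfolding A_def B_def using hxc[OF a(1)] hyc[OF a(2)] by (simp_all only: pc_R)
        have "pc (H i u) = A \<otimes>\<^bsub>R\<^esub> B" unfolding H_def A_def B_def by (rule pc_ring_hom(3)[OF hxc[OF a(1)] hyc[OF a(2)]])
        then show "pc (hx i ! fst u) \<otimes>\<^bsub>R\<^esub> s [^]\<^bsub>R\<^esub> fst u \<otimes>\<^bsub>R\<^esub> (pc (hy i ! snd u) \<otimes>\<^bsub>R\<^esub> Y [^]\<^bsub>R\<^esub> snd u) = E u \<otimes>\<^bsub>R\<^esub> pc (H i u)"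
          unfolding A_def[symmetric] B_def[symmetric] E_def using AB s Y by (simp add: R.m_ac)
      qed
    qed
  qed
  have vi: "v ! i \<in> carrier F" if "i < K * D" for i using v that by auto
  let ?P = "R.lsum (\<lambda>i. pc (v ! i) \<otimes>\<^bsub>R\<^esub> (zz [^]\<^bsub>R\<^esub> (i mod D) \<otimes>\<^bsub>R\<^esub> w [^]\<^bsub>R\<^esub> (i div D))) [0..<K * D]"
  have EH: "E u \<otimes>\<^bsub>R\<^esub> pc (H i u) \<in> carrier R" if "u \<in> set us" for i u by (rule R.m_closed[OF E pc_R[OF H[OF that]]])
  have Hv: "H i u \<otimes> v ! i \<in> carrier F" if "u \<in> set us" "i < K * D" for i u by (rule m_closed[OF H[OF that(1)] vi[OF that(2)]])
  have EHv: "E u \<otimes>\<^bsub>R\<^esub> pc (H i u \<otimes> v ! i) \<in> carrier R" if "u \<in> set us" "i < K * D" for i u by (rule R.m_closed[OF E pc_R[OF Hv[OF that]]])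
  \<comment> \<open>Each monomial z^A w^B is replaced by the product of its truncated expansions.
    Exchanging the sums afterwards turns the coefficient of s^a Y^b into the product of a row of the
    system with \<open>v\<close>.\<close>
  have "cg sm ?P (R.lsum (\<lambda>i. pc (v ! i) \<otimes>\<^bsub>R\<^esub> R.lsum (\<lambda>u. E u \<otimes>\<^bsub>R\<^esub> pc (H i u)) us) [0..<K * D])"
  proof (rule cg_lsum[OF sm])
    fix i assume "i \<in> set [0..<K * D]"
    then have i: "i < K * D" by simp
    show "cg sm (pc (v ! i) \<otimes>\<^bsub>R\<^esub> (zz [^]\<^bsub>R\<^esub> (i mod D) \<otimes>\<^bsub>R\<^esub> w [^]\<^bsub>R\<^esub> (i div D))) (pc (v ! i) \<otimes>\<^bsub>R\<^esub> R.lsum (\<lambda>u. E u \<otimes>\<^bsub>R\<^esub> pc (H i u)) us)"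
      unfolding prod[symmetric] by (rule cg_mult[OF sm cg_refl[OF sm pc_R[OF vi[OF i]]] cg_mult[OF sm hx(3) hy(3)]])
  qed
  also have "R.lsum (\<lambda>i. pc (v ! i) \<otimes>\<^bsub>R\<^esub> R.lsum (\<lambda>u. E u \<otimes>\<^bsub>R\<^esub> pc (H i u)) us) [0..<K * D] =
      R.lsum (\<lambda>i. R.lsum (\<lambda>u. E u \<otimes>\<^bsub>R\<^esub> pc (H i u \<otimes> v ! i)) us) [0..<K * D]"
  proof (rule R.lsum_cong)
    fix i assume "i \<in> set [0..<K * D]"
    then have i: "i < K * D" by simp
    have "pc (v ! i) \<otimes>\<^bsub>R\<^esub> R.lsum (\<lambda>u. E u \<otimes>\<^bsub>R\<^esub> pc (H i u)) us = R.lsum (\<lambda>u. pc (v ! i) \<otimes>\<^bsub>R\<^esub> (E u \<otimes>\<^bsub>R\<^esub> pc (H i u))) us"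
      by (rule R.lsum_distr[symmetric, OF pc_R[OF vi[OF i]] EH])
    also have "\<dots> = R.lsum (\<lambda>u. E u \<otimes>\<^bsub>R\<^esub> pc (H i u \<otimes> v ! i)) us"
    proof (rule R.lsum_cong)
      fix u assume u: "u \<in> set us"
      show "pc (v ! i) \<otimes>\<^bsub>R\<^esub> (E u \<otimes>\<^bsub>R\<^esub> pc (H i u)) = E u \<otimes>\<^bsub>R\<^esub> pc (H i u \<otimes> v ! i)"
        unfolding pc_ring_hom(3)[OF H[OF u] vi[OF i]] using E[of u] pc_R[OF H[OF u, of i]] pc_R[OF vi[OF i]] by (simp add: R.m_ac del: pc_R)
    qed
    finally show "pc (v ! i) \<otimes>\<^bsub>R\<^esub> R.lsum (\<lambda>u. E u \<otimes>\<^bsub>R\<^esub> pc (H i u)) us = R.lsum (\<lambda>u. E u \<otimes>\<^bsub>R\<^esub> pc (H i u \<otimes> v ! i)) us" .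
  qed
  also have "\<dots> = R.lsum (\<lambda>u. R.lsum (\<lambda>i. E u \<otimes>\<^bsub>R\<^esub> pc (H i u \<otimes> v ! i)) [0..<K * D]) us"
    by (rule R.lsum_swap) (rule EHv, simp_all)
  also have "\<dots> = R.lsum (\<lambda>u. E u \<otimes>\<^bsub>R\<^esub> pc (lsum (\<lambda>i. H i u \<otimes> v ! i) [0..<K * D])) us"
  proof (rule R.lsum_cong)
    fix u assume u: "u \<in> set us"
    interpret h: ring_hom_cring F R pc by (rule pc_hom)
    have a: "pc (lsum (\<lambda>i. H i u \<otimes> v ! i) [0..<K * D]) = R.lsum (\<lambda>i. pc (H i u \<otimes> v ! i)) [0..<K * D]"
      by (rule h.hom_lsum) (rule Hv[OF u], simp)
    show "R.lsum (\<lambda>i. E u \<otimes>\<^bsub>R\<^esub> pc (H i u \<otimes> v ! i)) [0..<K * D] = E u \<otimes>\<^bsub>R\<^esub> pc (lsum (\<lambda>i. H i u \<otimes> v ! i) [0..<K * D])"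
      unfolding a by (rule R.lsum_distr[OF E]) (rule pc_R[OF Hv[OF u]], simp)
  qed
  finally have 1: "cg sm ?P (R.lsum (\<lambda>u. E u \<otimes>\<^bsub>R\<^esub> pc (lsum (\<lambda>i. H i u \<otimes> v ! i) [0..<K * D])) us)" .
  have 2: "cg sm (R.lsum (\<lambda>u. E u \<otimes>\<^bsub>R\<^esub> pc (lsum (\<lambda>i. H i u \<otimes> v ! i) [0..<K * D])) us) (R.lsum (\<lambda>u. \<zero>\<^bsub>R\<^esub>) us)"
  proof (rule cg_lsum[OF sm])
    fix u assume u: "u \<in> set us"
    have l: "lsum (\<lambda>i. H i u \<otimes> v ! i) [0..<K * D] \<in> carrier F" by (rule lsum_closed) (rule Hv[OF u], simp)
    show "cg sm (E u \<otimes>\<^bsub>R\<^esub> pc (lsum (\<lambda>i. H i u \<otimes> v ! i) [0..<K * D])) \<zero>\<^bsub>R\<^esub>"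
    proof (cases "fst u + snd u < m")
      case True
      have "lsum (\<lambda>i. H i u \<otimes> v ! i) [0..<K * D] = \<zero>"
        using dot_gs_row(1)[OF D m x y v(1) conjunct1[OF us[OF u]] conjunct2[OF us[OF u]]] N[OF True] unfolding H_def hx_def hy_def by (rule trans[OF sym])
      then show ?thesis using R.r_null[OF E] cg_refl[OF sm R.zero_closed] by (simp only: pc_zero)
    next
      case False
      then obtain j where j: "fst u + snd u = j + m" by (metis add.commute le_Suc_ex not_less)
      have "E u = s [^]\<^bsub>R\<^esub> fst u \<otimes>\<^bsub>R\<^esub> (s [^]\<^bsub>R\<^esub> snd u \<otimes>\<^bsub>R\<^esub> t [^]\<^bsub>R\<^esub> snd u)"
        unfolding E_def t(2) R.nat_pow_distrib[OF s t(1)] ..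
      also have "\<dots> = s [^]\<^bsub>R\<^esub> (j + m) \<otimes>\<^bsub>R\<^esub> t [^]\<^bsub>R\<^esub> snd u"
        unfolding j[symmetric] R.nat_pow_mult[OF s, symmetric] using s t(1) by (simp add: R.m_assoc)
      also have "\<dots> = (s [^]\<^bsub>R\<^esub> j \<otimes>\<^bsub>R\<^esub> t [^]\<^bsub>R\<^esub> snd u) \<otimes>\<^bsub>R\<^esub> sm"
        unfolding R.nat_pow_mult[OF s, symmetric] sm_def using s t(1) by (simp add: R.m_ac)
      finally have e: "E u = (s [^]\<^bsub>R\<^esub> j \<otimes>\<^bsub>R\<^esub> t [^]\<^bsub>R\<^esub> snd u) \<otimes>\<^bsub>R\<^esub> sm" .
      define A where "A = s [^]\<^bsub>R\<^esub> j \<otimes>\<^bsub>R\<^esub> t [^]\<^bsub>R\<^esub> snd u"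
      define B where "B = pc (lsum (\<lambda>i. H i u \<otimes> v ! i) [0..<K * D])"
      have AB: "A \<in> carrier R" "B \<in> carrier R" unfolding A_def B_def using s t(1) l by (simp_all only: pc_R R.m_closed R.nat_pow_closed)
      have "E u \<otimes>\<^bsub>R\<^esub> B = \<zero>\<^bsub>R\<^esub> \<oplus>\<^bsub>R\<^esub> (A \<otimes>\<^bsub>R\<^esub> B) \<otimes>\<^bsub>R\<^esub> sm" unfolding e A_def[symmetric] using AB sm by (simp add: R.m_ac)
      then show ?thesis unfolding cg_def B_def[symmetric] using R.zero_closed R.m_closed[OF AB] by blast
    qed
  qed
  have 3: "R.lsum (\<lambda>u. \<zero>\<^bsub>R\<^esub>) us = \<zero>\<^bsub>R\<^esub>" by (rule R.lsum_zero) simp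
  have "cg sm ?P \<zero>\<^bsub>R\<^esub>" by (rule cg_trans[OF sm 1 2[unfolded 3]])
  then obtain h where h: "h \<in> carrier R" "?P = \<zero>\<^bsub>R\<^esub> \<oplus>\<^bsub>R\<^esub> h \<otimes>\<^bsub>R\<^esub> sm" unfolding cg_def by blast
  then have "?P = h \<otimes>\<^bsub>R\<^esub> sm" using R.l_zero[OF R.m_closed[OF h(1) sm]] by (rule_tac trans)
  then show ?thesis using h(1) unfolding sm_def s_def by blast
qed

lemma card_roots_mult:
  assumes P: "P \<in> carrier R" "P \<noteq> []" and S: "S \<subseteq> carrier F"
    and dv: "\<And>x. x \<in> S \<Longrightarrow> \<exists>h\<in>carrier R. P = h \<otimes>\<^bsub>R\<^esub> [\<one>, \<ominus> x] [^]\<^bsub>R\<^esub> m" and m: "m > 0"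
  shows "card S * m \<le> length P - 1"
proof -
  have am: "m \<le> alg_mult P x" if x: "x \<in> S" for x
  proof -
    obtain h where h: "h \<in> carrier R" "P = h \<otimes>\<^bsub>R\<^esub> [\<one>, \<ominus> x] [^]\<^bsub>R\<^esub> m" using dv[OF x] by blast
    have xc: "x \<in> carrier F" using x S by blast
    have "P = [\<one>, \<ominus> x] [^]\<^bsub>R\<^esub> m \<otimes>\<^bsub>R\<^esub> h" using h R.m_comm[OF h(1) R.nat_pow_closed[OF linear_R[OF xc]]] by metis
    then have "[\<one>, \<ominus> x] [^]\<^bsub>R\<^esub> m pdivides P" using h(1) unfolding pdivides_def factor_def by blast
    then show ?thesis by (rule alg_multE(2)[OF xc P])
  qed
  have sub: "S \<subseteq> rts P"
  proof
    fix x assume x: "x \<in> S"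
    have "alg_mult P x > 0" using am[OF x] m by simp
    then have "is_root P x" using alg_mult_gt_zero_iff_is_root[OF P(1)] by simp
    then show "x \<in> rts P" by (simp add: is_root_def rts_def)
  qed
  obtain cs where cs: "set cs = rts P" "distinct cs" using finite_distinct_list[OF finite_rts] by blast
  have "card S * m = (\<Sum>x\<in>S. m)" by simp
  also have "\<dots> \<le> (\<Sum>x\<in>S. alg_mult P x)" by (rule sum_mono) (rule am)
  also have "\<dots> \<le> (\<Sum>x\<in>rts P. alg_mult P x)" by (rule sum_mono2[OF finite_rts sub]) simp
  also have "\<dots> = sum_list (map (\<lambda>c. alg_mult P c) cs)" using sum_list_distinct_conv_sum_set[OF cs(2)] cs(1) by metis
  finally show ?thesis using sum_alg_mult(1)[OF P cs] by linarith
qed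

lemma length_lsum_le: "(\<And>i. i \<in> set is \<Longrightarrow> length (f i) \<le> n) \<Longrightarrow> length (R.lsum f is) \<le> n"
proof (induction "is")
  case (Cons i "is")
  have "length (R.lsum f is) \<le> n" by (rule Cons.IH) (use Cons.prems in simp)
  moreover have "length (f i) \<le> n" using Cons.prems by simp
  ultimately show ?case unfolding R.lsum.simps using length_add_le[of "f i" "R.lsum f is"] by linarith
qed (simp add: R_zero)

lemma length_mult_le: "a \<in> carrier R \<Longrightarrow> b \<in> carrier R \<Longrightarrow> length (a \<otimes>\<^bsub>R\<^esub> b) - 1 \<le> (length a - 1) + (length b - 1)"
proof (cases "a = [] \<or> b = []")
  case True
  assume "a \<in> carrier R" "b \<in> carrier R"
  then have "a \<otimes>\<^bsub>R\<^esub> b = []" using True R.l_null[of b] R.r_null[of a] by (auto simp: R_zero)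
  then show ?thesis by simp
next
  case False
  assume "a \<in> carrier R" "b \<in> carrier R"
  then show ?thesis using length_mult[of a b] False by simp
qed

lemma length_pow_le: "a \<in> carrier R \<Longrightarrow> length (a [^]\<^bsub>R\<^esub> (n::nat)) - 1 \<le> n * (length a - 1)"
proof (induction n)
  case (Suc n)
  have "length (a [^]\<^bsub>R\<^esub> n) - 1 \<le> n * (length a - 1)" by (rule Suc.IH[OF Suc.prems])
  then show ?case using length_mult_le[OF R.nat_pow_closed[OF Suc.prems] Suc.prems, of n] unfolding R.nat_pow_Suc mult_Suc by linarith
qed (simp add: R_one)

end

section \<open>Counting equations against unknowns\<close>

lemma length_concat_map_le: "(\<And>u. u \<in> set us \<Longrightarrow> length (f u) \<le> c) \<Longrightarrow> length (concat (map f us)) \<le> length us * c"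
proof (induction us)
  case (Cons u us)
  have "length (concat (map f us)) \<le> length us * c" by (rule Cons.IH) (use Cons.prems in simp)
  moreover have "length (f u) \<le> c" using Cons.prems by simp
  ultimately show ?case by simp
qed simp

lemma length_filter_upt: "length (filter P [0..<n]) = card {i. i < n \<and> P i}"
proof -
  have "length (filter P [0..<n]) = card (set (filter P [0..<n]))" by (rule distinct_card[symmetric]) simp
  also have "set (filter P [0..<n]) = {i. i < n \<and> P i}" by auto
  finally show ?thesis .
qed

lemma sum_list_triangle: "2 * sum_list (map (\<lambda>a. m - a) [0..<m]) = m * (m + 1)" for m :: nat
proof (induction m)
  case (Suc m)
  have "map (\<lambda>a. Suc m - a) [0..<Suc m] = Suc m # map (\<lambda>a. m - a) [0..<m]"
    by (simp add: upt_conv_Cons map_Suc_upt[symmetric] del: upt_Suc)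
  then show ?case using Suc by simp
qed simp

lemma sum_list_linear: "2 * sum_list (map (\<lambda>B. l * B) [0..<K]) + l * K = l * K * K" for K :: nat
proof (induction K)
  case (Suc K)
  have "2 * sum_list (map (\<lambda>B. l * B) [0..<Suc K]) + l * Suc K = (2 * sum_list (map (\<lambda>B. l * B) [0..<K]) + l * K) + 2 * (l * K) + l" by simp
  also have "\<dots> = l * Suc K * Suc K" unfolding Suc by (simp add: algebra_simps)
  finally show ?case .
qed simp

text \<open>There are at most N m (m + 1) / 2 vanishing conditions; for m = N l, the inequality N l
  + 1 <= t^2 bounds this by half of the K D unknowns, where K = N t and D = N l t. The degree
  conditions number at most the sum of l B over B < K, that is l K (K - 1) / 2, which is less than
  the other half because l K = D.\<close>

lemma length_gs_rows:
  assumes ys: "\<And>zs. zs \<in> set ys \<Longrightarrow> length zs = d" and l: "l > 0" and t: "t > 0" and N: "N = length xs * d" "N > 0" and lt: "N * l < t * t"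
  shows "length (gs_rows C [0..<N * l * t] [0..<N * t] [0..<N * l] l xs ys) < N * t * (N * l * t)"
proof -
  define m where "m = N * l"
  define D where "D = N * l * t"
  define K where "K = N * t"
  define T where "T = sum_list (map (\<lambda>a. m - a) [0..<m])"
  define S where "S = sum_list (map (\<lambda>B. l * B) [0..<K])"
  define A1 where "A1 = concat (map (\<lambda>u. concat (map (\<lambda>y. concat (map (\<lambda>a. map (\<lambda>b. gs_row C [0..<D] [0..<K] [0..<m] (fst u) y a b)
      (filter (\<lambda>b. a + b < length [0..<m]) [0..<m])) [0..<m])) (snd u))) (zip xs ys))"
  define A2 where "A2 = concat (map (\<lambda>B. map (\<lambda>A. erow C [0..<length [0..<K] * length [0..<D]] (B * length [0..<D] + A))
      (filter (\<lambda>A. length [0..<D] \<le> A + l * B) [0..<D])) [0..<K])"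
  have i: "length (filter (\<lambda>b. a + b < length [0..<m]) [0..<m]) \<le> m - a" for a
  proof -
    have "{i. i < m \<and> a + i < m} \<subseteq> {..<m - a}" by auto
    then have "card {i. i < m \<and> a + i < m} \<le> m - a" using card_mono[of "{..<m - a}"] by fastforce
    then show ?thesis by (simp add: length_filter_upt)
  qed
  have l1: "length (concat (map (\<lambda>a. map (\<lambda>b. gs_row C [0..<D] [0..<K] [0..<m] x y a b)
      (filter (\<lambda>b. a + b < length [0..<m]) [0..<m])) [0..<m])) \<le> T" for x y
    unfolding T_def length_concat map_map by (rule sum_list_mono) (use i in simp)
  have "length A1 \<le> length (zip xs ys) * (d * T)"
    unfolding A1_def
  proof (rule length_concat_map_le)
    fix u assume "u \<in> set (zip xs ys)"
    then have "snd u \<in> set ys" by (metis prod.collapse set_zip_rightD)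
    from ys[OF this] length_concat_map_le[of "snd u" "\<lambda>y. concat (map (\<lambda>a. map (\<lambda>b. gs_row C [0..<D] [0..<K] [0..<m] (fst u) y a b)
      (filter (\<lambda>b. a + b < length [0..<m]) [0..<m])) [0..<m])" T] l1
    show "length (concat (map (\<lambda>y. concat (map (\<lambda>a. map (\<lambda>b. gs_row C [0..<D] [0..<K] [0..<m] (fst u) y a b)
      (filter (\<lambda>b. a + b < length [0..<m]) [0..<m])) [0..<m])) (snd u))) \<le> d * T" by metis
  qed
  also have "\<dots> \<le> N * T" unfolding N(1) by simp
  finally have a1: "length A1 \<le> N * T" .
  have j: "length (filter (\<lambda>A. length [0..<D] \<le> A + c) [0..<D]) \<le> c" for c
  proof -
    have "{i. i < D \<and> D \<le> i + c} \<subseteq> {D - c..<D}" by auto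
    then have "card {i. i < D \<and> D \<le> i + c} \<le> card {D - c..<D}" by (rule card_mono[rotated]) simp
    then show ?thesis by (simp add: length_filter_upt)
  qed
  have a2: "length A2 \<le> S"
    unfolding A2_def S_def length_concat map_map by (rule sum_list_mono) (use j in simp)
  have len: "length (gs_rows C [0..<N * l * t] [0..<N * t] [0..<N * l] l xs ys) = length A1 + length A2"
    unfolding gs_rows_def A1_def A2_def length_append D_def K_def m_def ..
  have "N * (2 * T) = N * (m * (m + 1))" unfolding T_def sum_list_triangle ..
  also have "\<dots> = (N * N * l) * (N * l + 1)" unfolding m_def by (simp add: algebra_simps)
  also have "\<dots> \<le> (N * N * l) * (t * t)" by (rule mult_le_mono2) (use lt in simp)
  finally have b1: "2 * (N * T) \<le> N * t * (N * l * t)" by (simp add: algebra_simps)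
  have "2 * S + l * K = l * K * K" unfolding S_def by (rule sum_list_linear)
  also have "\<dots> = N * t * (N * l * t)" unfolding K_def by (simp add: algebra_simps)
  finally have b2: "2 * S + l * K = N * t * (N * l * t)" .
  have "l * K > 0" unfolding K_def using l t N by simp
  then show ?thesis unfolding len using a1 a2 b1 b2 by linarith
qed

lemma (in cring) lsum_delta: "(\<And>j. j < n \<Longrightarrow> g j \<in> carrier R) \<Longrightarrow> i < n \<Longrightarrow> lsum (\<lambda>j. (if j = i then \<one> else \<zero>) \<otimes> g j) [0..<n] = g i"
proof -
  assume g: "\<And>j. j < n \<Longrightarrow> g j \<in> carrier R" and i: "i < n"
  have e: "[0..<n] = [0..<i] @ i # [Suc i..<n]" using i by (metis le0 less_imp_le upt_conv_Cons upt_add_eq_append le_Suc_ex)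
  have z: "lsum (\<lambda>j. (if j = i then \<one> else \<zero>) \<otimes> g j) js = \<zero>" if "\<And>j. j \<in> set js \<Longrightarrow> j \<noteq> i \<and> j < n" for js
    by (rule lsum_zero) (use that g in auto)
  have z1: "lsum (\<lambda>j. (if j = i then \<one> else \<zero>) \<otimes> g j) [0..<i] = \<zero>" by (rule z) (use i in auto)
  have z2: "lsum (\<lambda>j. (if j = i then \<one> else \<zero>) \<otimes> g j) [Suc i..<n] = \<zero>" by (rule z) (use i in auto)
  have "lsum (\<lambda>j. (if j = i then \<one> else \<zero>) \<otimes> g j) [0..<n] =
      lsum (\<lambda>j. (if j = i then \<one> else \<zero>) \<otimes> g j) [0..<i] \<oplus> lsum (\<lambda>j. (if j = i then \<one> else \<zero>) \<otimes> g j) (i # [Suc i..<n])"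
    unfolding e by (rule lsum_append) (use g i in auto)
  then show ?thesis unfolding lsum.simps z1 z2 using g[OF i] by simp
qed

section \<open>Interpolation and decoding\<close>

context gfield
begin

definition agree :: "nat list list \<Rightarrow> nat list list list \<Rightarrow> nat list list \<Rightarrow> (nat list \<times> nat list list) list" where
  "agree xs ys w = filter (\<lambda>u. \<exists>y\<in>set (snd u). eval w (fst u) = y) (zip xs ys)"

text \<open>Connects the two views of the unknowns: a vector for the linear system, and a polynomial
  in Y over F[z] for the root finder.\<close>

lemma gs_poly_slices:
  assumes D: "D > 0" and v: "length v = K * D" "set v \<subseteq> carrier F" and w: "w \<in> carrier R"
  defines "Q \<equiv> map (\<lambda>B. normalize (rev (take D (drop (B * D) v)))) [0..<K]"
  shows "set Q \<subseteq> carrier R" "\<pi> < K * D \<Longrightarrow> v ! \<pi> \<noteq> \<zero> \<Longrightarrow> \<exists>q\<in>set Q. q \<noteq> []"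
    "R.hev Q w = R.lsum (\<lambda>i. pc (v ! i) \<otimes>\<^bsub>R\<^esub> (zz [^]\<^bsub>R\<^esub> (i mod D) \<otimes>\<^bsub>R\<^esub> w [^]\<^bsub>R\<^esub> (i div D))) [0..<K * D]" (is "_ = R.lsum ?f _")
proof -
  let ?s = "\<lambda>B. take D (drop (B * D) v)"
  have sl: "set (?s B) \<subseteq> carrier F" for B using v(2) set_take_subset[of D "drop (B * D) v"] set_drop_subset[of "B * D" v] by blast
  have bound: "B * D + A < K * D" if "B < K" "A < D" for A B
  proof -
    have "B * D + A < Suc B * D" using that by simp
    also have "\<dots> \<le> K * D" using that by (intro mult_le_mono1) simp
    finally show ?thesis .
  qed
  have len: "length (?s B) = D" if "B < K" for B
  proof -
    have "Suc B * D \<le> K * D" using that by (intro mult_le_mono1) simp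
    then show ?thesis using v(1) by simp
  qed
  have nth: "?s B ! A = v ! (B * D + A)" if "B < K" "A < D" for A B using that bound[OF that] v(1) by simp
  have "set (rev (?s B)) \<subseteq> carrier F" for B using sl by simp
  then show QR: "set Q \<subseteq> carrier R" unfolding Q_def using normalize_R by auto
  show "\<exists>q\<in>set Q. q \<noteq> []" if \<pi>: "\<pi> < K * D" "v ! \<pi> \<noteq> \<zero>"
  proof -
    have d: "\<pi> div D < K" "\<pi> mod D < D" using \<pi>(1) D by (simp_all add: less_mult_imp_div_less)
    have "?s (\<pi> div D) ! (\<pi> mod D) \<noteq> \<zero>" unfolding nth[OF d] using \<pi>(2) by simp
    moreover have "?s (\<pi> div D) ! (\<pi> mod D) \<in> set (rev (?s (\<pi> div D)))" using nth_mem[of "\<pi> mod D" "?s (\<pi> div D)"] d(2) len[OF d(1)] by simp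
    ultimately have "normalize (rev (?s (\<pi> div D))) \<noteq> []" using normalize_eq_Nil by blast
    then show ?thesis unfolding Q_def using d(1) by auto
  qed
  have vi: "pc (v ! i) \<in> carrier R" if "i < K * D" for i by (rule pc_R) (use v that in auto)
  have zz: "zz \<in> carrier R" by (rule pX_C(2))
  have f: "?f i \<in> carrier R" if "i < K * D" for i
    using vi[OF that] zz w by (simp only: R.m_closed R.nat_pow_closed)
  have slice: "normalize (rev (?s B)) \<otimes>\<^bsub>R\<^esub> w [^]\<^bsub>R\<^esub> B = R.lsum (\<lambda>A. ?f (B * D + A)) [0..<D]" if B: "B < K" for B
  proof -
    have wB: "w [^]\<^bsub>R\<^esub> B \<in> carrier R" by (rule R.nat_pow_closed[OF w])
    have "normalize (rev (?s B)) = R.lsum (\<lambda>A. map pc (?s B) ! A \<otimes>\<^bsub>R\<^esub> zz [^]\<^bsub>R\<^esub> A) [0..<D]"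
      using R.hev_lsum[OF map_pc_R[OF sl] zz, of B] hev_const[OF sl, of B] unfolding length_map len[OF B] by (rule_tac trans[OF sym])
    also have "\<dots> = R.lsum (\<lambda>A. pc (v ! (B * D + A)) \<otimes>\<^bsub>R\<^esub> zz [^]\<^bsub>R\<^esub> A) [0..<D]"
      by (rule R.lsum_cong) (use nth[OF B] len[OF B] in simp)
    finally have n: "normalize (rev (?s B)) = R.lsum (\<lambda>A. pc (v ! (B * D + A)) \<otimes>\<^bsub>R\<^esub> zz [^]\<^bsub>R\<^esub> A) [0..<D]" .
    have c: "pc (v ! (B * D + A)) \<otimes>\<^bsub>R\<^esub> zz [^]\<^bsub>R\<^esub> A \<in> carrier R" if "A \<in> set [0..<D]" for A
      using vi[OF bound[OF B]] that zz by (simp only: R.m_closed R.nat_pow_closed set_upt atLeastLessThan_iff)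
    have "normalize (rev (?s B)) \<otimes>\<^bsub>R\<^esub> w [^]\<^bsub>R\<^esub> B = w [^]\<^bsub>R\<^esub> B \<otimes>\<^bsub>R\<^esub> normalize (rev (?s B))"
      by (rule R.m_comm[OF _ wB]) (rule normalize_R, use sl in simp)
    also have "\<dots> = R.lsum (\<lambda>A. w [^]\<^bsub>R\<^esub> B \<otimes>\<^bsub>R\<^esub> (pc (v ! (B * D + A)) \<otimes>\<^bsub>R\<^esub> zz [^]\<^bsub>R\<^esub> A)) [0..<D]"
      unfolding n by (rule R.lsum_distr[symmetric, OF wB c])
    also have "\<dots> = R.lsum (\<lambda>A. ?f (B * D + A)) [0..<D]"
    proof (rule R.lsum_cong)
      fix A assume "A \<in> set [0..<D]"
      then have A: "A < D" by simp
      have "(B * D + A) mod D = A" "(B * D + A) div D = B" using A by simp_all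
      then show "w [^]\<^bsub>R\<^esub> B \<otimes>\<^bsub>R\<^esub> (pc (v ! (B * D + A)) \<otimes>\<^bsub>R\<^esub> zz [^]\<^bsub>R\<^esub> A) = ?f (B * D + A)"
        using vi[OF bound[OF B A]] wB zz by (simp add: R.m_ac del: pc_R)
    qed
    finally show ?thesis .
  qed
  have lQ: "length Q = K" unfolding Q_def by simp
  have "R.hev Q w = R.lsum (\<lambda>B. Q ! B \<otimes>\<^bsub>R\<^esub> w [^]\<^bsub>R\<^esub> B) [0..<K]" using R.hev_lsum[OF QR w] unfolding lQ .
  also have "\<dots> = R.lsum (\<lambda>B. R.lsum (\<lambda>A. ?f (B * D + A)) [0..<D]) [0..<K]"
    by (rule R.lsum_cong) (use slice in \<open>simp add: Q_def\<close>)
  also have "\<dots> = R.lsum (\<lambda>is. R.lsum ?f is) (map (\<lambda>B. map (\<lambda>A. B * D + A) [0..<D]) [0..<K])"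
    unfolding R.lsum_map ..
  also have "\<dots> = R.lsum ?f (concat (map (\<lambda>B. map (\<lambda>A. B * D + A) [0..<D]) [0..<K]))"
    by (rule R.lsum_concat[symmetric]) (rule f, simp add: concat_map_upt[OF D])
  also have "concat (map (\<lambda>B. map (\<lambda>A. B * D + A) [0..<D]) [0..<K]) = [0..<K * D]"
    unfolding concat_map_upt[OF D] by simp
  finally show "R.hev Q w = R.lsum ?f [0..<K * D]" .
qed

lemma gs_poly_C:
  assumes xs: "set xs \<subseteq> carrier F" "distinct xs" "xs \<noteq> []" and ys: "\<And>zs. zs \<in> set ys \<Longrightarrow> length zs = d \<and> set zs \<subseteq> carrier F"
    and pos: "l > 0" "t > 0" "d > 0" and lt: "length xs * d * l < t * t"
  defines "N \<equiv> length xs * d"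
  defines "Q \<equiv> gs_poly C [0..<N * l * t] [0..<N * t] [0..<N * l] l xs ys"
  shows "set Q \<subseteq> carrier R" "\<exists>q\<in>set Q. q \<noteq> []"
    "w \<in> carrier R \<Longrightarrow> length w \<le> l + 1 \<Longrightarrow> t \<le> length (agree xs ys w) \<Longrightarrow> R.hev Q w = \<zero>\<^bsub>R\<^esub>"
proof -
  define m where "m = N * l"
  define D where "D = N * l * t"
  define K where "K = N * t"
  let ?rws = "gs_rows C [0..<D] [0..<K] [0..<m] l xs ys"
  have N: "N > 0" using pos xs(3) by (simp add: N_def)
  have m: "m > 0" and D: "D > 0" using N pos by (simp_all add: m_def D_def)
  have zu: "fst u \<in> carrier F \<and> (\<forall>y\<in>set (snd u). y \<in> carrier F)" if "u \<in> set (zip xs ys)" for u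
  proof -
    have "(fst u, snd u) \<in> set (zip xs ys)" using that by simp
    then have "fst u \<in> set xs" "snd u \<in> set ys" by (blast dest: set_zip_leftD set_zip_rightD)+
    then show ?thesis using xs(1) ys by blast
  qed
  have rin: "set r \<subseteq> carrier F" if r: "r \<in> set ?rws" for r
  proof -
    have "(\<exists>u\<in>set (zip xs ys). \<exists>y\<in>set (snd u). \<exists>a b. a + b < m \<and> r = gs_row C [0..<D] [0..<K] [0..<m] (fst u) y a b) \<or>
        (\<exists>i. r = erow C [0..<K * D] i)"
      using r unfolding gs_rows_def by fastforce
    then consider (a) u y a b where "u \<in> set (zip xs ys)" "y \<in> set (snd u)" "a + b < m" "r = gs_row C [0..<D] [0..<K] [0..<m] (fst u) y a b"
      | (b) i where "r = erow C [0..<K * D] i"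
      by blast
    then show ?thesis
    proof cases
      case a
      have f: "fst u \<in> carrier F" "y \<in> carrier F" using zu[OF a(1)] a(2) by auto
      have "length (replicate (K * D) \<zero>) = K * D" by simp
      from dot_gs_row(2)[OF D m f this, of a b] show ?thesis using a(3,4) by simp
    next
      case b
      then show ?thesis by (auto simp: erow_C)
    qed
  qed
  have lr: "length ?rws < K * D" unfolding m_def D_def K_def
    by (rule length_gs_rows[OF _ pos(1,2) N_def[THEN meta_eq_to_obj_eq] N]) (use ys lt in \<open>auto simp: N_def\<close>)
  have rin': "\<forall>r\<in>set ?rws. set r \<subseteq> carrier F" using rin by blast
  obtain v vs \<pi> where v: "nullvecs C ?rws [0..<K * D] = v # vs" "piv (K * D) \<pi> v" "\<forall>r\<in>set ?rws. dot r v = \<zero>"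
    using nullvecs_C[OF rin' lr] by blast
  have vl: "length v = K * D" "set v \<subseteq> carrier F" "\<pi> < K * D" "v ! \<pi> \<noteq> \<zero>" using v(2) unfolding piv_def by auto
  have Qe: "Q = map (\<lambda>B. normalize (rev (take D (drop (B * D) v)))) [0..<K]"
    unfolding Q_def gs_poly_def D_def[symmetric] unfolding m_def[symmetric] K_def[symmetric] using v(1) by (simp add: pnorm_C)
  show "set Q \<subseteq> carrier R" unfolding Qe by (rule gs_poly_slices(1)[OF D vl(1,2) R.zero_closed])
  show "\<exists>q\<in>set Q. q \<noteq> []" unfolding Qe by (rule gs_poly_slices(2)[OF D vl(1,2) R.zero_closed vl(3,4)])
  assume w: "w \<in> carrier R" and lw: "length w \<le> l + 1" and t: "t \<le> length (agree xs ys w)"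
  define f where "f i = pc (v ! i) \<otimes>\<^bsub>R\<^esub> (zz [^]\<^bsub>R\<^esub> (i mod D) \<otimes>\<^bsub>R\<^esub> w [^]\<^bsub>R\<^esub> (i div D))" for i
  define P where "P = R.lsum f [0..<K * D]"
  have QP: "R.hev Q w = P" unfolding Qe P_def f_def by (rule gs_poly_slices(3)[OF D vl(1,2) w])
  have zz: "zz \<in> carrier R" by (rule pX_C(2))
  have vi: "v ! i \<in> carrier F" if "i < K * D" for i using vl that by auto
  have PR: "P \<in> carrier R" unfolding QP[symmetric] by (rule R.hev_closed[OF \<open>set Q \<subseteq> carrier R\<close> w])
  \<comment> \<open>The unit rows of the system force these coefficients to be zero, which keeps the
    degree of Q(z, w(z)) below D = m t.\<close>
  have v0: "v ! i = \<zero>" if i: "i < K * D" and b: "D \<le> i mod D + l * (i div D)" for i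
  proof -
    have "i div D < K" "i mod D < D" using i D by (simp_all add: less_mult_imp_div_less)
    moreover have "erow C [0..<K * D] (B * D + A) \<in> set ?rws" if "B < K" "A < D" "D \<le> A + l * B" for A B
      using that unfolding gs_rows_def by simp (intro disjI2 bexI[of _ B] imageI, auto)
    ultimately have "erow C [0..<K * D] (i div D * D + i mod D) \<in> set ?rws" using b by blast
    then have "dot (erow C [0..<K * D] i) v = \<zero>" using v(3) by simp
    moreover have "dot (erow C [0..<K * D] i) v = lsum (\<lambda>j. (if j = i then \<one> else \<zero>) \<otimes> v ! j) [0..<K * D]"
      unfolding erow_C by (rule trans[OF dot_conv_nth]) (use vl(1) in \<open>auto intro!: lsum_cong\<close>)
    ultimately show ?thesis using lsum_delta[of "K * D" "\<lambda>j. v ! j" i] vi i by simp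
  qed
  have lP: "length P \<le> D" unfolding P_def
  proof (rule length_lsum_le)
    fix i assume "i \<in> set [0..<K * D]"
    then have i: "i < K * D" by simp
    have wB: "w [^]\<^bsub>R\<^esub> (i div D) \<in> carrier R" and zA: "zz [^]\<^bsub>R\<^esub> (i mod D) \<in> carrier R" using w zz by (simp_all only: R.nat_pow_closed)
    have zw: "zz [^]\<^bsub>R\<^esub> (i mod D) \<otimes>\<^bsub>R\<^esub> w [^]\<^bsub>R\<^esub> (i div D) \<in> carrier R" by (rule R.m_closed[OF zA wB])
    show "length (f i) \<le> D"
    proof (cases "D \<le> i mod D + l * (i div D)")
      case True
      have "f i = \<zero>\<^bsub>R\<^esub>" unfolding f_def v0[OF i True] pc_zero by (rule R.l_null[OF zw])
      then show ?thesis by (simp add: R_zero)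
    next
      case False
      have "length (f i) - 1 \<le> (length (pc (v ! i)) - 1) + ((length (zz [^]\<^bsub>R\<^esub> (i mod D)) - 1) + (length (w [^]\<^bsub>R\<^esub> (i div D)) - 1))"
        unfolding f_def using length_mult_le[OF pc_R[OF vi[OF i]] zw] length_mult_le[OF zA wB] by linarith
      moreover have "length (pc (v ! i)) - 1 = 0" by (simp add: pc_def)
      moreover have "length (zz [^]\<^bsub>R\<^esub> (i mod D)) - 1 \<le> i mod D" using length_pow_le[OF zz, of "i mod D"] by (simp add: pX_C(1))
      moreover have "length (w [^]\<^bsub>R\<^esub> (i div D)) - 1 \<le> l * (i div D)"
      proof -
        have "(i div D) * (length w - 1) \<le> (i div D) * l" by (rule mult_le_mono2) (use lw in simp)
        then show ?thesis using length_pow_le[OF w, of "i div D"] unfolding mult.commute[of l] by linarith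
      qed
      ultimately show ?thesis using False by linarith
    qed
  qed
  \<comment> \<open>Otherwise t distinct roots of multiplicity m would require degree at least t m =
    D.\<close>
  have "P = []"
  proof (rule ccontr)
    assume P0: "P \<noteq> []"
    define S where "S = fst ` set (agree xs ys w)"
    have sub: "set (agree xs ys w) \<subseteq> set (zip xs ys)" by (auto simp: agree_def)
    have SF: "S \<subseteq> carrier F" unfolding S_def using sub zu by blast
    have "distinct (map fst (agree xs ys w))"
      unfolding agree_def by (rule distinct_map_filter) (use xs(2) in \<open>simp add: map_fst_zip_take\<close>)
    then have cS: "card S = length (agree xs ys w)" unfolding S_def using distinct_card by fastforce
    have "card S * m \<le> length P - 1"
    proof (rule card_roots_mult[OF PR P0 SF _ m])
      fix x assume "x \<in> S"
      then obtain u where u: "u \<in> set (agree xs ys w)" "x = fst u" unfolding S_def by blast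
      then obtain y where y: "y \<in> set (snd u)" "eval w x = y" unfolding agree_def by auto
      have uz: "u \<in> set (zip xs ys)" using u(1) sub by blast
      have x: "x \<in> carrier F" using zu[OF uz] u(2) by simp
      show "\<exists>h\<in>carrier R. P = h \<otimes>\<^bsub>R\<^esub> [\<one>, \<ominus> x] [^]\<^bsub>R\<^esub> m"
        unfolding P_def f_def
      proof (rule gs_divides[OF D m x vl(1,2) w y(2)])
        fix a b assume ab: "a + b < m"
        have "gs_row C [0..<D] [0..<K] [0..<m] x y a b \<in> set ?rws"
          unfolding gs_rows_def u(2) using uz y(1) ab by (force simp: u(2))
        then show "dot (gs_row C [0..<D] [0..<K] [0..<m] x y a b) v = \<zero>" using v(3) by blast
      qed
    qed
    moreover have "t * m \<le> card S * m" unfolding cS using t by (rule mult_le_mono1)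
    moreover have "t * m = D" by (simp add: D_def m_def)
    moreover have "length P > 0" using P0 by simp
    ultimately show False using lP by linarith
  qed
  then show "R.hev Q w = \<zero>\<^bsub>R\<^esub>" unfolding QP by (simp only: R_zero)
qed

lemma felt_R: "felt C Y \<in> carrier F"
  using p_gt1 by (auto simp: felt_def carrier_F md_C dm_C)

text \<open>For l = 0 the multiplicity m is 0 and there are no unknowns, so \<open>gs_poly\<close>
  returns []. The root finder must then report success without candidates.\<close>

lemma rr_Nil: "rr C as [] [0..<1] = (True, [])"
proof -
  have "rparts C as [] = []"
  proof -
    have "foldl (\<lambda>ps a. take 0 (g ps a)) [] zs = []" for g :: "nat list list list \<Rightarrow> nat list \<Rightarrow> nat list list list" and zs by (induction zs) auto
    moreover have "filter (\<lambda>h. 2 \<le> length h \<and> length h \<le> 0) hs = []" for hs :: "nat list list list" by (rule filter_False) auto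
    ultimately show ?thesis unfolding rparts_def list.size(3) by (simp only:)
  qed
  then have "fst (rrnode C as ([], []))" by (simp add: rrnode_def stripz_def pnorm_C uroots_def)
  then show ?thesis by (simp add: rr_def rrstep_def)
qed

text \<open>The final filter \<open>good\<close> makes every returned polynomial a solution;
  interpolation and root finding supply completeness.\<close>

lemma gs_decode_C:
  assumes xs: "set xs \<subseteq> carrier F" "distinct xs" "xs \<noteq> []" and ys: "\<And>zs. zs \<in> set ys \<Longrightarrow> length zs = d \<and> set zs \<subseteq> carrier F"
    and len: "length ys = length xs"
    and pos: "t > 0" "d > 0" and lt: "length xs * d * l < t * t"
  shows "separating (samples C S) \<Longrightarrow> fst (gs_decode C l t xs ys S)"
    "fst (gs_decode C l t xs ys S) \<Longrightarrow> distinct (snd (gs_decode C l t xs ys S)) \<and>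
      set (snd (gs_decode C l t xs ys S)) = {w \<in> carrier R. length w \<le> l + 1 \<and> t \<le> length (agree xs ys w)}"
proof -
  define as where "as = samples C S"
  define N where "N = length xs * d"
  define Q where "Q = gs_poly C [0..<N * l * t] [0..<N * t] [0..<N * l] l xs ys"
  define r where "r = rr C as Q [0..<l + 1]"
  have as: "set as \<subseteq> carrier F" unfolding as_def samples_def using felt_R by auto
  have "getd [] ys 0 \<in> set ys" using xs(3) len by (cases ys) (auto simp: getd_def)
  then have g: "length (getd [] ys 0) = d" using ys by blast
  have dec: "gs_decode C l t xs ys S = (fst r, dedup (filter (good C l t xs ys)
       (map (\<lambda>y. pnorm C [y]) (concat ys) @ map (\<lambda>u. pnorm C (fst u)) (snd r))))"
    unfolding gs_decode_def g Let_def r_def Q_def N_def as_def ..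
  have key: "(separating as \<longrightarrow> fst r) \<and> (fst r \<longrightarrow> (\<forall>nd\<in>set (snd r). set (fst nd) \<subseteq> carrier F) \<and>
    (\<forall>w\<in>carrier R. length w \<le> l + 1 \<longrightarrow> t \<le> length (agree xs ys w) \<longrightarrow>
       w \<in> set (map (\<lambda>y. pnorm C [y]) (concat ys) @ map (\<lambda>u. pnorm C (fst u)) (snd r))))"
  proof (cases "l = 0")
    case True
    have "nullvecs C rws [] = []" for rws
    proof -
      have "foldl (\<lambda>vs r. elim C r vs) [] rws = []" by (induction rws) (auto simp: elim_def)
      then show ?thesis by (simp add: nullvecs_def)
    qed
    then have "Q = []" unfolding Q_def gs_poly_def True by simp
    then have r: "r = (True, [])" unfolding r_def using rr_Nil by (simp add: True)
    \<comment> \<open>As t > 0, the constant w agrees with some data value y and is therefore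
      \<open>normalize [y]\<close>; the value y = 0 accounts for w = [].\<close>
    have "w \<in> set (map (\<lambda>y. pnorm C [y]) (concat ys))" if w: "w \<in> carrier R" "length w \<le> l + 1" "t \<le> length (agree xs ys w)" for w
    proof -
      have "agree xs ys w \<noteq> []" using w(3) pos by auto
      then obtain u where "u \<in> set (agree xs ys w)" by (cases "agree xs ys w") auto
      then obtain y where u: "(fst u, snd u) \<in> set (zip xs ys)" and y: "y \<in> set (snd u)" "eval w (fst u) = y" unfolding agree_def by auto
      have uu: "fst u \<in> set xs" "snd u \<in> set ys" using u by (blast dest: set_zip_leftD set_zip_rightD)+
      have "w = normalize [y]"
      proof (cases w)
        case Nil
        then show ?thesis using y(2) by simp
      next
        case (Cons c cs)
        then have wc: "w = [c]" using w(2) True by simp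
        then have "c \<in> carrier F" using w(1) R_set by fastforce
        then have "y = c" using y(2) wc xs(1) uu(1) by auto
        then show ?thesis using normalize_id[OF w(1)] wc by simp
      qed
      moreover have "y \<in> set (concat ys)" using y(1) uu(2) by auto
      ultimately show ?thesis by (auto simp: pnorm_C)
    qed
    then show ?thesis unfolding r by auto
  next
    case False
    then have l: "l > 0" by simp
    have Q: "set Q \<subseteq> carrier R" unfolding Q_def N_def by (rule gs_poly_C(1)[OF xs ys l pos lt])
    have nz: "\<exists>q\<in>set Q. q \<noteq> []" unfolding Q_def N_def by (rule gs_poly_C(2)[OF xs ys l pos lt])
    note R = rr_C[OF as Q nz, of "[0..<l + 1]", folded r_def]
    have "w \<in> set (map (\<lambda>u. pnorm C (fst u)) (snd r))" if f: "fst r" and w: "w \<in> carrier R" "length w \<le> l + 1" "t \<le> length (agree xs ys w)" for w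
    proof -
      have "R.hev Q w = \<zero>\<^bsub>R\<^esub>" unfolding Q_def N_def by (rule gs_poly_C(3)[OF xs ys l pos lt w])
      moreover have "length w \<le> length [0..<l + 1]" using w(2) by simp
      ultimately obtain nd where "nd \<in> set (snd r)" "w = normalize (fst nd)"
        using rr_complete[OF as Q nz f[unfolded r_def] w(1)] unfolding r_def by blast
      then show ?thesis by (auto simp: pnorm_C)
    qed
    moreover have "\<forall>nd\<in>set (snd r). set (fst nd) \<subseteq> carrier F" if "fst r" using R that unfolding nok_def by blast
    ultimately show ?thesis using R by auto
  qed
  show "separating (samples C S) \<Longrightarrow> fst (gs_decode C l t xs ys S)" using key unfolding dec as_def by simp
  assume "fst (gs_decode C l t xs ys S)"
  then have f: "fst r" unfolding dec by simp
  let ?cs = "map (\<lambda>y. pnorm C [y]) (concat ys) @ map (\<lambda>u. pnorm C (fst u)) (snd r)"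
  have cs: "w \<in> carrier R" if "w \<in> set ?cs" for w
  proof -
    from that consider y zs where "zs \<in> set ys" "y \<in> set zs" "w = normalize [y]" | u where "u \<in> set (snd r)" "w = normalize (fst u)"
      by (auto simp: pnorm_C)
    then show ?thesis
    proof cases
      case 1
      then have "y \<in> carrier F" using ys by blast
      then show ?thesis unfolding 1(3) by (intro normalize_R) simp
    next
      case 2
      then show ?thesis using key f normalize_R by blast
    qed
  qed
  have good: "good C l t xs ys w \<longleftrightarrow> length w \<le> l + 1 \<and> t \<le> length (agree xs ys w)" if w: "w \<in> carrier R" for w
  proof -
    have "filter (\<lambda>u. \<exists>y\<in>set (snd u). peval C w (fst u) = y) (zip xs ys) = agree xs ys w"
      unfolding agree_def
    proof (rule filter_cong[OF refl])
      fix u assume "u \<in> set (zip xs ys)"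
      then have "(fst u, snd u) \<in> set (zip xs ys)" by simp
      then have "fst u \<in> carrier F" using xs(1) by (blast dest: set_zip_leftD)
      then show "(\<exists>y\<in>set (snd u). peval C w (fst u) = y) = (\<exists>y\<in>set (snd u). eval w (fst u) = y)"
        using peval_C[OF R_set[OF w]] by simp
    qed
    then show ?thesis unfolding good_def by simp
  qed
  have "set (filter (good C l t xs ys) ?cs) = {w \<in> carrier R. length w \<le> l + 1 \<and> t \<le> length (agree xs ys w)}" (is "?A = ?B")
  proof
    show "?A \<subseteq> ?B"
    proof
      fix w assume "w \<in> ?A"
      then have "w \<in> set ?cs" "good C l t xs ys w" by (simp_all only: set_filter mem_Collect_eq)
      then show "w \<in> ?B" using good[OF cs] cs by blast
    qed
    show "?B \<subseteq> ?A"
    proof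
      fix w assume w: "w \<in> ?B"
      then have "w \<in> set ?cs" using key f by blast
      moreover have "good C l t xs ys w" using good w by blast
      ultimately show "w \<in> ?A" by (simp only: set_filter mem_Collect_eq simp_thms)
    qed
  qed
  then show "distinct (snd (gs_decode C l t xs ys S)) \<and>
      set (snd (gs_decode C l t xs ys S)) = {w \<in> carrier R. length w \<le> l + 1 \<and> t \<le> length (agree xs ys w)}"
    unfolding dec snd_conv using dedup[of "filter (good C l t xs ys) ?cs"] by simp
qed

end

section \<open>Random sample points and coin tosses\<close>

lemma digits_mod_eq:
  fixes q :: nat
  shows "(\<And>i. i < T \<Longrightarrow> Y div q ^ i mod q = Z div q ^ i mod q) \<Longrightarrow> Y mod q ^ T = Z mod q ^ T"
proof (induction T)
  case (Suc T)
  have "Y mod q ^ T = Z mod q ^ T" by (rule Suc.IH) (rule Suc.prems, simp)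
  moreover have "Y div q ^ T mod q = Z div q ^ T mod q" by (rule Suc.prems) simp
  ultimately show ?case unfolding power_Suc2 mod_mult2_eq by simp
qed simp

lemma inj_on_mod_div: "inj_on (\<lambda>Y :: nat. (Y mod M, Y div M)) A"
proof (rule inj_onI)
  fix Y Z assume "(Y mod M, Y div M) = (Z mod M, Z div M)"
  then have e: "Y mod M = Z mod M" "Y div M = Z div M" by (simp_all only: prod.inject)
  have "Y = Y div M * M + Y mod M" by simp
  also have "\<dots> = Z" unfolding e by simp
  finally show "Y = Z" .
qed

text \<open>Independence of the T base-q digits in counting form; the induction splits off the top
  digit.\<close>

lemma card_digits_le:
  fixes q :: nat
  assumes q: "q > 0" and B: "finite B"
  shows "card {Y. Y < q ^ T \<and> (\<forall>i<T. Y div q ^ i mod q \<in> B)} \<le> card B ^ T"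
proof (induction T)
  case 0
  have "{Y. Y < q ^ 0 \<and> (\<forall>i<0. Y div q ^ i mod q \<in> B)} = {0::nat}" by auto
  then show ?case by simp
next
  case (Suc T)
  let ?S = "\<lambda>T. {Y. Y < q ^ T \<and> (\<forall>i<T. Y div q ^ i mod q \<in> B)}"
  let ?f = "\<lambda>Y. (Y mod q ^ T, Y div q ^ T)"
  have "inj_on ?f (?S (Suc T))" by (rule inj_on_mod_div)
  moreover have "?f ` ?S (Suc T) \<subseteq> ?S T \<times> B"
  proof
    fix u assume "u \<in> ?f ` ?S (Suc T)"
    then obtain Y where Y: "Y < q ^ Suc T" "\<forall>i<Suc T. Y div q ^ i mod q \<in> B" and u: "u = ?f Y" by blast
    have "Y div q ^ T < q" using Y(1) by (simp add: less_mult_imp_div_less)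
    then have "Y div q ^ T \<in> B" using Y(2)[rule_format, of T] by simp
    moreover have "Y mod q ^ T div q ^ i mod q = Y div q ^ i mod q" if "i < T" for i
    proof -
      \<comment> \<open>The digit at position i survives reduction modulo q^T because q^(i+1)
        divides q^T.\<close>
      have e: "q ^ T = q ^ i * (q * q ^ (T - Suc i))" using that
        by (simp flip: power_Suc power_add)
      have "Y mod q ^ T div q ^ i = Y div q ^ i mod (q * q ^ (T - Suc i))" unfolding e mod_mult2_eq using q by simp
      then show ?thesis by (simp add: mod_mod_cancel)
    qed
    ultimately show "u \<in> ?S T \<times> B" unfolding u using Y(2) q by simp
  qed
  moreover have "finite (?S T \<times> B)" using B by simp
  ultimately have "card (?S (Suc T)) \<le> card (?S T \<times> B)" by (rule card_inj_on_le)
  also have "\<dots> \<le> card B ^ Suc T" using mult_le_mono1[OF Suc.IH, of "card B"] by (simp add: card_cartesian_product mult.commute)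
  finally show ?case .
qed

text \<open>Among the numbers below n each residue modulo M occurs at most
  \<open>n div M + 1\<close> times.\<close>

lemma card_mod_le:
  fixes M :: nat
  assumes "M > 0"
  shows "card {Y. Y < n \<and> P (Y mod M)} \<le> Suc (n div M) * card {Y. Y < M \<and> P Y}"
proof -
  let ?f = "\<lambda>Y. (Y mod M, Y div M)"
  have "inj_on ?f {Y. Y < n \<and> P (Y mod M)}" by (rule inj_on_mod_div)
  moreover have "?f ` {Y. Y < n \<and> P (Y mod M)} \<subseteq> {Y. Y < M \<and> P Y} \<times> {..n div M}"
    using assms by (auto intro!: div_le_mono)
  ultimately have "card {Y. Y < n \<and> P (Y mod M)} \<le> card ({Y. Y < M \<and> P Y} \<times> {..n div M})" by (rule card_inj_on_le) simp
  then show ?thesis by (simp add: card_cartesian_product mult.commute)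
qed

context gfield
begin

lemma bij_felt: "bij_betw (felt C) {..<p ^ k} (carrier F)"
proof -
  have "inj_on (felt C) {..<p ^ k}"
  proof (rule inj_onI)
    fix Y Z assume Y: "Y \<in> {..<p ^ k}" and Z: "Z \<in> {..<p ^ k}" and e: "felt C Y = felt C Z"
    have "Y div p ^ i mod p = Z div p ^ i mod p" if "i < k" for i
      using arg_cong[OF e, of "\<lambda>v. v ! i"] that by (simp add: felt_def)
    then have "Y mod p ^ k = Z mod p ^ k" by (rule digits_mod_eq)
    then show "Y = Z" using Y Z by simp
  qed
  moreover have "felt C ` {..<p ^ k} = carrier F"
    by (rule card_subset_eq[OF finite_F]) (use felt_R card_F card_image[OF calculation] in auto)
  ultimately show ?thesis by (simp add: bij_betw_def)
qed

text \<open>The samples read only the lowest \<open>nsamp C\<close> digits in base q.\<close>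

lemma samples_mod: "samples C (Y mod (p ^ k) ^ nsamp C) = samples C Y"
  unfolding samples_def fq_C
proof (rule map_cong[OF refl])
  fix i assume "i \<in> set [0..<nsamp C]"
  then have i: "i < nsamp C" by simp
  define q where "q = p ^ k"
  have q: "q > 0" using p_gt1 unfolding q_def by simp
  have e: "q ^ nsamp C = q ^ i * (q * q ^ (nsamp C - Suc i))" using i
    by (simp flip: power_Suc power_add)
  have "Y mod q ^ nsamp C div q ^ i = Y div q ^ i mod (q * q ^ (nsamp C - Suc i))" unfolding e mod_mult2_eq using q by simp
  then have "Y mod q ^ nsamp C div q ^ i mod q = Y div q ^ i mod q" by (simp add: mod_mod_cancel)
  then show "felt C (Y mod (p ^ k) ^ nsamp C div (p ^ k) ^ min i (nsamp C) mod p ^ k) = felt C (Y div (p ^ k) ^ min i (nsamp C) mod p ^ k)"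
    unfolding q_def using i by simp
qed

text \<open>Union bound: for a fixed pair of elements at most (q / 2)^T of the q^T numbers leave it
  unseparated, and there are at most q^2 pairs. The result 1/4 instead of 1/2 leaves room for a bias
  in the choice of the number.\<close>

lemma not_separating_count: "4 * card {Y. Y < (p ^ k) ^ nsamp C \<and> \<not> separating (samples C Y)} \<le> (p ^ k) ^ nsamp C"
proof -
  define q where "q = p ^ k"
  define T where "T = nsamp C"
  define B where "B u v = {d. d < q \<and> hval (felt C d) u = hval (felt C d) v}" for u v
  define W where "W = {w \<in> carrier F \<times> carrier F. fst w \<noteq> snd w}"
  define S where "S w = {Y. Y < q ^ T \<and> (\<forall>i<T. Y div q ^ i mod q \<in> B (fst w) (snd w))}" for w
  have q: "q > 0" using p_gt1 unfolding q_def by simp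
  have Bc: "2 * card (B u v) \<le> q" if uv: "u \<in> carrier F" "v \<in> carrier F" "u \<noteq> v" for u v
  proof -
    have "inj_on (felt C) (B u v)" using bij_felt unfolding bij_betw_def B_def q_def by (auto elim: inj_on_subset)
    moreover have "felt C ` B u v \<subseteq> {a \<in> carrier F. hval a u = hval a v}" unfolding B_def using felt_R by auto
    moreover have "finite {a \<in> carrier F. hval a u = hval a v}" using finite_F by simp
    ultimately have "card (B u v) \<le> card {a \<in> carrier F. hval a u = hval a v}" by (rule card_inj_on_le)
    then show ?thesis using bad_count[OF uv] unfolding q_def by linarith
  qed
  have fW: "finite W" unfolding W_def using finite_F by simp
  have cW: "card W \<le> q * q"
  proof -
    have "card W \<le> card (carrier F \<times> carrier F)" by (rule card_mono) (use finite_F in \<open>auto simp: W_def\<close>)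
    then show ?thesis by (simp add: card_cartesian_product card_F q_def)
  qed
  have "{Y. Y < (p ^ k) ^ nsamp C \<and> \<not> separating (samples C Y)} \<subseteq> (\<Union>w\<in>W. S w)"
  proof
    fix Y assume "Y \<in> {Y. Y < (p ^ k) ^ nsamp C \<and> \<not> separating (samples C Y)}"
    then have Y: "Y < q ^ T" "\<not> separating (samples C Y)" by (simp_all add: q_def T_def)
    then obtain u v where uv: "u \<in> carrier F" "v \<in> carrier F" "u \<noteq> v" "\<forall>a\<in>set (samples C Y). hval a u = hval a v"
      unfolding separating_def by blast
    have "Y div q ^ i mod q \<in> B u v" if i: "i < T" for i
    proof -
      have "felt C (Y div q ^ i mod q) \<in> set (samples C Y)" using i by (auto simp: samples_def q_def T_def intro!: image_eqI[of _ _ i])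
      then show ?thesis using uv(4) q unfolding B_def by simp
    qed
    then have "Y \<in> S (u, v)" unfolding S_def using Y(1) by simp
    moreover have "(u, v) \<in> W" unfolding W_def using uv by simp
    ultimately show "Y \<in> (\<Union>w\<in>W. S w)" by blast
  qed
  moreover have "finite (\<Union>w\<in>W. S w)" using fW by (auto simp: S_def)
  ultimately have c1: "card {Y. Y < (p ^ k) ^ nsamp C \<and> \<not> separating (samples C Y)} \<le> card (\<Union>w\<in>W. S w)" by (rule card_mono[rotated])
  also have "\<dots> \<le> (\<Sum>w\<in>W. card (S w))" by (rule card_UN_le[OF fW])
  finally have c1: "card {Y. Y < (p ^ k) ^ nsamp C \<and> \<not> separating (samples C Y)} \<le> (\<Sum>w\<in>W. card (S w))" .
  have c2: "2 ^ T * (\<Sum>w\<in>W. card (S w)) \<le> q * q * q ^ T"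
  proof -
    have "2 ^ T * card (S w) \<le> q ^ T" if w: "w \<in> W" for w
    proof -
      have "finite (B (fst w) (snd w))" by (simp add: B_def)
      then have "card (S w) \<le> card (B (fst w) (snd w)) ^ T" unfolding S_def by (rule card_digits_le[OF q])
      then have "2 ^ T * card (S w) \<le> (2 * card (B (fst w) (snd w))) ^ T" unfolding power_mult_distrib by simp
      also have "\<dots> \<le> q ^ T" by (rule power_mono) (use Bc w in \<open>auto simp: W_def\<close>)
      finally show ?thesis .
    qed
    then have "2 ^ T * (\<Sum>w\<in>W. card (S w)) \<le> (\<Sum>w\<in>W. q ^ T)" unfolding sum_distrib_left by (rule sum_mono)
    also have "\<dots> \<le> q * q * q ^ T" using cW by simp
    finally show ?thesis .
  qed
  have "q < 2 ^ length (bits q)" unfolding length_bits using floorlog_bounds[of q 2] q by simp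
  then have "q * q \<le> 2 ^ length (bits q) * 2 ^ length (bits q)" by (intro mult_le_mono) simp_all
  then have "4 * (q * q) \<le> 2 ^ T" unfolding T_def nsamp_def fq_C q_def[symmetric] power_add mult_2 by simp
  then have "4 * (q * q) * (\<Sum>w\<in>W. card (S w)) \<le> 2 ^ T * (\<Sum>w\<in>W. card (S w))" by (rule mult_le_mono1)
  then have "4 * (q * q) * (\<Sum>w\<in>W. card (S w)) \<le> q * q * q ^ T" using c2 by (rule le_trans)
  moreover have "4 * (q * q) * (\<Sum>w\<in>W. card (S w)) = q * q * (4 * (\<Sum>w\<in>W. card (S w)))" by (simp only: mult_ac)
  ultimately have "q * q * (4 * (\<Sum>w\<in>W. card (S w))) \<le> q * q * q ^ T" by (simp only:)
  then have "4 * (\<Sum>w\<in>W. card (S w)) \<le> q ^ T" using q by simp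
  then show ?thesis using c1 unfolding q_def T_def by linarith
qed

text \<open>The coins give a uniform number below 2^N, not below M = q^T. As M <= 2^N, each residue
  occurs at most 2^N / M + 1 <= 2 * 2^N / M times, so the failure rate at most doubles, from 1/4 to
  1/2.\<close>

lemma not_separating_pow2:
  assumes "(p ^ k) ^ nsamp C \<le> 2 ^ N"
  shows "2 * card {Y. Y < 2 ^ N \<and> \<not> separating (samples C Y)} \<le> 2 ^ N"
proof -
  define M where "M = (p ^ k) ^ nsamp C"
  define b where "b = card {Y. Y < M \<and> \<not> separating (samples C Y)}"
  have M: "M > 0" unfolding M_def using p_gt1 by simp
  have "card {Y. Y < 2 ^ N \<and> \<not> separating (samples C (Y mod M))} \<le> Suc (2 ^ N div M) * b"
    unfolding b_def by (rule card_mod_le[OF M])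
  then have "card {Y. Y < 2 ^ N \<and> \<not> separating (samples C Y)} \<le> Suc (2 ^ N div M) * b" unfolding M_def samples_mod .
  moreover have "4 * (Suc (2 ^ N div M) * b) \<le> Suc (2 ^ N div M) * M"
    using mult_le_mono2[OF not_separating_count, of "Suc (2 ^ N div M)"] unfolding b_def M_def by (simp add: algebra_simps)
  moreover have "Suc (2 ^ N div M) * M \<le> 2 ^ N + 2 ^ N"
  proof -
    have "2 ^ N div M * M \<le> 2 ^ N" by simp
    then show ?thesis using assms unfolding M_def[symmetric] mult_Suc by linarith
  qed
  ultimately show ?thesis by linarith
qed

end

section \<open>Reading coins into a number\<close>

primrec bval :: "nat \<Rightarrow> bool list \<Rightarrow> nat" where
  "bval n [] = n"
| "bval n (b # bs) = bval (n + n + of_bool b) bs"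

lemma bval_add: "bval n bs = n * 2 ^ length bs + bval 0 bs"
proof (induction bs arbitrary: n)
  case (Cons b bs)
  show ?case using Cons[of "n + n + of_bool b"] Cons[of "of_bool b"] by (simp add: algebra_simps)
qed simp

lemma bval_less: "bval 0 bs < 2 ^ length bs"
proof (induction bs)
  case (Cons b bs)
  then show ?case using bval_add[of "of_bool b" bs] by (cases b) auto
qed simp

lemma bval_inj: "length bs = length cs \<Longrightarrow> bval 0 bs = bval 0 cs \<Longrightarrow> bs = cs"
proof (induction bs cs rule: list_induct2)
  case (Cons b bs c cs)
  have e: "of_bool b * 2 ^ length bs + bval 0 bs = of_bool c * 2 ^ length bs + bval 0 cs"
    using Cons bval_add[of "of_bool b" bs] bval_add[of "of_bool c" cs] by simp
  have "b = c" using e bval_less[of bs] bval_less[of cs] Cons.hyps by (cases b; cases c) auto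
  then show ?case using e Cons.IH by simp
qed simp

lemma card_bool_lists: "card {r :: bool list. length r = T} = 2 ^ T" "finite {r :: bool list. length r = T}"
  using card_lists_length_eq[of "UNIV :: bool set" T] finite_lists_length_eq[of "UNIV :: bool set" T] by (simp_all)

text \<open>The event is controlled by the first \<open>N\<close> coins, and each pattern of them
  extends in 2^(T-N) ways, so counting patterns of length \<open>N\<close> is enough.\<close>

lemma prob_bits_le:
  assumes NT: "N \<le> T" and half: "2 * card {Y. Y < 2 ^ N \<and> P Y} \<le> 2 ^ N"
    and A: "\<And>r. length r = T \<Longrightarrow> r \<in> A \<Longrightarrow> P (bval 0 (take N r))"
  shows "measure_pmf.prob (pmf_of_set {r. length r = T}) A \<le> 1 / 2"
proof -
  let ?S = "{r :: bool list. length r = T}"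
  let ?f = "\<lambda>r. (bval 0 (take N r), drop N r)"
  have "inj_on ?f (?S \<inter> A)"
  proof (rule inj_onI)
    fix r s assume r: "r \<in> ?S \<inter> A" and s: "s \<in> ?S \<inter> A" and e: "?f r = ?f s"
    have e': "take N r = take N s" by (rule bval_inj) (use r s e in auto)
    have d: "drop N r = drop N s" using e by (simp only: prod.inject)
    have "r = take N r @ drop N r" by simp
    also have "\<dots> = s" unfolding e' d by simp
    finally show "r = s" .
  qed
  moreover have "?f ` (?S \<inter> A) \<subseteq> {Y. Y < 2 ^ N \<and> P Y} \<times> {r. length r = T - N}"
  proof
    fix u assume "u \<in> ?f ` (?S \<inter> A)"
    then obtain r where r: "length r = T" "r \<in> A" "u = ?f r" by blast
    have "bval 0 (take N r) < 2 ^ N" using bval_less[of "take N r"] r(1) NT by simp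
    then show "u \<in> {Y. Y < 2 ^ N \<and> P Y} \<times> {r. length r = T - N}" using A[OF r(1,2)] r(1,3) by simp
  qed
  moreover have "finite ({Y :: nat. Y < 2 ^ N \<and> P Y} \<times> {r :: bool list. length r = T - N})" using card_bool_lists(2) by simp
  ultimately have "card (?S \<inter> A) \<le> card ({Y. Y < 2 ^ N \<and> P Y} \<times> {r :: bool list. length r = T - N})" by (rule card_inj_on_le)
  then have "2 * card (?S \<inter> A) \<le> (2 * card {Y. Y < 2 ^ N \<and> P Y}) * 2 ^ (T - N)"
    by (simp add: card_cartesian_product card_bool_lists)
  also have "\<dots> \<le> 2 ^ N * 2 ^ (T - N)" using half by (rule mult_le_mono1)
  also have "\<dots> = 2 ^ T" using NT by (simp flip: power_add)
  finally have "2 * card (?S \<inter> A) \<le> 2 ^ T" .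
  then have "real (2 * card (?S \<inter> A)) \<le> real (2 ^ T)" by (rule of_nat_mono)
  then have "real (card (?S \<inter> A)) / 2 ^ T \<le> 1 / 2" by (simp add: field_simps)
  moreover have "measure_pmf.prob (pmf_of_set ?S) A = real (card (?S \<inter> A)) / real (card ?S)"
    by (rule measure_pmf_of_set) (use card_bool_lists(2) Ex_list_of_length[of T] in auto)
  ultimately show ?thesis by (simp add: card_bool_lists)
qed

definition flip_cond :: prog where "flip_cond = Seq (Prim Fst) (Prim IsPair)"

text \<open>The state pairs a counter list with the number read so far. A round removes one list
  entry and replaces n by 2 n + coin; the loop ends when the list is no longer a pair.\<close>

definition flip_body :: prog where
  "flip_body = Fork (Seq (Prim Fst) (Prim Snd))
     (Seq (Fork (Seq (Fork (Prim Snd) (Prim Snd)) (Prim Add)) Flip) (Prim Add))"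

lemma flip_body_run:
  "\<exists>t. runs flip_body (Pair (Pair a u) (Num n)) (b # r) t (Pair u (Num (n + n + of_bool b))) r \<and>
    t \<le> 40 * vsize (Pair (Pair a u) (Num n)) + 40"
proof -
  let ?v = "Pair (Pair a u) (Num n)"
  have P: "runs (Prim f) v r (vsize v + vsize w) w r" if "apply_prim f v = w" for f v w r using runs.Prim[of f v r] that by simp
  have 1: "runs (Seq (Prim Fst) (Prim Snd)) ?v (b # r) (1 + (vsize ?v + vsize (Pair a u)) + (vsize (Pair a u) + vsize u)) u (b # r)"
    by (rule runs.Seq[OF P P]) simp_all
  have 2: "runs (Fork (Prim Snd) (Prim Snd)) ?v (b # r) (1 + (vsize ?v + vsize (Num n)) + (vsize ?v + vsize (Num n))) (Pair (Num n) (Num n)) (b # r)"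
    by (rule runs.Fork[OF P P]) simp_all
  have 3: "runs (Seq (Fork (Prim Snd) (Prim Snd)) (Prim Add)) ?v (b # r)
      (1 + (1 + (vsize ?v + vsize (Num n)) + (vsize ?v + vsize (Num n))) + (vsize (Pair (Num n) (Num n)) + vsize (Num (n + n)))) (Num (n + n)) (b # r)"
    by (rule runs.Seq[OF 2 P]) simp
  note 4 = runs.Fork[OF 3 runs.Flip]
  note 5 = runs.Seq[OF 4 P[of Add "Pair (Num (n + n)) (Num (of_bool b))" "Num (n + n + of_bool b)"]]
  note 6 = runs.Fork[OF 1 5, folded flip_body_def]
  have f: "floorlog 2 (n + n) \<le> 2 * floorlog 2 n" using floorlog_add[of n n] by simp
  have g: "floorlog 2 (n + n + of_bool b) \<le> floorlog 2 (n + n) + 1" and g': "floorlog 2 (of_bool b) \<le> 1"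
    using floorlog_add[of "n + n" "of_bool b"] by (cases b; simp add: floorlog_def)+
  show ?thesis by (rule exI, rule conjI, rule 6, simp) (use f g g' vsize_pos[of a] vsize_pos[of u] in simp)
qed

lemma flip_loop_run:
  fixes bs :: "bool list"
  assumes "length r1 = length bs" "vsize (Pair (enc bs) (Num n)) \<le> S"
  shows "\<exists>t. runs (While flip_cond flip_body) (Pair (enc bs) (Num n)) (r1 @ r2) t (Pair (Num 0) (Num (bval n r1))) r2 \<and>
    t \<le> (length bs + 1) * (50 * S + 50)"
  using assms
proof (induction bs arbitrary: r1 n)
  case Nil
  let ?v = "Pair (Num 0) (Num n)"
  have "runs flip_cond ?v r2 (1 + (vsize ?v + vsize (Num 0)) + (vsize (Num 0) + vsize (Num 0))) (Num 0) r2"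
    unfolding flip_cond_def using runs.Seq[OF runs.Prim[of Fst ?v r2] runs.Prim[of IsPair]] by simp
  from runs.WhileFalse[OF this refl, of flip_body] show ?case using Nil by (intro exI conjI) (auto simp: floorlog_def)
next
  case (Cons b bs)
  obtain c rs where r1: "r1 = c # rs" "length rs = length bs" using Cons.prems(1) by (cases r1) auto
  let ?v = "Pair (Pair (enc b) (enc bs)) (Num n)"
  let ?m = "n + n + of_bool c"
  have sv: "vsize ?v \<le> S" using Cons.prems(2) by simp
  have c: "runs flip_cond ?v (c # rs @ r2) (1 + (vsize ?v + vsize (Pair (enc b) (enc bs))) + (vsize (Pair (enc b) (enc bs)) + vsize (Num 1))) (Num 1) (c # rs @ r2)"
    unfolding flip_cond_def using runs.Seq[OF runs.Prim[of Fst ?v "c # rs @ r2"] runs.Prim[of IsPair]] by simp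
  obtain t2 where b: "runs flip_body ?v (c # rs @ r2) t2 (Pair (enc bs) (Num ?m)) (rs @ r2)" "t2 \<le> 40 * vsize ?v + 40"
    using flip_body_run by blast
  \<comment> \<open>The number gains at most one bit per round while the counter list loses a whole
    entry, so the state never exceeds \<open>S\<close>.\<close>
  have "floorlog 2 ?m \<le> floorlog 2 n + 1"
  proof (cases "?m = 0")
    case True
    then show ?thesis by (simp add: floorlog_def)
  next
    case False
    then have "floorlog 2 ?m = floorlog 2 (?m div 2) + 1" by (subst compute_floorlog) simp
    moreover have "?m div 2 = n" by (cases c) auto
    ultimately show ?thesis by simp
  qed
  then have "vsize (Pair (enc bs) (Num ?m)) \<le> vsize ?v" using vsize_pos[of "enc b"] by simp
  then have "vsize (Pair (enc bs) (Num ?m)) \<le> S" using sv by linarith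
  from Cons.IH[OF r1(2) this] obtain t3 where l: "runs (While flip_cond flip_body) (Pair (enc bs) (Num ?m)) (rs @ r2) t3 (Pair (Num 0) (Num (bval ?m rs))) r2"
    "t3 \<le> (length bs + 1) * (50 * S + 50)" by blast
  note w = runs.WhileTrue[OF c _ b(1) l(1)]
  have c': "1 + (vsize ?v + vsize (Pair (enc b) (enc bs))) + (vsize (Pair (enc b) (enc bs)) + vsize (Num 1)) \<le> 5 * S + 5"
    using sv by (simp add: floorlog_def)
  show ?case unfolding r1(1)
  proof (intro exI conjI)
    show "runs (While flip_cond flip_body) (Pair (enc (b # bs)) (Num n)) ((c # rs) @ r2)
       (1 + (1 + (vsize ?v + vsize (Pair (enc b) (enc bs))) + (vsize (Pair (enc b) (enc bs)) + vsize (Num 1))) + t2 + t3) (Pair (Num 0) (Num (bval n (c # rs)))) r2"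
      using w by simp
    have "t2 \<le> 40 * S + 40" using b(2) sv by linarith
    then show "1 + (1 + (vsize ?v + vsize (Pair (enc b) (enc bs))) + (vsize (Pair (enc b) (enc bs)) + vsize (Num 1))) + t2 + t3
        \<le> (length (b # bs) + 1) * (50 * S + 50)" using c' l(2) by simp
  qed
qed

text \<open>If q^T has N binary digits, it is at most 2^N, so N coins suffice. The digit list itself
  is the loop counter for tossing them.\<close>

definition nbits :: "inp \<Rightarrow> bool list" where
  "nbits z = bits (fq (fst z) ^ nsamp (fst z))"

lemma pt_nbits: "pt nbits"
proof -
  have "pt (\<lambda>z :: inp. bits (fq (fst z) ^ min (nsamp (fst z)) (nsamp (fst z))))"
    unfolding nsamp_def by (intro pt_intros pb_intros)
  then show ?thesis by (rule pt_cong) (simp add: nbits_def)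
qed

lemma pb_nbits: "pb (\<lambda>z. length (nbits z))"
  by (rule pb_mono[OF pb_sz[OF pt_nbits]]) (rule length_le_sz)

text \<open>The initial loop is the only part that tosses coins; its number is then an ordinary
  input of the deterministic decoder. A final conditional turns the flag into the two required
  output formats.\<close>

lemma decode_prog:
  "\<exists>c B. pb B \<and> (\<forall>z r1 r2. length r1 = length (nbits z) \<longrightarrow> (\<exists>t. t \<le> B z \<and>
    runs c (enc z) (r1 @ r2) t (if fst (decode (z, bval 0 r1)) then Pair (Num 1) (enc (snd (decode (z, bval 0 r1)))) else Num 0) r2))"
proof -
  have "pt (\<lambda>z. (nbits z, 0 :: nat))" by (intro pt_Pair pt_nbits pt_const)
  then obtain c1 m1 where c1: "pb m1" "\<And>z r. \<exists>t. runs c1 (enc z) r t (enc (nbits z, 0 :: nat)) r \<and> t \<le> m1 z"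
    unfolding pt_on_def by blast
  obtain c2 m2 where c2: "pb m2" "\<And>x r. \<exists>t. runs c2 (enc x) r t (enc (decode x)) r \<and> t \<le> m2 x"
    using pt_decode unfolding pt_on_def by blast
  obtain P2 where P2: "\<And>x. m2 x \<le> poly P2 (sz x)" using c2(1) unfolding pb_def by blast
  let ?fin = "Cond (Prim Fst) (Fork (Prim (Const 1)) (Prim Snd)) (Prim (Const 0))"
  let ?c = "Seq (Fork (Prim Id) (Seq (Seq c1 (While flip_cond flip_body)) (Prim Snd))) (Seq c2 ?fin)"
  \<comment> \<open>\<open>L\<close> bounds the coin loop and thereby the size of the number read;
    \<open>V\<close> bounds the time of the decoder on that number.\<close>
  define L where "L z = (length (nbits z) + 1) * (50 * sz (nbits z, 0 :: nat) + 50)" for z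
  define V where "V z = poly P2 (1 + sz z + L z)" for z
  define B where "B z = 10 + 2 * sz z + m1 z + 3 * L z + 8 * V z" for z
  have pL: "pb L" unfolding L_def
    by (intro pb_add pb_mult pb_const pb_nbits pb_sz \<open>pt (\<lambda>z. (nbits z, 0 :: nat))\<close>)
  have pV: "pb V" unfolding V_def by (intro pb_poly pb_add pb_const pb_self pL)
  have pB: "pb B" unfolding B_def by (intro pb_add pb_mult pb_const pb_self pL pV c1(1))
  have "\<exists>t. t \<le> B z \<and> runs ?c (enc z) (r1 @ r2) t (if fst (decode (z, bval 0 r1)) then Pair (Num 1) (enc (snd (decode (z, bval 0 r1)))) else Num 0) r2"
    if len: "length r1 = length (nbits z)" for z r1 r2
  proof -
    let ?n = "bval 0 r1"
    obtain t1 where t1: "runs c1 (enc z) (r1 @ r2) t1 (Pair (enc (nbits z)) (Num 0)) (r1 @ r2)" "t1 \<le> m1 z"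
      using c1(2)[of z "r1 @ r2"] by auto
    obtain tl where tl: "runs (While flip_cond flip_body) (Pair (enc (nbits z)) (Num 0)) (r1 @ r2) tl (Pair (Num 0) (Num ?n)) r2" "tl \<le> L z"
      using flip_loop_run[OF len, of 0 "sz (nbits z, 0 :: nat)" r2] unfolding L_def by auto
    have sn: "vsize (Pair (Num 0) (Num ?n)) \<le> L z" using runs_size[OF tl(1)] tl(2) by linarith
    obtain t2 where t2: "runs c2 (Pair (enc z) (Num ?n)) r2 t2 (enc (decode (z, ?n))) r2" "t2 \<le> m2 (z, ?n)"
      using c2(2)[of "(z, ?n)" r2] by auto
    have "m2 (z, ?n) \<le> poly P2 (sz (z, ?n))" by (rule P2)
    also have "\<dots> \<le> V z" unfolding V_def by (rule poly_nat_mono) (use sn in simp)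
    finally have t2': "t2 \<le> V z" using t2(2) by simp
    let ?w = "enc (decode (z, ?n))"
    have sw: "vsize ?w \<le> V z" using runs_size[OF t2(1)] t2' by linarith
    have we: "?w = Pair (Num (of_bool (fst (decode (z, ?n))))) (enc (snd (decode (z, ?n))))" unfolding enc_prod_eq by simp
    have P: "runs (Prim f) v r (vsize v + vsize w) w r" if "apply_prim f v = w" for f v w r using runs.Prim[of f v r] that by simp
    have "\<exists>t3. runs ?fin ?w r2 t3 (if fst (decode (z, ?n)) then Pair (Num 1) (enc (snd (decode (z, ?n)))) else Num 0) r2 \<and> t3 \<le> 6 * V z + 6"
    proof (cases "fst (decode (z, ?n))")
      case True
      have f: "runs (Prim Fst) ?w r2 (vsize ?w + vsize (Num 1)) (Num 1) r2" by (rule P) (simp add: we True)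
      have s: "runs (Fork (Prim (Const 1)) (Prim Snd)) ?w r2 (1 + (vsize ?w + vsize (Num 1)) + (vsize ?w + vsize (enc (snd (decode (z, ?n))))))
          (Pair (Num 1) (enc (snd (decode (z, ?n))))) r2" by (rule runs.Fork[OF P P]) (simp_all add: we)
      have "vsize (enc (snd (decode (z, ?n)))) \<le> vsize ?w" by (simp add: we)
      with runs.CondTrue[OF f _ s] show ?thesis using True sw by (intro exI conjI) (auto simp: floorlog_def)
    next
      case False
      have f: "runs (Prim Fst) ?w r2 (vsize ?w + vsize (Num 0)) (Num 0) r2" by (rule P) (simp add: we False)
      have s: "runs (Prim (Const 0)) ?w r2 (vsize ?w + vsize (Num 0)) (Num 0) r2" by (rule P) simp
      from runs.CondFalse[OF f refl s] show ?thesis using False sw by (intro exI conjI) (auto simp: floorlog_def)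
    qed
    then obtain t3 where t3: "runs ?fin ?w r2 t3 (if fst (decode (z, ?n)) then Pair (Num 1) (enc (snd (decode (z, ?n)))) else Num 0) r2" "t3 \<le> 6 * V z + 6"
      by blast
    have i: "runs (Prim Id) (enc z) (r1 @ r2) (vsize (enc z) + vsize (enc z)) (enc z) (r1 @ r2)" by (rule P) simp
    have s: "runs (Prim Snd) (Pair (Num 0) (Num ?n)) r2 (vsize (Pair (Num 0) (Num ?n)) + vsize (Num ?n)) (Num ?n) r2" by (rule P) simp
    note R = runs.Seq[OF runs.Fork[OF i runs.Seq[OF runs.Seq[OF t1(1) tl(1)] s]] runs.Seq[OF t2(1) t3(1)]]
    show ?thesis
      by (rule exI, rule conjI[rotated], rule R) (use t1(2) tl(2) t2' t3(2) sn in \<open>simp add: B_def\<close>)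
  qed
  then show ?thesis using pB by blast
qed

section \<open>The decoding theorem\<close>

lemma enc_nat_eq: "Defs.enc_list (enc :: 'a::encodable \<Rightarrow> val) = enc" "Num = enc"
  by (simp_all add: fun_eq_iff enc_list_def enc_nat_def)

lemma enc_input_eq:
  "enc_input p k F n d x y l e = enc (((p, structure_constants k F), (l, e), map x [1..<n + 1], map (\<lambda>i. map (y i) [1..<d + 1]) [1..<n + 1]) :: inp)"
  unfolding enc_input_def enc_nat_eq by (simp add: enc_simps(3))

lemma rate_condition:
  fixes n d l e :: nat
  assumes "d \<ge> 1" "e < n"
  shows "real l < real n * (1 - real e / real n)\<^sup>2 / real d \<longleftrightarrow> real n * real l * real d < (real n - real e)\<^sup>2"
proof -
  have n: "real n > 0" and d: "real d > 0" using assms by simp_all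
  have "real n * (1 - real e / real n)\<^sup>2 = (real n - real e)\<^sup>2 / real n"
    using n by (simp add: field_simps power2_eq_square)
  then have "real n * (1 - real e / real n)\<^sup>2 / real d = (real n - real e)\<^sup>2 / (real n * real d)" by simp
  then show ?thesis using n d by (simp add: pos_less_divide_eq mult_ac)
qed

lemma rate_condition_sqrt:
  fixes n d l e :: nat
  assumes "d \<ge> 1" "e < n"
  shows "real l < real n * (1 - real e / real n)\<^sup>2 / real d \<longleftrightarrow> real e < real n - sqrt (real n * real l * real d)"
proof -
  have "real n - real e \<ge> 0" using assms by simp
  then have "sqrt (real n * real l * real d) < real n - real e \<longleftrightarrow> real n * real l * real d < (real n - real e)\<^sup>2"
    using real_sqrt_less_iff[of "real n * real l * real d" "(real n - real e)\<^sup>2"] by (simp only: real_sqrt_abs abs_of_nonneg)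
  then show ?thesis unfolding rate_condition[OF assms] by linarith
qed

text \<open>The integer forms that the algorithm works with; the second follows from n l <= n d l <
  (n - e)^2 <= n^2.\<close>

lemma rate_condition_nat:
  fixes n d l e :: nat
  assumes "d \<ge> 1" "e < n" "real l < real n * (1 - real e / real n)\<^sup>2 / real d"
  shows "n * d * l < (n - e) * (n - e)" "l < n"
proof -
  have "real n * real l * real d < (real n - real e)\<^sup>2" using assms(3) unfolding rate_condition[OF assms(1,2)] .
  then have "real (n * d * l) < real ((n - e) * (n - e))" using assms(2) by (simp add: of_nat_diff power2_eq_square mult_ac)
  then show lt: "n * d * l < (n - e) * (n - e)" by (simp only: of_nat_less_iff)
  have "n * 1 * l \<le> n * d * l" using assms(1) by (intro mult_le_mono) simp_all
  also note lt
  also have "(n - e) * (n - e) \<le> n * n" by (intro mult_le_mono) simp_all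
  finally show "l < n" by simp
qed

lemma decode_correct:
  assumes F: "explicit_finite_field p k F" and x: "\<forall>i\<in>{1..n}. x i \<in> carrier F" "inj_on x {1..n}"
    and d: "d \<ge> 1" and y: "\<forall>i\<in>{1..n}. \<forall>j\<in>{1..d}. y i j \<in> carrier F" and e: "e < n"
    and rate: "real l < real n * (1 - real e / real n)\<^sup>2 / real d"
  defines "z \<equiv> ((p, structure_constants k F), (l, e), map x [1..<n + 1], map (\<lambda>i. map (y i) [1..<d + 1]) [1..<n + 1])"
  shows "fst (decode (z, Y)) \<Longrightarrow> distinct (snd (decode (z, Y))) \<and> set (snd (decode (z, Y))) = decodings F n d x y l e"
    "2 * card {Y. Y < 2 ^ length (nbits z) \<and> \<not> fst (decode (z, Y))} \<le> 2 ^ length (nbits z)"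
proof -
  define C where "C = (p, structure_constants k F)"
  have "field F" using F unfolding explicit_finite_field_def by blast
  then interpret gfield F p k C using F by (intro gfield.intro gfield_axioms.intro) (simp_all add: C_def)
  define xs where "xs = map x [1..<n + 1]"
  define ys where "ys = map (\<lambda>i. map (y i) [1..<d + 1]) [1..<n + 1]"
  have up: "set [1..<n + 1] = {1..n}" "set [1..<d + 1] = {1..d}" by auto
  have xsF: "set xs \<subseteq> carrier F" unfolding xs_def set_map up using x(1) by blast
  have dx: "distinct xs" unfolding xs_def distinct_map up using x(2) by simp
  have xn: "xs \<noteq> []" unfolding xs_def using e by simp
  have len: "length xs = n" "length ys = length xs" unfolding xs_def ys_def by simp_all
  have ysF: "length zs = d \<and> set zs \<subseteq> carrier F" if zs: "zs \<in> set ys" for zs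
  proof -
    obtain i where i: "i \<in> {1..n}" "zs = map (y i) [1..<d + 1]" using zs unfolding ys_def set_map up by blast
    have "set zs \<subseteq> carrier F" unfolding i(2) set_map up using y i(1) by blast
    then show ?thesis using i(2) by simp
  qed
  have t: "n - e > 0" "d > 0" using e d by simp_all
  have lt: "length xs * d * l < (n - e) * (n - e)" unfolding len(1) by (rule rate_condition_nat(1)[OF d e rate])
  \<comment> \<open>So the program decodes with the true degree bound in spite of the minimum in
    \<open>decode\<close>.\<close>
  have l: "min l n = l" using rate_condition_nat(2)[OF d e rate] by simp
  have dec: "decode (z, Y) = gs_decode C l (n - e) xs ys Y" for Y
    unfolding decode_def z_def fst_conv snd_conv C_def[symmetric] xs_def[symmetric] ys_def[symmetric] len(1) l ..
  note G = gs_decode_C[OF xsF dx xn ysF len(2) t lt]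
  have ag: "length (agree xs ys w) = card {i \<in> {1..n}. \<exists>j\<in>{1..d}. eval w (x i) = y i j}" for w
  proof -
    have "zip xs ys = map (\<lambda>i. (x i, map (y i) [1..<d + 1])) [1..<n + 1]"
      unfolding xs_def ys_def zip_map_map zip_same_conv_map by simp
    then have "agree xs ys w = map (\<lambda>i. (x i, map (y i) [1..<d + 1])) (filter (\<lambda>i. \<exists>u\<in>set (map (y i) [1..<d + 1]). eval w (x i) = u) [1..<n + 1])"
      unfolding agree_def by (simp only: filter_map o_def fst_conv snd_conv)
    then have "length (agree xs ys w) = length (filter (\<lambda>i. \<exists>u\<in>set (map (y i) [1..<d + 1]). eval w (x i) = u) [1..<n + 1])" by (simp only: length_map)
    also have "\<dots> = card (set (filter (\<lambda>i. \<exists>u\<in>set (map (y i) [1..<d + 1]). eval w (x i) = u) [1..<n + 1]))"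
      by (rule distinct_card[symmetric]) simp
    also have "set (filter (\<lambda>i. \<exists>u\<in>set (map (y i) [1..<d + 1]). eval w (x i) = u) [1..<n + 1]) = {i \<in> {1..n}. \<exists>j\<in>{1..d}. eval w (x i) = y i j}"
      unfolding set_filter set_map up by blast
    finally show ?thesis .
  qed
  \<comment> \<open>The degree of a coefficient list is its length minus 1, and 0 for []; so degree
    at most l means length at most l + 1.\<close>
  have ds: "{w \<in> carrier R. length w \<le> l + 1 \<and> n - e \<le> length (agree xs ys w)} = decodings F n d x y l e"
    unfolding decodings_def ag by (rule Collect_cong) auto
  show "fst (decode (z, Y)) \<Longrightarrow> distinct (snd (decode (z, Y))) \<and> set (snd (decode (z, Y))) = decodings F n d x y l e"
    unfolding dec ds[symmetric] by (rule G(2))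
  have "(p ^ k) ^ nsamp C > 0" using p_gt1 by simp
  then have "(p ^ k) ^ nsamp C < 2 ^ length (bits ((p ^ k) ^ nsamp C))"
    unfolding length_bits using floorlog_bounds[of "(p ^ k) ^ nsamp C" 2] by simp
  then have "(p ^ k) ^ nsamp C \<le> 2 ^ length (nbits z)" unfolding nbits_def z_def fst_conv C_def[symmetric] fq_C by simp
  from not_separating_pow2[OF this]
  have b: "2 * card {Y. Y < 2 ^ length (nbits z) \<and> \<not> separating (samples C Y)} \<le> 2 ^ length (nbits z)" .
  \<comment> \<open>A false flag implies that the samples do not separate all pairs.\<close>
  have "card {Y. Y < 2 ^ length (nbits z) \<and> \<not> fst (decode (z, Y))} \<le> card {Y. Y < 2 ^ length (nbits z) \<and> \<not> separating (samples C Y)}"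
    by (rule card_mono) (use G(1) dec in auto)
  then show "2 * card {Y. Y < 2 ^ length (nbits z) \<and> \<not> fst (decode (z, Y))} \<le> 2 ^ length (nbits z)" using b by linarith
qed

theorem mainTheorem5:
  shows "(\<forall>n d l e :: nat. d \<ge> 1 \<and> e < n \<longrightarrow>
      (real l < real n * (1 - real e / real n)\<^sup>2 / real d \<longleftrightarrow>
       real e < real n - sqrt (real n * real l * real d))) \<and>
    (\<exists>(c :: prog) (P :: nat poly).
      \<forall>(p :: nat) (k :: nat) (F :: (nat list) ring) (n :: nat) (d :: nat)
        (x :: nat \<Rightarrow> nat list) (y :: nat \<Rightarrow> nat \<Rightarrow> nat list) (l :: nat) (e :: nat).
        explicit_finite_field p k F \<and>
        (\<forall>i\<in>{1..n}. x i \<in> carrier F) \<and> inj_on x {1..n} \<and>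
        d \<ge> 1 \<and> (\<forall>i\<in>{1..n}. \<forall>j\<in>{1..d}. y i j \<in> carrier F) \<and>
        e < n \<and> real l < real n * (1 - real e / real n)\<^sup>2 / real d \<longrightarrow>
        randomized_finds c (enc_input p k F n d x y l e)
          (poly P (vsize (enc_input p k F n d x y l e)))
          (enc_outputs (decodings F n d x y l e)))"
proof (rule conjI)
  show "\<forall>n d l e :: nat. d \<ge> 1 \<and> e < n \<longrightarrow>
      (real l < real n * (1 - real e / real n)\<^sup>2 / real d \<longleftrightarrow>
       real e < real n - sqrt (real n * real l * real d))"
    by (intro allI impI) (rule rate_condition_sqrt, simp_all)
  obtain c B where cB: "pb B" "\<And>z r1 r2. length r1 = length (nbits z) \<Longrightarrow> \<exists>t. t \<le> B z \<and>
    runs c (enc z) (r1 @ r2) t (if fst (decode (z, bval 0 r1)) then Pair (Num 1) (enc (snd (decode (z, bval 0 r1)))) else Num 0) r2"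
    using decode_prog by blast
  \<comment> \<open>The bound must cover the number of coins as well, because the program is started
    on exactly T random bits.\<close>
  have "pb (\<lambda>z. B z + length (nbits z))" by (rule pb_add[OF cB(1) pb_nbits])
  then obtain P where P: "\<And>z. B z + length (nbits z) \<le> poly P (sz z)" unfolding pb_def by blast
  show "\<exists>(c :: prog) (P :: nat poly).
      \<forall>(p :: nat) (k :: nat) (F :: (nat list) ring) (n :: nat) (d :: nat)
        (x :: nat \<Rightarrow> nat list) (y :: nat \<Rightarrow> nat \<Rightarrow> nat list) (l :: nat) (e :: nat).
        explicit_finite_field p k F \<and>
        (\<forall>i\<in>{1..n}. x i \<in> carrier F) \<and> inj_on x {1..n} \<and>
        d \<ge> 1 \<and> (\<forall>i\<in>{1..n}. \<forall>j\<in>{1..d}. y i j \<in> carrier F) \<and>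
        e < n \<and> real l < real n * (1 - real e / real n)\<^sup>2 / real d \<longrightarrow>
        randomized_finds c (enc_input p k F n d x y l e)
          (poly P (vsize (enc_input p k F n d x y l e)))
          (enc_outputs (decodings F n d x y l e))"
  proof (rule exI[of _ c], rule exI[of _ P], intro allI impI, elim conjE)
    fix p k :: nat and F :: "(nat list) ring" and n d :: nat and x :: "nat \<Rightarrow> nat list" and y :: "nat \<Rightarrow> nat \<Rightarrow> nat list" and l e :: nat
    assume H: "explicit_finite_field p k F" "\<forall>i\<in>{1..n}. x i \<in> carrier F" "inj_on x {1..n}" "d \<ge> 1"
      "\<forall>i\<in>{1..n}. \<forall>j\<in>{1..d}. y i j \<in> carrier F" "e < n" "real l < real n * (1 - real e / real n)\<^sup>2 / real d"
    define z :: inp where "z = ((p, structure_constants k F), (l, e), map x [1..<n + 1], map (\<lambda>i. map (y i) [1..<d + 1]) [1..<n + 1])"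
    note D = decode_correct[OF H, folded z_def]
    have v: "enc_input p k F n d x y l e = enc z" unfolding enc_input_eq z_def ..
    define T where "T = poly P (sz z)"
    define N where "N = length (nbits z)"
    define w where "w r = (if fst (decode (z, bval 0 (take N r))) then Pair (Num 1) (enc (snd (decode (z, bval 0 (take N r))))) else Num 0)" for r
    have NT: "N \<le> T" "B z \<le> T" using P[of z] unfolding N_def T_def by linarith+
    have run: "\<exists>t r'. t \<le> T \<and> runs c (enc z) r t (w r) r'" if r: "length r = T" for r
    proof -
      have "length (take N r) = length (nbits z)" using r NT(1) by (simp add: N_def)
      from cB(2)[OF this, of "drop N r"] obtain t where "t \<le> B z" "runs c (enc z) r t (w r) (drop N r)" unfolding w_def by auto
      then show ?thesis using NT(2) le_trans by blast
    qed
    have "randomized_finds c (enc z) T (enc_outputs (decodings F n d x y l e))"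
      unfolding randomized_finds_def
    proof (rule conjI, intro allI impI)
      fix r :: "bool list" assume r: "length r = T"
      obtain t r' where t: "t \<le> T" "runs c (enc z) r t (w r) r'" using run[OF r] by blast
      have "w r = Num 0 \<or> (\<exists>u\<in>enc_outputs (decodings F n d x y l e). w r = Pair (Num 1) u)"
      proof (cases "fst (decode (z, bval 0 (take N r)))")
        case True
        let ?ws = "snd (decode (z, bval 0 (take N r)))"
        have "enc ?ws \<in> enc_outputs (decodings F n d x y l e)"
          unfolding enc_outputs_def enc_nat_eq using D(1)[OF True] by blast
        then show ?thesis unfolding w_def using True by simp
      qed (simp add: w_def)
      then show "\<exists>t w r'. runs c (enc z) r t w r' \<and> t \<le> T \<and> (w = Num 0 \<or> (\<exists>u\<in>enc_outputs (decodings F n d x y l e). w = Pair (Num 1) u))"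
        using t by blast
    next
      show "measure_pmf.prob (pmf_of_set {r. length r = T}) {r. \<exists>t r'. runs c (enc z) r t (Num 0) r'} \<le> 1 / 2"
      proof (rule prob_bits_le[OF NT(1) D(2)[folded N_def]])
        fix r assume r: "length r = T" and "r \<in> {r. \<exists>t r'. runs c (enc z) r t (Num 0) r'}"
        then obtain t r' where 1: "runs c (enc z) r t (Num 0) r'" by blast
        obtain t' r'' where 2: "runs c (enc z) r t' (w r) r''" using run[OF r] by blast
        \<comment> \<open>For fixed coins the run is unique, so a failing run is the run constructed
          above, and its value is \<open>Num 0\<close> only if the flag is false.\<close>
        have "w r = Num 0" using runs_deterministic[OF 1 2] by blast
        then show "\<not> fst (decode (z, bval 0 (take N r)))" unfolding w_def by (auto split: if_splits)
      qed
    qed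
    then show "randomized_finds c (enc_input p k F n d x y l e) (poly P (vsize (enc_input p k F n d x y l e))) (enc_outputs (decodings F n d x y l e))"
      unfolding v T_def .
  qed
qed

end
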